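(* Let $G$ be a second countable locally compact Hausdorff groupoid with a left Haar system. Then $\|\phi\|_{cb}\le\|\phi\|$ for all $\phi\in B(G)$.
   Context: Hilbert spaces are separable and inner products are conjugate linear in the first variable. $G$ has unit space $G^0$ and range and source maps $r,s$. A $G$-Hilbert bundle is a continuous Hilbert bundle $\mathfrak H=\{\mathfrak H_u\}_{u\in G^0}$ over $G^0$ (a continuous field of Hilbert spaces in Dixmier's sense) together with, for each $x\in G$, a linear isometry $L_x$ of $\mathfrak H_{s(x)}$ onto $\mathfrak H_{r(x)}$ such that $x\mapsto L_x$ is a groupoid homomorphism and, for all bounded continuous sections $\xi,\eta$ of $\mathfrak H$, the function $(\xi,\eta):x\mapsto (L_x\xi(s(x)),\eta(r(x)))$ (a coefficient) is continuous on $G$. $B(G)$ is the set of all coefficients $(\xi,\eta)$ over all $G$-Hilbert bundles and bounded continuous sections, and for $\phi\in B(G)$, $\|\phi\|=\inf\|\xi\|\|\eta\|$ over all representations $\phi=(\xi,\eta)$, where $\|\xi\|=\sup_u\|\xi(u)\|$. $C^*(G)$ is the full groupoid $C^*$-algebra of $G$ and $\pi:C_c(G)\to C^*(G)$ is the canonical embedding. For $\phi\in B(G)$, the map $T_\phi\pi(f)=\pi(\phi f)$ ($f\in C_c(G)$, pointwise product) extends to a completely bounded map $T_\phi$ on $C^*(G)$, and $\|\phi\|_{cb}$ denotes the completely bounded norm $\|T_\phi\|_{cb}$. *)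

theory Defs
  imports "HOL-Analysis.Analysis"
begin

section \<open>Separable complex Hilbert spaces\<close>

text \<open>
  Fibres of a bundle and representation spaces are Hilbert spaces that have to be quantified over,
  so a Hilbert space is a structure on a carrier set rather than a type.
\<close>

record 'h hilb =
  hcarrier :: "'h set"
  hzero :: 'h
  hadd :: "'h \<Rightarrow> 'h \<Rightarrow> 'h"
  hscale :: "complex \<Rightarrow> 'h \<Rightarrow> 'h"
  hip :: "'h \<Rightarrow> 'h \<Rightarrow> complex"

definition hnorm :: "'h hilb \<Rightarrow> 'h \<Rightarrow> real" where
  "hnorm H x = sqrt (Re (hip H x x))"

definition hdiff :: "'h hilb \<Rightarrow> 'h \<Rightarrow> 'h \<Rightarrow> 'h" where
  "hdiff H x y = hadd H x (hscale H (- 1) y)"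

text \<open>The value 0 outside the carrier makes this a total distance function as required by the
  locale \<^locale>\<open>Metric_space\<close>.\<close>

definition hdist :: "'h hilb \<Rightarrow> 'h \<Rightarrow> 'h \<Rightarrow> real" where
  "hdist H x y = (if x \<in> hcarrier H \<and> y \<in> hcarrier H then hnorm H (hdiff H x y) else 0)"

primrec hsum :: "'h hilb \<Rightarrow> (nat \<Rightarrow> 'h) \<Rightarrow> nat \<Rightarrow> 'h" where
  "hsum H f 0 = hzero H"
| "hsum H f (Suc n) = hadd H (hsum H f n) (f n)"

definition complex_vector_space :: "'h hilb \<Rightarrow> bool" where
  "complex_vector_space H \<longleftrightarrow>
     hzero H \<in> hcarrier H \<and>
     (\<forall>x\<in>hcarrier H. \<forall>y\<in>hcarrier H. hadd H x y \<in> hcarrier H) \<and>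
     (\<forall>a. \<forall>x\<in>hcarrier H. hscale H a x \<in> hcarrier H) \<and>
     (\<forall>x\<in>hcarrier H. \<forall>y\<in>hcarrier H. \<forall>z\<in>hcarrier H.
        hadd H (hadd H x y) z = hadd H x (hadd H y z)) \<and>
     (\<forall>x\<in>hcarrier H. \<forall>y\<in>hcarrier H. hadd H x y = hadd H y x) \<and>
     (\<forall>x\<in>hcarrier H. hadd H x (hzero H) = x) \<and>
     (\<forall>x\<in>hcarrier H. hadd H x (hscale H (- 1) x) = hzero H) \<and>
     (\<forall>x\<in>hcarrier H. hscale H 1 x = x) \<and>
     (\<forall>a b. \<forall>x\<in>hcarrier H. hscale H a (hscale H b x) = hscale H (a * b) x) \<and>
     (\<forall>a b. \<forall>x\<in>hcarrier H. hscale H (a + b) x = hadd H (hscale H a x) (hscale H b x)) \<and>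
     (\<forall>a. \<forall>x\<in>hcarrier H. \<forall>y\<in>hcarrier H.
        hscale H a (hadd H x y) = hadd H (hscale H a x) (hscale H a y))"

text \<open>The inner product is linear in the second variable and hence, by Hermitian symmetry,
  conjugate linear in the first.\<close>

definition inner_product_space :: "'h hilb \<Rightarrow> bool" where
  "inner_product_space H \<longleftrightarrow>
     complex_vector_space H \<and>
     (\<forall>x\<in>hcarrier H. \<forall>y\<in>hcarrier H. \<forall>z\<in>hcarrier H.
        hip H x (hadd H y z) = hip H x y + hip H x z) \<and>
     (\<forall>a. \<forall>x\<in>hcarrier H. \<forall>y\<in>hcarrier H. hip H x (hscale H a y) = a * hip H x y) \<and>
     (\<forall>x\<in>hcarrier H. \<forall>y\<in>hcarrier H. hip H y x = cnj (hip H x y)) \<and>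
     (\<forall>x\<in>hcarrier H. 0 \<le> Re (hip H x x)) \<and>
     (\<forall>x\<in>hcarrier H. hip H x x = 0 \<longrightarrow> x = hzero H)"

definition separable_hilbert_space :: "'h hilb \<Rightarrow> bool" where
  "separable_hilbert_space H \<longleftrightarrow>
     inner_product_space H \<and>
     Metric_space.mcomplete (hcarrier H) (hdist H) \<and>
     separable_space (Metric_space.mtopology (hcarrier H) (hdist H))"

definition hlinear :: "'h hilb \<Rightarrow> 'k hilb \<Rightarrow> ('h \<Rightarrow> 'k) \<Rightarrow> bool" where
  "hlinear H K A \<longleftrightarrow>
     A \<in> hcarrier H \<rightarrow> hcarrier K \<and>
     (\<forall>x\<in>hcarrier H. \<forall>y\<in>hcarrier H. A (hadd H x y) = hadd K (A x) (A y)) \<and>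
     (\<forall>a. \<forall>x\<in>hcarrier H. A (hscale H a x) = hscale K a (A x))"

definition bounded_operators :: "'h hilb \<Rightarrow> ('h \<Rightarrow> 'h) set" where
  "bounded_operators H =
     {A \<in> extensional (hcarrier H).
        hlinear H H A \<and> (\<exists>C. \<forall>x\<in>hcarrier H. hnorm H (A x) \<le> C * hnorm H x)}"

text \<open>The operator norm of an \<open>n \<times> n\<close> matrix of operators on \<open>H\<close>, acting on the
  \<open>n\<close>-fold Hilbert space direct sum of \<open>H\<close>.\<close>

definition matrix_opnorm :: "'h hilb \<Rightarrow> nat \<Rightarrow> (nat \<Rightarrow> nat \<Rightarrow> 'h \<Rightarrow> 'h) \<Rightarrow> ennreal" where
  "matrix_opnorm H n A =
     (SUP h \<in> {h. (\<forall>j<n. h j \<in> hcarrier H) \<and> (\<Sum>j<n. (hnorm H (h j))\<^sup>2) \<le> 1}.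
        ennreal (sqrt (\<Sum>i<n. (hnorm H (hsum H (\<lambda>j. A i j (h j)) n))\<^sup>2)))"

text \<open>
  Universe for separable Hilbert spaces: the coordinate map with respect to a dense sequence injects
  every separable Hilbert space into the sequences of complex numbers, so every separable Hilbert
  space is isometrically isomorphic to one whose carrier is a set of such sequences. (The operations
  on the carrier are arbitrary; they need not be the pointwise ones.)
\<close>

type_synonym hpoint = "nat \<Rightarrow> complex"


section \<open>Locally compact groupoids and Haar systems\<close>

text \<open>
  The groupoid is the whole type; its multiplication is only meaningful on composable pairs, i.e.
  pairs \<open>(x, y)\<close> with \<open>src G x = rng G y\<close>.
\<close>

record 'g gpd =
  rng :: "'g \<Rightarrow> 'g"
  src :: "'g \<Rightarrow> 'g"
  gmult :: "'g \<Rightarrow> 'g \<Rightarrow> 'g"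
  ginv :: "'g \<Rightarrow> 'g"

definition groupoid :: "'g gpd \<Rightarrow> bool" where
  "groupoid G \<longleftrightarrow>
     (\<forall>x. rng G (rng G x) = rng G x \<and> src G (rng G x) = rng G x \<and>
          rng G (src G x) = src G x \<and> src G (src G x) = src G x) \<and>
     (\<forall>x y. src G x = rng G y \<longrightarrow>
        rng G (gmult G x y) = rng G x \<and> src G (gmult G x y) = src G y) \<and>
     (\<forall>x y z. src G x = rng G y \<and> src G y = rng G z \<longrightarrow>
        gmult G (gmult G x y) z = gmult G x (gmult G y z)) \<and>
     (\<forall>x. gmult G (rng G x) x = x \<and> gmult G x (src G x) = x) \<and>
     (\<forall>x. rng G (ginv G x) = src G x \<and> src G (ginv G x) = rng G x \<and>
          gmult G x (ginv G x) = rng G x \<and> gmult G (ginv G x) x = src G x)"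

definition unit_space :: "'g gpd \<Rightarrow> 'g set" where
  "unit_space G = range (rng G)"

text \<open>Continuity of the range and source maps follows from that of the multiplication and the
  inversion.\<close>

definition locally_compact_groupoid :: "'g::topological_space gpd \<Rightarrow> bool" where
  "locally_compact_groupoid G \<longleftrightarrow>
     groupoid G \<and>
     locally_compact_space (euclidean :: 'g topology) \<and>
     continuous_on {(x, y). src G x = rng G y} (\<lambda>(x, y). gmult G x y) \<and>
     continuous_on UNIV (ginv G)"

definition Cc :: "('g::topological_space \<Rightarrow> complex) set" where
  "Cc = {f. continuous_on UNIV f \<and> compact (closure {x. f x \<noteq> 0})}"

text \<open>
  The measure attached to a unit \<open>u\<close> is a Borel measure on the whole space, finite on compact sets
  (so regular, as the space is second countable and locally compact Hausdorff), with support exactly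
  the range fibre over \<open>u\<close>. The integrals over the range fibre of \<open>src G x\<close> are restricted
  explicitly because \<open>gmult G x y\<close> is uncontrolled, and possibly not measurable in \<open>y\<close>, elsewhere.
\<close>

definition left_haar_system :: "'g::topological_space gpd \<Rightarrow> ('g \<Rightarrow> 'g measure) \<Rightarrow> bool" where
  "left_haar_system G lam \<longleftrightarrow>
     (\<forall>u\<in>unit_space G.
        sets (lam u) = sets borel \<and>
        (\<forall>K. compact K \<longrightarrow> emeasure (lam u) K < \<infinity>) \<and>
        (\<forall>V. open V \<longrightarrow> (emeasure (lam u) V = 0 \<longleftrightarrow> V \<inter> {x. rng G x = u} = {}))) \<and>
     (\<forall>f\<in>Cc. continuous_on (unit_space G) (\<lambda>u. LINT x|lam u. f x)) \<and>
     (\<forall>f\<in>Cc. \<forall>x.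
        (LINT y:{y. rng G y = src G x}|lam (src G x). f (gmult G x y)) = (LINT y|lam (rng G x). f y))"


section \<open>Hilbert bundles and the algebra B(G)\<close>

text \<open>Continuous fields of Hilbert spaces over \<open>X\<close> in the sense of Dixmier; \<open>Gam\<close> is the space of
  continuous sections. Sections are \<open>undefined\<close> outside \<open>X\<close>.\<close>

definition continuous_hilbert_field ::
  "'x::topological_space set \<Rightarrow> ('x \<Rightarrow> 'h hilb) \<Rightarrow> ('x \<Rightarrow> 'h) set \<Rightarrow> bool" where
  "continuous_hilbert_field X H Gam \<longleftrightarrow>
     (\<forall>u\<in>X. separable_hilbert_space (H u)) \<and>
     Gam \<subseteq> (\<Pi>\<^sub>E u\<in>X. hcarrier (H u)) \<and>
     (\<lambda>u\<in>X. hzero (H u)) \<in> Gam \<and>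
     (\<forall>xi\<in>Gam. \<forall>eta\<in>Gam. (\<lambda>u\<in>X. hadd (H u) (xi u) (eta u)) \<in> Gam) \<and>
     (\<forall>a. \<forall>xi\<in>Gam. (\<lambda>u\<in>X. hscale (H u) a (xi u)) \<in> Gam) \<and>
     (\<forall>u\<in>X. \<forall>h\<in>hcarrier (H u). \<forall>e>0. \<exists>xi\<in>Gam. hnorm (H u) (hdiff (H u) h (xi u)) < e) \<and>
     (\<forall>xi\<in>Gam. continuous_on X (\<lambda>u. hnorm (H u) (xi u))) \<and>
     (\<forall>xi \<in> (\<Pi>\<^sub>E u\<in>X. hcarrier (H u)).
        (\<forall>u\<in>X. \<forall>e>0. \<exists>zeta\<in>Gam. \<exists>U. open U \<and> u \<in> U \<and>
           (\<forall>v\<in>U \<inter> X. hnorm (H v) (hdiff (H v) (xi v) (zeta v)) \<le> e))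
        \<longrightarrow> xi \<in> Gam)"

definition bounded_sections ::
  "'x set \<Rightarrow> ('x \<Rightarrow> 'h hilb) \<Rightarrow> ('x \<Rightarrow> 'h) set \<Rightarrow> ('x \<Rightarrow> 'h) set" where
  "bounded_sections X H Gam = {xi \<in> Gam. bdd_above ((\<lambda>u. hnorm (H u) (xi u)) ` X)}"

definition section_norm :: "'x set \<Rightarrow> ('x \<Rightarrow> 'h hilb) \<Rightarrow> ('x \<Rightarrow> 'h) \<Rightarrow> real" where
  "section_norm X H xi = (SUP u\<in>X. hnorm (H u) (xi u))"

definition coefficient ::
  "'g gpd \<Rightarrow> ('g \<Rightarrow> 'h hilb) \<Rightarrow> ('g \<Rightarrow> 'h \<Rightarrow> 'h) \<Rightarrow> ('g \<Rightarrow> 'h) \<Rightarrow> ('g \<Rightarrow> 'h) \<Rightarrow> 'g \<Rightarrow> complex" where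
  "coefficient G H L xi eta = (\<lambda>x. hip (H (rng G x)) (L x (xi (src G x))) (eta (rng G x)))"

definition G_hilbert_bundle ::
  "'g::topological_space gpd \<Rightarrow> ('g \<Rightarrow> 'h hilb) \<Rightarrow> ('g \<Rightarrow> 'h) set \<Rightarrow> ('g \<Rightarrow> 'h \<Rightarrow> 'h) \<Rightarrow> bool" where
  "G_hilbert_bundle G H Gam L \<longleftrightarrow>
     continuous_hilbert_field (unit_space G) H Gam \<and>
     (\<forall>x. hlinear (H (src G x)) (H (rng G x)) (L x) \<and>
          (\<forall>h\<in>hcarrier (H (src G x)). hnorm (H (rng G x)) (L x h) = hnorm (H (src G x)) h) \<and>
          L x ` hcarrier (H (src G x)) = hcarrier (H (rng G x))) \<and>
     (\<forall>x y. src G x = rng G y \<longrightarrow>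
        (\<forall>h\<in>hcarrier (H (src G y)). L (gmult G x y) h = L x (L y h))) \<and>
     (\<forall>xi\<in>bounded_sections (unit_space G) H Gam. \<forall>eta\<in>bounded_sections (unit_space G) H Gam.
        continuous_on UNIV (coefficient G H L xi eta))"

definition represents ::
  "'g::topological_space gpd \<Rightarrow> ('g \<Rightarrow> complex) \<Rightarrow> ('g \<Rightarrow> 'h hilb) \<Rightarrow> ('g \<Rightarrow> 'h) set \<Rightarrow>
   ('g \<Rightarrow> 'h \<Rightarrow> 'h) \<Rightarrow> ('g \<Rightarrow> 'h) \<Rightarrow> ('g \<Rightarrow> 'h) \<Rightarrow> bool" where
  "represents G phi H Gam L xi eta \<longleftrightarrow>
     G_hilbert_bundle G H Gam L \<and>
     xi \<in> bounded_sections (unit_space G) H Gam \<and>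
     eta \<in> bounded_sections (unit_space G) H Gam \<and>
     phi = coefficient G H L xi eta"

definition BG :: "'g::topological_space gpd \<Rightarrow> ('g \<Rightarrow> complex) set" where
  "BG G = {phi. \<exists>(H :: 'g \<Rightarrow> hpoint hilb) Gam L xi eta. represents G phi H Gam L xi eta}"

definition BG_norm :: "'g::topological_space gpd \<Rightarrow> ('g \<Rightarrow> complex) \<Rightarrow> real" where
  "BG_norm G phi =
     Inf {section_norm (unit_space G) H xi * section_norm (unit_space G) H eta
          | (H :: 'g \<Rightarrow> hpoint hilb) Gam L xi eta. represents G phi H Gam L xi eta}"


section \<open>The full groupoid C*-algebra\<close>

definition convolution ::
  "'g::topological_space gpd \<Rightarrow> ('g \<Rightarrow> 'g measure) \<Rightarrow> ('g \<Rightarrow> complex) \<Rightarrow> ('g \<Rightarrow> complex) \<Rightarrow>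
   'g \<Rightarrow> complex" where
  "convolution G lam f g =
     (\<lambda>x. LINT y:{y. rng G y = rng G x}|lam (rng G x). f y * g (gmult G (ginv G y) x))"

definition involution :: "'g gpd \<Rightarrow> ('g \<Rightarrow> complex) \<Rightarrow> 'g \<Rightarrow> complex" where
  "involution G f = (\<lambda>x. cnj (f (ginv G x)))"

definition I_norm :: "'g gpd \<Rightarrow> ('g \<Rightarrow> 'g measure) \<Rightarrow> ('g \<Rightarrow> complex) \<Rightarrow> real" where
  "I_norm G lam f =
     max (SUP u\<in>unit_space G. LINT x|lam u. norm (f x))
         (SUP u\<in>unit_space G. LINT x|lam u. norm (f (ginv G x)))"

text \<open>Bounded representations of the *-algebra \<open>Cc\<close> in the sense of Renault: nondegenerate
  *-representations on separable Hilbert spaces that are contractive for the I-norm.\<close>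

type_synonym 'g crep = "hpoint hilb \<times> (('g \<Rightarrow> complex) \<Rightarrow> hpoint \<Rightarrow> hpoint)"

definition bounded_reps :: "'g::topological_space gpd \<Rightarrow> ('g \<Rightarrow> 'g measure) \<Rightarrow> 'g crep set" where
  "bounded_reps G lam = {(H, rho).
     separable_hilbert_space H \<and>
     rho \<in> Cc \<rightarrow>\<^sub>E bounded_operators H \<and>
     (\<forall>f\<in>Cc. \<forall>g\<in>Cc. \<forall>h\<in>hcarrier H. rho (\<lambda>x. f x + g x) h = hadd H (rho f h) (rho g h)) \<and>
     (\<forall>a. \<forall>f\<in>Cc. \<forall>h\<in>hcarrier H. rho (\<lambda>x. a * f x) h = hscale H a (rho f h)) \<and>
     (\<forall>f\<in>Cc. \<forall>g\<in>Cc. \<forall>h\<in>hcarrier H. rho (convolution G lam f g) h = rho f (rho g h)) \<and>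
     (\<forall>f\<in>Cc. \<forall>h\<in>hcarrier H. \<forall>k\<in>hcarrier H.
        hip H (rho (involution G f) h) k = hip H h (rho f k)) \<and>
     (\<forall>f\<in>Cc. \<forall>h\<in>hcarrier H. hnorm H (rho f h) \<le> I_norm G lam f * hnorm H h) \<and>
     (\<forall>h\<in>hcarrier H. \<forall>e>0. \<exists>n f k.
        (\<forall>i<n. f i \<in> Cc \<and> k i \<in> hcarrier H) \<and>
        hnorm H (hdiff H h (hsum H (\<lambda>i. rho (f i) (k i)) n)) < e)}"

text \<open>
  The full C*-algebra is the completion of \<open>Cc\<close> in the norm \<open>\<parallel>f\<parallel> = sup \<parallel>rho f\<parallel>\<close>, the supremum being over
  all bounded representations. It is realised as the closure of the image of \<open>Cc\<close> under the
  universal representation: an element is a family of operators, one on the space of each bounded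
  representation, with all operations pointwise. Accordingly the C*-norm on \<open>n \<times> n\<close> matrices
  over the algebra is the supremum of the operator norms of the components.
\<close>

type_synonym 'g celem = "'g crep \<Rightarrow> hpoint \<Rightarrow> hpoint"

definition cembed ::
  "'g::topological_space gpd \<Rightarrow> ('g \<Rightarrow> 'g measure) \<Rightarrow> ('g \<Rightarrow> complex) \<Rightarrow> 'g celem" where
  "cembed G lam f = (\<lambda>r\<in>bounded_reps G lam. snd r f)"

definition cadd ::
  "'g::topological_space gpd \<Rightarrow> ('g \<Rightarrow> 'g measure) \<Rightarrow> 'g celem \<Rightarrow> 'g celem \<Rightarrow> 'g celem" where
  "cadd G lam a b =
     (\<lambda>r\<in>bounded_reps G lam. \<lambda>h\<in>hcarrier (fst r). hadd (fst r) (a r h) (b r h))"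

definition cscale ::
  "'g::topological_space gpd \<Rightarrow> ('g \<Rightarrow> 'g measure) \<Rightarrow> complex \<Rightarrow> 'g celem \<Rightarrow> 'g celem" where
  "cscale G lam z a = (\<lambda>r\<in>bounded_reps G lam. \<lambda>h\<in>hcarrier (fst r). hscale (fst r) z (a r h))"

definition matrix_norm ::
  "'g::topological_space gpd \<Rightarrow> ('g \<Rightarrow> 'g measure) \<Rightarrow> nat \<Rightarrow> (nat \<Rightarrow> nat \<Rightarrow> 'g celem) \<Rightarrow> ennreal" where
  "matrix_norm G lam n a =
     (SUP r\<in>bounded_reps G lam. matrix_opnorm (fst r) n (\<lambda>i j. a i j r))"

definition cnorm :: "'g::topological_space gpd \<Rightarrow> ('g \<Rightarrow> 'g measure) \<Rightarrow> 'g celem \<Rightarrow> ennreal" where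
  "cnorm G lam a = matrix_norm G lam 1 (\<lambda>i j. a)"

definition Cstar :: "'g::topological_space gpd \<Rightarrow> ('g \<Rightarrow> 'g measure) \<Rightarrow> 'g celem set" where
  "Cstar G lam = {a \<in> (\<Pi>\<^sub>E r\<in>bounded_reps G lam. bounded_operators (fst r)).
     \<forall>e>0. \<exists>f\<in>Cc. cnorm G lam (cadd G lam a (cscale G lam (- 1) (cembed G lam f))) \<le> ennreal e}"


section \<open>Completely bounded maps and the multiplier attached to a function\<close>

definition cb_norm ::
  "'g::topological_space gpd \<Rightarrow> ('g \<Rightarrow> 'g measure) \<Rightarrow> ('g celem \<Rightarrow> 'g celem) \<Rightarrow> ennreal" where
  "cb_norm G lam T =
     (SUP n. SUP a \<in> {a. (\<forall>i<n. \<forall>j<n. a i j \<in> Cstar G lam) \<and> matrix_norm G lam n a \<le> 1}.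
        matrix_norm G lam n (\<lambda>i j. T (a i j)))"

definition completely_bounded ::
  "'g::topological_space gpd \<Rightarrow> ('g \<Rightarrow> 'g measure) \<Rightarrow> ('g celem \<Rightarrow> 'g celem) \<Rightarrow> bool" where
  "completely_bounded G lam T \<longleftrightarrow>
     T \<in> Cstar G lam \<rightarrow> Cstar G lam \<and>
     (\<forall>a\<in>Cstar G lam. \<forall>b\<in>Cstar G lam. T (cadd G lam a b) = cadd G lam (T a) (T b)) \<and>
     (\<forall>z. \<forall>a\<in>Cstar G lam. T (cscale G lam z a) = cscale G lam z (T a)) \<and>
     cb_norm G lam T < \<infinity>"

text \<open>The completely bounded extension is unique on \<open>Cstar G lam\<close> by density; extensionality makes
  it unique as a function.\<close>

definition multiplier ::
  "'g::topological_space gpd \<Rightarrow> ('g \<Rightarrow> 'g measure) \<Rightarrow> ('g \<Rightarrow> complex) \<Rightarrow> 'g celem \<Rightarrow> 'g celem" where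
  "multiplier G lam phi =
     (THE T. T \<in> extensional (Cstar G lam) \<and> completely_bounded G lam T \<and>
        (\<forall>f\<in>Cc. T (cembed G lam f) = cembed G lam (\<lambda>x. phi x * f x)))"

definition cb_multiplier_norm ::
  "'g::topological_space gpd \<Rightarrow> ('g \<Rightarrow> 'g measure) \<Rightarrow> ('g \<Rightarrow> complex) \<Rightarrow> ennreal" where
  "cb_multiplier_norm G lam phi = cb_norm G lam (multiplier G lam phi)"

end

theory Submission
  imports Defs
begin

text \<open>
  Let \<open>phi\<close> be the coefficient of \<open>xi\<close>, \<open>eta\<close> and \<open>rho\<close> a bounded representation on \<open>R\<close>. The bundle and
  \<open>rho\<close> have a tensor product representation \<open>sigma\<close> of \<open>Cc\<close> for which
  \<open>\<langle>eta \<otimes> k, sigma f (xi \<otimes> h)\<rangle> = \<langle>k, rho (phi f) h\<rangle>\<close>, up to complex conjugation in the bundle; so the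
  multiplier by \<open>phi\<close> is the compression of \<open>sigma\<close> by two operators of norms \<open>\<parallel>xi\<parallel>\<close> and \<open>\<parallel>eta\<parallel>\<close>.

  Instead of disintegrating \<open>rho\<close>, \<open>sigma\<close> is obtained by a GNS construction on \<open>Cc\<^sup>n\<close> from
  \<open>\<langle>F, F'\<rangle> = \<Sum> \<langle>h_i, rho (phi_xi (F_i* F'_j)) h_j\<rangle>\<close> with \<open>phi_xi\<close> the coefficient of \<open>xi\<close>, \<open>xi\<close>. For a
  finite frame \<open>e_n\<close> of sections that is almost complete on the compact supports involved,
  \<open>phi_xi (F_i* F'_j)\<close> is close in I-norm to \<open>\<Sum>_n (phi_n F_i)* (phi_n F'_j)\<close>, where \<open>phi_n\<close> is the
  coefficient of \<open>xi\<close>, \<open>e_n\<close>. This gives positivity, and, when \<open>eta / \<parallel>eta\<parallel>\<close> belongs to the frame, the bound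
  \<open>\<parallel>\<Sum>_j rho (phi F_j) h_j\<parallel> \<le> \<parallel>eta\<parallel> \<parallel>F\<parallel>\<close>, from which the matrix estimate follows by two applications of the
  Cauchy-Schwarz inequality.
\<close>

section \<open>Semi-inner product spaces\<close>

text \<open>A bound on a matrix over \<open>Cc\<close> can be exploited only through members of
  \<open>bounded_reps\<close>. So the space of \<open>sigma\<close> has to be a separable Hilbert
  space with points of type \<open>hpoint\<close>, and \<open>sigma\<close> has to be nondegenerate
  and contractive for the I-norm. This is the reason for a completion written in coordinates, for
  the passage to an essential subspace, and for a bound on \<open>act\<close> with constant exactly
  1. The second obstacle is that no approximate unit of \<open>Cc\<close> is at hand: the space
  contains the vectors f (xi \<otimes> h) but not xi \<otimes> h. If it contained them, the matrix
  bound could be applied to xi \<otimes> h_j directly. Instead it is applied to vectors produced by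
  the adjoint matrix, which lie in the space, and two Cauchy-Schwarz steps lead back. Conjugation
  enters because \<open>coeff xi xi\<close> is <L_x xi, xi>, where the tensor product with the
  bundle itself would have <xi, L_x xi>; it is the conjugate bundle that is tensored. Frames replace
  orthonormal bases of the fibres: they consist of finitely many continuous sections and only have
  to be good over a compact set, so no measurable choices arise.\<close>

locale semi_ip =
  fixes H :: "'h hilb"
  assumes vs: "complex_vector_space H"
    and ip_add_right: "\<And>x y z. x \<in> hcarrier H \<Longrightarrow> y \<in> hcarrier H \<Longrightarrow> z \<in> hcarrier H \<Longrightarrow>
        hip H x (hadd H y z) = hip H x y + hip H x z"
    and ip_scale_right: "\<And>a x y. x \<in> hcarrier H \<Longrightarrow> y \<in> hcarrier H \<Longrightarrow>
        hip H x (hscale H a y) = a * hip H x y"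
    and ip_sym: "\<And>x y. x \<in> hcarrier H \<Longrightarrow> y \<in> hcarrier H \<Longrightarrow> hip H y x = cnj (hip H x y)"
    and ip_nonneg: "\<And>x. x \<in> hcarrier H \<Longrightarrow> 0 \<le> Re (hip H x x)"
begin

abbreviation C where "C \<equiv> hcarrier H"
abbreviation dst where "dst x y \<equiv> hnorm H (hdiff H x y)"

lemma zero_closed [simp]: "hzero H \<in> C"
  and add_closed [simp]: "x \<in> C \<Longrightarrow> y \<in> C \<Longrightarrow> hadd H x y \<in> C"
  and scale_closed [simp]: "x \<in> C \<Longrightarrow> hscale H a x \<in> C"
  and add_assoc: "x \<in> C \<Longrightarrow> y \<in> C \<Longrightarrow> z \<in> C \<Longrightarrow> hadd H (hadd H x y) z = hadd H x (hadd H y z)"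
  and add_comm: "x \<in> C \<Longrightarrow> y \<in> C \<Longrightarrow> hadd H x y = hadd H y x"
  and add_zero: "x \<in> C \<Longrightarrow> hadd H x (hzero H) = x"
  and add_neg: "x \<in> C \<Longrightarrow> hadd H x (hscale H (-1) x) = hzero H"
  and scale_one: "x \<in> C \<Longrightarrow> hscale H 1 x = x"
  and scale_scale: "x \<in> C \<Longrightarrow> hscale H a (hscale H b x) = hscale H (a * b) x"
  and scale_add_left: "x \<in> C \<Longrightarrow> hscale H (a + b) x = hadd H (hscale H a x) (hscale H b x)"
  and scale_add_right: "x \<in> C \<Longrightarrow> y \<in> C \<Longrightarrow> hscale H a (hadd H x y) = hadd H (hscale H a x) (hscale H a y)"
  by (insert vs, unfold complex_vector_space_def, (elim conjE, metis)+)

lemma zero_add: "x \<in> C \<Longrightarrow> hadd H (hzero H) x = x"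
  using add_comm add_zero zero_closed by metis

lemma scale_zero: "x \<in> C \<Longrightarrow> hscale H 0 x = hzero H"
  using scale_add_left[of x 1 "-1"] add_neg scale_one by simp

lemma scale_hzero: "hscale H a (hzero H) = hzero H"
  by (metis scale_zero scale_scale zero_closed mult_zero_right)

lemma diff_closed [simp]: "x \<in> C \<Longrightarrow> y \<in> C \<Longrightarrow> hdiff H x y \<in> C"
  by (simp add: hdiff_def)

lemma hsum_closed: "(\<And>i. i < n \<Longrightarrow> f i \<in> C) \<Longrightarrow> hsum H f n \<in> C"
  by (induction n) auto

lemma hsum_scale: "(\<And>i. i < n \<Longrightarrow> f i \<in> C) \<Longrightarrow> hscale H a (hsum H f n) = hsum H (\<lambda>i. hscale H a (f i)) n"
  by (induction n) (simp_all add: scale_hzero scale_add_right hsum_closed)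

lemma hsum_cong: "(\<And>i. i < n \<Longrightarrow> f i = g i) \<Longrightarrow> hsum H f n = hsum H g n"
  by (induction n) auto

lemma ip_add_left: "x \<in> C \<Longrightarrow> y \<in> C \<Longrightarrow> z \<in> C \<Longrightarrow> hip H (hadd H x y) z = hip H x z + hip H y z"
  using ip_add_right ip_sym by (metis add_closed complex_cnj_add)

lemma ip_scale_left: "x \<in> C \<Longrightarrow> y \<in> C \<Longrightarrow> hip H (hscale H a x) y = cnj a * hip H x y"
  using ip_scale_right ip_sym by (metis scale_closed complex_cnj_mult)

lemma ip_diff_right: "x \<in> C \<Longrightarrow> y \<in> C \<Longrightarrow> z \<in> C \<Longrightarrow> hip H x (hdiff H y z) = hip H x y - hip H x z"
  by (simp add: hdiff_def ip_add_right ip_scale_right)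

lemma ip_diff_left: "x \<in> C \<Longrightarrow> y \<in> C \<Longrightarrow> z \<in> C \<Longrightarrow> hip H (hdiff H x y) z = hip H x z - hip H y z"
  by (simp add: hdiff_def ip_add_left ip_scale_left)

lemma ip_zero_right: "x \<in> C \<Longrightarrow> hip H x (hzero H) = 0"
  by (metis scale_zero ip_scale_right zero_closed mult_zero_left)

lemma ip_zero_left: "x \<in> C \<Longrightarrow> hip H (hzero H) x = 0"
  using ip_zero_right ip_sym by (metis complex_cnj_zero zero_closed)

lemma ip_hsum_right: "x \<in> C \<Longrightarrow> (\<And>i. i < n \<Longrightarrow> f i \<in> C) \<Longrightarrow> hip H x (hsum H f n) = (\<Sum>i<n. hip H x (f i))"
  by (induction n) (simp_all add: ip_zero_right ip_add_right hsum_closed)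

lemma ip_hsum_left: "x \<in> C \<Longrightarrow> (\<And>i. i < n \<Longrightarrow> f i \<in> C) \<Longrightarrow> hip H (hsum H f n) x = (\<Sum>i<n. hip H (f i) x)"
  by (induction n) (simp_all add: ip_zero_left ip_add_left hsum_closed)

lemma ip_self: "x \<in> C \<Longrightarrow> hip H x x = of_real ((hnorm H x)\<^sup>2)"
  using ip_sym[of x x] ip_nonneg[of x]
  by (simp add: hnorm_def complex_eq_iff)

lemma norm_sq: "x \<in> C \<Longrightarrow> (hnorm H x)\<^sup>2 = Re (hip H x x)"
  using ip_self[of x] by simp

lemma norm_nonneg [simp]: "x \<in> C \<Longrightarrow> 0 \<le> hnorm H x"
  using ip_nonneg by (simp add: hnorm_def)

lemma norm_zero: "hnorm H (hzero H) = 0"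
  by (simp add: hnorm_def ip_zero_left)

text \<open>The square norm of y - t c x, with c the inner product and t real, is a nonnegative
  quadratic polynomial in t. Vectors of norm 0 may be nonzero here, so they need a case of their
  own.\<close>

lemma cauchy_schwarz:
  assumes x: "x \<in> C" and y: "y \<in> C"
  shows "norm (hip H x y) \<le> hnorm H x * hnorm H y"
proof -
  define c where "c = hip H x y"
  define A where "A = (hnorm H x)\<^sup>2"
  define B where "B = (hnorm H y)\<^sup>2"
  have ineq: "0 \<le> B - 2 * t * (cmod c)\<^sup>2 + t\<^sup>2 * (cmod c)\<^sup>2 * A" for t :: real
  proof -
    have yx: "hip H y x = cnj c" using ip_sym[OF x y] c_def by simp
    have "hip H (hdiff H y (hscale H (t * c) x)) (hdiff H y (hscale H (t * c) x))
       = hip H y y - t * c * cnj c - cnj (t * c) * c + cnj (t * c) * (t * c) * hip H x x"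
      using x y by (simp add: ip_diff_left ip_diff_right ip_scale_left ip_scale_right yx c_def[symmetric] algebra_simps)
    also have "\<dots> = of_real B - 2 * t * (c * cnj c) + t^2 * (c * cnj c) * of_real A"
      using x y by (simp add: ip_self A_def B_def algebra_simps power2_eq_square)
    also have "\<dots> = of_real (B - 2 * t * (cmod c)\<^sup>2 + t\<^sup>2 * (cmod c)\<^sup>2 * A)"
      by (simp add: complex_norm_square[symmetric])
    finally have "Re (hip H (hdiff H y (hscale H (t * c) x)) (hdiff H y (hscale H (t * c) x)))
       = B - 2 * t * (cmod c)\<^sup>2 + t\<^sup>2 * (cmod c)\<^sup>2 * A" by simp
    moreover have "0 \<le> Re (hip H (hdiff H y (hscale H (t * c) x)) (hdiff H y (hscale H (t * c) x)))"
      using x y by (intro ip_nonneg) simp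
    ultimately show ?thesis by simp
  qed
  have "(cmod c)\<^sup>2 \<le> A * B"
  proof (cases "A = 0")
    case True
    have "c = 0"
    proof (rule ccontr)
      assume "c \<noteq> 0"
      \<comment> \<open>For A = 0 the inequality is linear in t, and this t makes its right-hand
        side -1.\<close>
      then have "2 * ((B + 1) / (2 * (cmod c)\<^sup>2)) * (cmod c)\<^sup>2 = B + 1" by simp
      then show False using ineq[of "(B + 1) / (2 * (cmod c)\<^sup>2)"] True by simp
    qed
    then show ?thesis using True by simp
  next
    case False
    then have "A > 0" by (simp add: A_def)
    then show ?thesis
      using ineq[of "1 / A"] by (simp add: field_simps power2_eq_square)
  qed
  then have "cmod c \<le> sqrt (A * B)" by (rule real_le_rsqrt)
  then show ?thesis using x y by (simp add: c_def A_def B_def real_sqrt_mult)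
qed

lemma norm_add_sq: "x \<in> C \<Longrightarrow> y \<in> C \<Longrightarrow>
    (hnorm H (hadd H x y))\<^sup>2 = (hnorm H x)\<^sup>2 + 2 * Re (hip H x y) + (hnorm H y)\<^sup>2"
  using ip_sym[of x y] by (simp add: norm_sq ip_add_left ip_add_right)

lemma norm_diff_sq: "x \<in> C \<Longrightarrow> y \<in> C \<Longrightarrow>
    (hnorm H (hdiff H x y))\<^sup>2 = (hnorm H x)\<^sup>2 - 2 * Re (hip H x y) + (hnorm H y)\<^sup>2"
  using ip_sym[of x y] by (simp add: norm_sq ip_diff_left ip_diff_right)

lemma norm_scale: "x \<in> C \<Longrightarrow> hnorm H (hscale H a x) = cmod a * hnorm H x"
proof -
  assume x: "x \<in> C"
  have "hip H (hscale H a x) (hscale H a x) = (a * cnj a) * hip H x x"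
    using x by (simp add: ip_scale_left ip_scale_right)
  also have "\<dots> = of_real ((cmod a * hnorm H x)\<^sup>2)"
    using x by (simp add: complex_norm_square[symmetric] ip_self power_mult_distrib)
  finally have "Re (hip H (hscale H a x) (hscale H a x)) = (cmod a * hnorm H x)\<^sup>2" by simp
  then show ?thesis using x by (simp add: hnorm_def[of H "hscale H a x"])
qed

lemma norm_triangle: "x \<in> C \<Longrightarrow> y \<in> C \<Longrightarrow> hnorm H (hadd H x y) \<le> hnorm H x + hnorm H y"
proof (rule power2_le_imp_le)
  assume x: "x \<in> C" and y: "y \<in> C"
  have "Re (hip H x y) \<le> hnorm H x * hnorm H y"
    using cauchy_schwarz[OF x y] complex_Re_le_cmod order_trans by blast
  then show "(hnorm H (hadd H x y))\<^sup>2 \<le> (hnorm H x + hnorm H y)\<^sup>2"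
    using x y by (simp add: norm_add_sq power2_sum)
  show "0 \<le> hnorm H x + hnorm H y" using x y by simp
qed

lemma norm_hsum_le: "(\<And>i. i < n \<Longrightarrow> f i \<in> C) \<Longrightarrow> hnorm H (hsum H f n) \<le> (\<Sum>i<n. hnorm H (f i))"
proof (induction n)
  case (Suc n)
  then have "hnorm H (hsum H f (Suc n)) \<le> hnorm H (hsum H f n) + hnorm H (f n)"
    by (simp add: norm_triangle hsum_closed)
  then show ?case using Suc by fastforce
qed (simp add: norm_zero)

lemma diff_self: "x \<in> C \<Longrightarrow> hdiff H x x = hzero H"
  by (simp add: hdiff_def add_neg)

lemma add_diff_cancel: "x \<in> C \<Longrightarrow> y \<in> C \<Longrightarrow> hadd H (hdiff H x y) y = x"
proof -
  assume x: "x \<in> C" and y: "y \<in> C"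
  have "hadd H (hscale H (-1) y) y = hzero H" using y by (metis add_comm add_neg scale_closed)
  then show ?thesis using x y by (simp add: hdiff_def add_assoc add_zero)
qed

lemma norm_diff_swap: "x \<in> C \<Longrightarrow> y \<in> C \<Longrightarrow> dst x y = dst y x"
proof -
  assume x: "x \<in> C" and y: "y \<in> C"
  have "(dst x y)\<^sup>2 = (dst y x)\<^sup>2"
    using x y ip_sym[of x y] by (simp add: norm_diff_sq)
  then show ?thesis using x y by (simp add: power2_eq_iff_nonneg)
qed

lemma norm_diff_triangle: "x \<in> C \<Longrightarrow> y \<in> C \<Longrightarrow> z \<in> C \<Longrightarrow>
    dst x z \<le> dst x y + dst y z"
proof -
  assume x: "x \<in> C" and y: "y \<in> C" and z: "z \<in> C"
  have "hdiff H x z = hadd H (hdiff H x y) (hdiff H y z)"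
    using x y z by (metis add_diff_cancel add_assoc diff_closed hdiff_def scale_closed)
  then show ?thesis using x y z by (simp add: norm_triangle)
qed

lemma norm_le_diff: "x \<in> C \<Longrightarrow> y \<in> C \<Longrightarrow> hnorm H x \<le> dst x y + hnorm H y"
  using norm_triangle[of "hdiff H x y" y] by (simp add: add_diff_cancel)

lemma add_add: "\<lbrakk>x \<in> C; y \<in> C; z \<in> C; w \<in> C\<rbrakk> \<Longrightarrow>
   hadd H (hadd H x y) (hadd H z w) = hadd H (hadd H x z) (hadd H y w)"
proof -
  assume *: "x \<in> C" "y \<in> C" "z \<in> C" "w \<in> C"
  have "hadd H (hadd H x y) (hadd H z w) = hadd H x (hadd H (hadd H y z) w)"
    using * by (simp add: add_assoc)
  also have "\<dots> = hadd H x (hadd H (hadd H z y) w)"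
    using * add_comm[of y z] by simp
  also have "\<dots> = hadd H (hadd H x z) (hadd H y w)"
    using * by (simp add: add_assoc)
  finally show ?thesis .
qed

lemma hdiff_add: "\<lbrakk>x \<in> C; y \<in> C; z \<in> C; w \<in> C\<rbrakk> \<Longrightarrow>
   hdiff H (hadd H x y) (hadd H z w) = hadd H (hdiff H x z) (hdiff H y w)"
  unfolding hdiff_def
  using add_add[of x y "hscale H (-1) z" "hscale H (-1) w"] by (simp add: scale_add_right)

lemma hdiff_scale: "\<lbrakk>x \<in> C; y \<in> C\<rbrakk> \<Longrightarrow>
   hdiff H (hscale H a x) (hscale H a y) = hscale H a (hdiff H x y)"
  unfolding hdiff_def using scale_scale[of y a "-1"] scale_scale[of y "-1" a]
  by (simp add: scale_add_right)

lemma ip_diff_bound: "\<lbrakk>x \<in> C; y \<in> C; z \<in> C; w \<in> C\<rbrakk> \<Longrightarrow>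
   cmod (hip H x y - hip H z w) \<le> dst x z * hnorm H y + hnorm H z * dst y w"
proof -
  assume *: "x \<in> C" "y \<in> C" "z \<in> C" "w \<in> C"
  have "hip H x y - hip H z w = hip H (hdiff H x z) y + hip H z (hdiff H y w)"
    using * by (simp add: ip_diff_left ip_diff_right)
  then have "cmod (hip H x y - hip H z w) \<le> cmod (hip H (hdiff H x z) y) + cmod (hip H z (hdiff H y w))"
    by (simp add: norm_triangle_ineq)
  then show ?thesis
    using * cauchy_schwarz[of "hdiff H x z" y] cauchy_schwarz[of z "hdiff H y w"] by simp
qed

lemma eq_iff_norm_diff: "x \<in> C \<Longrightarrow> y \<in> C \<Longrightarrow> hdiff H x y = hzero H \<Longrightarrow> x = y"
  using add_diff_cancel[of x y] zero_add[of y] by simp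

end

locale ip_space = semi_ip +
  assumes definite: "\<And>x. x \<in> hcarrier H \<Longrightarrow> hip H x x = 0 \<Longrightarrow> x = hzero H"
begin

lemma norm_eq_zero: "x \<in> C \<Longrightarrow> hnorm H x = 0 \<Longrightarrow> x = hzero H"
  using definite ip_self by simp

lemma hdist_eq: "x \<in> C \<Longrightarrow> y \<in> C \<Longrightarrow> hdist H x y = dst x y"
  by (simp add: hdist_def)

lemma metric_space: "Metric_space C (hdist H)"
proof
  fix x y z
  show "0 \<le> hdist H x y" by (simp add: hdist_def)
  show "hdist H x y = hdist H y x" by (simp add: hdist_def norm_diff_swap)
  assume x: "x \<in> C" and y: "y \<in> C"
  show "(hdist H x y = 0) = (x = y)"
  proof
    assume "hdist H x y = 0"
    then have "hdiff H x y = hzero H" using x y norm_eq_zero by (simp add: hdist_def)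
    then show "x = y" by (rule eq_iff_norm_diff[OF x y])
  next
    assume "x = y"
    then show "hdist H x y = 0" using y by (simp add: hdist_def diff_self norm_zero)
  qed
  assume z: "z \<in> C"
  show "hdist H x z \<le> hdist H x y + hdist H y z"
    using x y z norm_diff_triangle by (simp add: hdist_def)
qed

lemma diff_limit_unique:
  assumes "x \<in> C" "y \<in> C" "\<And>n. f n \<in> C"
    "(\<lambda>n. dst (f n) x) \<longlonglongrightarrow> 0" "(\<lambda>n. dst (f n) y) \<longlonglongrightarrow> 0"
  shows "x = y"
proof -
  have "(\<lambda>n. dst (f n) x + dst (f n) y) \<longlonglongrightarrow> 0"
    using tendsto_add[OF assms(4,5)] by simp
  moreover have "dst x y \<le> dst (f n) x + dst (f n) y" for n
    using norm_diff_triangle[of x "f n" y] norm_diff_swap[of x "f n"] assms by simp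
  ultimately have "dst x y \<le> 0"
    by (meson LIMSEQ_le_const)
  then have "dst x y = 0"
    using assms(1,2) by (intro order_antisym) simp_all
  then have "hdiff H x y = hzero H"
    using assms(1,2) by (intro norm_eq_zero) simp_all
  then show ?thesis by (rule eq_iff_norm_diff[OF assms(1,2)])
qed

end

lemma ip_space_iff: "ip_space H \<longleftrightarrow> inner_product_space H"
  unfolding ip_space_def ip_space_axioms_def semi_ip_def inner_product_space_def by blast

locale hilbert_space = ip_space +
  assumes complete: "Metric_space.mcomplete (hcarrier H) (hdist H)"
    and separable: "separable_space (Metric_space.mtopology (hcarrier H) (hdist H))"
begin

lemma Cauchy_convergent:
  assumes "\<And>n. f n \<in> C"
    and "\<And>e. e > 0 \<Longrightarrow> \<exists>N. \<forall>m\<ge>N. \<forall>n\<ge>N. dst (f m) (f n) < e"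
  shows "\<exists>x\<in>C. (\<lambda>n. dst (f n) x) \<longlonglongrightarrow> 0"
proof -
  interpret M: Metric_space C "hdist H" by (rule metric_space)
  have "M.MCauchy f"
    unfolding M.MCauchy_def using assms(1) assms(2) by (fastforce simp: hdist_eq)
  then obtain x where x: "limitin M.mtopology f x sequentially"
    using complete unfolding M.mcomplete_def by blast
  then have xC: "x \<in> C" by (simp add: M.limitin_metric)
  have "(\<lambda>n. hdist H (f n) x) \<longlonglongrightarrow> 0"
    using x by (simp add: M.limitin_metric_dist_null)
  then show ?thesis using xC assms(1) by (auto simp: hdist_eq)
qed

end

lemma hilbert_space_iff: "hilbert_space H \<longleftrightarrow> separable_hilbert_space H"
  unfolding hilbert_space_def hilbert_space_axioms_def separable_hilbert_space_def ip_space_iff by blast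

section \<open>Completion of a separable semi-inner product space\<close>

lemma LIMSEQ_null_comparison:
  assumes "g \<longlonglongrightarrow> (0::real)" and "\<And>n. norm (f n) \<le> g n"
  shows "f \<longlonglongrightarrow> 0"
  using assms by (intro Lim_null_comparison[of f g]) auto

definition hcauchy :: "'h hilb \<Rightarrow> (nat \<Rightarrow> 'h) \<Rightarrow> bool" where
  "hcauchy H w \<longleftrightarrow> (\<forall>n. w n \<in> hcarrier H) \<and>
     (\<forall>e>0. \<exists>N. \<forall>m\<ge>N. \<forall>n\<ge>N. hnorm H (hdiff H (w m) (w n)) < e)"

context semi_ip begin

lemma hcauchy_closed: "hcauchy H w \<Longrightarrow> w n \<in> C"
  by (simp add: hcauchy_def)

lemma hcauchy_const: "x \<in> C \<Longrightarrow> hcauchy H (\<lambda>n. x)"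
  by (simp add: hcauchy_def diff_self norm_zero)

lemma hcauchy_image:
  assumes w: "hcauchy H w" and A: "\<And>x. x \<in> C \<Longrightarrow> A x \<in> C"
    and diff: "\<And>x y. x \<in> C \<Longrightarrow> y \<in> C \<Longrightarrow> dst (A x) (A y) \<le> B * dst x y"
  shows "hcauchy H (\<lambda>n. A (w n))"
  unfolding hcauchy_def
proof (intro conjI allI impI)
  fix n show "A (w n) \<in> C" using w A by (simp add: hcauchy_def)
next
  fix e :: real assume "e > 0"
  \<comment> \<open>\<open>B\<close> may be 0 or negative, so |B| + 1 serves as a positive Lipschitz
    constant.\<close>
  then have "e / (\<bar>B\<bar> + 1) > 0" by simp
  then obtain N where N: "\<And>m n. m \<ge> N \<Longrightarrow> n \<ge> N \<Longrightarrow> dst (w m) (w n) < e / (\<bar>B\<bar> + 1)"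
    using w unfolding hcauchy_def by meson
  have "dst (A (w m)) (A (w n)) < e" if "m \<ge> N" "n \<ge> N" for m n
  proof -
    have 0: "0 \<le> dst (w m) (w n)" using w by (simp add: hcauchy_closed)
    have "dst (A (w m)) (A (w n)) \<le> B * dst (w m) (w n)"
      using diff w by (simp add: hcauchy_closed)
    also have "\<dots> \<le> (\<bar>B\<bar> + 1) * dst (w m) (w n)"
      using 0 by (intro mult_right_mono) auto
    also have "\<dots> < (\<bar>B\<bar> + 1) * (e / (\<bar>B\<bar> + 1))"
      using N[OF that] by (intro mult_strict_left_mono) auto
    also have "\<dots> = e" by simp
    finally show ?thesis .
  qed
  then show "\<exists>N. \<forall>m\<ge>N. \<forall>n\<ge>N. dst (A (w m)) (A (w n)) < e" by blast
qed

lemma hcauchy_scale: "hcauchy H w \<Longrightarrow> hcauchy H (\<lambda>n. hscale H a (w n))"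
  by (erule hcauchy_image[where B = "cmod a"]) (simp_all add: hdiff_scale norm_scale)

lemma hcauchy_add:
  assumes w: "hcauchy H w" and w': "hcauchy H w'"
  shows "hcauchy H (\<lambda>n. hadd H (w n) (w' n))"
  unfolding hcauchy_def
proof (intro conjI allI impI)
  fix n show "hadd H (w n) (w' n) \<in> C" using w w' by (simp add: hcauchy_def)
next
  fix e :: real assume "e > 0"
  then have e2: "e / 2 > 0" by simp
  obtain N where N: "\<And>m n. m \<ge> N \<Longrightarrow> n \<ge> N \<Longrightarrow> dst (w m) (w n) < e / 2"
    using w e2 unfolding hcauchy_def by meson
  obtain N' where N': "\<And>m n. m \<ge> N' \<Longrightarrow> n \<ge> N' \<Longrightarrow> dst (w' m) (w' n) < e / 2"
    using w' e2 unfolding hcauchy_def by meson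
  have "dst (hadd H (w m) (w' m)) (hadd H (w n) (w' n)) < e"
    if "m \<ge> max N N'" "n \<ge> max N N'" for m n
  proof -
    have "dst (hadd H (w m) (w' m)) (hadd H (w n) (w' n))
       \<le> dst (w m) (w n) + dst (w' m) (w' n)"
      using w w' by (simp add: hdiff_add norm_triangle hcauchy_closed)
    then show ?thesis using N[of m n] N'[of m n] that by simp
  qed
  then show "\<exists>N. \<forall>m\<ge>N. \<forall>n\<ge>N. dst (hadd H (w m) (w' m)) (hadd H (w n) (w' n)) < e" by blast
qed

lemma hcauchy_diff: "hcauchy H w \<Longrightarrow> hcauchy H w' \<Longrightarrow> hcauchy H (\<lambda>n. hdiff H (w n) (w' n))"
  unfolding hdiff_def[of H] by (intro hcauchy_add hcauchy_scale)

lemma hcauchy_bounded: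
  assumes w: "hcauchy H w"
  obtains B where "B > 0" "\<And>n. hnorm H (w n) \<le> B"
proof -
  obtain N where N: "\<And>m n. m \<ge> N \<Longrightarrow> n \<ge> N \<Longrightarrow> dst (w m) (w n) < 1"
    using w unfolding hcauchy_def by (meson zero_less_one)
  define B where "B = 1 + hnorm H (w N) + (\<Sum>i<N. hnorm H (w i))"
  have nn: "0 \<le> hnorm H (w i)" for i using w by (simp add: hcauchy_closed)
  have s: "0 \<le> (\<Sum>i<N. hnorm H (w i))" using nn by (simp add: sum_nonneg)
  have "hnorm H (w n) \<le> B" for n
  proof (cases "n < N")
    case True
    then have "hnorm H (w n) \<le> (\<Sum>i<N. hnorm H (w i))"
      using nn by (intro member_le_sum) auto
    then show ?thesis using nn[of N] by (simp add: B_def)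
  next
    case False
    then show ?thesis
      using N[of n N] norm_le_diff[of "w n" "w N"] s w by (simp add: B_def hcauchy_closed)
  qed
  moreover have "B > 0" using nn[of N] s by (simp add: B_def)
  ultimately show ?thesis using that by blast
qed

lemma convergent_ip:
  assumes w: "hcauchy H w" and w': "hcauchy H w'"
  shows "convergent (\<lambda>n. hip H (w n) (w' n))"
proof (rule Cauchy_convergent, rule metric_CauchyI)
  fix e :: real assume "e > 0"
  obtain B where B: "B > 0" "\<And>n. hnorm H (w n) \<le> B" using hcauchy_bounded[OF w] by blast
  obtain B' where B': "B' > 0" "\<And>n. hnorm H (w' n) \<le> B'" using hcauchy_bounded[OF w'] by blast
  have e1: "e / (2 * B') > 0" "e / (2 * B) > 0" using \<open>e > 0\<close> B B' by simp_all
  obtain N where N: "\<And>m n. m \<ge> N \<Longrightarrow> n \<ge> N \<Longrightarrow> dst (w m) (w n) < e / (2 * B')"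
    using w e1 unfolding hcauchy_def by meson
  obtain N' where N': "\<And>m n. m \<ge> N' \<Longrightarrow> n \<ge> N' \<Longrightarrow> dst (w' m) (w' n) < e / (2 * B)"
    using w' e1 unfolding hcauchy_def by meson
  have "dist (hip H (w m) (w' m)) (hip H (w n) (w' n)) < e" if "m \<ge> max N N'" "n \<ge> max N N'" for m n
  proof -
    have c: "w m \<in> C" "w n \<in> C" "w' m \<in> C" "w' n \<in> C" using w w' by (simp_all add: hcauchy_closed)
    have "cmod (hip H (w m) (w' m) - hip H (w n) (w' n))
      \<le> dst (w m) (w n) * hnorm H (w' m) + hnorm H (w n) * dst (w' m) (w' n)"
      using c by (intro ip_diff_bound)
    also have "\<dots> \<le> dst (w m) (w n) * B' + B * dst (w' m) (w' n)"
      using B B' c by (intro add_mono mult_left_mono mult_right_mono) auto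
    also have "\<dots> < (e / (2 * B')) * B' + B * (e / (2 * B))"
      using N[of m n] N'[of m n] that B B'
      by (intro add_strict_mono mult_strict_left_mono mult_strict_right_mono) auto
    also have "\<dots> = e" using B B' by (simp add: field_simps)
    finally show ?thesis by (simp add: dist_norm)
  qed
  then show "\<exists>M. \<forall>m\<ge>M. \<forall>n\<ge>M. dist (hip H (w m) (w' m)) (hip H (w n) (w' n)) < e" by blast
qed

lemma ip_null_limit:
  assumes w: "hcauchy H w" and w': "hcauchy H w'" and v: "hcauchy H v" and v': "hcauchy H v'"
    and "(\<lambda>n. dst (w n) (v n)) \<longlonglongrightarrow> 0" "(\<lambda>n. dst (w' n) (v' n)) \<longlonglongrightarrow> 0"
  shows "(\<lambda>n. hip H (w n) (w' n) - hip H (v n) (v' n)) \<longlonglongrightarrow> 0"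
proof -
  obtain B where B: "B > 0" "\<And>n. hnorm H (v n) \<le> B" using hcauchy_bounded[OF v] by blast
  obtain B' where B': "B' > 0" "\<And>n. hnorm H (w' n) \<le> B'" using hcauchy_bounded[OF w'] by blast
  have "(\<lambda>n. dst (w n) (v n) * B' + B * dst (w' n) (v' n)) \<longlonglongrightarrow> 0 * B' + B * 0"
    using assms(5,6) by (intro tendsto_intros)
  then have "(\<lambda>n. dst (w n) (v n) * B' + B * dst (w' n) (v' n)) \<longlonglongrightarrow> 0"
    by simp
  moreover have "norm (hip H (w n) (w' n) - hip H (v n) (v' n))
      \<le> dst (w n) (v n) * B' + B * dst (w' n) (v' n)" for n
  proof -
    have c: "w n \<in> C" "v n \<in> C" "w' n \<in> C" "v' n \<in> C"
      using w w' v v' by (simp_all add: hcauchy_closed)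
    have "cmod (hip H (w n) (w' n) - hip H (v n) (v' n))
      \<le> dst (w n) (v n) * hnorm H (w' n) + hnorm H (v n) * dst (w' n) (v' n)"
      using c by (intro ip_diff_bound)
    also have "\<dots> \<le> dst (w n) (v n) * B' + B * dst (w' n) (v' n)"
      using B B' c by (intro add_mono mult_left_mono mult_right_mono) auto
    finally show ?thesis .
  qed
  ultimately show ?thesis by (rule LIMSEQ_null_comparison)
qed

end

locale dense_semi_ip = semi_ip +
  fixes d :: "nat \<Rightarrow> 'a"
  assumes d_closed: "\<And>n. d n \<in> hcarrier H"
    and d_dense: "\<And>x e. x \<in> hcarrier H \<Longrightarrow> e > 0 \<Longrightarrow> \<exists>n. dst x (d n) < e"
begin

text \<open>A Cauchy sequence is represented by the limits of its inner products with the dense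
  sequence; these determine it up to null sequences.\<close>

definition coords :: "(nat \<Rightarrow> 'a) \<Rightarrow> hpoint" where
  "coords w = (\<lambda>n. lim (\<lambda>k. hip H (d n) (w k)))"

lemma coords_lim: "hcauchy H w \<Longrightarrow> (\<lambda>k. hip H (d n) (w k)) \<longlonglongrightarrow> coords w n"
  unfolding coords_def using convergent_ip[OF hcauchy_const[OF d_closed]] convergent_LIMSEQ_iff by blast

lemma coords_eqI:
  assumes w: "hcauchy H w" and v: "hcauchy H v" and null: "(\<lambda>n. dst (w n) (v n)) \<longlonglongrightarrow> 0"
  shows "coords w = coords v"
proof
  fix n
  have "(\<lambda>k. hip H (d n) (w k) - hip H (d n) (v k)) \<longlonglongrightarrow> 0"
    using w v null d_closed by (intro ip_null_limit hcauchy_const) (simp_all add: diff_self norm_zero)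
  moreover have "(\<lambda>k. hip H (d n) (w k) - hip H (d n) (v k)) \<longlonglongrightarrow> coords w n - coords v n"
    using w v by (intro tendsto_intros coords_lim)
  ultimately show "coords w n = coords v n"
    using LIMSEQ_unique by fastforce
qed

text \<open>For large k the vector \<open>z k\<close> is close to a fixed \<open>z N\<close>, which
  is close to some \<open>d j\<close>. So the square norm of \<open>z k\<close> differs from <d j, z
  k> by little, uniformly in k, and the latter tends to 0.\<close>

lemma null_if_coords_zero:
  assumes z: "hcauchy H z" and 0: "\<And>n. (\<lambda>k. hip H (d n) (z k)) \<longlonglongrightarrow> 0"
  shows "(\<lambda>n. hnorm H (z n)) \<longlonglongrightarrow> 0"
proof -
  obtain B where B: "B > 0" "\<And>n. hnorm H (z n) \<le> B" using hcauchy_bounded[OF z] by blast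
  have zc: "z n \<in> C" for n using z by (rule hcauchy_closed)
  have "(\<lambda>n. (hnorm H (z n))\<^sup>2) \<longlonglongrightarrow> 0"
  proof (rule LIMSEQ_I)
    fix e :: real assume e: "e > 0"
    define t where "t = e / (3 * B)"
    have t: "t > 0" using e B by (simp add: t_def)
    obtain N where N: "\<And>m n. m \<ge> N \<Longrightarrow> n \<ge> N \<Longrightarrow> dst (z m) (z n) < t"
      using z t unfolding hcauchy_def by meson
    obtain j where j: "dst (z N) (d j) < t" using d_dense[OF zc t] by blast
    obtain M where M: "\<And>k. k \<ge> M \<Longrightarrow> norm (hip H (d j) (z k) - 0) < e / 3"
      using LIMSEQ_D[OF 0[of j], of "e / 3"] e by auto
    have "norm ((hnorm H (z k))\<^sup>2 - 0) < e" if k: "k \<ge> max N M" for k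
    proof -
      have "hip H (z k) (z k) = hip H (hdiff H (z k) (z N)) (z k) + hip H (hdiff H (z N) (d j)) (z k) + hip H (d j) (z k)"
        using zc d_closed by (simp add: ip_diff_left)
      then have "cmod (hip H (z k) (z k)) \<le> cmod (hip H (hdiff H (z k) (z N)) (z k)) + cmod (hip H (hdiff H (z N) (d j)) (z k)) + cmod (hip H (d j) (z k))"
        by (metis norm_triangle_mono norm_triangle_ineq order_refl)
      also have "\<dots> < t * B + t * B + e / 3"
      proof (intro add_le_less_mono add_mono)
        have "cmod (hip H (hdiff H (z k) (z N)) (z k)) \<le> dst (z k) (z N) * hnorm H (z k)"
          using zc by (simp add: cauchy_schwarz)
        also have "\<dots> \<le> t * B" using N[of k N] k B zc t by (intro mult_mono) auto
        finally show "cmod (hip H (hdiff H (z k) (z N)) (z k)) \<le> t * B" .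
        have "cmod (hip H (hdiff H (z N) (d j)) (z k)) \<le> dst (z N) (d j) * hnorm H (z k)"
          using zc d_closed by (simp add: cauchy_schwarz)
        also have "\<dots> \<le> t * B" using j B zc t by (intro mult_mono) auto
        finally show "cmod (hip H (hdiff H (z N) (d j)) (z k)) \<le> t * B" .
        show "cmod (hip H (d j) (z k)) < e / 3" using M[of k] k by simp
      qed
      also have "\<dots> = e" using B by (simp add: t_def)
      finally show ?thesis using zc by (simp add: ip_self norm_power)
    qed
    then show "\<exists>no. \<forall>n\<ge>no. norm ((hnorm H (z n))\<^sup>2 - 0) < e" by blast
  qed
  then have "(\<lambda>n. sqrt ((hnorm H (z n))\<^sup>2)) \<longlonglongrightarrow> sqrt 0" by (rule tendsto_real_sqrt)
  then show ?thesis using zc by simp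
qed

lemma coords_eqD:
  assumes w: "hcauchy H w" and v: "hcauchy H v" and eq: "coords w = coords v"
  shows "(\<lambda>n. dst (w n) (v n)) \<longlonglongrightarrow> 0"
proof (rule null_if_coords_zero)
  show "hcauchy H (\<lambda>n. hdiff H (w n) (v n))" using w v by (rule hcauchy_diff)
  fix n
  have "(\<lambda>k. hip H (d n) (w k) - hip H (d n) (v k)) \<longlonglongrightarrow> coords w n - coords v n"
    using w v by (intro tendsto_intros coords_lim)
  then show "(\<lambda>k. hip H (d n) (hdiff H (w k) (v k))) \<longlonglongrightarrow> 0"
    using eq d_closed w v by (simp add: ip_diff_right hcauchy_closed)
qed

definition rep :: "hpoint \<Rightarrow> nat \<Rightarrow> 'a" where
  "rep c = (SOME w. hcauchy H w \<and> coords w = c)"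

text \<open>Addition and scaling are pointwise because coordinates are linear in the sequence. The
  inner product is not a coordinatewise expression, so it is taken along representatives;
  \<open>cpl_ip\<close> shows that their choice is immaterial.\<close>

definition cpl :: "hpoint hilb" where
  "cpl = \<lparr>hcarrier = coords ` {w. hcauchy H w}, hzero = (\<lambda>n. 0), hadd = (\<lambda>c c' n. c n + c' n),
     hscale = (\<lambda>a c n. a * c n), hip = (\<lambda>c c'. lim (\<lambda>k. hip H (rep c k) (rep c' k)))\<rparr>"

lemma cpl_simps [simp]:
  "hzero cpl = (\<lambda>n. 0)" "hadd cpl c c' = (\<lambda>n. c n + c' n)" "hscale cpl a c = (\<lambda>n. a * c n)"
  by (simp_all add: cpl_def)

lemma cpl_carrier: "hcarrier cpl = coords ` {w. hcauchy H w}"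
  by (simp add: cpl_def)

lemma coords_in: "hcauchy H w \<Longrightarrow> coords w \<in> hcarrier cpl"
  by (simp add: cpl_carrier)

lemma rep: assumes "c \<in> hcarrier cpl" shows "hcauchy H (rep c)" "coords (rep c) = c"
  using assms someI_ex[of "\<lambda>w. hcauchy H w \<and> coords w = c"] by (auto simp: rep_def cpl_carrier)

lemma rep_coords_null:
  assumes w: "hcauchy H w"
  shows "(\<lambda>n. dst (rep (coords w) n) (w n)) \<longlonglongrightarrow> 0"
  using w rep[OF coords_in[OF w]] by (intro coords_eqD)

lemma cpl_ip:
  assumes w: "hcauchy H w" and v: "hcauchy H v"
  shows "(\<lambda>k. hip H (w k) (v k)) \<longlonglongrightarrow> hip cpl (coords w) (coords v)"
proof -
  let ?w = "rep (coords w)" and ?v = "rep (coords v)"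
  have c: "hcauchy H ?w" "hcauchy H ?v" using rep coords_in w v by auto
  have 1: "(\<lambda>k. hip H (?w k) (?v k)) \<longlonglongrightarrow> hip cpl (coords w) (coords v)"
    using convergent_ip[OF c] by (simp add: cpl_def convergent_LIMSEQ_iff)
  have 2: "(\<lambda>k. hip H (?w k) (?v k) - hip H (w k) (v k)) \<longlonglongrightarrow> 0"
    using w v c by (intro ip_null_limit rep_coords_null)
  show ?thesis using tendsto_diff[OF 1 2] by simp
qed

lemma coords_add:
  assumes "hcauchy H w" "hcauchy H v"
  shows "coords (\<lambda>k. hadd H (w k) (v k)) = (\<lambda>n. coords w n + coords v n)"
proof
  fix n
  have "(\<lambda>k. hip H (d n) (w k) + hip H (d n) (v k)) \<longlonglongrightarrow> coords w n + coords v n"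
    using assms by (intro tendsto_add coords_lim)
  then have "(\<lambda>k. hip H (d n) (hadd H (w k) (v k))) \<longlonglongrightarrow> coords w n + coords v n"
    using d_closed assms by (simp add: ip_add_right hcauchy_closed)
  then show "coords (\<lambda>k. hadd H (w k) (v k)) n = coords w n + coords v n"
    using coords_lim[OF hcauchy_add[OF assms], of n] LIMSEQ_unique by blast
qed

lemma coords_scale:
  assumes "hcauchy H w"
  shows "coords (\<lambda>k. hscale H a (w k)) = (\<lambda>n. a * coords w n)"
proof
  fix n
  have "(\<lambda>k. a * hip H (d n) (w k)) \<longlonglongrightarrow> a * coords w n"
    using assms by (intro tendsto_mult tendsto_const coords_lim)
  then have "(\<lambda>k. hip H (d n) (hscale H a (w k))) \<longlonglongrightarrow> a * coords w n"
    using d_closed assms by (simp add: ip_scale_right hcauchy_closed)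
  then show "coords (\<lambda>k. hscale H a (w k)) n = a * coords w n"
    using coords_lim[OF hcauchy_scale[OF assms], of n] LIMSEQ_unique by blast
qed

lemma coords_diff:
  assumes "hcauchy H w" "hcauchy H v"
  shows "coords (\<lambda>k. hdiff H (w k) (v k)) = hdiff cpl (coords w) (coords v)"
  unfolding hdiff_def[of H] using assms by (subst coords_add) (simp_all add: hcauchy_scale coords_scale hdiff_def)

lemma coords_zero: "coords (\<lambda>k. hzero H) = (\<lambda>n. 0)"
proof
  fix n
  have "(\<lambda>k. hip H (d n) (hzero H)) \<longlonglongrightarrow> coords (\<lambda>k. hzero H) n"
    by (intro coords_lim hcauchy_const zero_closed)
  then show "coords (\<lambda>k. hzero H) n = 0"
    using d_closed LIMSEQ_unique[OF _ tendsto_const] by (fastforce simp: ip_zero_right)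
qed

lemma cpl_cases:
  assumes "c \<in> hcarrier cpl"
  obtains w where "hcauchy H w" "c = coords w"
  using assms by (auto simp: cpl_carrier)

lemma cpl_norm:
  assumes w: "hcauchy H w"
  shows "(\<lambda>k. hnorm H (w k)) \<longlonglongrightarrow> hnorm cpl (coords w)"
  using cpl_ip[OF w w] unfolding hnorm_def[of H] hnorm_def[of cpl]
  by (intro tendsto_real_sqrt tendsto_Re)

lemma cpl_complex_vector_space: "complex_vector_space cpl"
proof -
  have z: "(\<lambda>n. 0) \<in> hcarrier cpl"
    using coords_in[OF hcauchy_const[OF zero_closed]] by (simp add: coords_zero)
  have a: "(\<lambda>n. c n + c' n) \<in> hcarrier cpl" if "c \<in> hcarrier cpl" "c' \<in> hcarrier cpl" for c c'
    using that by (elim cpl_cases) (simp add: coords_add[symmetric] coords_in hcauchy_add)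
  have s: "(\<lambda>n. a * c n) \<in> hcarrier cpl" if "c \<in> hcarrier cpl" for a c
    using that by (elim cpl_cases) (simp add: coords_scale[symmetric] coords_in hcauchy_scale)
  show ?thesis
    unfolding complex_vector_space_def using z a s by (simp add: algebra_simps)
qed

lemma cpl_ip_space: "ip_space cpl"
proof (unfold_locales)
  show "complex_vector_space cpl" by (rule cpl_complex_vector_space)
next
  fix x y z assume "x \<in> hcarrier cpl" "y \<in> hcarrier cpl" "z \<in> hcarrier cpl"
  then obtain u v w where c: "hcauchy H u" "hcauchy H v" "hcauchy H w"
    and eq: "x = coords u" "y = coords v" "z = coords w" by (metis cpl_cases)
  have "(\<lambda>k. hip H (u k) (v k) + hip H (u k) (w k)) \<longlonglongrightarrow> hip cpl x y + hip cpl x z"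
    unfolding eq using c by (intro tendsto_add cpl_ip)
  moreover have "(\<lambda>k. hip H (u k) (hadd H (v k) (w k))) \<longlonglongrightarrow> hip cpl x (hadd cpl y z)"
    unfolding eq cpl_simps coords_add[OF c(2,3), symmetric] using c by (intro cpl_ip hcauchy_add)
  ultimately show "hip cpl x (hadd cpl y z) = hip cpl x y + hip cpl x z"
    using c by (simp add: ip_add_right hcauchy_closed LIMSEQ_unique)
next
  fix a x y assume "x \<in> hcarrier cpl" "y \<in> hcarrier cpl"
  then obtain u v where c: "hcauchy H u" "hcauchy H v"
    and eq: "x = coords u" "y = coords v" by (metis cpl_cases)
  have "(\<lambda>k. a * hip H (u k) (v k)) \<longlonglongrightarrow> a * hip cpl x y"
    unfolding eq using c by (intro tendsto_mult tendsto_const cpl_ip)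
  moreover have "(\<lambda>k. hip H (u k) (hscale H a (v k))) \<longlonglongrightarrow> hip cpl x (hscale cpl a y)"
    unfolding eq cpl_simps coords_scale[OF c(2), symmetric] using c by (intro cpl_ip hcauchy_scale)
  ultimately show "hip cpl x (hscale cpl a y) = a * hip cpl x y"
    using c by (simp add: ip_scale_right hcauchy_closed LIMSEQ_unique)
next
  fix x y assume "x \<in> hcarrier cpl" "y \<in> hcarrier cpl"
  then obtain u v where c: "hcauchy H u" "hcauchy H v"
    and eq: "x = coords u" "y = coords v" by (metis cpl_cases)
  have "(\<lambda>k. cnj (hip H (u k) (v k))) \<longlonglongrightarrow> cnj (hip cpl x y)"
    unfolding eq using c by (intro tendsto_cnj cpl_ip)
  moreover have "(\<lambda>k. hip H (v k) (u k)) \<longlonglongrightarrow> hip cpl y x"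
    unfolding eq using c by (intro cpl_ip)
  moreover have "hip H (v k) (u k) = cnj (hip H (u k) (v k))" for k
    using c by (intro ip_sym hcauchy_closed)
  ultimately show "hip cpl y x = cnj (hip cpl x y)"
    by (simp add: LIMSEQ_unique)
next
  fix x assume "x \<in> hcarrier cpl"
  then obtain u where c: "hcauchy H u" and eq: "x = coords u" by (metis cpl_cases)
  have "(\<lambda>k. Re (hip H (u k) (u k))) \<longlonglongrightarrow> Re (hip cpl x x)"
    unfolding eq using c by (intro tendsto_Re cpl_ip)
  moreover have "0 \<le> Re (hip H (u k) (u k))" for k using c by (intro ip_nonneg hcauchy_closed)
  ultimately show "0 \<le> Re (hip cpl x x)" by (meson LIMSEQ_le_const)
  assume 0: "hip cpl x x = 0"
  then have "hnorm cpl x = 0" by (simp add: hnorm_def)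
  then have "(\<lambda>k. hnorm H (u k)) \<longlonglongrightarrow> 0" using cpl_norm[OF c] eq by simp
  then have "(\<lambda>k. dst (u k) (hzero H)) \<longlonglongrightarrow> 0"
    using c hcauchy_closed[OF c] by (simp add: hdiff_def scale_hzero add_zero)
  then have "coords u = coords (\<lambda>k. hzero H)"
    using c by (intro coords_eqI hcauchy_const zero_closed)
  then show "x = hzero cpl" by (simp add: eq coords_zero)
qed

abbreviation dstK where "dstK c c' \<equiv> hnorm cpl (hdiff cpl c c')"

definition emb :: "'a \<Rightarrow> hpoint" where "emb x = coords (\<lambda>k. x)"

lemma emb_in: "x \<in> C \<Longrightarrow> emb x \<in> hcarrier cpl"
  by (simp add: emb_def coords_in hcauchy_const)

lemma emb_ip: "x \<in> C \<Longrightarrow> y \<in> C \<Longrightarrow> hip cpl (emb x) (emb y) = hip H x y"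
  using cpl_ip[OF hcauchy_const hcauchy_const, of x y] LIMSEQ_unique[OF _ tendsto_const]
  unfolding emb_def by blast

lemma emb_norm: "x \<in> C \<Longrightarrow> hnorm cpl (emb x) = hnorm H x"
  by (simp add: hnorm_def emb_ip)

lemma emb_add: "x \<in> C \<Longrightarrow> y \<in> C \<Longrightarrow> emb (hadd H x y) = hadd cpl (emb x) (emb y)"
  by (simp add: emb_def coords_add hcauchy_const)

lemma emb_diff: "x \<in> C \<Longrightarrow> y \<in> C \<Longrightarrow> emb (hdiff H x y) = hdiff cpl (emb x) (emb y)"
  by (simp add: emb_def coords_diff hcauchy_const)

lemma emb_zero: "emb (hzero H) = hzero cpl"
  by (simp add: emb_def coords_zero)

lemma emb_hsum: "(\<And>i. i < n \<Longrightarrow> f i \<in> C) \<Longrightarrow> emb (hsum H f n) = hsum cpl (\<lambda>i. emb (f i)) n"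
  by (induction n) (simp_all only: hsum.simps emb_zero emb_add hsum_closed less_Suc_eq less_imp_le simp_thms)

lemma emb_lim:
  assumes w: "hcauchy H w"
  shows "(\<lambda>k. dstK (emb (w k)) (coords w)) \<longlonglongrightarrow> 0"
proof (rule LIMSEQ_I)
  fix e :: real assume "e > 0"
  then have "e / 2 > 0" by simp
  then obtain N where N: "\<And>m n. m \<ge> N \<Longrightarrow> n \<ge> N \<Longrightarrow> dst (w m) (w n) < e / 2"
    using w unfolding hcauchy_def by meson
  interpret K: ip_space cpl by (rule cpl_ip_space)
  have "norm (dstK (emb (w k)) (coords w) - 0) < e" if "k \<ge> N" for k
  proof -
    have wk: "hcauchy H (\<lambda>j. w k)" using w by (intro hcauchy_const hcauchy_closed)
    have "(\<lambda>j. dst (w k) (w j)) \<longlonglongrightarrow> dstK (emb (w k)) (coords w)"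
      using cpl_norm[OF hcauchy_diff[OF wk w]] by (simp add: coords_diff[OF wk w] emb_def)
    moreover have "\<forall>j\<ge>N. dst (w k) (w j) \<le> e / 2"
      using N[OF that] less_imp_le by blast
    ultimately have "dstK (emb (w k)) (coords w) \<le> e / 2"
      by (meson LIMSEQ_le_const2)
    moreover have "0 \<le> dstK (emb (w k)) (coords w)"
      using w hcauchy_closed[OF w] by (intro K.norm_nonneg K.diff_closed emb_in coords_in)
    ultimately show ?thesis using \<open>e > 0\<close> by simp
  qed
  then show "\<exists>no. \<forall>n\<ge>no. norm (dstK (emb (w n)) (coords w) - 0) < e" by blast
qed

lemma emb_dense:
  assumes "c \<in> hcarrier cpl" "e > 0"
  shows "\<exists>x\<in>C. dstK c (emb x) < e"
proof -
  interpret K: ip_space cpl by (rule cpl_ip_space)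
  obtain w where w: "hcauchy H w" "c = coords w" using assms cpl_cases by blast
  obtain k where "norm (dstK (emb (w k)) c - 0) < e"
    using LIMSEQ_D[OF emb_lim[OF w(1)] assms(2)] w by blast
  moreover have "w k \<in> C" using w by (simp add: hcauchy_closed)
  ultimately show ?thesis
    using assms K.norm_diff_swap[of c "emb (w k)"] emb_in[of "w k"] by (intro bexI[of _ "w k"]) auto
qed

text \<open>Each member of the sequence is replaced by an embedded vector at distance below 1 / (n +
  1). These vectors form a Cauchy sequence of \<open>H\<close> itself, and its coordinates are the
  limit.\<close>

lemma cpl_complete: "Metric_space.mcomplete (hcarrier cpl) (hdist cpl)"
proof -
  interpret K: ip_space cpl by (rule cpl_ip_space)
  interpret M: Metric_space "hcarrier cpl" "hdist cpl" by (rule K.metric_space)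
  show ?thesis
    unfolding M.mcomplete_def
  proof (intro allI impI)
    fix s assume s: "M.MCauchy s"
    then have sc: "s n \<in> hcarrier cpl" for n by (auto simp: M.MCauchy_def)
    have "\<exists>x\<in>C. dstK (s n) (emb x) < 1 / real (Suc n)" for n
      using emb_dense[OF sc] by simp
    then obtain v where v: "\<And>n. v n \<in> C" "\<And>n. dstK (s n) (emb (v n)) < 1 / real (Suc n)"
      by metis
    have ev: "emb (v n) \<in> hcarrier cpl" for n using v emb_in by blast
    have "hcauchy H v"
      unfolding hcauchy_def
    proof (intro conjI allI impI v)
      fix e :: real assume e: "e > 0"
      then have "e / 3 > 0" by simp
      then obtain N where N: "\<And>m n. m \<ge> N \<Longrightarrow> n \<ge> N \<Longrightarrow> hdist cpl (s m) (s n) < e / 3"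
        using s unfolding M.MCauchy_def by meson
      obtain N' where N': "1 / real (Suc N') < e / 3" using \<open>e / 3 > 0\<close> nat_approx_posE by blast
      have "dst (v m) (v n) < e" if "m \<ge> max N N'" "n \<ge> max N N'" for m n
      proof -
        have i: "1 / real (Suc k) \<le> 1 / real (Suc N')" if "k \<ge> N'" for k
          using that by (simp add: field_simps)
        have "dst (v m) (v n) = dstK (emb (v m)) (emb (v n))"
          using v by (simp add: emb_diff[symmetric] emb_norm)
        also have "\<dots> \<le> dstK (emb (v m)) (s m) + dstK (s m) (emb (v n))"
          using ev sc by (intro K.norm_diff_triangle)
        also have "dstK (s m) (emb (v n)) \<le> dstK (s m) (s n) + dstK (s n) (emb (v n))"
          using ev sc by (intro K.norm_diff_triangle)
        also have "dstK (emb (v m)) (s m) = dstK (s m) (emb (v m))"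
          using ev sc by (intro K.norm_diff_swap)
        finally show ?thesis
          using v(2)[of m] v(2)[of n] i[of m] i[of n] N' N[of m n] that sc by (simp add: K.hdist_eq)
      qed
      then show "\<exists>N. \<forall>m\<ge>N. \<forall>n\<ge>N. dst (v m) (v n) < e" by blast
    qed
    then have cv: "coords v \<in> hcarrier cpl" and lim: "(\<lambda>k. dstK (emb (v k)) (coords v)) \<longlonglongrightarrow> 0"
      using coords_in emb_lim by auto
    have "(\<lambda>k. 1 / real (Suc k) + dstK (emb (v k)) (coords v)) \<longlonglongrightarrow> 0 + 0"
      using lim LIMSEQ_inverse_real_of_nat by (intro tendsto_add) (auto simp: inverse_eq_divide)
    then have "(\<lambda>k. 1 / real (Suc k) + dstK (emb (v k)) (coords v)) \<longlonglongrightarrow> 0" by simp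
    moreover have "norm (hdist cpl (s k) (coords v)) \<le> 1 / real (Suc k) + dstK (emb (v k)) (coords v)" for k
    proof -
      have "dstK (s k) (coords v) \<le> dstK (s k) (emb (v k)) + dstK (emb (v k)) (coords v)"
        using ev sc cv by (intro K.norm_diff_triangle)
      then show ?thesis using v(2)[of k] sc cv by (simp add: K.hdist_eq)
    qed
    ultimately have "(\<lambda>k. hdist cpl (s k) (coords v)) \<longlonglongrightarrow> 0"
      by (rule LIMSEQ_null_comparison)
    then have "limitin M.mtopology s (coords v) sequentially"
      using sc cv by (auto simp: M.limitin_metric_dist_null)
    then show "\<exists>x. limitin M.mtopology s x sequentially" by blast
  qed
qed

lemma cpl_separable: "separable_space (Metric_space.mtopology (hcarrier cpl) (hdist cpl))"
proof -
  interpret K: ip_space cpl by (rule cpl_ip_space)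
  interpret M: Metric_space "hcarrier cpl" "hdist cpl" by (rule K.metric_space)
  have r: "range (\<lambda>n. emb (d n)) \<subseteq> hcarrier cpl" using emb_in d_closed by blast
  have "M.mtopology closure_of (range (\<lambda>n. emb (d n))) = hcarrier cpl"
  proof
    show "M.mtopology closure_of range (\<lambda>n. emb (d n)) \<subseteq> hcarrier cpl"
      using closure_of_subset_topspace[of M.mtopology] by simp
    show "hcarrier cpl \<subseteq> M.mtopology closure_of range (\<lambda>n. emb (d n))"
    proof
      fix c assume c: "c \<in> hcarrier cpl"
      have "\<exists>y\<in>range (\<lambda>n. emb (d n)). y \<in> M.mball c e" if "e > 0" for e
      proof -
        have e2: "e / 2 > 0" using that by simp
        obtain x where x: "x \<in> C" "dstK c (emb x) < e / 2" using emb_dense[OF c e2] by blast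
        obtain n where n: "dst x (d n) < e / 2" using d_dense[OF x(1) e2] by blast
        have "dstK (emb x) (emb (d n)) < e / 2"
          using n x d_closed by (simp add: emb_diff[symmetric] emb_norm)
        moreover have "dstK c (emb (d n)) \<le> dstK c (emb x) + dstK (emb x) (emb (d n))"
          using c x d_closed emb_in by (intro K.norm_diff_triangle) auto
        ultimately have "hdist cpl c (emb (d n)) < e"
          using x c d_closed emb_in by (simp add: K.hdist_eq)
        then show ?thesis using c d_closed emb_in by (auto simp: M.in_mball)
      qed
      then show "c \<in> M.mtopology closure_of range (\<lambda>n. emb (d n))"
        using c by (auto simp: M.metric_closure_of)
    qed
  qed
  then show ?thesis
    unfolding separable_space_def using r by (intro exI[of _ "range (\<lambda>n. emb (d n))"]) simp
qed

lemma cpl_hilbert: "separable_hilbert_space cpl"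
  unfolding hilbert_space_iff[symmetric] hilbert_space_def hilbert_space_axioms_def
  using cpl_ip_space cpl_complete cpl_separable by blast

section \<open>Extension of bounded operators to the completion\<close>

definition lift :: "('a \<Rightarrow> 'a) \<Rightarrow> hpoint \<Rightarrow> hpoint" where
  "lift A = (\<lambda>c\<in>hcarrier cpl. coords (\<lambda>k. A (rep c k)))"

lemma linear_diff:
  assumes "hlinear H H A" "x \<in> C" "y \<in> C"
  shows "A (hdiff H x y) = hdiff H (A x) (A y)"
  using assms unfolding hlinear_def hdiff_def by simp

context
  fixes A B
  assumes lin: "hlinear H H A" and bd: "\<And>x. x \<in> C \<Longrightarrow> hnorm H (A x) \<le> B * hnorm H x"
begin

lemma A_closed: "x \<in> C \<Longrightarrow> A x \<in> C"
  using lin by (auto simp: hlinear_def)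

lemma hcauchy_A: "hcauchy H w \<Longrightarrow> hcauchy H (\<lambda>k. A (w k))"
  by (erule hcauchy_image[where B = B]) (simp_all add: A_closed linear_diff[OF lin, symmetric] bd)

text \<open>The representative used in \<open>lift\<close> differs from \<open>w\<close> by a null
  sequence, which the bound on \<open>A\<close> keeps null.\<close>

lemma lift_coords:
  assumes w: "hcauchy H w"
  shows "lift A (coords w) = coords (\<lambda>k. A (w k))"
proof -
  let ?v = "rep (coords w)"
  have v: "hcauchy H ?v" using rep coords_in w by auto
  have "(\<lambda>k. B * dst (?v k) (w k)) \<longlonglongrightarrow> B * 0"
    using rep_coords_null[OF w] by (intro tendsto_mult tendsto_const)
  then have "(\<lambda>k. B * dst (?v k) (w k)) \<longlonglongrightarrow> 0" by simp
  moreover have "norm (dst (A (?v k)) (A (w k))) \<le> B * dst (?v k) (w k)" for k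
    using v w bd[of "hdiff H (?v k) (w k)"] by (simp add: hcauchy_closed A_closed linear_diff[OF lin, symmetric])
  ultimately have "(\<lambda>k. dst (A (?v k)) (A (w k))) \<longlonglongrightarrow> 0"
    by (rule LIMSEQ_null_comparison)
  then have "coords (\<lambda>k. A (?v k)) = coords (\<lambda>k. A (w k))"
    using v w by (intro coords_eqI hcauchy_A)
  then show ?thesis by (simp add: lift_def coords_in w)
qed

lemma lift_emb: "x \<in> C \<Longrightarrow> lift A (emb x) = emb (A x)"
  by (simp add: emb_def lift_coords hcauchy_const)

lemma lift_norm: "c \<in> hcarrier cpl \<Longrightarrow> hnorm cpl (lift A c) \<le> B * hnorm cpl c"
proof -
  assume "c \<in> hcarrier cpl"
  then obtain w where w: "hcauchy H w" and c: "c = coords w" by (metis cpl_cases)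
  have 1: "(\<lambda>k. hnorm H (A (w k))) \<longlonglongrightarrow> hnorm cpl (lift A c)"
    unfolding c lift_coords[OF w] using w by (intro cpl_norm hcauchy_A)
  have 2: "(\<lambda>k. B * hnorm H (w k)) \<longlonglongrightarrow> B * hnorm cpl c"
    unfolding c using w by (intro tendsto_mult tendsto_const cpl_norm)
  show ?thesis
    using bd w hcauchy_closed by (intro LIMSEQ_le[OF 1 2]) blast
qed

lemma lift_linear: "hlinear cpl cpl (lift A)"
  unfolding hlinear_def
proof (intro conjI ballI allI funcsetI)
  fix c assume "c \<in> hcarrier cpl"
  then obtain w where w: "hcauchy H w" and c: "c = coords w" by (metis cpl_cases)
  show "lift A c \<in> hcarrier cpl" unfolding c lift_coords[OF w] using w by (intro coords_in hcauchy_A)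
  fix a
  show "lift A (hscale cpl a c) = hscale cpl a (lift A c)"
    using w lin by (simp add: c coords_scale[symmetric] lift_coords hcauchy_scale hcauchy_A hlinear_def hcauchy_closed)
next
  fix c c' assume "c \<in> hcarrier cpl" "c' \<in> hcarrier cpl"
  then obtain w w' where w: "hcauchy H w" "hcauchy H w'" and c: "c = coords w" "c' = coords w'" by (metis cpl_cases)
  show "lift A (hadd cpl c c') = hadd cpl (lift A c) (lift A c')"
    using w lin by (simp add: c coords_add[symmetric] lift_coords hcauchy_add hcauchy_A hlinear_def hcauchy_closed)
qed

lemma lift_bounded: "lift A \<in> bounded_operators cpl"
  unfolding bounded_operators_def using lift_linear lift_norm by (auto simp: lift_def)

end

end

text \<open>The dense set \<open>D\<close> need not meet \<open>S\<close>. For each y in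
  \<open>D\<close> and each k a point of \<open>S\<close> within 1 / (k + 1) of y is picked if there
  is one; these countably many points are dense in \<open>S\<close>. The lemma serves the essential
  subspace, whose elements are approximated by families not known to lie in it.\<close>

lemma separable_subset:
  assumes "semi_ip H" and S: "S \<subseteq> hcarrier H" "S \<noteq> {}" and D: "countable D" "D \<subseteq> hcarrier H"
    and dense: "\<And>x e. x \<in> S \<Longrightarrow> e > 0 \<Longrightarrow> \<exists>y\<in>D. hnorm H (hdiff H x y) < e"
  obtains d :: "nat \<Rightarrow> 'h" where "\<And>n. d n \<in> S" "\<And>x e. x \<in> S \<Longrightarrow> e > 0 \<Longrightarrow> \<exists>n. hnorm H (hdiff H x (d n)) < e"
proof -
  interpret semi_ip H by fact
  define pick where "pick = (\<lambda>(y, k::nat). if \<exists>x\<in>S. hnorm H (hdiff H x y) < 1 / real (Suc k)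
     then (SOME x. x \<in> S \<and> hnorm H (hdiff H x y) < 1 / real (Suc k)) else (SOME x. x \<in> S))"
  define E where "E = pick ` (D \<times> UNIV)"
  have pS: "pick yk \<in> S" for yk
  proof -
    obtain y k where yk: "yk = (y, k)" by (cases yk)
    show ?thesis
    proof (cases "\<exists>x\<in>S. hnorm H (hdiff H x y) < 1 / real (Suc k)")
      case True
      then show ?thesis
        using someI_ex[of "\<lambda>x. x \<in> S \<and> hnorm H (hdiff H x y) < 1 / real (Suc k)"] by (auto simp: yk pick_def)
    next
      case False
      then show ?thesis using S(2) by (auto simp: yk pick_def some_in_eq)
    qed
  qed
  obtain x0 where "x0 \<in> S" using S by blast
  then obtain y0 where "y0 \<in> D" using dense[of x0 1] by auto
  have "countable E" "E \<noteq> {}" using D(1) \<open>y0 \<in> D\<close> by (auto simp: E_def)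
  then have rE: "range (from_nat_into E) = E" by (rule range_from_nat_into[rotated])
  show ?thesis
  proof (rule that)
    show "from_nat_into E n \<in> S" for n
      using rE pS by (metis E_def imageE rangeI)
    fix x e assume x: "x \<in> S" and e: "(e::real) > 0"
    then have "e / 2 > 0" by simp
    then obtain k where k: "1 / real (Suc k) < e / 2" using nat_approx_posE by blast
    obtain y where y: "y \<in> D" "hnorm H (hdiff H x y) < 1 / real (Suc k)" using dense[OF x, of "1 / real (Suc k)"] by auto
    have "\<exists>x. x \<in> S \<and> hnorm H (hdiff H x y) < 1 / real (Suc k)" using x y by blast
    then have py: "hnorm H (hdiff H (pick (y, k)) y) < 1 / real (Suc k)"
      using someI_ex[of "\<lambda>x. x \<in> S \<and> hnorm H (hdiff H x y) < 1 / real (Suc k)"] by (auto simp: pick_def)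
    have c: "x \<in> C" "y \<in> C" "pick (y, k) \<in> C" using x y D S pS by auto
    have "hnorm H (hdiff H x (pick (y, k))) \<le> hnorm H (hdiff H x y) + hnorm H (hdiff H y (pick (y, k)))"
      using c by (intro norm_diff_triangle)
    also have "hnorm H (hdiff H y (pick (y, k))) = hnorm H (hdiff H (pick (y, k)) y)"
      using c by (intro norm_diff_swap)
    finally have "hnorm H (hdiff H x (pick (y, k))) < e" using y py k by linarith
    moreover have "pick (y, k) \<in> range (from_nat_into E)" using y rE by (auto simp: E_def)
    ultimately show "\<exists>n. hnorm H (hdiff H x (from_nat_into E n)) < e" by (metis rangeE)
  qed
qed

section \<open>Functions of compact support on a locally compact space\<close>

lemma Hausdorff_euclidean: "Hausdorff_space (euclidean :: 'g::t2_space topology)"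
  unfolding Hausdorff_space_def by (metis disjnt_def hausdorff open_openin)

lemma lc_neighbourhood:
  fixes W :: "'g::t2_space set"
  assumes lc: "locally_compact_space (euclidean :: 'g topology)" and W: "open W" "x \<in> W"
  obtains V where "open V" "x \<in> V" "compact (closure V)" "closure V \<subseteq> W"
proof -
  have "neighbourhood_base_of (\<lambda>C. compactin euclidean C \<and> closedin euclidean C) (euclidean :: 'g topology)"
    using lc locally_compact_space_neighbourhood_base_closedin[OF disjI1[OF Hausdorff_euclidean]] by blast
  then have "\<exists>V K. openin euclidean V \<and> (compactin euclidean K \<and> closedin euclidean K) \<and> x \<in> V \<and> V \<subseteq> K \<and> K \<subseteq> W"
    using W unfolding neighbourhood_base_of by simp
  then obtain V K where *: "open V" "compact K" "closed K" "x \<in> V" "V \<subseteq> K" "K \<subseteq> W"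
    by (elim exE conjE) (simp only: compactin_euclidean_iff open_openin[symmetric] closed_closedin[symmetric])
  then have "closure V \<subseteq> K" by (simp add: closure_minimal)
  then have "compact (closure V)" using * compact_Int_closed[of K "closure V"] by (simp add: inf.absorb2)
  then show ?thesis using that * \<open>closure V \<subseteq> K\<close> by blast
qed

lemma lc_compact_neighbourhood:
  fixes K :: "'g::t2_space set"
  assumes lc: "locally_compact_space (euclidean :: 'g topology)" and K: "compact K" and W: "open W" "K \<subseteq> W"
  obtains V where "open V" "K \<subseteq> V" "compact (closure V)" "closure V \<subseteq> W"
proof -
  have "\<forall>x\<in>K. \<exists>V. open V \<and> x \<in> V \<and> compact (closure V) \<and> closure V \<subseteq> W"
    using lc_neighbourhood[OF lc W(1)] W(2) by (metis subsetD)
  then obtain V where V: "\<And>x. x \<in> K \<Longrightarrow> open (V x) \<and> x \<in> V x \<and> compact (closure (V x)) \<and> closure (V x) \<subseteq> W"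
    by metis
  obtain D where D: "D \<subseteq> K" "finite D" "K \<subseteq> (\<Union>x\<in>D. V x)"
    by (rule compactE_image[OF K, of K V]) (use V in auto)
  have cK: "compact (\<Union>x\<in>D. closure (V x))" using D V by (intro compact_UN) auto
  have sub: "closure (\<Union>x\<in>D. V x) \<subseteq> (\<Union>x\<in>D. closure (V x))"
    using closure_subset by (intro closure_minimal compact_imp_closed[OF cK]) blast
  then have "compact (closure (\<Union>x\<in>D. V x))"
    using cK compact_Int_closed[OF cK closed_closure] by (metis inf.absorb2)
  moreover have "closure (\<Union>x\<in>D. V x) \<subseteq> W" using D V sub by blast
  moreover have "open (\<Union>x\<in>D. V x)" using D V by auto
  ultimately show ?thesis using that D by metis
qed

lemma CcI:
  fixes f :: "'g::t2_space \<Rightarrow> complex"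
  assumes "continuous_on UNIV f" "compact K" "\<And>x. x \<notin> K \<Longrightarrow> f x = 0"
  shows "f \<in> Cc"
proof -
  have "closure {x. f x \<noteq> 0} \<subseteq> K"
    using assms by (intro closure_minimal compact_imp_closed) auto
  then have "compact (closure {x. f x \<noteq> 0})"
    using assms(2) compact_Int_closed[of K "closure {x. f x \<noteq> 0}"] by (simp add: inf.absorb2)
  then show ?thesis using assms(1) by (simp add: Cc_def)
qed

lemma CcE:
  fixes f :: "'g::t2_space \<Rightarrow> complex"
  assumes "f \<in> Cc"
  obtains K where "continuous_on UNIV f" "compact K" "\<And>x. x \<notin> K \<Longrightarrow> f x = 0"
proof (rule that)
  show "continuous_on UNIV f" "compact (closure {x. f x \<noteq> 0})" using assms by (auto simp: Cc_def)
  show "f x = 0" if "x \<notin> closure {x. f x \<noteq> 0}" for x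
    using that closure_subset[of "{x. f x \<noteq> 0}"] by blast
qed

lemma Cc_continuous: "f \<in> Cc \<Longrightarrow> continuous_on UNIV f"
  by (simp add: Cc_def)

lemma Cc_zero: "(\<lambda>x. 0) \<in> Cc"
  by (simp add: Cc_def)

lemma Cc_add:
  fixes f :: "'g::t2_space \<Rightarrow> complex"
  assumes "f \<in> Cc" "g \<in> Cc" shows "(\<lambda>x. f x + g x) \<in> Cc"
proof -
  obtain K where K: "continuous_on UNIV f" "compact K" "\<And>x. x \<notin> K \<Longrightarrow> f x = 0" using assms CcE by blast
  obtain K' where K': "continuous_on UNIV g" "compact K'" "\<And>x. x \<notin> K' \<Longrightarrow> g x = 0" using assms CcE by blast
  show ?thesis by (rule CcI[of _ "K \<union> K'"]) (use K K' in \<open>auto intro!: continuous_intros\<close>)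
qed

lemma Cc_mult:
  fixes f :: "'g::t2_space \<Rightarrow> complex"
  assumes "continuous_on UNIV a" "f \<in> Cc" shows "(\<lambda>x. a x * f x) \<in> Cc"
proof -
  obtain K where K: "continuous_on UNIV f" "compact K" "\<And>x. x \<notin> K \<Longrightarrow> f x = 0" using assms CcE by blast
  show ?thesis by (rule CcI[of _ "K"]) (use K assms in \<open>auto intro!: continuous_intros\<close>)
qed

lemma Cc_cmult: "f \<in> Cc \<Longrightarrow> (\<lambda>x. a * f x) \<in> Cc" for f :: "'g::t2_space \<Rightarrow> complex"
  by (rule Cc_mult) auto

lemma Cc_diff:
  fixes f :: "'g::t2_space \<Rightarrow> complex"
  assumes "f \<in> Cc" "g \<in> Cc" shows "(\<lambda>x. f x - g x) \<in> Cc"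
  using Cc_add[OF assms(1) Cc_cmult[OF assms(2), of "-1"]] by simp

lemma Cc_sum:
  fixes f :: "'i \<Rightarrow> 'g::t2_space \<Rightarrow> complex"
  shows "(\<And>i. i \<in> I \<Longrightarrow> f i \<in> Cc) \<Longrightarrow> (\<lambda>x. \<Sum>i\<in>I. f i x) \<in> Cc"
  by (induction I rule: infinite_finite_induct) (auto simp: Cc_zero Cc_add)

lemma Cc_norm:
  fixes f :: "'g::t2_space \<Rightarrow> complex"
  assumes "f \<in> Cc" shows "(\<lambda>x. of_real (cmod (f x))) \<in> Cc"
proof -
  obtain K where K: "continuous_on UNIV f" "compact K" "\<And>x. x \<notin> K \<Longrightarrow> f x = 0" using assms CcE by blast
  show ?thesis by (rule CcI[of _ "K"]) (use K in \<open>auto intro!: continuous_intros\<close>)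
qed

lemma Cc_cutoff:
  fixes K :: "'g::t2_space set"
  assumes lc: "locally_compact_space (euclidean :: 'g topology)" and K: "compact K"
  obtains c :: "'g \<Rightarrow> real" where "continuous_on UNIV c" "\<And>x. 0 \<le> c x" "\<And>x. c x \<le> 1"
    "\<And>x. x \<in> K \<Longrightarrow> c x = 1" "(\<lambda>x. of_real (c x)) \<in> Cc"
proof -
  obtain V where V: "open V" "K \<subseteq> V" "compact (closure V)"
    by (rule lc_compact_neighbourhood[OF lc K open_UNIV subset_UNIV])
  have cr: "completely_regular_space (euclidean :: 'g topology)"
    by (rule locally_compact_regular_imp_completely_regular_space[OF lc disjI1[OF Hausdorff_euclidean]])
  obtain c where c: "continuous_map euclidean (top_of_set {0..1::real}) c" "c ` (- V) \<subseteq> {0}" "c ` K \<subseteq> {1}"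
    by (rule Urysohn_completely_regular_compact_closed[of 0 1 "euclidean :: 'g topology" K "- V"])
       (use cr K V in \<open>auto simp: disjnt_def\<close>)
  then have cc: "continuous_on UNIV c" "\<And>x. c x \<in> {0..1}"
    by (auto simp: continuous_map_in_subtopology Pi_iff)
  have c0: "c x = 0" if "x \<notin> closure V" for x
    using c(2) that closure_subset[of V] by (auto simp: image_subset_iff)
  have "(\<lambda>x. complex_of_real (c x)) \<in> Cc"
    by (rule CcI[of _ "closure V"]) (use cc c0 V in \<open>auto intro!: continuous_intros\<close>)
  moreover have "c x = 1" if "x \<in> K" for x using c(3) that by auto
  ultimately show ?thesis using that cc by auto
qed

lemma Tietze_compact:
  fixes K :: "'g::t2_space set" and f :: "'g \<Rightarrow> complex"
  assumes lc: "locally_compact_space (euclidean :: 'g topology)" and K: "compact K" and f: "continuous_on K f"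
  obtains g where "continuous_on UNIV g" "\<And>x. x \<in> K \<Longrightarrow> g x = f x"
proof -
  have cr: "completely_regular_space (euclidean :: 'g topology)"
    by (rule locally_compact_regular_imp_completely_regular_space[OF lc disjI1[OF Hausdorff_euclidean]])
  have ext: "\<exists>g. continuous_on UNIV g \<and> (\<forall>x\<in>K. g x = h x)" if h: "continuous_on K h" for h :: "'g \<Rightarrow> real"
  proof -
    obtain g where "continuous_map euclidean euclideanreal g" "\<And>x. x \<in> K \<Longrightarrow> g x = h x"
      by (rule Tietze_extension_completely_regular[OF cr, of K UNIV h]) (use K h in \<open>simp_all add: is_interval_univ\<close>)
    then show ?thesis by auto
  qed
  obtain g1 where g1: "continuous_on UNIV g1" "\<And>x. x \<in> K \<Longrightarrow> g1 x = Re (f x)"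
    using ext[OF continuous_on_Re[OF f]] by blast
  obtain g2 where g2: "continuous_on UNIV g2" "\<And>x. x \<in> K \<Longrightarrow> g2 x = Im (f x)"
    using ext[OF continuous_on_Im[OF f]] by blast
  show ?thesis
    by (rule that[of "\<lambda>x. Complex (g1 x) (g2 x)"])
       (use g1 g2 in \<open>auto intro!: continuous_intros simp: Complex_eq complex_eq_iff\<close>)
qed

section \<open>Groupoids with a Haar system\<close>

locale haar_groupoid =
  fixes G :: "'g::{second_countable_topology, t2_space} gpd" and lam :: "'g \<Rightarrow> 'g measure"
  assumes lcg: "locally_compact_groupoid G" and haar: "left_haar_system G lam"
begin

abbreviation r where "r \<equiv> rng G"
abbreviation s where "s \<equiv> src G"
abbreviation mu where "mu \<equiv> gmult G"
abbreviation iv where "iv \<equiv> ginv G"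
abbreviation U where "U \<equiv> unit_space G"
abbreviation "fib u \<equiv> {y. r y = u}"

lemma lc: "locally_compact_space (euclidean :: 'g topology)"
  and groupoid: "groupoid G"
  and mu_cont: "continuous_on {(x, y). s x = r y} (\<lambda>(x, y). mu x y)"
  and iv_cont: "continuous_on UNIV iv"
  using lcg by (auto simp: locally_compact_groupoid_def)

lemma rr [simp]: "r (r x) = r x" and sr [simp]: "s (r x) = r x" and rs [simp]: "r (s x) = s x" and ss [simp]: "s (s x) = s x"
  and r_iv [simp]: "r (iv x) = s x" and s_iv [simp]: "s (iv x) = r x"
  and mu_iv [simp]: "mu x (iv x) = r x" and iv_mu [simp]: "mu (iv x) x = s x"
  and r_mu_left [simp]: "mu (r x) x = x" and mu_s_right [simp]: "mu x (s x) = x"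
  using groupoid by (auto simp: groupoid_def)

lemma r_mu [simp]: "s x = r y \<Longrightarrow> r (mu x y) = r x" and s_mu [simp]: "s x = r y \<Longrightarrow> s (mu x y) = s y"
  and mu_assoc: "s x = r y \<Longrightarrow> s y = r z \<Longrightarrow> mu (mu x y) z = mu x (mu y z)"
  using groupoid by (auto simp: groupoid_def)

lemma unit_iff: "u \<in> U \<longleftrightarrow> r u = u"
  unfolding unit_space_def by (metis rangeE rangeI rr)

lemma r_in_U [simp]: "r x \<in> U" and s_in_U [simp]: "s x \<in> U"
  by (simp_all add: unit_iff)

lemma U_nonempty: "U \<noteq> {}"
  using r_in_U by blast

lemma iv_mu_cancel [simp]: "s x = r z \<Longrightarrow> mu (iv x) (mu x z) = z"
  by (simp add: mu_assoc[symmetric])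

lemma mu_iv_cancel [simp]: "r y = r x \<Longrightarrow> mu y (mu (iv y) x) = x"
  by (simp add: mu_assoc[symmetric])

lemma iv_iv [simp]: "iv (iv x) = x"
  by (metis iv_mu iv_mu_cancel mu_s_right r_iv r_mu_left rs s_iv sr)

lemma iv_unique: "s x = r y \<Longrightarrow> mu x y = r x \<Longrightarrow> y = iv x"
  by (metis iv_mu_cancel mu_s_right s_iv)

lemma iv_mult: "s x = r y \<Longrightarrow> iv (mu x y) = mu (iv y) (iv x)"
  by (rule iv_unique[symmetric]) (simp_all add: mu_assoc)

lemma iv_iv_mult [simp]: "r y = r x \<Longrightarrow> iv (mu (iv y) x) = mu (iv x) y"
  by (simp add: iv_mult)

lemma continuous_on_mu [continuous_intros]:
  assumes "continuous_on A f" "continuous_on A g" "\<And>x. x \<in> A \<Longrightarrow> s (f x) = r (g x)"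
  shows "continuous_on A (\<lambda>x. mu (f x) (g x))"
proof -
  have "continuous_on A ((\<lambda>(x, y). mu x y) \<circ> (\<lambda>x. (f x, g x)))"
    using assms by (intro continuous_on_compose continuous_on_Pair continuous_on_subset[OF mu_cont]) auto
  then show ?thesis by (simp add: o_def)
qed

lemma continuous_on_iv [continuous_intros]: "continuous_on A f \<Longrightarrow> continuous_on A (\<lambda>x. iv (f x))"
  using continuous_on_compose[of A f iv] continuous_on_subset[OF iv_cont] by (auto simp: o_def)

lemma continuous_on_r [continuous_intros]:
  assumes "continuous_on A f" shows "continuous_on A (\<lambda>x. r (f x))"
proof -
  have "continuous_on A (\<lambda>x. mu (f x) (iv (f x)))" using assms by (intro continuous_intros) auto
  then show ?thesis by simp
qed

lemma continuous_on_s [continuous_intros]: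
  assumes "continuous_on A f" shows "continuous_on A (\<lambda>x. s (f x))"
proof -
  have "continuous_on A (\<lambda>x. mu (iv (f x)) (f x))" using assms by (intro continuous_intros) auto
  then show ?thesis by simp
qed

lemma continuous_on_Cc:
  "f \<in> Cc \<Longrightarrow> continuous_on A g \<Longrightarrow> continuous_on A (\<lambda>x. f (g x))"
  by (rule continuous_on_compose2[OF Cc_continuous]) auto

lemma closed_fib: "closed (fib u)"
proof -
  have "closed {x \<in> UNIV. r x = u}"
    by (intro continuous_closed_preimage_constant continuous_intros closed_UNIV)
  then show ?thesis by simp
qed

lemma Cc_involution: "f \<in> Cc \<Longrightarrow> involution G f \<in> Cc"
proof -
  assume f: "f \<in> Cc"
  obtain K where K: "continuous_on UNIV f" "compact K" "\<And>x. x \<notin> K \<Longrightarrow> f x = 0" by (rule CcE[OF f]) blast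
  have "continuous_on UNIV (\<lambda>x. cnj (f (iv x)))"
    by (intro continuous_on_cnj continuous_on_compose2[OF K(1)] continuous_intros) auto
  moreover have "compact (iv ` K)"
    using K by (intro compact_continuous_image continuous_on_subset[OF iv_cont]) auto
  moreover have "cnj (f (iv x)) = 0" if "x \<notin> iv ` K" for x
    using that K(3)[of "iv x"] by (metis iv_iv image_eqI complex_cnj_zero)
  ultimately show ?thesis unfolding involution_def by (rule CcI)
qed

lemma involution_involution [simp]: "involution G (involution G f) = f"
  by (simp add: involution_def)

subsection \<open>Integration over the range fibres\<close>

lemma sets_lam: "u \<in> U \<Longrightarrow> sets (lam u) = sets borel"
  and compact_finite: "u \<in> U \<Longrightarrow> compact K \<Longrightarrow> emeasure (lam u) K < \<infinity>"
  and null_iff: "u \<in> U \<Longrightarrow> open V \<Longrightarrow> emeasure (lam u) V = 0 \<longleftrightarrow> V \<inter> fib u = {}"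
  and haar_cont: "f \<in> Cc \<Longrightarrow> continuous_on U (\<lambda>u. LINT x|lam u. f x)"
  and haar_inv: "f \<in> Cc \<Longrightarrow> (LINT y:fib (s x)|lam (s x). f (mu x y)) = (LINT y|lam (r x). f y)"
  by (insert haar, unfold left_haar_system_def, (elim conjE, simp)+)

lemma space_lam: "u \<in> U \<Longrightarrow> space (lam u) = UNIV"
  using sets_eq_imp_space_eq[OF sets_lam] by simp

lemma borel_lam: "u \<in> U \<Longrightarrow> f \<in> borel_measurable borel \<Longrightarrow> f \<in> borel_measurable (lam u)"
  using measurable_cong_sets[OF sets_lam refl] by blast

lemma sigma_finite_lam: "u \<in> U \<Longrightarrow> sigma_finite_measure (lam u)"
proof -
  assume u: "u \<in> U"
  obtain B :: "'g set set" where B: "countable B" "topological_basis B" using ex_countable_basis by blast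
  define A where "A = closure ` {b \<in> B. compact (closure b)}"
  have "countable A" using B by (auto simp: A_def intro: countable_subset[OF _ B(1)])
  moreover have "A \<subseteq> sets (lam u)" using u by (auto simp: A_def sets_lam)
  moreover have "\<Union>A = space (lam u)"
  proof -
    have "x \<in> \<Union>A" for x
    proof -
      obtain V where V: "open V" "x \<in> V" "compact (closure V)" by (rule lc_neighbourhood[OF lc open_UNIV UNIV_I])
      obtain b where b: "b \<in> B" "x \<in> b" "b \<subseteq> V" using topological_basisE[OF B(2) V(1,2)] by metis
      have "closure b \<subseteq> closure V" using b by (simp add: closure_mono)
      then have "compact (closure b)" using V compact_Int_closed[of "closure V" "closure b"] by (simp add: inf.absorb2)
      then show ?thesis using b closure_subset by (auto simp: A_def)
    qed
    then show ?thesis using u by (auto simp: space_lam)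
  qed
  moreover have "\<forall>a\<in>A. emeasure (lam u) a \<noteq> \<infinity>"
    using compact_finite[OF u] by (auto simp: A_def dest!: less_imp_neq)
  ultimately show ?thesis by (intro sigma_finite_measure.intro) blast
qed

text \<open>The complement of the fibre is an open set that misses it, hence null by the support
  condition of a Haar system.\<close>

lemma AE_fib: "u \<in> U \<Longrightarrow> AE x in lam u. x \<in> fib u"
proof -
  assume u: "u \<in> U"
  have "open (- fib u)" using closed_fib by blast
  then have "emeasure (lam u) (- fib u) = 0" using null_iff[OF u] by simp
  then show ?thesis
    using u \<open>open (- fib u)\<close> by (intro AE_I[of _ _ "- fib u"]) (auto simp: sets_lam)
qed

definition fint :: "'g \<Rightarrow> ('g \<Rightarrow> complex) \<Rightarrow> complex" where
  "fint u k = (LINT y:fib u|lam u. k y)"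

text \<open>Convolution integrands such as f(y) g(y^{-1} x) make sense only for y in one range
  fibre, so continuity and compact support are required there alone.\<close>

definition fibC :: "'g \<Rightarrow> ('g \<Rightarrow> complex) \<Rightarrow> bool" where
  "fibC u k \<longleftrightarrow> continuous_on (fib u) k \<and> (\<exists>K. compact K \<and> (\<forall>y\<in>fib u. y \<notin> K \<longrightarrow> k y = 0))"

lemma fibCI: "continuous_on (fib u) k \<Longrightarrow> compact K \<Longrightarrow> (\<And>y. r y = u \<Longrightarrow> y \<notin> K \<Longrightarrow> k y = 0) \<Longrightarrow> fibC u k"
  unfolding fibC_def by blast

lemma fibC_Cc: "f \<in> Cc \<Longrightarrow> fibC u f"
  by (metis CcE fibCI continuous_on_subset subset_UNIV)

text \<open>A Haar system is described by its values on \<open>Cc\<close>, hence by functions on the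
  whole groupoid. Through this extension its properties reach functions that are meaningful on one
  fibre only.\<close>

lemma fibC_extend:
  assumes "fibC u k"
  obtains k' where "k' \<in> Cc" "\<And>y. r y = u \<Longrightarrow> k' y = k y"
proof -
  obtain K where K: "continuous_on (fib u) k" "compact K" "\<And>y. r y = u \<Longrightarrow> y \<notin> K \<Longrightarrow> k y = 0"
    using assms unfolding fibC_def by blast
  obtain c where c: "continuous_on UNIV c" "\<And>x. x \<in> K \<Longrightarrow> c x = (1::real)" "(\<lambda>x. of_real (c x)) \<in> Cc"
    using Cc_cutoff[OF lc K(2)] by metis
  obtain K' where K': "compact K'" "\<And>x. x \<notin> K' \<Longrightarrow> complex_of_real (c x) = 0" by (rule CcE[OF c(3)]) blast
  \<comment> \<open>Prescribing \<open>k\<close> on all of \<open>K'\<close> makes \<open>g\<close>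
    vanish at points of the fibre in \<open>K'\<close> outside \<open>K\<close>, and
    \<open>c\<close> vanishes outside \<open>K'\<close>. So the product agrees with \<open>k\<close>
    on the whole fibre.\<close>
  obtain g where g: "continuous_on UNIV g" "\<And>x. x \<in> K' \<inter> fib u \<Longrightarrow> g x = k x"
    by (rule Tietze_compact[OF lc, of "K' \<inter> fib u" k])
       (use K' K closed_fib in \<open>auto intro: compact_Int_closed continuous_on_subset\<close>)
  show ?thesis
  proof (rule that)
    show "(\<lambda>x. g x * of_real (c x)) \<in> Cc" using g c by (intro Cc_mult)
    fix y assume y: "r y = u"
    show "g y * of_real (c y) = k y"
      using g(2)[of y] c(2)[of y] K'(2)[of y] K(3)[OF y] y by (cases "y \<in> K"; cases "y \<in> K'") auto
  qed
qed

lemma Cc_bounded: fixes f :: "'g \<Rightarrow> complex" assumes f: "f \<in> Cc" obtains B where "B > 0" "\<And>x. cmod (f x) \<le> B"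
proof -
  obtain K where K: "continuous_on UNIV f" "compact K" "\<And>x. x \<notin> K \<Longrightarrow> f x = 0" by (rule CcE[OF f]) blast
  have "bounded (f ` K)"
    using K by (intro compact_imp_bounded compact_continuous_image continuous_on_subset[OF K(1)]) auto
  then obtain B where B: "B > 0" "\<And>x. x \<in> K \<Longrightarrow> cmod (f x) \<le> B" unfolding bounded_pos by blast
  show ?thesis
  proof (rule that[OF B(1)])
    show "cmod (f x) \<le> B" for x using B K(3)[of x] by (cases "x \<in> K") auto
  qed
qed

lemma Cc_integrable: assumes u: "u \<in> U" and f: "f \<in> Cc" shows "integrable (lam u) f"
proof -
  obtain K where K: "continuous_on UNIV f" "compact K" "\<And>x. x \<notin> K \<Longrightarrow> f x = 0" by (rule CcE[OF f]) blast
  obtain B where B: "\<And>x. cmod (f x) \<le> B" using Cc_bounded[OF f] by metis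
  show ?thesis
  proof (rule integrableI_bounded_set[of K _ _ B])
    show "K \<in> sets (lam u)" using K u by (simp add: sets_lam borel_compact)
    show "f \<in> borel_measurable (lam u)" using K u by (intro borel_lam borel_measurable_continuous_onI)
    show "emeasure (lam u) K < \<infinity>" using u K by (intro compact_finite)
  qed (use B K in auto)
qed

lemma fint_cong: "(\<And>y. r y = u \<Longrightarrow> k y = k' y) \<Longrightarrow> fint u k = fint u k'"
  unfolding fint_def set_lebesgue_integral_def by (intro Bochner_Integration.integral_cong) (auto simp: indicator_def)

lemma fint_Cc: assumes u: "u \<in> U" and f: "f \<in> Cc" shows "fint u f = (LINT y|lam u. f y)"
  unfolding fint_def set_lebesgue_integral_def
proof (rule integral_cong_AE)
  have fm: "f \<in> borel_measurable (lam u)" using Cc_integrable[OF u f] by auto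
  have "fib u \<in> sets (lam u)" using closed_fib u by (simp add: sets_lam)
  then show "(\<lambda>x. indicat_real (fib u) x *\<^sub>R f x) \<in> borel_measurable (lam u)" using fm by measurable
  show "f \<in> borel_measurable (lam u)" by (rule fm)
  show "AE x in lam u. indicat_real (fib u) x *\<^sub>R f x = f x" using AE_fib[OF u] by eventually_elim simp
qed

lemma fibC_cong: "(\<And>y. r y = u \<Longrightarrow> k y = k' y) \<Longrightarrow> fibC u k = fibC u k'"
  unfolding fibC_def by (intro conj_cong continuous_on_cong) auto

lemma fint_add: assumes u: "u \<in> U" and k: "fibC u k" "fibC u k'"
  shows "fint u (\<lambda>y. k y + k' y) = fint u k + fint u k'"
proof -
  obtain f where f: "f \<in> Cc" "\<And>y. r y = u \<Longrightarrow> f y = k y" using fibC_extend[OF k(1)] by metis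
  obtain f' where f': "f' \<in> Cc" "\<And>y. r y = u \<Longrightarrow> f' y = k' y" using fibC_extend[OF k(2)] by metis
  have "fint u (\<lambda>y. k y + k' y) = fint u (\<lambda>y. f y + f' y)" using f f' by (intro fint_cong) simp
  also have "\<dots> = fint u f + fint u f'"
    using f f' u by (simp add: fint_Cc Cc_add Cc_integrable)
  also have "\<dots> = fint u k + fint u k'" using f f' fint_cong by metis
  finally show ?thesis .
qed

lemma fibC_add: assumes "fibC u k" "fibC u k'" shows "fibC u (\<lambda>y. k y + k' y)"
proof -
  obtain f where f: "f \<in> Cc" "\<And>y. r y = u \<Longrightarrow> f y = k y" using fibC_extend[OF assms(1)] by metis
  obtain f' where f': "f' \<in> Cc" "\<And>y. r y = u \<Longrightarrow> f' y = k' y" using fibC_extend[OF assms(2)] by metis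
  have "fibC u (\<lambda>y. f y + f' y)" using f f' by (intro fibC_Cc Cc_add)
  then show ?thesis by (rule iffD1[OF fibC_cong, rotated]) (simp add: f f')
qed

lemma fint_cmult: "fint u (\<lambda>y. a * k y) = a * fint u k"
  unfolding fint_def by simp

lemma fint_mult_right: "fint u (\<lambda>y. k y * a) = fint u k * a"
  unfolding fint_def by simp

lemma fint_cnj: "fint u (\<lambda>y. cnj (k y)) = cnj (fint u k)"
  unfolding fint_def set_lebesgue_integral_def by (subst Bochner_Integration.integral_cnj[symmetric]) simp

lemma fint_zero: "(\<And>y. r y = u \<Longrightarrow> k y = 0) \<Longrightarrow> fint u k = 0"
  using fint_cong[of u k "\<lambda>y. 0"] by (simp add: fint_def)

definition nint :: "'g \<Rightarrow> ('g \<Rightarrow> complex) \<Rightarrow> real" where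
  "nint u f = (LINT x|lam u. cmod (f x))"

lemma nint_fint: "u \<in> U \<Longrightarrow> f \<in> Cc \<Longrightarrow> of_real (nint u f) = fint u (\<lambda>x. of_real (cmod (f x)))"
  by (simp add: fint_Cc Cc_norm nint_def)

lemma fint_real_mono:
  assumes u: "u \<in> U" and k: "fibC u (\<lambda>y. of_real (k y))" "fibC u (\<lambda>y. of_real (k' y))"
    and le: "\<And>y. r y = u \<Longrightarrow> k y \<le> k' y"
  shows "Re (fint u (\<lambda>y. of_real (k y))) \<le> Re (fint u (\<lambda>y. of_real (k' y)))"
proof -
  obtain f where f: "f \<in> Cc" "\<And>y. r y = u \<Longrightarrow> f y = of_real (k y)" using fibC_extend[OF k(1)] by metis
  obtain f' where f': "f' \<in> Cc" "\<And>y. r y = u \<Longrightarrow> f' y = of_real (k' y)" using fibC_extend[OF k(2)] by metis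
  have "Re (fint u f) \<le> Re (fint u f')"
    unfolding fint_Cc[OF u f(1)] fint_Cc[OF u f'(1)]
      integral_Re[OF Cc_integrable[OF u f(1)], symmetric] integral_Re[OF Cc_integrable[OF u f'(1)], symmetric]
  proof (rule integral_mono_AE)
    show "AE x in lam u. Re (f x) \<le> Re (f' x)" using AE_fib[OF u] by eventually_elim (simp add: f f' le)
  qed (use f f' u in \<open>auto intro: Cc_integrable\<close>)
  then show ?thesis using f f' fint_cong[of u f "\<lambda>y. of_real (k y)"] fint_cong[of u f' "\<lambda>y. of_real (k' y)"] by simp
qed

lemma norm_fint_le:
  assumes u: "u \<in> U" and k: "fibC u k"
  shows "cmod (fint u k) \<le> Re (fint u (\<lambda>y. of_real (cmod (k y))))"
proof -
  obtain f where f: "f \<in> Cc" "\<And>y. r y = u \<Longrightarrow> f y = k y" using fibC_extend[OF k(1)] by metis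
  have "cmod (fint u f) \<le> nint u f"
    using u f by (simp add: fint_Cc nint_def)
  also have "\<dots> = Re (fint u (\<lambda>y. of_real (cmod (f y))))" using nint_fint[OF u f(1)] by (metis Re_complex_of_real)
  also have "fint u (\<lambda>y. of_real (cmod (f y))) = fint u (\<lambda>y. of_real (cmod (k y)))" using f by (intro fint_cong) simp
  finally show ?thesis using f fint_cong[of u f k] by simp
qed

lemma fibC_norm: "fibC u k \<Longrightarrow> fibC u (\<lambda>y. of_real (cmod (k y)))"
  unfolding fibC_def by (elim conjE exE) (rule conjI, intro continuous_intros, auto)

lemma fibC_mult: "continuous_on (fib u) a \<Longrightarrow> fibC u k \<Longrightarrow> fibC u (\<lambda>y. a y * k y)"
  unfolding fibC_def by (elim conjE exE) (rule conjI, intro continuous_intros, auto)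

lemma fibC_mult2: "continuous_on (fib u) a \<Longrightarrow> fibC u k \<Longrightarrow> fibC u (\<lambda>y. k y * a y)"
  using fibC_mult[of u a k] by (simp add: mult.commute)

lemma left_inv:
  assumes k: "fibC (r x) k"
  shows "fint (s x) (\<lambda>y. k (mu x y)) = fint (r x) k"
proof -
  obtain f where f: "f \<in> Cc" "\<And>y. r y = r x \<Longrightarrow> f y = k y" using fibC_extend[OF k(1)] by metis
  have "fint (s x) (\<lambda>y. k (mu x y)) = fint (s x) (\<lambda>y. f (mu x y))" using f by (intro fint_cong) simp
  also have "\<dots> = fint (r x) f" using haar_inv[OF f(1), of x] fint_Cc[OF r_in_U f(1)] by (simp add: fint_def)
  also have "\<dots> = fint (r x) k" using f by (intro fint_cong) simp
  finally show ?thesis .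
qed

text \<open>\<open>P\<close> is controlled only on the square of the fibre. Cut off by the indicator
  of this closed set it becomes Borel on the product, whose product \<sigma>-algebra is the Borel
  one by second countability; it is then bounded and lives on a set of finite measure.\<close>

lemma fubini_fib:
  assumes u: "u \<in> U" and cont: "continuous_on (fib u \<times> fib u) (\<lambda>(z, y). P z y)"
    and K: "compact K" "compact K'" and zero: "\<And>z y. r z = u \<Longrightarrow> r y = u \<Longrightarrow> z \<notin> K \<or> y \<notin> K' \<Longrightarrow> P z y = 0"
  shows "fint u (\<lambda>y. fint u (\<lambda>z. P z y)) = fint u (\<lambda>z. fint u (\<lambda>y. P z y))"
proof -
  let ?F = "fib u"
  define Q where "Q = (\<lambda>z y. indicat_real (?F \<times> ?F) (z, y) *\<^sub>R P z y)"
  interpret M: sigma_finite_measure "lam u" by (rule sigma_finite_lam[OF u])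
  interpret pair_sigma_finite "lam u" "lam u" by unfold_locales
  have sets: "sets (lam u \<Otimes>\<^sub>M lam u) = sets borel"
    using sets_pair_measure_cong[OF sets_lam[OF u] sets_lam[OF u]] unfolding borel_prod .
  have "(\<lambda>p. indicat_real (?F \<times> ?F) p *\<^sub>R (case p of (z, y) \<Rightarrow> P z y)) \<in> borel_measurable borel"
    using cont closed_fib by (intro borel_measurable_continuous_on_indicator) (auto intro!: borel_closed closed_Times)
  then have Qm: "case_prod Q \<in> borel_measurable (lam u \<Otimes>\<^sub>M lam u)"
    using measurable_cong_sets[OF sets refl] by (auto simp: Q_def case_prod_unfold)
  have cK: "compact ((K \<times> K') \<inter> (?F \<times> ?F))"
    using K closed_fib by (intro compact_Int_closed compact_Times closed_Times)
  have "bounded ((\<lambda>(z, y). P z y) ` ((K \<times> K') \<inter> (?F \<times> ?F)))"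
    using cK by (intro compact_imp_bounded compact_continuous_image continuous_on_subset[OF cont]) auto
  then obtain B where B0: "\<forall>x\<in>(\<lambda>(z, y). P z y) ` ((K \<times> K') \<inter> (?F \<times> ?F)). cmod x \<le> B" and Bpos: "B > 0"
    unfolding bounded_pos by blast
  have B: "cmod (P z y) \<le> B" if "z \<in> K" "y \<in> K'" "r z = u" "r y = u" for z y
    using bspec[OF B0 imageI[of "(z, y)"]] that by simp
  have int: "integrable (lam u \<Otimes>\<^sub>M lam u) (case_prod Q)"
  proof (rule integrableI_bounded_set[of "K \<times> K'" _ _ B])
    show "K \<times> K' \<in> sets (lam u \<Otimes>\<^sub>M lam u)"
      using K u by (intro pair_measureI) (auto simp: sets_lam borel_compact)
    have "emeasure (lam u \<Otimes>\<^sub>M lam u) (K \<times> K') = emeasure (lam u) K * emeasure (lam u) K'"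
      using K u by (intro M.emeasure_pair_measure_Times) (auto simp: sets_lam borel_compact)
    then show "emeasure (lam u \<Otimes>\<^sub>M lam u) (K \<times> K') < \<infinity>"
      using compact_finite[OF u K(1)] compact_finite[OF u K(2)] by (simp add: ennreal_mult_less_top)
    show "AE x in lam u \<Otimes>\<^sub>M lam u. x \<in> K \<times> K' \<longrightarrow> cmod (case x of (z, y) \<Rightarrow> Q z y) \<le> B"
      using B Bpos by (auto simp: Q_def indicator_def less_imp_le)
    show "AE x in lam u \<Otimes>\<^sub>M lam u. x \<notin> K \<times> K' \<longrightarrow> (case x of (z, y) \<Rightarrow> Q z y) = 0"
    proof (intro AE_I2 impI)
      fix x assume "x \<notin> K \<times> K'"
      then show "(case x of (z, y) \<Rightarrow> Q z y) = 0"
        using zero[of "fst x" "snd x"] by (auto simp: Q_def indicator_def case_prod_unfold mem_Times_iff)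
    qed
  qed (rule Qm)
  have "(\<integral>y. (\<integral>z. Q z y \<partial>lam u) \<partial>lam u) = (\<integral>z. (\<integral>y. Q z y \<partial>lam u) \<partial>lam u)"
    using int by (rule Fubini_integral)
  moreover have "(\<integral>z. Q z y \<partial>lam u) = indicat_real ?F y *\<^sub>R fint u (\<lambda>z. P z y)" for y
  proof (cases "y \<in> ?F")
    case True
    then show ?thesis unfolding fint_def set_lebesgue_integral_def Q_def
      by (simp add: indicator_times)
  next
    case False
    then show ?thesis by (simp add: Q_def indicator_times)
  qed
  moreover have "(\<integral>y. Q z y \<partial>lam u) = indicat_real ?F z *\<^sub>R fint u (\<lambda>y. P z y)" for z
  proof (cases "z \<in> ?F")
    case True
    then show ?thesis unfolding fint_def set_lebesgue_integral_def Q_def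
      by (simp add: indicator_times)
  next
    case False
    then show ?thesis by (simp add: Q_def indicator_times)
  qed
  ultimately have "(\<integral>y. indicat_real ?F y *\<^sub>R fint u (\<lambda>z. P z y) \<partial>lam u) = (\<integral>z. indicat_real ?F z *\<^sub>R fint u (\<lambda>y. P z y) \<partial>lam u)"
    by simp
  then show ?thesis by (simp add: fint_def[of u "\<lambda>y. fint u (\<lambda>z. P z y)"] fint_def[of u "\<lambda>z. fint u (\<lambda>y. P z y)"] set_lebesgue_integral_def)
qed

text \<open>Both the integrand and the measure move with x. The integrand at the limit point is
  extended to some \<open>k\<close> in \<open>Cc\<close>, for which the Haar system gives
  convergence; along the sequence the true integrands are uniformly close to \<open>k\<close> on a
  compact set that carries all of them.\<close>

lemma continuous_fint:
  assumes cont: "continuous_on {(x, y). r x = r y} (\<lambda>(x, y). h x y)" and K: "compact K"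
    and zero: "\<And>x y. r x = r y \<Longrightarrow> y \<notin> K \<Longrightarrow> h x y = 0"
  shows "continuous_on UNIV (\<lambda>x. fint (r x) (h x))"
proof (rule continuous_on_sequentiallyI)
  fix X :: "nat \<Rightarrow> 'g" and x assume X: "X \<longlonglongrightarrow> x"
  have hC: "fibC (r x) (h x)" for x
  proof (rule fibCI[OF _ K])
    show "continuous_on (fib (r x)) (h x)"
    proof -
      have "continuous_on (fib (r x)) (\<lambda>y. (\<lambda>(x, y). h x y) (x, y))"
        by (rule continuous_on_compose2[OF cont continuous_on_Pair[OF continuous_on_const continuous_on_id]]) auto
      then show ?thesis by simp
    qed
    show "h x y = 0" if "r y = r x" "y \<notin> K" for y using zero[of x y] that by simp
  qed
  obtain k where k: "k \<in> Cc" "\<And>y. r y = r x \<Longrightarrow> k y = h x y" using fibC_extend[OF hC[of x]] by metis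
  obtain K1 where K1: "compact K1" "\<And>y. y \<notin> K1 \<Longrightarrow> k y = 0" by (rule CcE[OF k(1)]) blast
  define K2 where "K2 = K \<union> K1"
  have K2: "compact K2" using K K1 by (auto simp: K2_def)
  obtain c where c: "\<And>x. 0 \<le> c x" "\<And>x. x \<in> K2 \<Longrightarrow> c x = (1::real)" "(\<lambda>x. of_real (c x)) \<in> Cc"
    using Cc_cutoff[OF lc K2] by metis
  have rX: "(\<lambda>n. r (X n)) \<longlonglongrightarrow> r x"
    using continuous_on_tendsto_compose[OF continuous_on_r[OF continuous_on_id, of UNIV] X] by simp
  have lim: "(\<lambda>n. fint (r (X n)) f) \<longlonglongrightarrow> fint (r x) f" if f: "f \<in> Cc" for f
    using continuous_on_tendsto_compose[OF haar_cont[OF f] rX] f by (simp add: fint_Cc)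
  \<comment> \<open>Eventually bounds the integral of \<open>c\<close>, and with it the measure of
    \<open>K2\<close>, in the fibres along the sequence.\<close>
  define C0 where "C0 = cmod (fint (r x) (\<lambda>x. of_real (c x))) + 1"
  have C0: "C0 > 0" unfolding C0_def by (rule add_nonneg_pos) auto
  have evC: "\<forall>\<^sub>F n in sequentially. cmod (fint (r (X n)) (\<lambda>x. of_real (c x))) < C0"
    using tendsto_norm[OF lim[OF c(3)]] by (rule order_tendstoD) (simp add: C0_def)
  have uniform: "\<forall>\<^sub>F n in sequentially. \<forall>y. r y = r (X n) \<longrightarrow> y \<in> K2 \<longrightarrow> cmod (h (X n) y - k y) < e" if e: "e > 0" for e
  \<comment> \<open>Otherwise offending points of \<open>K2\<close> have a subsequence converging to
    a point over r x, where \<open>h x\<close> and \<open>k\<close> agree; by joint continuity the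
    difference tends to 0 along it.\<close>
  proof (rule ccontr)
    assume "\<not> ?thesis"
    then have "\<exists>\<^sub>F n in sequentially. \<not> (\<forall>y. r y = r (X n) \<longrightarrow> y \<in> K2 \<longrightarrow> cmod (h (X n) y - k y) < e)"
      by (simp only: not_eventually)
    then have "infinite {n. \<not> (\<forall>y. r y = r (X n) \<longrightarrow> y \<in> K2 \<longrightarrow> cmod (h (X n) y - k y) < e)}"
      by (simp only: cofinite_eq_sequentially[symmetric] frequently_cofinite not_False_eq_True)
    then obtain q :: "nat \<Rightarrow> nat" where q: "strict_mono q"
        "\<And>n. q n \<in> {n. \<not> (\<forall>y. r y = r (X n) \<longrightarrow> y \<in> K2 \<longrightarrow> cmod (h (X n) y - k y) < e)}"
      using infinite_enumerate by blast
    then have "\<forall>n. \<exists>y. r y = r (X (q n)) \<and> y \<in> K2 \<and> e \<le> cmod (h (X (q n)) y - k y)"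
      by (auto simp: not_less)
    then obtain Y where Y: "\<And>n. r (Y n) = r (X (q n))" "\<And>n. Y n \<in> K2" "\<And>n. e \<le> cmod (h (X (q n)) (Y n) - k (Y n))"
      by metis
    obtain y p where y: "y \<in> K2" "strict_mono (p :: nat \<Rightarrow> nat)" "(Y \<circ> p) \<longlonglongrightarrow> y"
      using compact_imp_seq_compact[OF K2] Y(2) unfolding seq_compact_def by metis
    have X': "(\<lambda>n. X (q (p n))) \<longlonglongrightarrow> x"
      using LIMSEQ_subseq_LIMSEQ[OF X strict_mono_o[OF q(1) y(2)]] by (simp add: o_def)
    have "(\<lambda>n. r (X (q (p n)))) \<longlonglongrightarrow> r x"
      using continuous_on_tendsto_compose[OF continuous_on_r[OF continuous_on_id, of UNIV] X'] by simp
    moreover have "(\<lambda>n. r (Y (p n))) \<longlonglongrightarrow> r y"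
      using continuous_on_tendsto_compose[OF continuous_on_r[OF continuous_on_id, of UNIV] y(3)] by (simp add: o_def)
    ultimately have ry: "r y = r x" unfolding Y(1) by (rule LIMSEQ_unique[rotated])
    have "(\<lambda>n. (X (q (p n)), Y (p n))) \<longlonglongrightarrow> (x, y)" using X' y(3) by (intro tendsto_Pair) (auto simp: o_def)
    then have 1: "(\<lambda>n. h (X (q (p n))) (Y (p n))) \<longlonglongrightarrow> h x y"
      using continuous_on_tendsto_compose[OF cont, of "\<lambda>n. (X (q (p n)), Y (p n))" "(x, y)" sequentially] ry Y(1) by simp
    have 2: "(\<lambda>n. k (Y (p n))) \<longlonglongrightarrow> k y"
      using continuous_on_tendsto_compose[OF Cc_continuous[OF k(1)] y(3)] by (simp add: o_def)
    have "(\<lambda>n. cmod (h (X (q (p n))) (Y (p n)) - k (Y (p n)))) \<longlonglongrightarrow> cmod (h x y - k y)"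
      using 1 2 by (intro tendsto_intros)
    moreover have "h x y - k y = 0" using k(2) ry by simp
    ultimately have "(\<lambda>n. cmod (h (X (q (p n))) (Y (p n)) - k (Y (p n)))) \<longlonglongrightarrow> 0" by simp
    then have "e \<le> 0" by (rule LIMSEQ_le_const) (use Y(3) in blast)
    then show False using e by simp
  qed
  have "(\<lambda>n. fint (r (X n)) (h (X n)) - fint (r (X n)) k) \<longlonglongrightarrow> 0"
  proof (rule tendstoI)
    fix e :: real assume e: "e > 0"
    then have "e / C0 > 0" using C0 by simp
    from uniform[OF this] evC
    show "\<forall>\<^sub>F n in sequentially. dist (fint (r (X n)) (h (X n)) - fint (r (X n)) k) 0 < e"
    proof eventually_elim
      fix n assume 1: "\<forall>y. r y = r (X n) \<longrightarrow> y \<in> K2 \<longrightarrow> cmod (h (X n) y - k y) < e / C0"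
        and 2: "cmod (fint (r (X n)) (\<lambda>x. of_real (c x))) < C0"
      let ?u = "r (X n)"
      have kC: "fibC ?u (\<lambda>y. (-1) * k y)" using k by (intro fibC_mult fibC_Cc) auto
      have dC: "fibC ?u (\<lambda>y. h (X n) y - k y)"
        using hC[of "X n"] fibC_Cc[OF k(1), of ?u] K2
        by (intro fibCI[OF _ K2]) (auto simp: fibC_def K2_def zero K1 intro!: continuous_intros)
      have "fint ?u (h (X n)) - fint ?u k = fint ?u (\<lambda>y. h (X n) y - k y)"
        using fint_add[OF r_in_U hC kC] fint_cmult[of ?u "-1" k] by simp
      then have "cmod (fint ?u (h (X n)) - fint ?u k) \<le> Re (fint ?u (\<lambda>y. of_real (cmod (h (X n) y - k y))))"
        using norm_fint_le[OF r_in_U dC] by simp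
      also have "\<dots> \<le> Re (fint ?u (\<lambda>y. of_real ((e / C0) * c y)))"
      proof (rule fint_real_mono)
        show "fibC ?u (\<lambda>y. complex_of_real (cmod (h (X n) y - k y)))" by (rule fibC_norm[OF dC])
        show "fibC ?u (\<lambda>y. complex_of_real (e / C0 * c y))"
          using fibC_Cc[OF Cc_cmult[OF c(3), of "of_real (e / C0)"]] by simp
        fix y assume y: "r y = ?u"
        show "cmod (h (X n) y - k y) \<le> e / C0 * c y"
        proof (cases "y \<in> K2")
          case True
          then have "cmod (h (X n) y - k y) < e / C0" using 1 y by blast
          then show ?thesis using c(2)[OF True] by simp
        next
          case False
          then show ?thesis using zero[of "X n" y] K1 y c(1)[of y] e C0 by (simp add: K2_def)
        qed
      qed simp
      also have "\<dots> = (e / C0) * Re (fint ?u (\<lambda>y. of_real (c y)))"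
        by (simp only: of_real_mult fint_cmult Re_complex_of_real times_complex.sel Im_complex_of_real mult_zero_left diff_zero)
      also have "\<dots> \<le> (e / C0) * cmod (fint ?u (\<lambda>y. of_real (c y)))"
        using e C0 complex_Re_le_cmod by (intro mult_left_mono) auto
      also have "\<dots> < (e / C0) * C0" using 2 e C0 by (intro mult_strict_left_mono) auto
      also have "\<dots> = e" using C0 by simp
      finally show "dist (fint ?u (h (X n)) - fint ?u k) 0 < e" by simp
    qed
  qed
  from tendsto_add[OF this lim[OF k(1)]]
  have "(\<lambda>n. fint (r (X n)) (h (X n))) \<longlonglongrightarrow> fint (r x) k" by simp
  then show "(\<lambda>n. fint (r (X n)) (h (X n))) \<longlonglongrightarrow> fint (r x) (h x)"
    using fint_cong[of "r x" k "h x"] k by simp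
qed

end

context haar_groupoid
begin

subsection \<open>The convolution algebra\<close>

abbreviation conv where "conv \<equiv> convolution G lam"
abbreviation star where "star \<equiv> involution G"

lemma conv_fint: "conv f g x = fint (r x) (\<lambda>y. f y * g (mu (iv y) x))"
  unfolding convolution_def fint_def ..

lemma continuous_on_conv_kernel:
  assumes f: "f \<in> Cc" and g: "g \<in> Cc"
  shows "continuous_on {(x, y). r x = r y} (\<lambda>(x, y). f y * g (mu (iv y) x))"
proof -
  have "continuous_on {p. r (fst p) = r (snd p)} (\<lambda>p. f (snd p) * g (mu (iv (snd p)) (fst p)))"
    by (intro continuous_on_mult continuous_on_Cc[OF f] continuous_on_Cc[OF g] continuous_intros) auto
  then show ?thesis by (simp add: case_prod_unfold)
qed

lemma fibC_conv:
  assumes f: "f \<in> Cc" and g: "g \<in> Cc" and x: "r x = u"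
  shows "fibC u (\<lambda>y. f y * g (mu (iv y) x))"
proof (rule fibC_mult2[OF _ fibC_Cc[OF f]])
  show "continuous_on (fib u) (\<lambda>y. g (mu (iv y) x))"
    using x by (intro continuous_on_Cc[OF g] continuous_intros) auto
qed

lemma compact_product:
  assumes "compact K" "compact K'"
  shows "compact ((\<lambda>(x, y). mu x y) ` ((K \<times> K') \<inter> {(x, y). s x = r y}))"
proof (rule compact_continuous_image)
  show "continuous_on (K \<times> K' \<inter> {(x, y). s x = r y}) (\<lambda>(x, y). mu x y)"
    by (rule continuous_on_subset[OF mu_cont]) auto
  have "closed {p. s (fst p) = r (snd p)}"
    by (intro closed_Collect_eq continuous_intros)
  then show "compact (K \<times> K' \<inter> {(x, y). s x = r y})"
    using assms by (intro compact_Int_closed compact_Times) (simp_all add: case_prod_unfold)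
qed

lemma conv_Cc [simp]:
  assumes f: "f \<in> Cc" and g: "g \<in> Cc"
  shows "conv f g \<in> Cc"
proof -
  obtain K where K: "compact K" "\<And>x. x \<notin> K \<Longrightarrow> f x = 0" by (rule CcE[OF f]) blast
  obtain K' where K': "compact K'" "\<And>x. x \<notin> K' \<Longrightarrow> g x = 0" by (rule CcE[OF g]) blast
  show ?thesis
  proof (rule CcI[OF _ compact_product[OF K(1) K'(1)]])
    show "continuous_on UNIV (conv f g)"
      unfolding conv_fint[abs_def]
      by (rule continuous_fint[OF continuous_on_conv_kernel[OF f g] K(1)]) (simp add: K)
    fix x assume x: "x \<notin> (\<lambda>(x, y). mu x y) ` (K \<times> K' \<inter> {(x, y). s x = r y})"
    have "f y * g (mu (iv y) x) = 0" if y: "r y = r x" for y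
    proof (rule ccontr)
      assume "f y * g (mu (iv y) x) \<noteq> 0"
      then have "y \<in> K" "mu (iv y) x \<in> K'" using K K' by auto
      moreover have "(\<lambda>(x, y). mu x y) (y, mu (iv y) x) = x" using y by simp
      moreover have "s y = r (mu (iv y) x)" using y by simp
      ultimately show False using x by (metis (mono_tags, lifting) IntI SigmaI case_prodI image_eqI mem_Collect_eq)
    qed
    then show "conv f g x = 0" unfolding conv_fint by (rule fint_zero)
  qed
qed

lemma star_Cc [simp]: "f \<in> Cc \<Longrightarrow> star f \<in> Cc"
  by (rule Cc_involution)

lemma conv_add_left: "f \<in> Cc \<Longrightarrow> f' \<in> Cc \<Longrightarrow> g \<in> Cc \<Longrightarrow> conv (\<lambda>x. f x + f' x) g = (\<lambda>x. conv f g x + conv f' g x)"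
  unfolding conv_fint[abs_def] by (rule ext, subst fint_add[symmetric]) (simp_all add: fibC_conv distrib_right)

lemma conv_add_right: "f \<in> Cc \<Longrightarrow> g \<in> Cc \<Longrightarrow> g' \<in> Cc \<Longrightarrow> conv f (\<lambda>x. g x + g' x) = (\<lambda>x. conv f g x + conv f g' x)"
  unfolding conv_fint[abs_def] by (rule ext, subst fint_add[symmetric]) (simp_all add: fibC_conv distrib_left)

lemma conv_cmult_left: "conv (\<lambda>x. a * f x) g = (\<lambda>x. a * conv f g x)"
  unfolding conv_fint[abs_def] by (simp add: mult.assoc fint_cmult)

lemma conv_cmult_right: "conv f (\<lambda>x. a * g x) = (\<lambda>x. a * conv f g x)"
  unfolding conv_fint[abs_def] by (simp add: mult.left_commute fint_cmult)

text \<open>Substituting x y for y, which left invariance allows, turns the integral into one over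
  the fibre of s x, where it is the convolution at the inverse of x.\<close>

lemma star_conv:
  assumes f: "f \<in> Cc" and g: "g \<in> Cc"
  shows "star (conv f g) = conv (star g) (star f)"
proof
  fix x
  have "conv (star g) (star f) x = fint (r x) (\<lambda>y. cnj (g (iv y)) * cnj (f (mu (iv x) y)))"
    unfolding conv_fint by (rule fint_cong) (simp add: involution_def)
  also have "\<dots> = fint (s x) (\<lambda>y. cnj (g (iv (mu x y))) * cnj (f (mu (iv x) (mu x y))))"
  proof (rule left_inv[symmetric])
    have "fibC (r x) (\<lambda>y. star g y * star f (mu (iv y) x))" by (rule fibC_conv) (use f g in auto)
    then show "fibC (r x) (\<lambda>y. cnj (g (iv y)) * cnj (f (mu (iv x) y)))"
      by (rule iffD1[OF fibC_cong, rotated]) (simp add: involution_def)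
  qed
  also have "\<dots> = fint (s x) (\<lambda>y. cnj (f y * g (mu (iv y) (iv x))))"
    by (rule fint_cong) (simp add: iv_mult)
  also have "\<dots> = star (conv f g) x" unfolding fint_cnj by (simp add: involution_def conv_fint)
  finally show "star (conv f g) x = conv (star g) (star f) x" by simp
qed

text \<open>Fubini on the fibre over r x, followed by left invariance under z in the inner
  integral.\<close>

lemma conv_assoc:
  assumes f: "f \<in> Cc" and g: "g \<in> Cc" and h: "h \<in> Cc"
  shows "conv (conv f g) h = conv f (conv g h)"
proof
  fix x
  define u where "u = r x"
  have u: "u \<in> U" by (simp add: u_def)
  obtain K where K: "compact K" "\<And>x. x \<notin> K \<Longrightarrow> f x = 0" by (rule CcE[OF f]) blast
  obtain K' where K': "compact K'" "\<And>x. x \<notin> K' \<Longrightarrow> g x = 0" by (rule CcE[OF g]) blast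
  let ?K2 = "(\<lambda>(x, y). mu x y) ` (K \<times> K' \<inter> {(x, y). s x = r y})"
  define P where "P = (\<lambda>z y. f z * g (mu (iv z) y) * h (mu (iv y) x))"
  have "conv (conv f g) h x = fint u (\<lambda>y. conv f g y * h (mu (iv y) x))"
    by (simp add: conv_fint u_def)
  also have "\<dots> = fint u (\<lambda>y. fint u (\<lambda>z. P z y))"
    by (rule fint_cong) (simp add: P_def conv_fint fint_mult_right)
  also have "\<dots> = fint u (\<lambda>z. fint u (\<lambda>y. P z y))"
  \<comment> \<open>A nonzero value forces z into \<open>K\<close> and z^{-1} y into
    \<open>K'\<close>, hence y into the product of the two compact sets.\<close>
  proof (rule fubini_fib[OF u _ K(1) compact_product[OF K(1) K'(1)]])
    have "continuous_on (fib u \<times> fib u) (\<lambda>p. f (fst p) * g (mu (iv (fst p)) (snd p)) * h (mu (iv (snd p)) x))"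
      by (intro continuous_intros continuous_on_Cc[OF f] continuous_on_Cc[OF g] continuous_on_Cc[OF h]) (auto simp: u_def)
    then show "continuous_on (fib u \<times> fib u) (\<lambda>(z, y). P z y)" by (simp add: P_def case_prod_unfold)
    fix z y assume zy: "r z = u" "r y = u" "z \<notin> K \<or> y \<notin> ?K2"
    show "P z y = 0"
    proof (cases "z \<in> K \<and> mu (iv z) y \<in> K'")
      case True
      have "(\<lambda>(x, y). mu x y) (z, mu (iv z) y) = y" "s z = r (mu (iv z) y)" using zy by simp_all
      then have "y \<in> ?K2" using True by (metis (mono_tags, lifting) IntI SigmaI case_prodI image_eqI mem_Collect_eq)
      then show ?thesis using zy True by simp
    next
      case False
      then show ?thesis using K K' by (auto simp: P_def)
    qed
  qed
  also have "\<dots> = fint u (\<lambda>z. f z * conv g h (mu (iv z) x))"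
  proof (rule fint_cong)
    fix z assume z: "r z = u"
    have "fint u (\<lambda>y. P z y) = f z * fint (r z) (\<lambda>y. g (mu (iv z) y) * h (mu (iv y) x))"
      using z by (simp add: P_def mult.assoc fint_cmult)
    also have "fint (r z) (\<lambda>y. g (mu (iv z) y) * h (mu (iv y) x))
       = fint (s z) (\<lambda>y. g (mu (iv z) (mu z y)) * h (mu (iv (mu z y)) x))"
    proof (rule left_inv[symmetric])
      have 1: "compact ((\<lambda>(x, y). mu x y) ` ({z} \<times> K' \<inter> {(x, y). s x = r y}))"
        by (rule compact_product) (use K' in auto)
      show "fibC (r z) (\<lambda>y. g (mu (iv z) y) * h (mu (iv y) x))"
      proof (rule fibCI[OF _ 1])
        show "continuous_on (fib (r z)) (\<lambda>y. g (mu (iv z) y) * h (mu (iv y) x))"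
          using z by (intro continuous_intros continuous_on_Cc[OF g] continuous_on_Cc[OF h]) (auto simp: u_def)
        fix y assume y: "r y = r z" "y \<notin> (\<lambda>(x, y). mu x y) ` ({z} \<times> K' \<inter> {(x, y). s x = r y})"
        have "(\<lambda>(x, y). mu x y) (z, mu (iv z) y) = y" "s z = r (mu (iv z) y)" using y by simp_all
        then have "mu (iv z) y \<notin> K'" using y(2)
          by (metis (mono_tags, lifting) IntI SigmaI case_prodI image_eqI mem_Collect_eq singletonI)
        then show "g (mu (iv z) y) * h (mu (iv y) x) = 0" using K' by simp
      qed
    qed
    also have "\<dots> = fint (s z) (\<lambda>y. g y * h (mu (iv y) (mu (iv z) x)))"
      by (rule fint_cong) (use z in \<open>simp add: iv_mult mu_assoc u_def\<close>)
    also have "\<dots> = conv g h (mu (iv z) x)" using z by (simp add: conv_fint u_def)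
    finally show "fint u (\<lambda>y. P z y) = f z * conv g h (mu (iv z) x)" .
  qed
  also have "\<dots> = conv f (conv g h) x" by (simp add: conv_fint u_def)
  finally show "conv (conv f g) h x = conv f (conv g h) x" .
qed

subsection \<open>The I-norm\<close>

abbreviation Inorm where "Inorm \<equiv> I_norm G lam"

lemma nint_star: "nint u (star f) = (LINT x|lam u. cmod (f (iv x)))"
  by (simp add: nint_def involution_def)

lemma nint_nonneg: "0 \<le> nint u f"
  by (simp add: nint_def)

text \<open>The fibre integral is continuous in the unit and vanishes off the compact image of the
  support under r. Boundedness is what gives the real suprema in the I-norm their meaning.\<close>

lemma nint_bdd: assumes f: "f \<in> Cc" shows "bdd_above ((\<lambda>u. nint u f) ` U)"
proof -
  obtain K where K: "continuous_on UNIV f" "compact K" "\<And>x. x \<notin> K \<Longrightarrow> f x = 0" by (rule CcE[OF f]) blast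
  have 1: "continuous_on U (\<lambda>u. LINT x|lam u. complex_of_real (cmod (f x)))" by (rule haar_cont[OF Cc_norm[OF f]])
  have "compact (r ` K)" using K by (intro compact_continuous_image continuous_intros)
  moreover have "r ` K \<subseteq> U" by auto
  ultimately have "bounded ((\<lambda>u. LINT x|lam u. complex_of_real (cmod (f x))) ` r ` K)"
    by (intro compact_imp_bounded compact_continuous_image[OF continuous_on_subset[OF 1]])
  then obtain B where B0: "\<forall>x\<in>(\<lambda>u. LINT x|lam u. complex_of_real (cmod (f x))) ` r ` K. cmod x \<le> B" and Bpos: "B > 0"
    unfolding bounded_pos by blast
  have "nint u f \<le> B" if u: "u \<in> U" for u
  proof (cases "u \<in> r ` K")
    case True
    then show ?thesis using bspec[OF B0 imageI[OF True]] by (simp add: nint_def)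
  next
    case False
    then have "fint u (\<lambda>x. of_real (cmod (f x))) = 0" using K(3) by (intro fint_zero) force
    then show ?thesis using nint_fint[OF u f] Bpos by simp
  qed
  then show ?thesis by (auto simp: bdd_above_def)
qed

lemma nint_le_Inorm: "f \<in> Cc \<Longrightarrow> u \<in> U \<Longrightarrow> nint u f \<le> Inorm f"
proof -
  assume f: "f \<in> Cc" and u: "u \<in> U"
  have "nint u f \<le> (SUP u\<in>U. LINT x|lam u. cmod (f x))"
    using nint_bdd[OF f] u unfolding nint_def[symmetric] by (intro cSUP_upper) auto
  then show ?thesis by (simp add: I_norm_def)
qed

lemma nint_star_le_Inorm: "f \<in> Cc \<Longrightarrow> u \<in> U \<Longrightarrow> nint u (star f) \<le> Inorm f"
proof -
  assume f: "f \<in> Cc" and u: "u \<in> U"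
  have "nint u (star f) \<le> (SUP u\<in>U. LINT x|lam u. cmod (f (iv x)))"
    using nint_bdd[OF star_Cc[OF f]] u unfolding nint_star[symmetric] by (intro cSUP_upper) auto
  then show ?thesis by (simp add: I_norm_def)
qed

lemma Inorm_leI:
  assumes "\<And>u. u \<in> U \<Longrightarrow> nint u f \<le> c" "\<And>u. u \<in> U \<Longrightarrow> nint u (star f) \<le> c"
  shows "Inorm f \<le> c"
  unfolding I_norm_def nint_star[symmetric] nint_def[symmetric] using assms U_nonempty
  by (intro max.boundedI cSUP_least)

lemma Inorm_nonneg: "f \<in> Cc \<Longrightarrow> 0 \<le> Inorm f"
  using nint_le_Inorm[of f "r undefined"] nint_nonneg[of "r undefined" f] by simp

lemma Inorm_star: "f \<in> Cc \<Longrightarrow> Inorm (star f) = Inorm f"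
  by (intro antisym Inorm_leI) (simp_all add: nint_le_Inorm nint_star_le_Inorm nint_star_le_Inorm[of "star f", simplified] nint_le_Inorm[of "star f"])

lemma nint_mono:
  assumes "u \<in> U" "f \<in> Cc" "g \<in> Cc" "\<And>x. cmod (f x) \<le> cmod (g x)"
  shows "nint u f \<le> nint u g"
  unfolding nint_def using assms by (intro integral_mono integrable_norm Cc_integrable) auto

lemma Inorm_mono:
  assumes f: "f \<in> Cc" and g: "g \<in> Cc" and le: "\<And>x. cmod (f x) \<le> cmod (g x)"
  shows "Inorm f \<le> Inorm g"
proof (rule Inorm_leI)
  fix u assume u: "u \<in> U"
  show "nint u f \<le> Inorm g" using nint_mono[OF u f g le] nint_le_Inorm[OF g u] by simp
  have "nint u (star f) \<le> nint u (star g)"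
    using u f g le by (intro nint_mono star_Cc) (auto simp: involution_def)
  then show "nint u (star f) \<le> Inorm g" using nint_star_le_Inorm[OF g u] by simp
qed

lemma Inorm_cmult_le: "f \<in> Cc \<Longrightarrow> Inorm (\<lambda>x. a * f x) \<le> cmod a * Inorm f"
proof (rule Inorm_leI)
  fix u assume f: "f \<in> Cc" and u: "u \<in> U"
  show "nint u (\<lambda>x. a * f x) \<le> cmod a * Inorm f"
    using nint_le_Inorm[OF f u] by (simp add: nint_def norm_mult mult_left_mono)
  show "nint u (star (\<lambda>x. a * f x)) \<le> cmod a * Inorm f"
    using nint_star_le_Inorm[OF f u] by (simp add: nint_star norm_mult mult_left_mono)
qed

lemma nint_add_le: "u \<in> U \<Longrightarrow> f \<in> Cc \<Longrightarrow> g \<in> Cc \<Longrightarrow> nint u (\<lambda>x. f x + g x) \<le> nint u f + nint u g"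
proof -
  assume u: "u \<in> U" and f: "f \<in> Cc" and g: "g \<in> Cc"
  have "nint u (\<lambda>x. f x + g x) \<le> (LINT x|lam u. cmod (f x) + cmod (g x))"
    unfolding nint_def using u f g
    by (intro integral_mono integrable_norm Bochner_Integration.integrable_add Cc_integrable Cc_add norm_triangle_ineq)
  also have "\<dots> = nint u f + nint u g"
    unfolding nint_def using u f g by (intro Bochner_Integration.integral_add integrable_norm Cc_integrable)
  finally show ?thesis .
qed

lemma Inorm_add_le:
  assumes f: "f \<in> Cc" and g: "g \<in> Cc"
  shows "Inorm (\<lambda>x. f x + g x) \<le> Inorm f + Inorm g"
proof (rule Inorm_leI)
  fix u assume u: "u \<in> U"
  show "nint u (\<lambda>x. f x + g x) \<le> Inorm f + Inorm g"
    using nint_add_le[OF u f g] nint_le_Inorm[OF f u] nint_le_Inorm[OF g u] by simp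
  have "star (\<lambda>x. f x + g x) = (\<lambda>x. star f x + star g x)" by (simp add: involution_def)
  then show "nint u (star (\<lambda>x. f x + g x)) \<le> Inorm f + Inorm g"
    using nint_add_le[OF u star_Cc[OF f] star_Cc[OF g]] nint_star_le_Inorm[OF f u] nint_star_le_Inorm[OF g u] by simp
qed

lemma cmod_conv_le:
  assumes f: "f \<in> Cc" and g: "g \<in> Cc"
  shows "cmod (conv f g x) \<le> Re (conv (\<lambda>x. of_real (cmod (f x))) (\<lambda>x. of_real (cmod (g x))) x)"
  unfolding conv_fint using norm_fint_le[OF r_in_U fibC_conv[OF f g refl], of x] by (simp add: norm_mult)

text \<open>Fubini and left invariance: after the substitution the inner integral depends on y only
  through s y. Applied to absolute values it yields submultiplicativity of the I-norm.\<close>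

lemma fint_conv:
  assumes u: "u \<in> U" and f: "f \<in> Cc" and g: "g \<in> Cc"
  shows "fint u (conv f g) = fint u (\<lambda>y. f y * fint (s y) g)"
proof -
  obtain K where K: "compact K" "\<And>x. x \<notin> K \<Longrightarrow> f x = 0" by (rule CcE[OF f]) blast
  obtain K' where K': "compact K'" "\<And>x. x \<notin> K' \<Longrightarrow> g x = 0" by (rule CcE[OF g]) blast
  let ?K2 = "(\<lambda>(x, y). mu x y) ` (K \<times> K' \<inter> {(x, y). s x = r y})"
  define P where "P = (\<lambda>z y. f z * g (mu (iv z) y))"
  have "fint u (conv f g) = fint u (\<lambda>y. fint u (\<lambda>z. P z y))"
    by (rule fint_cong) (simp add: P_def conv_fint)
  also have "\<dots> = fint u (\<lambda>z. fint u (\<lambda>y. P z y))"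
  proof (rule fubini_fib[OF u _ K(1) compact_product[OF K(1) K'(1)]])
    have "continuous_on (fib u \<times> fib u) (\<lambda>p. f (fst p) * g (mu (iv (fst p)) (snd p)))"
      by (intro continuous_intros continuous_on_Cc[OF f] continuous_on_Cc[OF g]) auto
    then show "continuous_on (fib u \<times> fib u) (\<lambda>(z, y). P z y)" by (simp add: P_def case_prod_unfold)
    fix z y assume zy: "r z = u" "r y = u" "z \<notin> K \<or> y \<notin> ?K2"
    show "P z y = 0"
    proof (cases "z \<in> K \<and> mu (iv z) y \<in> K'")
      case True
      have "(\<lambda>(x, y). mu x y) (z, mu (iv z) y) = y" "s z = r (mu (iv z) y)" using zy by simp_all
      then have "y \<in> ?K2" using True by (metis (mono_tags, lifting) IntI SigmaI case_prodI image_eqI mem_Collect_eq)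
      then show ?thesis using zy True by simp
    next
      case False
      then show ?thesis using K K' by (auto simp: P_def)
    qed
  qed
  also have "\<dots> = fint u (\<lambda>z. f z * fint (s z) g)"
  proof (rule fint_cong)
    fix z assume z: "r z = u"
    have 1: "compact ((\<lambda>(x, y). mu x y) ` ({z} \<times> K' \<inter> {(x, y). s x = r y}))"
      by (rule compact_product) (use K' in auto)
    have "fint (r z) (\<lambda>y. g (mu (iv z) y)) = fint (s z) (\<lambda>y. g (mu (iv z) (mu z y)))"
    proof (rule left_inv[symmetric], rule fibCI[OF _ 1])
      show "continuous_on (fib (r z)) (\<lambda>y. g (mu (iv z) y))"
        by (intro continuous_intros continuous_on_Cc[OF g]) auto
      fix y assume y: "r y = r z" "y \<notin> (\<lambda>(x, y). mu x y) ` ({z} \<times> K' \<inter> {(x, y). s x = r y})"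
      have "(\<lambda>(x, y). mu x y) (z, mu (iv z) y) = y" "s z = r (mu (iv z) y)" using y by simp_all
      then have "mu (iv z) y \<notin> K'" using y(2)
        by (metis (mono_tags, lifting) IntI SigmaI case_prodI image_eqI mem_Collect_eq singletonI)
      then show "g (mu (iv z) y) = 0" using K' by simp
    qed
    also have "\<dots> = fint (s z) g" by (rule fint_cong) simp
    finally show "fint u (\<lambda>y. P z y) = f z * fint (s z) g" using z by (simp add: P_def fint_cmult)
  qed
  finally show ?thesis .
qed

lemma nint_conv_le:
  assumes u: "u \<in> U" and f: "f \<in> Cc" and g: "g \<in> Cc" and c: "\<And>v. v \<in> U \<Longrightarrow> nint v g \<le> c"
  shows "nint u (conv f g) \<le> nint u f * c"
proof -
  let ?f = "\<lambda>x. complex_of_real (cmod (f x))" and ?g = "\<lambda>x. complex_of_real (cmod (g x))"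
  have fg: "?f \<in> Cc" "?g \<in> Cc" using f g by (simp_all add: Cc_norm)
  have c0: "0 \<le> c" using c[OF u] nint_nonneg[of u g] by simp
  have "nint u (conv f g) \<le> (LINT x|lam u. Re (conv ?f ?g x))"
    unfolding nint_def
  proof (rule integral_mono)
    show "integrable (lam u) (\<lambda>x. cmod (conv f g x))" using u f g by (intro integrable_norm Cc_integrable conv_Cc)
    show "integrable (lam u) (\<lambda>x. Re (conv ?f ?g x))" using u fg by (intro integrable_Re Cc_integrable conv_Cc)
  qed (rule cmod_conv_le[OF f g])
  also have "\<dots> = Re (fint u (conv ?f ?g))"
    unfolding fint_Cc[OF u conv_Cc[OF fg]] by (rule integral_Re[OF Cc_integrable[OF u conv_Cc[OF fg]]])
  also have "fint u (conv ?f ?g) = fint u (\<lambda>y. of_real (cmod (f y) * nint (s y) g))"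
    unfolding fint_conv[OF u fg] by (rule fint_cong) (simp add: nint_fint g)
  also have "Re \<dots> \<le> Re (fint u (\<lambda>y. of_real (cmod (f y) * c)))"
  proof (rule fint_real_mono[OF u])
    \<comment> \<open>\<open>fint_real_mono\<close> compares fibrewise continuous functions, so the
      inner integral has to be shown continuous in y.\<close>
    have "continuous_on UNIV (\<lambda>y. fint (r (s y)) ?g)"
    proof -
      have 1: "continuous_on U (\<lambda>u. fint u ?g)"
        using haar_cont[OF fg(2)] by (rule continuous_on_cong[THEN iffD1, rotated 2]) (simp_all add: fint_Cc fg)
      have "continuous_on UNIV (\<lambda>y. fint (s y) ?g)"
        by (rule continuous_on_compose2[OF 1]) (auto intro!: continuous_intros)
      then show ?thesis by simp
    qed
    then have "(\<lambda>y. fint (s y) ?g * ?f y) \<in> Cc" using fg by (intro Cc_mult) simp_all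
    then have "fibC u (\<lambda>y. fint (s y) ?g * ?f y)" by (rule fibC_Cc)
    then show "fibC u (\<lambda>y. complex_of_real (cmod (f y) * nint (s y) g))"
      by (simp add: nint_fint[OF s_in_U g] mult.commute)
    show "fibC u (\<lambda>y. complex_of_real (cmod (f y) * c))"
      using fibC_Cc[OF Cc_cmult[OF fg(1), of "of_real c"]] by (simp add: mult.commute)
    show "cmod (f y) * nint (s y) g \<le> cmod (f y) * c" for y
      using c[OF s_in_U] by (intro mult_left_mono) auto
  qed
  also have "\<dots> = Re (of_real (nint u f) * of_real c)"
    by (simp add: nint_fint[OF u f] fint_mult_right del: Re_complex_of_real of_real_mult[symmetric])
  also have "\<dots> = nint u f * c" by (simp flip: of_real_mult)
  finally show ?thesis .
qed

text \<open>The I-norm is a maximum of two suprema. The second one is the first one for the adjoint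
  functions, where the factors change places.\<close>

lemma Inorm_conv_le:
  assumes f: "f \<in> Cc" and g: "g \<in> Cc"
  shows "Inorm (conv f g) \<le> Inorm f * Inorm g"
proof (rule Inorm_leI)
  fix u assume u: "u \<in> U"
  have "nint u (conv f g) \<le> nint u f * Inorm g"
    using u f g by (rule nint_conv_le) (rule nint_le_Inorm[OF g])
  also have "\<dots> \<le> Inorm f * Inorm g"
    using nint_le_Inorm[OF f u] Inorm_nonneg[OF g] by (rule mult_right_mono)
  finally show "nint u (conv f g) \<le> Inorm f * Inorm g" .
  have "nint u (star (conv f g)) \<le> nint u (star g) * Inorm f"
    unfolding star_conv[OF f g] using u star_Cc[OF g] star_Cc[OF f]
    by (rule nint_conv_le) (rule nint_star_le_Inorm[OF f])
  also have "\<dots> \<le> Inorm g * Inorm f"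
    using nint_star_le_Inorm[OF g u] Inorm_nonneg[OF f] by (rule mult_right_mono)
  finally show "nint u (star (conv f g)) \<le> Inorm f * Inorm g" by (simp add: mult.commute)
qed

lemma Inorm_mult_le:
  assumes a: "continuous_on UNIV a" and b: "\<And>x. cmod (a x) \<le> b" and f: "f \<in> Cc"
  shows "Inorm (\<lambda>x. a x * f x) \<le> b * Inorm f"
proof -
  have b0: "0 \<le> b" using b[of undefined] norm_ge_zero order_trans by blast
  have "Inorm (\<lambda>x. a x * f x) \<le> Inorm (\<lambda>x. of_real b * f x)"
    using f a b b0 by (intro Inorm_mono Cc_mult) (auto simp: norm_mult intro!: mult_right_mono)
  also have "\<dots> \<le> b * Inorm f" using Inorm_cmult_le[OF f, of "of_real b"] b0 by simp
  finally show ?thesis .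
qed

subsection \<open>Separability\<close>

text \<open>For every finite list of basic open sets with values from a countable dense set, and
  every k, one function is chosen that is within 1 / (k + 1) of these values on these sets and
  vanishes off their union. A given function and the choice made for its data are uniformly close
  and both live on a relatively compact set, so they are close in the I-norm.\<close>

lemma Cc_separable:
  obtains D :: "('g \<Rightarrow> complex) set" where "countable D" "D \<subseteq> Cc"
    "\<And>f e. f \<in> Cc \<Longrightarrow> e > 0 \<Longrightarrow> \<exists>g\<in>D. Inorm (\<lambda>x. f x - g x) < e"
proof -
  obtain B :: "'g set set" where B: "countable B" "topological_basis B" using ex_countable_basis by blast
  obtain Q :: "complex set" where Q: "countable Q" "\<And>X. open X \<Longrightarrow> X \<noteq> {} \<Longrightarrow> \<exists>q\<in>Q. q \<in> X"
    using countable_dense_setE by metis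
  define good :: "('g set \<times> complex) list \<Rightarrow> nat \<Rightarrow> ('g \<Rightarrow> complex) \<Rightarrow> bool" where
    "good = (\<lambda>l k f. f \<in> Cc \<and> (\<forall>(b, q)\<in>set l. \<forall>x\<in>b. cmod (f x - q) < 1 / real (Suc k)) \<and>
       (\<forall>x. x \<notin> (\<Union>(b, q)\<in>set l. b) \<longrightarrow> f x = 0))"
  define pick where "pick = (\<lambda>(l, k). if \<exists>f. good l k f then (SOME f. good l k f) else (\<lambda>x. 0))"
  define D where "D = pick ` (lists (B \<times> Q) \<times> UNIV)"
  have "countable D" using B Q by (auto simp: D_def)
  moreover have "D \<subseteq> Cc"
  proof
    fix f assume "f \<in> D"
    then obtain l k where f: "f = pick (l, k)" by (auto simp: D_def)
    show "f \<in> Cc"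
    proof (cases "\<exists>f. good l k f")
      case True
      then have "good l k f" using someI_ex[of "good l k"] by (simp add: f pick_def)
      then show ?thesis by (simp add: good_def)
    qed (use Cc_zero in \<open>auto simp: f pick_def\<close>)
  qed
  moreover have "\<exists>g\<in>D. Inorm (\<lambda>x. f x - g x) < e" if f: "f \<in> Cc" and e: "e > 0" for f and e :: real
  proof -
    obtain K where K: "continuous_on UNIV f" "compact K" "\<And>x. x \<notin> K \<Longrightarrow> f x = 0" by (rule CcE[OF f]) blast
    obtain W where W: "open W" "K \<subseteq> W" "compact (closure W)"
      by (rule lc_compact_neighbourhood[OF lc K(2) open_UNIV subset_UNIV])
    obtain c where c: "\<And>x. 0 \<le> c x" "\<And>x. x \<in> closure W \<Longrightarrow> c x = (1::real)" "(\<lambda>x. complex_of_real (c x)) \<in> Cc"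
      using Cc_cutoff[OF lc W(3)] by metis
    define I where "I = Inorm (\<lambda>x. complex_of_real (c x))"
    have I: "0 \<le> I" unfolding I_def by (rule Inorm_nonneg[OF c(3)])
    \<comment> \<open>Two functions with the same data differ by less than 2 / (k + 1), and only
      where \<open>c\<close> is 1. The summand 1 prevents a division by 0.\<close>
    have "e / (2 * (I + 1)) > 0" using e I by simp
    then obtain k where k: "1 / real (Suc k) < e / (2 * (I + 1))" using nat_approx_posE by blast
    define d where "d = 1 / real (Suc k)"
    have d: "d > 0" by (simp add: d_def)
    have ex: "\<exists>b q. x \<in> b \<and> b \<in> B \<and> q \<in> Q \<and> b \<subseteq> W \<and> (\<forall>y\<in>b. cmod (f y - q) < d)" if x: "x \<in> K" for x
    proof -
      obtain q where q: "q \<in> Q" "q \<in> ball (f x) (d / 2)" using Q(2)[of "ball (f x) (d / 2)"] d by auto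
      have op: "open (W \<inter> f -` ball (f x) (d / 2))"
        using W K(1) by (intro open_Int) (auto simp: continuous_on_open_vimage[OF open_UNIV])
      have "x \<in> W \<inter> f -` ball (f x) (d / 2)" using x W d by auto
      then obtain b where b: "b \<in> B" "x \<in> b" "b \<subseteq> W \<inter> f -` ball (f x) (d / 2)"
        by (rule topological_basisE[OF B(2) op])
      have "cmod (f y - q) < d" if "y \<in> b" for y
      proof -
        have 1: "dist (f x) (f y) < d / 2" using b(3) that by auto
        have 2: "dist (f x) q < d / 2" using q by auto
        have "dist (f y) q \<le> dist (f x) (f y) + dist (f x) q" by (metis dist_triangle3 dist_commute dist_triangle)
        then show ?thesis using 1 2 by (simp add: dist_norm)
      qed
      then show ?thesis using b q by blast
    qed
    then obtain b q where bq: "\<And>x. x \<in> K \<Longrightarrow> x \<in> b x \<and> b x \<in> B \<and> q x \<in> Q \<and> b x \<subseteq> W \<and> (\<forall>y\<in>b x. cmod (f y - q x) < d)"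
      by metis
    have ob: "open (b x)" if "x \<in> K" for x using bq[OF that] topological_basis_open[OF B(2)] by blast
    obtain F where F: "F \<subseteq> K" "finite F" "K \<subseteq> (\<Union>x\<in>F. b x)"
      by (rule compactE_image[OF K(2), of K b]) (use bq ob in auto)
    obtain xs where xs: "set xs = F" using finite_list[OF F(2)] by blast
    define l where "l = map (\<lambda>x. (b x, q x)) xs"
    have l: "set l = (\<lambda>x. (b x, q x)) ` F" by (simp add: l_def xs)
    have "good l k f"
      unfolding good_def using f F bq K(3) by (fastforce simp: l d_def)
    then have gp: "good l k (pick (l, k))" using someI[of "good l k" f] by (auto simp: pick_def)
    define g where "g = pick (l, k)"
    have g: "g \<in> Cc" "\<And>x y. x \<in> F \<Longrightarrow> y \<in> b x \<Longrightarrow> cmod (g y - q x) < d" "\<And>y. y \<notin> (\<Union>x\<in>F. b x) \<Longrightarrow> g y = 0"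
      using gp unfolding good_def by (auto simp: l g_def d_def)
    have "g \<in> D" using F bq by (auto simp: D_def g_def lists_eq_set l subset_iff intro!: imageI)
    moreover have "Inorm (\<lambda>x. f x - g x) < e"
    proof -
      have "Inorm (\<lambda>x. f x - g x) \<le> Inorm (\<lambda>x. of_real (2 * d) * complex_of_real (c x))"
      proof (rule Inorm_mono)
        show "(\<lambda>x. f x - g x) \<in> Cc" by (rule Cc_diff[OF f g(1)])
        show "(\<lambda>x. of_real (2 * d) * complex_of_real (c x)) \<in> Cc" by (rule Cc_cmult[OF c(3)])
        fix y
        show "cmod (f y - g y) \<le> cmod (of_real (2 * d) * complex_of_real (c y))"
        proof (cases "y \<in> (\<Union>x\<in>F. b x)")
          case True
          then obtain x where x: "x \<in> F" "y \<in> b x" by blast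
          have "y \<in> W" using x bq F by blast
          then have "c y = 1" using c(2) closure_subset by blast
          moreover have "cmod (f y - q x) < d" using x bq F by blast
          moreover have "cmod (g y - q x) < d" using g(2) x by blast
          moreover have "cmod (f y - g y) \<le> cmod (f y - q x) + cmod (g y - q x)"
            using norm_triangle_ineq4[of "f y - q x" "g y - q x"] by simp
          ultimately show ?thesis using d by (simp add: norm_mult)
        next
          case False
          then have "f y = 0" "g y = 0" using F K(3) g(3) by blast+
          then show ?thesis by simp
        qed
      qed
      also have "\<dots> \<le> 2 * d * I" using Inorm_cmult_le[OF c(3), of "of_real (2 * d)"] d by (simp add: I_def norm_mult)
      also have "\<dots> \<le> 2 * d * (I + 1)" using d by simp
      also have "\<dots> < 2 * (e / (2 * (I + 1))) * (I + 1)"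
        using k I unfolding d_def by (intro mult_strict_right_mono mult_strict_left_mono) auto
      also have "\<dots> = e" using I by (simp add: field_simps)
      finally show ?thesis .
    qed
    ultimately show ?thesis by blast
  qed
  ultimately show ?thesis using that by blast
qed

end

section \<open>Hilbert bundles and their coefficients\<close>

text \<open>Polarisation: the norm of a sum yields the real part, and the factor -\<i> turns
  imaginary parts into real ones. A bundle postulates of \<open>L x\<close> only that it is linear,
  onto and preserves norms.\<close>

lemma isometry_ip:
  assumes H: "semi_ip H" and K: "semi_ip K" and lin: "hlinear H K A"
    and iso: "\<And>x. x \<in> hcarrier H \<Longrightarrow> hnorm K (A x) = hnorm H x"
    and x: "x \<in> hcarrier H" and y: "y \<in> hcarrier H"
  shows "hip K (A x) (A y) = hip H x y"
proof -
  interpret H: semi_ip H by fact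
  interpret K: semi_ip K by fact
  have A: "A x \<in> hcarrier K" "A (hadd H x y) = hadd K (A x) (A y)" "A (hscale H c x) = hscale K c (A x)"
    if "x \<in> hcarrier H" "y \<in> hcarrier H" for x y c
    using lin that by (auto simp: hlinear_def)
  have re: "Re (hip K (A x) (A y)) = Re (hip H x y)" if "x \<in> hcarrier H" "y \<in> hcarrier H" for x y
  proof -
    have "(hnorm K (hadd K (A x) (A y)))\<^sup>2 = (hnorm H (hadd H x y))\<^sup>2"
      using that iso[of "hadd H x y"] by (simp add: A)
    then show ?thesis
      using that iso by (simp add: A H.norm_add_sq K.norm_add_sq)
  qed
  have "Re (hip K (A x) (A (hscale H (- \<i>) y))) = Re (hip H x (hscale H (- \<i>) y))"
    using x y by (intro re) simp_all
  then have "Im (hip K (A x) (A y)) = Im (hip H x y)"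
    using x y by (simp add: A H.ip_scale_right K.ip_scale_right)
  then show ?thesis using re[OF x y] by (simp add: complex_eq_iff)
qed

locale G_bundle = haar_groupoid G lam
  for G :: "'g::{second_countable_topology, t2_space} gpd" and lam +
  fixes H :: "'g \<Rightarrow> 'h hilb" and Gam :: "('g \<Rightarrow> 'h) set" and L :: "'g \<Rightarrow> 'h \<Rightarrow> 'h"
  assumes is_bundle: "G_hilbert_bundle G H Gam L"
begin

lemma field: "continuous_hilbert_field U H Gam"
  using is_bundle by (simp add: G_hilbert_bundle_def)

lemma hilbert_fibre: "u \<in> U \<Longrightarrow> hilbert_space (H u)"
  using field by (simp add: continuous_hilbert_field_def hilbert_space_iff)

lemma semi_fibre: "u \<in> U \<Longrightarrow> semi_ip (H u)"
  using hilbert_fibre by (simp add: hilbert_space_def ip_space_def)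

lemma Gam_closed: "xi \<in> Gam \<Longrightarrow> u \<in> U \<Longrightarrow> xi u \<in> hcarrier (H u)"
  using field unfolding continuous_hilbert_field_def by (elim conjE) blast

lemma Gam_zero: "(\<lambda>u\<in>U. hzero (H u)) \<in> Gam"
  and Gam_add: "xi \<in> Gam \<Longrightarrow> eta \<in> Gam \<Longrightarrow> (\<lambda>u\<in>U. hadd (H u) (xi u) (eta u)) \<in> Gam"
  and Gam_scale: "xi \<in> Gam \<Longrightarrow> (\<lambda>u\<in>U. hscale (H u) a (xi u)) \<in> Gam"
  and Gam_dense: "u \<in> U \<Longrightarrow> h \<in> hcarrier (H u) \<Longrightarrow> e > 0 \<Longrightarrow> \<exists>xi\<in>Gam. hnorm (H u) (hdiff (H u) h (xi u)) < e"
  and Gam_norm_cont: "xi \<in> Gam \<Longrightarrow> continuous_on U (\<lambda>u. hnorm (H u) (xi u))"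
  by (insert field, unfold continuous_hilbert_field_def, (elim conjE, simp)+)

lemma Gam_local:
  assumes "xi \<in> (\<Pi>\<^sub>E u\<in>U. hcarrier (H u))"
    "\<And>u e. u \<in> U \<Longrightarrow> e > 0 \<Longrightarrow> \<exists>zeta\<in>Gam. \<exists>V. open V \<and> u \<in> V \<and>
           (\<forall>v\<in>V \<inter> U. hnorm (H v) (hdiff (H v) (xi v) (zeta v)) \<le> e)"
  shows "xi \<in> Gam"
proof -
  note 1 = field[unfolded continuous_hilbert_field_def, THEN conjunct2, THEN conjunct2, THEN conjunct2,
      THEN conjunct2, THEN conjunct2, THEN conjunct2, THEN conjunct2]
  show ?thesis by (rule bspec[OF 1 assms(1), THEN mp]) (intro ballI allI impI assms(2))
qed

text \<open>Near u the factor is almost the constant \<open>a u\<close>, so the product is locally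
  close to a scalar multiple of \<open>xi\<close>. A field is closed under such local uniform
  approximation.\<close>

lemma Gam_mult:
  assumes xi: "xi \<in> Gam" and a: "continuous_on U a"
  shows "(\<lambda>u\<in>U. hscale (H u) (a u) (xi u)) \<in> Gam"
proof (rule Gam_local)
  show "(\<lambda>u\<in>U. hscale (H u) (a u) (xi u)) \<in> (\<Pi>\<^sub>E u\<in>U. hcarrier (H u))"
    using Gam_closed[OF xi] semi_ip.scale_closed[OF semi_fibre] by auto
  fix u and e :: real assume u: "u \<in> U" and e: "e > 0"
  have cont: "continuous_on U (\<lambda>v. cmod (a v - a u) * hnorm (H v) (xi v))"
    using a Gam_norm_cont[OF xi] by (intro continuous_intros)
  obtain V where V: "open V" "u \<in> V" "\<And>v. v \<in> U \<Longrightarrow> v \<in> V \<Longrightarrow> cmod (a v - a u) * hnorm (H v) (xi v) \<in> {..<e}"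
    using cont[unfolded continuous_on_topological, rule_format, OF u, of "{..<e}"] e by auto
  have "hnorm (H v) (hdiff (H v) ((\<lambda>u\<in>U. hscale (H u) (a u) (xi u)) v) ((\<lambda>v\<in>U. hscale (H v) (a u) (xi v)) v)) \<le> e"
    if v: "v \<in> V \<inter> U" for v
  proof -
    interpret v: semi_ip "H v" using v by (intro semi_fibre) auto
    have x: "xi v \<in> hcarrier (H v)" using v Gam_closed[OF xi] by auto
    have "hdiff (H v) (hscale (H v) (a v) (xi v)) (hscale (H v) (a u) (xi v)) = hscale (H v) (a v - a u) (xi v)"
      using x v.scale_add_left[OF x, of "a v" "- a u"] by (simp add: hdiff_def v.scale_scale)
    then show ?thesis using v V(3)[of v] x by (simp add: v.norm_scale less_imp_le)
  qed
  then show "\<exists>zeta\<in>Gam. \<exists>V. open V \<and> u \<in> V \<and>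
           (\<forall>v\<in>V \<inter> U. hnorm (H v) (hdiff (H v) ((\<lambda>u\<in>U. hscale (H u) (a u) (xi u)) v) (zeta v)) \<le> e)"
    using V(1,2) Gam_scale[OF xi, of "a u"] by blast
qed

lemma Gam_re_ip_cont:
  assumes xi: "xi \<in> Gam" and eta: "eta \<in> Gam"
  shows "continuous_on U (\<lambda>u. Re (hip (H u) (xi u) (eta u)))"
proof -
  have "continuous_on U (\<lambda>u. ((hnorm (H u) ((\<lambda>u\<in>U. hadd (H u) (xi u) (eta u)) u))\<^sup>2 - (hnorm (H u) (xi u))\<^sup>2 - (hnorm (H u) (eta u))\<^sup>2) / 2)"
    by (intro continuous_intros Gam_norm_cont Gam_add xi eta) simp
  then show ?thesis
  proof (rule continuous_on_cong[THEN iffD1, rotated 2])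
    fix u assume u: "u \<in> U"
    interpret u: semi_ip "H u" using u by (rule semi_fibre)
    show "((hnorm (H u) ((\<lambda>u\<in>U. hadd (H u) (xi u) (eta u)) u))\<^sup>2 - (hnorm (H u) (xi u))\<^sup>2 - (hnorm (H u) (eta u))\<^sup>2) / 2 = Re (hip (H u) (xi u) (eta u))"
      using u Gam_closed xi eta by (simp add: u.norm_add_sq)
  qed simp
qed

lemma Gam_ip_cont:
  assumes xi: "xi \<in> Gam" and eta: "eta \<in> Gam"
  shows "continuous_on U (\<lambda>u. hip (H u) (xi u) (eta u))"
proof -
  have "continuous_on U (\<lambda>u. Re (hip (H u) (xi u) ((\<lambda>u\<in>U. hscale (H u) (- \<i>) (eta u)) u)))"
    by (intro Gam_re_ip_cont Gam_scale xi eta)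
  then have "continuous_on U (\<lambda>u. Im (hip (H u) (xi u) (eta u)))"
  proof (rule continuous_on_cong[THEN iffD1, rotated 2])
    fix u assume u: "u \<in> U"
    interpret u: semi_ip "H u" using u by (rule semi_fibre)
    show "Re (hip (H u) (xi u) ((\<lambda>u\<in>U. hscale (H u) (- \<i>) (eta u)) u)) = Im (hip (H u) (xi u) (eta u))"
      using u Gam_closed xi eta by (simp add: u.ip_scale_right)
  qed simp
  then have "continuous_on U (\<lambda>u. complex_of_real (Re (hip (H u) (xi u) (eta u))) + \<i> * complex_of_real (Im (hip (H u) (xi u) (eta u))))"
    using Gam_re_ip_cont[OF xi eta] by (intro continuous_on_add continuous_on_mult continuous_on_of_real continuous_on_const)
  then show ?thesis by (simp only: complex_eq[symmetric])
qed

abbreviation bsec where "bsec \<equiv> bounded_sections U H Gam"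

lemma bsec_Gam: "xi \<in> bsec \<Longrightarrow> xi \<in> Gam"
  by (simp add: bounded_sections_def)

lemma bsec_closed: "xi \<in> bsec \<Longrightarrow> u \<in> U \<Longrightarrow> xi u \<in> hcarrier (H u)"
  by (simp add: bsec_Gam Gam_closed)

lemma bsec_iff: "xi \<in> bsec \<longleftrightarrow> xi \<in> Gam \<and> (\<exists>B. \<forall>u\<in>U. hnorm (H u) (xi u) \<le> B)"
  unfolding bounded_sections_def bdd_above_def by auto

lemma section_norm_ge: "xi \<in> bsec \<Longrightarrow> u \<in> U \<Longrightarrow> hnorm (H u) (xi u) \<le> section_norm U H xi"
  unfolding section_norm_def bounded_sections_def by (intro cSUP_upper) auto

lemma section_norm_nonneg: "xi \<in> bsec \<Longrightarrow> 0 \<le> section_norm U H xi"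
  using section_norm_ge[of xi "r undefined"] semi_ip.norm_nonneg[OF semi_fibre bsec_closed, of "r undefined" xi]
  by (metis order_trans r_in_U)

text \<open>The density axiom provides sections that may be unbounded. The factor B / max B norm
  truncates the norm at \<open>B\<close>, and it is 1 at u because \<open>B\<close> exceeds the norm
  there.\<close>

lemma bsec_approx:
  assumes u: "u \<in> U" and h: "h \<in> hcarrier (H u)" and e: "e > 0"
  obtains xi where "xi \<in> bsec" "hnorm (H u) (hdiff (H u) h (xi u)) < e"
proof -
  obtain z where z: "z \<in> Gam" "hnorm (H u) (hdiff (H u) h (z u)) < e" using Gam_dense[OF u h e] by blast
  have nn: "0 \<le> hnorm (H v) (z v)" if "v \<in> U" for v
    using semi_ip.norm_nonneg[OF semi_fibre Gam_closed] z that by blast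
  define B where "B = hnorm (H u) (z u) + 1"
  have B: "B > 0" using nn[OF u] by (simp add: B_def)
  define a where "a = (\<lambda>v. complex_of_real (B / max B (hnorm (H v) (z v))))"
  have a: "continuous_on U a"
    unfolding a_def using B Gam_norm_cont[OF z(1)] by (intro continuous_intros) (auto simp: max_def)
  define x where "x = (\<lambda>v\<in>U. hscale (H v) (a v) (z v))"
  have xG: "x \<in> Gam" unfolding x_def by (rule Gam_mult[OF z(1) a])
  have "hnorm (H v) (x v) \<le> B" if v: "v \<in> U" for v
  proof -
    interpret v: semi_ip "H v" using v by (rule semi_fibre)
    have "hnorm (H v) (x v) = B * (hnorm (H v) (z v) / max B (hnorm (H v) (z v)))"
      using v B Gam_closed[OF z(1)] by (simp add: x_def v.norm_scale a_def norm_divide)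
    also have "\<dots> \<le> B * 1" using B nn[OF v] by (intro mult_left_mono) (auto simp: divide_le_eq)
    finally show ?thesis by simp
  qed
  then have "x \<in> bsec" using xG by (auto simp: bsec_iff)
  moreover have "x u = z u"
  proof -
    interpret u: semi_ip "H u" using u by (rule semi_fibre)
    have "hnorm (H u) (z u) \<le> B" by (simp add: B_def)
    then have "a u = of_real (B / B)" by (simp only: a_def max_absorb1)
    then have "a u = 1" using B by simp
    then show ?thesis using u Gam_closed[OF z(1) u] by (simp add: x_def u.scale_one)
  qed
  ultimately show ?thesis using that z by simp
qed

subsection \<open>The action\<close>

lemma L_linear: "hlinear (H (s x)) (H (r x)) (L x)"
  and L_norm: "h \<in> hcarrier (H (s x)) \<Longrightarrow> hnorm (H (r x)) (L x h) = hnorm (H (s x)) h"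
  and L_mult: "s x = r y \<Longrightarrow> h \<in> hcarrier (H (s y)) \<Longrightarrow> L (mu x y) h = L x (L y h)"
  using is_bundle unfolding G_hilbert_bundle_def by blast+

lemma coeff_cont: "xi \<in> bsec \<Longrightarrow> eta \<in> bsec \<Longrightarrow> continuous_on UNIV (coefficient G H L xi eta)"
  using is_bundle unfolding G_hilbert_bundle_def by blast

lemma L_closed: "h \<in> hcarrier (H (s x)) \<Longrightarrow> L x h \<in> hcarrier (H (r x))"
  using L_linear[of x] by (auto simp: hlinear_def)

lemma L_ip: "h \<in> hcarrier (H (s x)) \<Longrightarrow> k \<in> hcarrier (H (s x)) \<Longrightarrow> hip (H (r x)) (L x h) (L x k) = hip (H (s x)) h k"
  by (rule isometry_ip[OF semi_fibre semi_fibre L_linear]) (auto simp: L_norm)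

abbreviation coeff where "coeff \<equiv> coefficient G H L"

lemma coeff_bound:
  assumes xi: "xi \<in> bsec" and eta: "eta \<in> bsec"
  shows "cmod (coeff xi eta x) \<le> section_norm U H xi * section_norm U H eta"
proof -
  interpret rx: semi_ip "H (r x)" by (rule semi_fibre) simp
  have "cmod (coeff xi eta x) \<le> hnorm (H (r x)) (L x (xi (s x))) * hnorm (H (r x)) (eta (r x))"
    unfolding coefficient_def by (intro rx.cauchy_schwarz L_closed bsec_closed xi eta) simp_all
  also have "\<dots> = hnorm (H (s x)) (xi (s x)) * hnorm (H (r x)) (eta (r x))"
    by (simp add: L_norm bsec_closed xi)
  also have "\<dots> \<le> section_norm U H xi * section_norm U H eta"
    by (intro mult_mono section_norm_ge xi eta section_norm_nonneg rx.norm_nonneg bsec_closed) simp_all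
  finally show ?thesis .
qed

lemma coeff_Cc [simp]: "xi \<in> bsec \<Longrightarrow> eta \<in> bsec \<Longrightarrow> f \<in> Cc \<Longrightarrow> (\<lambda>x. coeff xi eta x * f x) \<in> Cc"
  by (intro Cc_mult coeff_cont)

text \<open>Applying the unitary of y^{-1} to both vectors splits the coefficient at x into a vector
  that depends on y^{-1} x and one that depends on y^{-1}. These are the arguments of the two
  factors in the convolution of \<open>star f\<close> and \<open>g\<close>, so a frame can be
  inserted between them.\<close>

lemma coeff_translate:
  assumes xi: "xi \<in> bsec" and y: "r y = r x"
  shows "coeff xi xi x = hip (H (s y)) (L (mu (iv y) x) (xi (s x))) (L (iv y) (xi (r x)))"
proof -
  have c: "xi (s x) \<in> hcarrier (H (s x))" "xi (r x) \<in> hcarrier (H (r x))" by (simp_all add: bsec_closed xi)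
  have "L (mu (iv y) x) (xi (s x)) = L (iv y) (L x (xi (s x)))" by (rule L_mult) (use c y in simp_all)
  then have "hip (H (s y)) (L (mu (iv y) x) (xi (s x))) (L (iv y) (xi (r x)))
     = hip (H (r (iv y))) (L (iv y) (L x (xi (s x)))) (L (iv y) (xi (r x)))" by simp
  also have "\<dots> = hip (H (s (iv y))) (L x (xi (s x))) (xi (r x))"
    using c y L_closed by (intro L_ip) simp_all
  also have "\<dots> = coeff xi xi x" using y by (simp add: coefficient_def)
  finally show ?thesis by simp
qed

subsection \<open>Finite frames\<close>

text \<open>The form \<open>Qf e N u\<close> is that of \<open>1 - \<Sum> |e_n\<rangle>\<langle>e_n|\<close> on the fibre at \<open>u\<close>.\<close>

definition Qf :: "(nat \<Rightarrow> 'g \<Rightarrow> 'h) \<Rightarrow> nat \<Rightarrow> 'g \<Rightarrow> 'h \<Rightarrow> 'h \<Rightarrow> complex" where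
  "Qf e N u a b = hip (H u) a b - (\<Sum>n<N. hip (H u) a (e n u) * hip (H u) (e n u) b)"

text \<open>That is, \<Sum> |e_n><e_n| \<le> 1 on every fibre. Orthonormal sections are not aimed
  at: normalising them would mean dividing by norms that can vanish at some units.\<close>

definition frame :: "(nat \<Rightarrow> 'g \<Rightarrow> 'h) \<Rightarrow> nat \<Rightarrow> bool" where
  "frame e N \<longleftrightarrow> (\<forall>n<N. e n \<in> bsec) \<and> (\<forall>u\<in>U. \<forall>a\<in>hcarrier (H u). 0 \<le> Re (Qf e N u a a))"

text \<open>It makes the Cauchy-Schwarz inequality available for the defect form, by which smallness
  on the diagonal becomes smallness off the diagonal.\<close>

lemma semi_Qf:
  assumes fr: "frame e N" and u: "u \<in> U"
  shows "semi_ip ((H u)\<lparr>hip := Qf e N u\<rparr>)"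
proof -
  interpret u: semi_ip "H u" using u by (rule semi_fibre)
  have e: "e n u \<in> hcarrier (H u)" if "n < N" for n using fr that u by (auto simp: frame_def bsec_closed)
  have sy: "cnj (hip (H u) a b) = hip (H u) b a" if "a \<in> hcarrier (H u)" "b \<in> hcarrier (H u)" for a b
    using u.ip_sym[of a b] that by simp
  show ?thesis
  proof
    show "complex_vector_space ((H u)\<lparr>hip := Qf e N u\<rparr>)"
    proof -
      have eqs: "hcarrier ((H u)\<lparr>hip := Qf e N u\<rparr>) = hcarrier (H u)" "hzero ((H u)\<lparr>hip := Qf e N u\<rparr>) = hzero (H u)"
        "hadd ((H u)\<lparr>hip := Qf e N u\<rparr>) = hadd (H u)" "hscale ((H u)\<lparr>hip := Qf e N u\<rparr>) = hscale (H u)" by simp_all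
      show ?thesis using u.vs unfolding complex_vector_space_def eqs .
    qed
  next
    fix x y z
    assume "x \<in> hcarrier ((H u)\<lparr>hip := Qf e N u\<rparr>)" "y \<in> hcarrier ((H u)\<lparr>hip := Qf e N u\<rparr>)" "z \<in> hcarrier ((H u)\<lparr>hip := Qf e N u\<rparr>)"
    then show "hip ((H u)\<lparr>hip := Qf e N u\<rparr>) x (hadd ((H u)\<lparr>hip := Qf e N u\<rparr>) y z)
      = hip ((H u)\<lparr>hip := Qf e N u\<rparr>) x y + hip ((H u)\<lparr>hip := Qf e N u\<rparr>) x z"
      by (simp add: Qf_def u.ip_add_right e distrib_left sum.distrib)
  next
    fix a x y
    assume "x \<in> hcarrier ((H u)\<lparr>hip := Qf e N u\<rparr>)" "y \<in> hcarrier ((H u)\<lparr>hip := Qf e N u\<rparr>)"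
    then show "hip ((H u)\<lparr>hip := Qf e N u\<rparr>) x (hscale ((H u)\<lparr>hip := Qf e N u\<rparr>) a y)
      = a * hip ((H u)\<lparr>hip := Qf e N u\<rparr>) x y"
      by (simp add: Qf_def u.ip_scale_right e right_diff_distrib sum_distrib_left mult.left_commute)
  next
    fix x y
    assume "x \<in> hcarrier ((H u)\<lparr>hip := Qf e N u\<rparr>)" "y \<in> hcarrier ((H u)\<lparr>hip := Qf e N u\<rparr>)"
    then show "hip ((H u)\<lparr>hip := Qf e N u\<rparr>) y x = cnj (hip ((H u)\<lparr>hip := Qf e N u\<rparr>) x y)"
      by (simp add: Qf_def sy e mult.commute)
  next
    fix x assume "x \<in> hcarrier ((H u)\<lparr>hip := Qf e N u\<rparr>)"
    then show "0 \<le> Re (hip ((H u)\<lparr>hip := Qf e N u\<rparr>) x x)"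
      using fr u by (simp add: frame_def)
  qed
qed

lemma frame_norm_le:
  assumes fr: "frame e N" and u: "u \<in> U" and a: "a \<in> hcarrier (H u)"
  shows "Re (Qf e N u a a) \<le> (hnorm (H u) a)\<^sup>2"
proof -
  interpret u: semi_ip "H u" using u by (rule semi_fibre)
  have "Re (hip (H u) a (e n u) * hip (H u) (e n u) a) \<ge> 0" if "n < N" for n
  proof -
    have "e n u \<in> hcarrier (H u)" using fr that u by (auto simp: frame_def bsec_closed)
    then have "hip (H u) (e n u) a = cnj (hip (H u) a (e n u))" by (rule u.ip_sym[OF a])
    then show ?thesis by (simp add: complex_norm_square[symmetric])
  qed
  then have "0 \<le> (\<Sum>n<N. Re (hip (H u) a (e n u) * hip (H u) (e n u) a))" by (intro sum_nonneg) simp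
  then show ?thesis using a by (simp add: Qf_def u.norm_sq Re_sum)
qed

text \<open>A Gram-Schmidt step with a regularised denominator: w = (z - \<Sum> <e_n, z> e_n) / sqrt
  (t + d), where t is the defect at z. The defect at a drops by |Qf a z|^2 / (t + d), which
  Cauchy-Schwarz keeps nonnegative, and at z there remains d t / (t + d) \<le> d. Since d > 0, w is
  continuous even where t vanishes.\<close>

lemma frame_step:
  assumes fr: "frame e N" and z: "z \<in> bsec" and d: "d > 0"
  obtains w where "frame (e(N := w)) (Suc N)"
    "\<And>u. u \<in> U \<Longrightarrow> Re (Qf (e(N := w)) (Suc N) u (z u) (z u)) \<le> d"
    "\<And>u a. u \<in> U \<Longrightarrow> a \<in> hcarrier (H u) \<Longrightarrow> Re (Qf (e(N := w)) (Suc N) u a a) \<le> Re (Qf e N u a a)"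
proof -
  have eb: "e n \<in> bsec" if "n < N" for n using fr that by (simp add: frame_def)
  define t where "t = (\<lambda>u. Re (Qf e N u (z u) (z u)))"
  have t0: "0 \<le> t u" if "u \<in> U" for u using fr that z by (simp add: t_def frame_def bsec_closed)
  have tc: "continuous_on U t"
    unfolding t_def Qf_def using eb z by (intro continuous_intros Gam_ip_cont bsec_Gam) auto
  have sums: "(\<lambda>u\<in>U. hsum (H u) (\<lambda>n. hscale (H u) (hip (H u) (e n u) (z u)) (e n u)) M) \<in> Gam" if "M \<le> N" for M
    using that
  proof (induction M)
    case 0
    then show ?case using Gam_zero by (simp only: hsum.simps)
  next
    case (Suc M)
    have "(\<lambda>u\<in>U. hscale (H u) (hip (H u) (e M u) (z u)) (e M u)) \<in> Gam"
      using Suc eb z by (intro Gam_mult Gam_ip_cont bsec_Gam) auto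
    moreover have "(\<lambda>u\<in>U. hsum (H u) (\<lambda>n. hscale (H u) (hip (H u) (e n u) (z u)) (e n u)) M) \<in> Gam"
      by (rule Suc.IH) (use Suc.prems in simp)
    ultimately have "(\<lambda>u\<in>U. hadd (H u) ((\<lambda>u\<in>U. hsum (H u) (\<lambda>n. hscale (H u) (hip (H u) (e n u) (z u)) (e n u)) M) u)
       ((\<lambda>u\<in>U. hscale (H u) (hip (H u) (e M u) (z u)) (e M u)) u)) \<in> Gam" by (rule Gam_add[rotated])
    moreover have "(\<lambda>u\<in>U. hadd (H u) ((\<lambda>u\<in>U. hsum (H u) (\<lambda>n. hscale (H u) (hip (H u) (e n u) (z u)) (e n u)) M) u)
       ((\<lambda>u\<in>U. hscale (H u) (hip (H u) (e M u) (z u)) (e M u)) u))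
      = (\<lambda>u\<in>U. hsum (H u) (\<lambda>n. hscale (H u) (hip (H u) (e n u) (z u)) (e n u)) (Suc M))"
      by (auto simp: restrict_def)
    ultimately show ?case by (simp only:)
  qed
  define p where "p = (\<lambda>u\<in>U. hsum (H u) (\<lambda>n. hscale (H u) (hip (H u) (e n u) (z u)) (e n u)) N)"
  define q where "q = (\<lambda>u\<in>U. hadd (H u) (z u) ((\<lambda>u\<in>U. hscale (H u) (-1) (p u)) u))"
  have pG: "p \<in> Gam" unfolding p_def by (rule sums) simp
  have qG: "q \<in> Gam" unfolding q_def by (intro Gam_add Gam_scale bsec_Gam z pG)
  define c where "c = (\<lambda>u. 1 / sqrt (t u + d))"
  have cc: "continuous_on U (\<lambda>u. complex_of_real (c u))"
  proof -
    have "sqrt (t u + d) \<noteq> 0" if "u \<in> U" for u using t0[OF that] d by simp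
    then show ?thesis unfolding c_def using tc by (intro continuous_intros) auto
  qed
  define w where "w = (\<lambda>u\<in>U. hscale (H u) (of_real (c u)) (q u))"
  have wG: "w \<in> Gam" unfolding w_def by (rule Gam_mult[OF qG cc])
  have csq: "c u * c u = 1 / (t u + d)" if "u \<in> U" for u
    using t0[OF that] d by (simp add: c_def)
  have ipw: "hip (H u) a (w u) = of_real (c u) * Qf e N u a (z u)" if u: "u \<in> U" and a: "a \<in> hcarrier (H u)" for u a
  proof -
    interpret u: semi_ip "H u" using u by (rule semi_fibre)
    have e: "e n u \<in> hcarrier (H u)" if "n < N" for n using eb that u by (simp add: bsec_closed)
    have zu: "z u \<in> hcarrier (H u)" using u z by (simp add: bsec_closed)
    have pu: "p u \<in> hcarrier (H u)" using u pG by (simp add: Gam_closed)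
    have "hip (H u) a (p u) = (\<Sum>n<N. hip (H u) a (e n u) * hip (H u) (e n u) (z u))"
      using u a e by (simp add: p_def u.ip_hsum_right u.ip_scale_right mult.commute)
    then have "hip (H u) a (q u) = Qf e N u a (z u)"
      using u a zu pu by (simp add: q_def Qf_def u.ip_add_right u.ip_scale_right)
    then show ?thesis using u a Gam_closed[OF qG u] by (simp add: w_def u.ip_scale_right)
  qed
  have Qw: "Qf (e(N := w)) (Suc N) u a a = Qf e N u a a - of_real ((cmod (Qf e N u a (z u)))\<^sup>2 / (t u + d))"
    if u: "u \<in> U" and a: "a \<in> hcarrier (H u)" for u a
  proof -
    interpret u: semi_ip "H u" using u by (rule semi_fibre)
    have "hip (H u) a (w u) * hip (H u) (w u) a = hip (H u) a (w u) * cnj (hip (H u) a (w u))"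
      using u.ip_sym[OF a Gam_closed[OF wG u]] by simp
    also have "\<dots> = of_real ((cmod (hip (H u) a (w u)))\<^sup>2)" by (simp add: complex_norm_square[symmetric])
    also have "(cmod (hip (H u) a (w u)))\<^sup>2 = (c u * c u) * (cmod (Qf e N u a (z u)))\<^sup>2"
      by (simp add: ipw[OF u a] norm_mult power_mult_distrib power2_eq_square)
    also have "\<dots> = (cmod (Qf e N u a (z u)))\<^sup>2 / (t u + d)" by (simp add: csq[OF u])
    finally show ?thesis by (simp add: Qf_def)
  qed
  have le: "(cmod (Qf e N u a (z u)))\<^sup>2 \<le> Re (Qf e N u a a) * t u" if u: "u \<in> U" and a: "a \<in> hcarrier (H u)" for u a
  proof -
    interpret Q: semi_ip "(H u)\<lparr>hip := Qf e N u\<rparr>" using fr u by (rule semi_Qf)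
    have zu: "z u \<in> hcarrier (H u)" using u z by (simp add: bsec_closed)
    have "cmod (Qf e N u a (z u)) \<le> sqrt (Re (Qf e N u a a)) * sqrt (t u)"
      using Q.cauchy_schwarz[of a "z u"] a zu by (simp add: hnorm_def t_def)
    then have "(cmod (Qf e N u a (z u)))\<^sup>2 \<le> (sqrt (Re (Qf e N u a a)) * sqrt (t u))\<^sup>2"
      by (intro power_mono) simp_all
    also have "\<dots> = Re (Qf e N u a a) * t u"
      using t0[OF u] fr u a by (simp add: power_mult_distrib frame_def)
    finally show ?thesis .
  qed
  have pos: "0 \<le> Re (Qf (e(N := w)) (Suc N) u a a)" if u: "u \<in> U" and a: "a \<in> hcarrier (H u)" for u a
  proof -
    have q0: "0 \<le> Re (Qf e N u a a)" using fr u a by (simp add: frame_def)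
    have "(cmod (Qf e N u a (z u)))\<^sup>2 \<le> Re (Qf e N u a a) * (t u + d)"
      using le[OF u a] mult_left_mono[of "t u" "t u + d", OF _ q0] d by simp
    then have "(cmod (Qf e N u a (z u)))\<^sup>2 / (t u + d) \<le> Re (Qf e N u a a)"
      using t0[OF u] d by (simp add: divide_le_eq)
    then show ?thesis by (simp add: Qw[OF u a])
  qed
  have mono: "Re (Qf (e(N := w)) (Suc N) u a a) \<le> Re (Qf e N u a a)" if u: "u \<in> U" and a: "a \<in> hcarrier (H u)" for u a
    using t0[OF u] d by (simp add: Qw[OF u a])
  have small: "Re (Qf (e(N := w)) (Suc N) u (z u) (z u)) \<le> d" if u: "u \<in> U" for u
  proof -
    have zu: "z u \<in> hcarrier (H u)" using u z by (simp add: bsec_closed)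
    interpret Q: semi_ip "(H u)\<lparr>hip := Qf e N u\<rparr>" using fr u by (rule semi_Qf)
    have "Qf e N u (z u) (z u) = of_real (t u)"
      using Q.ip_self[of "z u"] zu t0[OF u] by (simp add: hnorm_def t_def flip: of_real_power)
    then have "Re (Qf (e(N := w)) (Suc N) u (z u) (z u)) = t u - (t u)\<^sup>2 / (t u + d)"
      by (simp add: Qw[OF u zu])
    also have "\<dots> = d * (t u / (t u + d))"
      using t0[OF u] d by (simp add: field_simps power2_eq_square)
    also have "\<dots> \<le> d * 1" using t0[OF u] d by (intro mult_left_mono) (simp_all add: divide_le_eq)
    finally show ?thesis by simp
  qed
  have wb: "w \<in> bsec"
  proof -
    have "hnorm (H u) (w u) \<le> 1" if u: "u \<in> U" for u
    \<comment> \<open>The new defect at w itself is at most \<parallel>w\<parallel>^2 -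
      \<parallel>w\<parallel>^4, which would be negative.\<close>
    proof (rule ccontr)
      interpret u: semi_ip "H u" using u by (rule semi_fibre)
      assume "\<not> hnorm (H u) (w u) \<le> 1"
      then have n1: "1 < (hnorm (H u) (w u))\<^sup>2" by (simp add: one_less_power)
      have wu: "w u \<in> hcarrier (H u)" by (rule Gam_closed[OF wG u])
      have "Qf (e(N := w)) (Suc N) u (w u) (w u) = Qf e N u (w u) (w u) - (hip (H u) (w u) (w u))\<^sup>2"
        by (simp add: Qf_def power2_eq_square)
      then have "0 \<le> Re (Qf e N u (w u) (w u)) - ((hnorm (H u) (w u))\<^sup>2)\<^sup>2"
        using pos[OF u wu] by (simp add: u.ip_self[OF wu] flip: of_real_power)
      then have "((hnorm (H u) (w u))\<^sup>2)\<^sup>2 \<le> (hnorm (H u) (w u))\<^sup>2"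
        using frame_norm_le[OF fr u wu] by simp
      moreover have "(hnorm (H u) (w u))\<^sup>2 * 1 < (hnorm (H u) (w u))\<^sup>2 * (hnorm (H u) (w u))\<^sup>2"
        using n1 by (intro mult_strict_left_mono) linarith+
      ultimately show False by (simp add: power2_eq_square[of "(hnorm (H u) (w u))\<^sup>2"])
    qed
    then show ?thesis using wG by (auto simp: bsec_iff)
  qed
  have "frame (e(N := w)) (Suc N)"
    unfolding frame_def using eb wb pos by (simp add: less_Suc_eq)
  then show ?thesis using that small mono by blast
qed

text \<open>Later steps do not spoil sections treated earlier, as the defect form only
  decreases.\<close>

lemma frame_extend:
  assumes fr: "frame e0 N0" and F: "finite F" "F \<subseteq> bsec" and d: "d > 0"
  shows "\<exists>e N. frame e N \<and> N0 \<le> N \<and> (\<forall>n<N0. e n = e0 n) \<and> (\<forall>z\<in>F. \<forall>u\<in>U. Re (Qf e N u (z u) (z u)) \<le> d)"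
  using F
proof (induction F)
  case empty
  then show ?case using fr by blast
next
  case (insert z F)
  then obtain e N where e: "frame e N" "N0 \<le> N" "\<forall>n<N0. e n = e0 n" "\<forall>z\<in>F. \<forall>u\<in>U. Re (Qf e N u (z u) (z u)) \<le> d" by auto
  obtain w where w: "frame (e(N := w)) (Suc N)"
    "\<And>u. u \<in> U \<Longrightarrow> Re (Qf (e(N := w)) (Suc N) u (z u) (z u)) \<le> d"
    "\<And>u a. u \<in> U \<Longrightarrow> a \<in> hcarrier (H u) \<Longrightarrow> Re (Qf (e(N := w)) (Suc N) u a a) \<le> Re (Qf e N u a a)"
    using frame_step[OF e(1) _ d, of z] insert.prems by auto
  have "Re (Qf (e(N := w)) (Suc N) u (y u) (y u)) \<le> d" if "y \<in> insert z F" "u \<in> U" for y u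
  proof (cases "y = z")
    case False
    then have "Re (Qf e N u (y u) (y u)) \<le> d" using that e(4) by blast
    moreover have "y u \<in> hcarrier (H u)" using that insert.prems by (intro bsec_closed) auto
    ultimately show ?thesis using w(3)[OF that(2)] order_trans by blast
  qed (use w that in auto)
  moreover have "N0 \<le> Suc N" "\<forall>n<N0. (e(N := w)) n = e0 n" using e(2,3) by auto
  ultimately show ?case using w(1) by blast
qed

text \<open>The vectors L x (xi (s x)) lie in varying fibres, but their distance to a fixed section
  is continuous in x because coefficients are. By compactness finitely many sections approximate all
  of them over \<open>K\<close>, and the frame is extended until its defect is small at these
  sections.\<close>

lemma frame_exists:
  assumes fr: "frame e0 N0" and xi: "xi \<in> bsec" and K: "compact K" and d: "d > 0"
  shows "\<exists>e N. frame e N \<and> N0 \<le> N \<and> (\<forall>n<N0. e n = e0 n) \<and>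
    (\<forall>x\<in>K. Re (Qf e N (r x) (L x (xi (s x))) (L x (xi (s x)))) \<le> d)"
proof -
  define D where "D = (\<lambda>z x. (hnorm (H (s x)) (xi (s x)))\<^sup>2 - 2 * Re (coeff xi z x) + (hnorm (H (r x)) (z (r x)))\<^sup>2)"
  have Lc: "L x (xi (s x)) \<in> hcarrier (H (r x))" for x by (simp add: L_closed bsec_closed xi)
  have D: "D z x = (hnorm (H (r x)) (hdiff (H (r x)) (L x (xi (s x))) (z (r x))))\<^sup>2" if "z \<in> bsec" for z x
  proof -
    interpret rx: semi_ip "H (r x)" by (rule semi_fibre) simp
    show ?thesis using that by (simp add: rx.norm_diff_sq Lc bsec_closed D_def coefficient_def L_norm xi)
  qed
  have Dc: "continuous_on UNIV (D z)" if "z \<in> bsec" for z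
  proof -
    have "continuous_on UNIV (\<lambda>x. hnorm (H (s x)) (xi (s x)))"
      by (rule continuous_on_compose2[OF Gam_norm_cont[OF bsec_Gam[OF xi]]]) (auto intro!: continuous_intros)
    moreover have "continuous_on UNIV (\<lambda>x. hnorm (H (r x)) (z (r x)))"
      by (rule continuous_on_compose2[OF Gam_norm_cont[OF bsec_Gam[OF that]]]) (auto intro!: continuous_intros)
    ultimately show ?thesis unfolding D_def using coeff_cont[OF xi that] by (intro continuous_intros)
  qed
  \<comment> \<open>\<open>d\<close> bounds square norms. Two errors sqrt (d / 4), one from the
    approximation and one from the defect at the section, add up to sqrt d.\<close>
  define Op where "Op = (\<lambda>z. {x. D z x < d / 4})"
  have op: "open (Op z)" if "z \<in> bsec" for z
    unfolding Op_def using Dc[OF that] by (intro open_Collect_less) (auto intro!: continuous_intros)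
  have "K \<subseteq> (\<Union>z\<in>bsec. Op z)"
  proof
    fix x assume "x \<in> K"
    have "sqrt (d / 4) > 0" using d by simp
    then obtain z where z: "z \<in> bsec" "hnorm (H (r x)) (hdiff (H (r x)) (L x (xi (s x))) (z (r x))) < sqrt (d / 4)"
      using bsec_approx[OF r_in_U Lc] by blast
    interpret rx: semi_ip "H (r x)" by (rule semi_fibre) simp
    have "(hnorm (H (r x)) (hdiff (H (r x)) (L x (xi (s x))) (z (r x))))\<^sup>2 < (sqrt (d / 4))\<^sup>2"
      using z(2) Lc[of x] bsec_closed[OF z(1) r_in_U] by (intro power_strict_mono) simp_all
    then have "x \<in> Op z" using d by (simp add: Op_def D[OF z(1)])
    then show "x \<in> (\<Union>z\<in>bsec. Op z)" using z(1) by blast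
  qed
  then obtain F where F: "F \<subseteq> bsec" "finite F" "K \<subseteq> (\<Union>z\<in>F. Op z)"
    using op by (rule_tac compactE_image[OF K, of bsec Op]) auto
  have "d / 4 > 0" using d by simp
  then obtain e N where e: "frame e N" "N0 \<le> N" "\<forall>n<N0. e n = e0 n" "\<forall>z\<in>F. \<forall>u\<in>U. Re (Qf e N u (z u) (z u)) \<le> d / 4"
    using frame_extend[OF fr F(2,1)] by blast
  have "Re (Qf e N (r x) (L x (xi (s x))) (L x (xi (s x)))) \<le> d" if "x \<in> K" for x
  proof -
    have "x \<in> (\<Union>z\<in>F. Op z)" using F(3) that by blast
    then obtain z where z: "z \<in> F" "x \<in> Op z" by blast
    then have z: "z \<in> F" "D z x < d / 4" by (simp_all add: Op_def)
    have zb: "z \<in> bsec" using z F by blast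
    let ?a = "L x (xi (s x))" and ?z = "z (r x)"
    interpret rx: semi_ip "H (r x)" by (rule semi_fibre) simp
    interpret Q: semi_ip "(H (r x))\<lparr>hip := Qf e N (r x)\<rparr>" by (rule semi_Qf[OF e(1)]) simp
    have c: "?a \<in> hcarrier (H (r x))" "?z \<in> hcarrier (H (r x))" using Lc zb by (simp_all add: bsec_closed)
    have nQ: "hnorm ((H (r x))\<lparr>hip := Qf e N (r x)\<rparr>) b = sqrt (Re (Qf e N (r x) b b))" for b by (simp add: hnorm_def)
    have dQ: "hdiff ((H (r x))\<lparr>hip := Qf e N (r x)\<rparr>) ?a ?z = hdiff (H (r x)) ?a ?z" by (simp add: hdiff_def)
    have 1: "Re (Qf e N (r x) (hdiff (H (r x)) ?a ?z) (hdiff (H (r x)) ?a ?z)) \<le> d / 4"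
      using frame_norm_le[OF e(1) r_in_U rx.diff_closed[OF c]] z(2) by (simp add: D[OF zb])
    have 2: "Re (Qf e N (r x) ?z ?z) \<le> d / 4" using e(4) z(1) by simp
    have "sqrt (Re (Qf e N (r x) ?a ?a)) \<le> sqrt (Re (Qf e N (r x) (hdiff (H (r x)) ?a ?z) (hdiff (H (r x)) ?a ?z))) + sqrt (Re (Qf e N (r x) ?z ?z))"
      using Q.norm_le_diff[of ?a ?z] c by (simp add: nQ dQ)
    also have "\<dots> \<le> sqrt (d / 4) + sqrt (d / 4)" using 1 2 by (intro add_mono real_sqrt_le_mono)
    also have "\<dots> = sqrt d" using d by (simp add: real_sqrt_divide)
    finally show ?thesis by simp
  qed
  then show ?thesis using e by blast
qed

text \<open>It lets a frame start with a multiple of a given section, which all later extensions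
  retain.\<close>

lemma frame_singleton:
  assumes eta: "eta \<in> bsec" and c: "c > 0" "\<And>u. u \<in> U \<Longrightarrow> hnorm (H u) (eta u) \<le> c"
  shows "frame (\<lambda>n. \<lambda>u\<in>U. hscale (H u) (of_real (1 / c)) (eta u)) 1"
proof -
  let ?e = "\<lambda>u\<in>U. hscale (H u) (of_real (1 / c)) (eta u)"
  have n: "hnorm (H u) (?e u) \<le> 1" if u: "u \<in> U" for u
  proof -
    interpret u: semi_ip "H u" using u by (rule semi_fibre)
    show ?thesis using u c bsec_closed[OF eta u] by (simp add: u.norm_scale norm_divide divide_le_eq)
  qed
  have eG: "?e \<in> Gam" by (intro Gam_scale bsec_Gam eta)
  then have eb: "?e \<in> bsec" using n by (auto simp: bsec_iff)
  have "0 \<le> Re (Qf (\<lambda>n. ?e) 1 u a a)" if u: "u \<in> U" and a: "a \<in> hcarrier (H u)" for u a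
  proof -
    interpret u: semi_ip "H u" using u by (rule semi_fibre)
    have eu: "?e u \<in> hcarrier (H u)" by (rule Gam_closed[OF eG u])
    have "cmod (hip (H u) a (?e u)) \<le> hnorm (H u) a * hnorm (H u) (?e u)" by (rule u.cauchy_schwarz[OF a eu])
    also have "\<dots> \<le> hnorm (H u) a * 1" using n[OF u] a by (intro mult_left_mono) simp_all
    finally have "(cmod (hip (H u) a (?e u)))\<^sup>2 \<le> (hnorm (H u) a)\<^sup>2" by (intro power_mono) simp_all
    moreover have "hip (H u) a (?e u) * hip (H u) (?e u) a = of_real ((cmod (hip (H u) a (?e u)))\<^sup>2)"
      using u.ip_sym[OF a eu] by (simp add: complex_norm_square[symmetric])
    ultimately show ?thesis by (simp add: Qf_def u.ip_self[OF a])
  qed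
  then show ?thesis using eb by (simp add: frame_def)
qed

text \<open>By \<open>coeff_translate\<close> the difference is the convolution integral of
  \<open>star f\<close> and \<open>g\<close> with the extra factor \<open>Qf\<close> at the vectors
  of y^{-1} x and y^{-1}. Where the integrand is nonzero both arguments lie in \<open>K\<close>, so
  Cauchy-Schwarz for \<open>Qf\<close> bounds this factor by d.\<close>

lemma frame_kernel:
  assumes fr: "frame e N" and xi: "xi \<in> bsec" and d: "d \<ge> 0"
    and small: "\<And>x. x \<in> K \<Longrightarrow> Re (Qf e N (r x) (L x (xi (s x))) (L x (xi (s x)))) \<le> d"
    and f: "f \<in> Cc" "\<And>x. x \<notin> K \<Longrightarrow> f x = 0" and g: "g \<in> Cc" "\<And>x. x \<notin> K \<Longrightarrow> g x = 0"
  shows "Inorm (\<lambda>x. coeff xi xi x * conv (star f) g x -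
      (\<Sum>n<N. conv (star (\<lambda>x. coeff xi (e n) x * f x)) (\<lambda>x. coeff xi (e n) x * g x) x)) \<le> d * (Inorm f * Inorm g)"
proof -
  have eb: "e n \<in> bsec" if "n < N" for n using fr that by (simp add: frame_def)
  define E where "E = (\<lambda>x. coeff xi xi x * conv (star f) g x -
      (\<Sum>n<N. conv (star (\<lambda>x. coeff xi (e n) x * f x)) (\<lambda>x. coeff xi (e n) x * g x) x))"
  have Ecc: "E \<in> Cc"
    unfolding E_def using f g xi eb by (intro Cc_diff Cc_sum coeff_Cc conv_Cc star_Cc) auto
  define f' g' where "f' = (\<lambda>x. complex_of_real (cmod (star f x)))" and "g' = (\<lambda>x. complex_of_real (cmod (g x)))"
  have fg': "f' \<in> Cc" "g' \<in> Cc" unfolding f'_def g'_def using f g by (intro Cc_norm star_Cc; simp)+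
  have Lc: "L x (xi (s x)) \<in> hcarrier (H (r x))" for x by (simp add: L_closed bsec_closed xi)
  have bound: "cmod (E x) \<le> cmod (of_real d * conv f' g' x)" for x
  proof -
    let ?Q = "\<lambda>y. Qf e N (s y) (L (mu (iv y) x) (xi (s x))) (L (iv y) (xi (r x)))"
    let ?k = "\<lambda>y. star f y * g (mu (iv y) x)"
    have fibC_term: "fibC (r x) (\<lambda>y. star (\<lambda>x. coeff xi (e n) x * f x) y * (coeff xi (e n) (mu (iv y) x) * g (mu (iv y) x)))" if "n < N" for n
      using fibC_conv[of "star (\<lambda>x. coeff xi (e n) x * f x)" "\<lambda>x. coeff xi (e n) x * g x" x "r x"] xi eb[OF that] f g by simp
    \<comment> \<open>The support condition is carried through the induction, since
      \<open>fint_add\<close> asks for it.\<close>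
    have sums: "(\<Sum>n<M. conv (star (\<lambda>x. coeff xi (e n) x * f x)) (\<lambda>x. coeff xi (e n) x * g x) x)
       = fint (r x) (\<lambda>y. \<Sum>n<M. star (\<lambda>x. coeff xi (e n) x * f x) y * (coeff xi (e n) (mu (iv y) x) * g (mu (iv y) x)))
       \<and> fibC (r x) (\<lambda>y. \<Sum>n<M. star (\<lambda>x. coeff xi (e n) x * f x) y * (coeff xi (e n) (mu (iv y) x) * g (mu (iv y) x)))"
      if "M \<le> N" for M
      using that
    proof (induction M)
      case 0
      then show ?case using fibC_Cc[OF Cc_zero] by (simp add: fint_zero)
    next
      case (Suc M)
      let ?A = "\<lambda>y. \<Sum>n<M. star (\<lambda>x. coeff xi (e n) x * f x) y * (coeff xi (e n) (mu (iv y) x) * g (mu (iv y) x))"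
      let ?B = "\<lambda>y. star (\<lambda>x. coeff xi (e M) x * f x) y * (coeff xi (e M) (mu (iv y) x) * g (mu (iv y) x))"
      have B: "fibC (r x) ?B" using Suc by (intro fibC_term) simp
      have A: "fibC (r x) ?A" using Suc by simp
      show ?case using Suc fint_add[OF r_in_U A B] fibC_add[OF A B] by (simp add: conv_fint)
    qed
    let ?S = "\<lambda>y. \<Sum>n<N. star (\<lambda>x. coeff xi (e n) x * f x) y * (coeff xi (e n) (mu (iv y) x) * g (mu (iv y) x))"
    have kC: "fibC (r x) ?k" by (rule fibC_conv) (use f g in simp_all)
    have S: "fibC (r x) ?S" using sums[of N] by simp
    have dC: "fibC (r x) (\<lambda>y. coeff xi xi x * ?k y - ?S y)"
      using fibC_add[OF fibC_mult[OF continuous_on_const kC, of "coeff xi xi x"] fibC_mult[OF continuous_on_const S, of "-1"]] by simp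
    have "E x = coeff xi xi x * fint (r x) ?k - fint (r x) ?S"
      using sums[of N] by (simp add: E_def conv_fint)
    also have "\<dots> = fint (r x) (\<lambda>y. coeff xi xi x * ?k y - ?S y)"
      using fint_add[OF r_in_U fibC_mult[OF continuous_on_const kC, of "coeff xi xi x"] fibC_mult[OF continuous_on_const S, of "-1"]]
        fint_cmult[of "r x" "-1" ?S] by (simp add: fint_cmult)
    finally have "cmod (E x) \<le> Re (fint (r x) (\<lambda>y. of_real (cmod (coeff xi xi x * ?k y - ?S y))))"
      using norm_fint_le[OF r_in_U dC] by simp
    also have "\<dots> \<le> Re (fint (r x) (\<lambda>y. of_real (d * (cmod (star f y) * cmod (g (mu (iv y) x))))))"
    proof (rule fint_real_mono)
      show "fibC (r x) (\<lambda>y. complex_of_real (cmod (coeff xi xi x * ?k y - ?S y)))" by (rule fibC_norm[OF dC])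
      show "fibC (r x) (\<lambda>y. complex_of_real (d * (cmod (star f y) * cmod (g (mu (iv y) x)))))"
        using fibC_mult[OF continuous_on_const fibC_norm[OF kC], of "of_real d"] by (simp add: norm_mult)
      fix y assume y: "r y = r x"
      show "cmod (coeff xi xi x * ?k y - ?S y) \<le> d * (cmod (star f y) * cmod (g (mu (iv y) x)))"
      proof (cases "iv y \<in> K \<and> mu (iv y) x \<in> K")
        case False
        then have "f (iv y) = 0 \<or> g (mu (iv y) x) = 0" using f(2)[of "iv y"] g(2)[of "mu (iv y) x"] by blast
        then show ?thesis by (elim disjE) (simp_all add: involution_def)
      next
        case True
        interpret sy: semi_ip "H (s y)" by (rule semi_fibre) simp
        interpret Q: semi_ip "(H (s y))\<lparr>hip := Qf e N (s y)\<rparr>" by (rule semi_Qf[OF fr]) simp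
        have c: "L (mu (iv y) x) (xi (s x)) \<in> hcarrier (H (s y))" "L (iv y) (xi (r x)) \<in> hcarrier (H (s y))"
          using Lc[of "mu (iv y) x"] Lc[of "iv y"] y by simp_all
        have en: "e n (s y) \<in> hcarrier (H (s y))" if "n < N" for n using eb[OF that] by (simp add: bsec_closed)
        have "?S y = (\<Sum>n<N. hip (H (s y)) (L (mu (iv y) x) (xi (s x))) (e n (s y)) * hip (H (s y)) (e n (s y)) (L (iv y) (xi (r x)))) * ?k y"
          unfolding sum_distrib_right
        proof (rule sum.cong[OF refl])
          fix n assume "n \<in> {..<N}"
          then have "hip (H (s y)) (e n (s y)) (L (iv y) (xi (r x))) = cnj (coeff xi (e n) (iv y))"
            using sy.ip_sym[OF c(2) en] y by (simp add: coefficient_def)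
          moreover have "hip (H (s y)) (L (mu (iv y) x) (xi (s x))) (e n (s y)) = coeff xi (e n) (mu (iv y) x)"
            using y by (simp add: coefficient_def)
          ultimately show "star (\<lambda>x. coeff xi (e n) x * f x) y * (coeff xi (e n) (mu (iv y) x) * g (mu (iv y) x)) =
             hip (H (s y)) (L (mu (iv y) x) (xi (s x))) (e n (s y)) * hip (H (s y)) (e n (s y)) (L (iv y) (xi (r x))) * ?k y"
            by (simp add: involution_def)
        qed
        then have "coeff xi xi x * ?k y - ?S y = ?Q y * ?k y"
          by (simp add: coeff_translate[OF xi y] Qf_def left_diff_distrib)
        moreover have "cmod (?Q y) \<le> d"
        proof -
          have "cmod (?Q y) \<le> sqrt (Re (Qf e N (s y) (L (mu (iv y) x) (xi (s x))) (L (mu (iv y) x) (xi (s x)))))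
             * sqrt (Re (Qf e N (s y) (L (iv y) (xi (r x))) (L (iv y) (xi (r x)))))"
            using Q.cauchy_schwarz[of "L (mu (iv y) x) (xi (s x))" "L (iv y) (xi (r x))"] c by (simp add: hnorm_def)
          also have "\<dots> \<le> sqrt d * sqrt d"
            using small[of "mu (iv y) x"] small[of "iv y"] True y d Q.ip_nonneg c
            by (intro mult_mono real_sqrt_le_mono) simp_all
          finally show ?thesis using d by simp
        qed
        ultimately show ?thesis by (simp add: norm_mult mult_right_mono)
      qed
    qed simp
    also have "\<dots> = Re (of_real d * conv f' g' x)"
      by (simp only: of_real_mult fint_cmult conv_fint f'_def g'_def)
    also have "\<dots> \<le> cmod (of_real d * conv f' g' x)" by (rule complex_Re_le_cmod)
    finally show ?thesis .
  qed
  have "Inorm E \<le> Inorm (\<lambda>x. of_real d * conv f' g' x)"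
    by (rule Inorm_mono[OF Ecc Cc_cmult bound]) (simp add: fg')
  also have "\<dots> \<le> d * Inorm (conv f' g')" using Inorm_cmult_le[of "conv f' g'" "of_real d"] fg' d by simp
  also have "\<dots> \<le> d * (Inorm f' * Inorm g')" using fg' d by (intro mult_left_mono Inorm_conv_le)
  also have "\<dots> \<le> d * (Inorm f * Inorm g)"
  proof (intro mult_left_mono mult_mono)
    have "Inorm f' \<le> Inorm (star f)" using f by (intro Inorm_mono fg') (simp_all add: f'_def)
    then show "Inorm f' \<le> Inorm f" using f by (simp add: Inorm_star)
    show "Inorm g' \<le> Inorm g" using g by (intro Inorm_mono fg') (simp_all add: g'_def)
  qed (use f g fg' d Inorm_nonneg in auto)
  finally show ?thesis by (simp add: E_def)
qed

end

section \<open>The tensor product of a bundle with a representation\<close>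

locale crep = haar_groupoid G lam
  for G :: "'g::{second_countable_topology, t2_space} gpd" and lam +
  fixes R :: "hpoint hilb" and rho :: "('g \<Rightarrow> complex) \<Rightarrow> hpoint \<Rightarrow> hpoint"
  assumes is_rep: "(R, rho) \<in> bounded_reps G lam"
begin

abbreviation CR where "CR \<equiv> hcarrier R"

lemma hilbert_R: "hilbert_space R"
  using is_rep by (simp add: bounded_reps_def hilbert_space_iff)

sublocale R: hilbert_space R by (rule hilbert_R)

lemma rho_op: "f \<in> Cc \<Longrightarrow> rho f \<in> bounded_operators R"
  and rho_add: "f \<in> Cc \<Longrightarrow> g \<in> Cc \<Longrightarrow> h \<in> CR \<Longrightarrow> rho (\<lambda>x. f x + g x) h = hadd R (rho f h) (rho g h)"
  and rho_cmult: "f \<in> Cc \<Longrightarrow> h \<in> CR \<Longrightarrow> rho (\<lambda>x. a * f x) h = hscale R a (rho f h)"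
  and rho_conv: "f \<in> Cc \<Longrightarrow> g \<in> Cc \<Longrightarrow> h \<in> CR \<Longrightarrow> rho (conv f g) h = rho f (rho g h)"
  and rho_star: "f \<in> Cc \<Longrightarrow> h \<in> CR \<Longrightarrow> k \<in> CR \<Longrightarrow> hip R (rho (star f) h) k = hip R h (rho f k)"
  and rho_bound: "f \<in> Cc \<Longrightarrow> h \<in> CR \<Longrightarrow> hnorm R (rho f h) \<le> Inorm f * hnorm R h"
  by (insert is_rep, unfold bounded_reps_def mem_Collect_eq case_prod_conv, (elim conjE, blast)+)

lemma rho_linear: "f \<in> Cc \<Longrightarrow> hlinear R R (rho f)"
  using rho_op by (auto simp: bounded_operators_def)

lemma rho_closed [simp]: "f \<in> Cc \<Longrightarrow> h \<in> CR \<Longrightarrow> rho f h \<in> CR"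
  using rho_linear[of f] by (auto simp: hlinear_def)

text \<open>Matrix coefficients of \<open>rho\<close>, as functionals bounded for the I-norm; they
  carry the kernel estimates from \<open>Cc\<close> to the Hilbert space.\<close>

definition T :: "hpoint \<Rightarrow> hpoint \<Rightarrow> ('g \<Rightarrow> complex) \<Rightarrow> complex" where
  "T h k f = hip R h (rho f k)"

context
  fixes h k assumes h: "h \<in> CR" and k: "k \<in> CR"
begin

lemma T_add: "f \<in> Cc \<Longrightarrow> g \<in> Cc \<Longrightarrow> T h k (\<lambda>x. f x + g x) = T h k f + T h k g"
  using h k by (simp add: T_def rho_add R.ip_add_right)

lemma T_cmult: "f \<in> Cc \<Longrightarrow> T h k (\<lambda>x. a * f x) = a * T h k f"
  using h k by (simp add: T_def rho_cmult R.ip_scale_right)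

lemma T_diff: "f \<in> Cc \<Longrightarrow> g \<in> Cc \<Longrightarrow> T h k (\<lambda>x. f x - g x) = T h k f - T h k g"
  using T_add[of f "\<lambda>x. - 1 * g x"] T_cmult[of g "-1"] Cc_cmult[of g "-1"] by simp

lemma T_sum: "(\<And>i. i < N \<Longrightarrow> f i \<in> Cc) \<Longrightarrow> T h k (\<lambda>x. \<Sum>i<N. f i x) = (\<Sum>i<(N::nat). T h k (f i))"
proof (induction N)
  case 0
  show ?case using T_cmult[OF Cc_zero, of 0] by simp
next
  case (Suc N)
  have "T h k (\<lambda>x. (\<Sum>i<N. f i x) + f N x) = T h k (\<lambda>x. \<Sum>i<N. f i x) + T h k (f N)"
    by (intro T_add Cc_sum Suc.prems) auto
  then show ?case using Suc by simp
qed

lemma T_bound: "f \<in> Cc \<Longrightarrow> cmod (T h k f) \<le> hnorm R h * Inorm f * hnorm R k"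
proof -
  assume f: "f \<in> Cc"
  have "cmod (T h k f) \<le> hnorm R h * hnorm R (rho f k)"
    unfolding T_def using h k f by (intro R.cauchy_schwarz) simp_all
  also have "\<dots> \<le> hnorm R h * (Inorm f * hnorm R k)"
    using h k f by (intro mult_left_mono rho_bound) simp_all
  finally show ?thesis by (simp add: mult.assoc)
qed

lemma T_star_conv: "f \<in> Cc \<Longrightarrow> g \<in> Cc \<Longrightarrow> T h k (conv (star f) g) = hip R (rho f h) (rho g k)"
  using h k rho_star[of "star f" h "rho g k"] by (simp add: T_def rho_conv)

end

lemma T_star: "f \<in> Cc \<Longrightarrow> h \<in> CR \<Longrightarrow> k \<in> CR \<Longrightarrow> T h k (star f) = cnj (T k h f)"
  unfolding T_def by (subst R.ip_sym[of "rho (star f) k" h]) (simp_all add: rho_star)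

end

text \<open>For t > A > 0 the powers of t / A outgrow every constant; for A = 0 the case k = 0
  suffices. This is the spectral radius argument of \<open>act_norm\<close>: constants that depend
  on the vector disappear under 2^k-th roots.\<close>

lemma le_if_two_powers_le:
  fixes t A D :: real
  assumes t: "0 \<le> t" and A: "0 \<le> A" and le: "\<And>k. t ^ (2 ^ k) \<le> D * A ^ (2 ^ k)"
  shows "t \<le> A"
proof (rule ccontr)
  assume "\<not> t \<le> A"
  then have tA: "A < t" by simp
  show False
  proof (cases "A = 0")
    case True
    then show ?thesis using le[of 0] tA by simp
  next
    case False
    then have A0: "A > 0" using A by simp
    then have gt: "1 < t / A" using tA by simp
    obtain m where m: "D < (t / A) ^ m" using real_arch_pow[OF gt] by blast
    have "(t / A) ^ m \<le> (t / A) ^ (2 ^ m)"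
      using gt by (intro power_increasing) (simp_all add: less_imp_le)
    also have "\<dots> \<le> D" using le[of m] A0 by (simp add: power_divide divide_le_eq)
    finally show False using m by simp
  qed
qed

context G_bundle
begin

text \<open>The homomorphism property makes \<open>L u\<close> idempotent, and a linear isometric
  idempotent is the identity.\<close>

lemma L_unit:
  assumes u: "u \<in> U" and h: "h \<in> hcarrier (H u)"
  shows "L u h = h"
proof -
  interpret u: hilbert_space "H u" using u by (rule hilbert_fibre)
  have ru: "r u = u" using u by (simp add: unit_iff)
  then have su: "s u = u" by (metis sr)
  have mm: "mu u u = u" by (metis r_mu_left ru)
  have c: "L u h \<in> hcarrier (H u)" using L_closed[of h u] h ru su by simp
  have "L u (L u h) = L u h" using L_mult[of u u h] h ru su mm by simp
  moreover have "L u (hdiff (H u) (L u h) h) = hdiff (H u) (L u (L u h)) (L u h)"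
    using L_linear[of u] c h unfolding ru su hlinear_def hdiff_def by simp
  ultimately have "hnorm (H u) (L u (hdiff (H u) (L u h) h)) = 0"
    using c by (simp add: u.diff_self u.norm_zero)
  then have "hnorm (H u) (hdiff (H u) (L u h) h) = 0"
    using L_norm[of "hdiff (H u) (L u h) h" u] c h ru su by simp
  then have "hdiff (H u) (L u h) h = hzero (H u)" using c h by (intro u.norm_eq_zero u.diff_closed)
  then show ?thesis by (rule u.eq_iff_norm_diff[OF c h])
qed

text \<open>The translation formula with y = x moves the action from one vector to the other. The
  Hermitian symmetry of \<open>tform\<close> rests on it.\<close>

lemma coeff_hermitian:
  assumes xi: "xi \<in> bsec"
  shows "cnj (coeff xi xi (iv x)) = coeff xi xi x"
proof -
  interpret sx: semi_ip "H (s x)" by (rule semi_fibre) simp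
  have c: "xi (s x) \<in> hcarrier (H (s x))" "L (iv x) (xi (r x)) \<in> hcarrier (H (s x))"
    using L_closed[of "xi (r x)" "iv x"] by (simp_all add: bsec_closed xi)
  have "coeff xi xi x = hip (H (s x)) (L (s x) (xi (s x))) (L (iv x) (xi (r x)))"
    using coeff_translate[OF xi, of x x] by simp
  also have "\<dots> = hip (H (s x)) (xi (s x)) (L (iv x) (xi (r x)))"
    using L_unit[OF s_in_U c(1)] by simp
  also have "\<dots> = cnj (coeff xi xi (iv x))"
    using sx.ip_sym[OF c(2) c(1)] by (simp add: coefficient_def)
  finally show ?thesis by simp
qed

end

locale bundle_rep = G_bundle G lam H Gam L + crep G lam R rho
  for G :: "'g::{second_countable_topology, t2_space} gpd" and lam and H :: "'g \<Rightarrow> 'h hilb" and Gam L R rho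

locale tensor_rep = bundle_rep G lam H Gam L R rho
  for G :: "'g::{second_countable_topology, t2_space} gpd" and lam and H :: "'g \<Rightarrow> 'h hilb" and Gam L R rho +
  fixes xi :: "'g \<Rightarrow> 'h" and n :: nat and h :: "nat \<Rightarrow> hpoint"
  assumes xi: "xi \<in> bounded_sections (unit_space G) H Gam" and hC: "\<And>i. i < n \<Longrightarrow> h i \<in> hcarrier R"
begin

abbreviation kern where "kern F F' i j \<equiv> (\<lambda>x. coeff xi xi x * conv (star (F i)) (F' j) x)"

text \<open>\<open>tform F F'\<close> is the inner product of \<open>\<Sum> F_i (xi \<otimes> h_i)\<close> and \<open>\<Sum> F'_j (xi \<otimes> h_j)\<close>
  for the integrated form of \<open>L \<otimes> rho\<close>.\<close>

definition tform :: "(nat \<Rightarrow> 'g \<Rightarrow> complex) \<Rightarrow> (nat \<Rightarrow> 'g \<Rightarrow> complex) \<Rightarrow> complex" where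
  "tform F F' = (\<Sum>i<n. \<Sum>j<n. T (h i) (h j) (kern F F' i j))"

text \<open>Up to the conjugation in the bundle this is the adjoint of k -> eta \<otimes> k,
  evaluated at \<Sum> F_j (xi \<otimes> h_j).\<close>

definition slice :: "('g \<Rightarrow> 'h) \<Rightarrow> (nat \<Rightarrow> 'g \<Rightarrow> complex) \<Rightarrow> hpoint" where
  "slice eta F = hsum R (\<lambda>j. rho (\<lambda>x. coeff xi eta x * F j x) (h j)) n"

lemma slice_closed: "eta \<in> bsec \<Longrightarrow> (\<And>i. F i \<in> Cc) \<Longrightarrow> slice eta F \<in> CR"
  unfolding slice_def using xi hC by (intro R.hsum_closed rho_closed coeff_Cc) auto

text \<open>Taking \<open>eta / c\<close> as the first vector of a frame, the left-hand side is \<open>c\<^sup>2\<close> times the first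
  of the terms \<open>\<parallel>slice (e m) F\<parallel>\<^sup>2\<close>, whose sum approximates \<open>tform F F\<close>.\<close>

lemma slice_bound:
  assumes eta: "eta \<in> bsec" and c: "c > 0" "\<And>u. u \<in> U \<Longrightarrow> hnorm (H u) (eta u) \<le> c" and F: "\<And>i. F i \<in> Cc"
  shows "(hnorm R (slice eta F))\<^sup>2 \<le> c\<^sup>2 * Re (tform F F)"
proof -
  have "\<exists>K. compact K \<and> (\<forall>x. x \<notin> K \<longrightarrow> F i x = 0)" for i
  proof -
    obtain K where "compact K" "\<And>x. x \<notin> K \<Longrightarrow> F i x = 0" by (rule CcE[OF F[of i]]) blast
    then show ?thesis by blast
  qed
  then obtain Ki where Ki: "\<And>i. compact (Ki i)" "\<And>i x. x \<notin> Ki i \<Longrightarrow> F i x = 0" by metis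
  define K where "K = (\<Union>i<n. Ki i)"
  have K: "compact K" unfolding K_def using Ki by (intro compact_UN) auto
  have F0: "F i x = 0" if "i < n" "x \<notin> K" for i x using that Ki(2) by (auto simp: K_def)
  let ?e0 = "\<lambda>u\<in>U. hscale (H u) (of_real (1 / c)) (eta u)"
  have fr0: "frame (\<lambda>n. ?e0) 1" by (rule frame_singleton[OF eta c])
  \<comment> \<open>The frame error is at most \<open>d * B\<close>. As \<open>B\<close> does not
    involve the frame, d can tend to 0 although the frame changes with it.\<close>
  define B where "B = (\<Sum>i<n. \<Sum>j<n. hnorm R (h i) * (Inorm (F i) * Inorm (F j)) * hnorm R (h j))"
  have main: "(hnorm R (slice eta F))\<^sup>2 \<le> c\<^sup>2 * (Re (tform F F) + d * B)" if d: "d > 0" for d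
  proof -
    obtain e N where e: "frame e N" "1 \<le> N" "\<forall>n<1. e n = ?e0"
      "\<forall>x\<in>K. Re (Qf e N (r x) (L x (xi (s x))) (L x (xi (s x)))) \<le> d"
      using frame_exists[OF fr0 xi K d] by blast
    have eb: "e m \<in> bsec" if "m < N" for m using e(1) that by (simp add: frame_def)
    define X where "X = (\<lambda>m i j. conv (star (\<lambda>x. coeff xi (e m) x * F i x)) (\<lambda>x. coeff xi (e m) x * F j x))"
    have XCc: "X m i j \<in> Cc" if "m < N" for m i j
      unfolding X_def using xi eb[OF that] F by (intro conv_Cc star_Cc coeff_Cc)
    have Y: "(kern F F i j) \<in> Cc" for i j
      using xi F by (intro coeff_Cc conv_Cc star_Cc)
    \<comment> \<open>A square norm of a slice consists of values of \<open>T\<close> at the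
      convolutions of the multiplied functions; their sum over the frame is what
      \<open>frame_kernel\<close> compares with \<open>kern\<close>.\<close>
    have slice_sq: "of_real ((hnorm R (slice (e m) F))\<^sup>2) = (\<Sum>i<n. \<Sum>j<n. T (h i) (h j) (X m i j))" if m: "m < N" for m
    proof -
      have c: "rho (\<lambda>x. coeff xi (e m) x * F j x) (h j) \<in> CR" if "j < n" for j
        using that hC xi eb[OF m] F by simp
      have cl: "slice (e m) F \<in> CR" by (rule slice_closed[OF eb[OF m] F])
      have "of_real ((hnorm R (slice (e m) F))\<^sup>2) = hip R (slice (e m) F) (slice (e m) F)"
        using R.ip_self[OF cl] by simp
      also have "\<dots> = (\<Sum>i<n. hip R (rho (\<lambda>x. coeff xi (e m) x * F i x) (h i)) (slice (e m) F))"
        using c cl by (subst slice_def, subst R.ip_hsum_left) auto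
      also have "\<dots> = (\<Sum>i<n. \<Sum>j<n. hip R (rho (\<lambda>x. coeff xi (e m) x * F i x) (h i)) (rho (\<lambda>x. coeff xi (e m) x * F j x) (h j)))"
        using c by (intro sum.cong refl, subst slice_def, subst R.ip_hsum_right) auto
      also have "\<dots> = (\<Sum>i<n. \<Sum>j<n. T (h i) (h j) (X m i j))"
        unfolding X_def using hC xi eb[OF m] F by (intro sum.cong refl T_star_conv[symmetric] coeff_Cc) auto
      finally show ?thesis .
    qed
    have "tform F F - (\<Sum>m<N. of_real ((hnorm R (slice (e m) F))\<^sup>2))
       = (\<Sum>i<n. \<Sum>j<n. T (h i) (h j) (\<lambda>x. coeff xi xi x * conv (star (F i)) (F j) x - (\<Sum>m<N. X m i j x)))"
    proof -
      have "(\<Sum>m<N. of_real ((hnorm R (slice (e m) F))\<^sup>2)) = (\<Sum>m<N. \<Sum>i<n. \<Sum>j<n. T (h i) (h j) (X m i j))"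
        using slice_sq by (intro sum.cong) auto
      also have "\<dots> = (\<Sum>i<n. \<Sum>m<N. \<Sum>j<n. T (h i) (h j) (X m i j))" by (rule sum.swap)
      also have "\<dots> = (\<Sum>i<n. \<Sum>j<n. \<Sum>m<N. T (h i) (h j) (X m i j))" by (intro sum.cong refl sum.swap)
      finally have 1: "(\<Sum>m<N. of_real ((hnorm R (slice (e m) F))\<^sup>2)) = (\<Sum>i<n. \<Sum>j<n. \<Sum>m<N. T (h i) (h j) (X m i j))" .
      have "T (h i) (h j) (\<lambda>x. coeff xi xi x * conv (star (F i)) (F j) x - (\<Sum>m<N. X m i j x))
          = T (h i) (h j) (kern F F i j) - (\<Sum>m<N. T (h i) (h j) (X m i j))"
        if "i < n" "j < n" for i j
      proof -
        have "T (h i) (h j) (\<lambda>x. coeff xi xi x * conv (star (F i)) (F j) x - (\<Sum>m<N. X m i j x))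
          = T (h i) (h j) (kern F F i j) - T (h i) (h j) (\<lambda>x. \<Sum>m<N. X m i j x)"
          using XCc by (intro T_diff hC that Y Cc_sum) auto
        also have "T (h i) (h j) (\<lambda>x. \<Sum>m<N. X m i j x) = (\<Sum>m<N. T (h i) (h j) (X m i j))"
          using XCc by (intro T_sum hC that) auto
        finally show ?thesis .
      qed
      then show ?thesis unfolding tform_def 1 by (simp add: sum_subtractf)
    qed
    then have "cmod (tform F F - (\<Sum>m<N. of_real ((hnorm R (slice (e m) F))\<^sup>2)))
       \<le> (\<Sum>i<n. \<Sum>j<n. cmod (T (h i) (h j) (\<lambda>x. coeff xi xi x * conv (star (F i)) (F j) x - (\<Sum>m<N. X m i j x))))"
      by (simp only:) (rule order_trans[OF norm_sum], rule sum_mono, rule norm_sum)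
    also have "\<dots> \<le> (\<Sum>i<n. \<Sum>j<n. d * (hnorm R (h i) * (Inorm (F i) * Inorm (F j)) * hnorm R (h j)))"
    proof (intro sum_mono)
      fix i j assume "i \<in> {..<n}" "j \<in> {..<n}"
      then have ij: "i < n" "j < n" by simp_all
      let ?E = "\<lambda>x. coeff xi xi x * conv (star (F i)) (F j) x - (\<Sum>m<N. X m i j x)"
      have E: "?E \<in> Cc" using XCc by (intro Cc_diff Y Cc_sum) auto
      have "Inorm ?E \<le> d * (Inorm (F i) * Inorm (F j))"
        unfolding X_def using d ij by (intro frame_kernel[OF e(1) xi _ e(4)[rule_format]] F F0) simp_all
      then have "hnorm R (h i) * Inorm ?E * hnorm R (h j) \<le> hnorm R (h i) * (d * (Inorm (F i) * Inorm (F j))) * hnorm R (h j)"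
        using hC[OF ij(1)] hC[OF ij(2)] by (intro mult_right_mono mult_left_mono) simp_all
      then show "cmod (T (h i) (h j) ?E) \<le> d * (hnorm R (h i) * (Inorm (F i) * Inorm (F j)) * hnorm R (h j))"
        using T_bound[OF hC[OF ij(1)] hC[OF ij(2)] E] by (simp add: mult_ac)
    qed
    also have "\<dots> = d * B" by (simp add: B_def sum_distrib_left)
    finally have "Re (\<Sum>m<N. of_real ((hnorm R (slice (e m) F))\<^sup>2)) \<le> Re (tform F F) + d * B"
      using abs_Re_le_cmod[of "tform F F - (\<Sum>m<N. of_real ((hnorm R (slice (e m) F))\<^sup>2))"] by simp
    then have "(\<Sum>m<N. (hnorm R (slice (e m) F))\<^sup>2) \<le> Re (tform F F) + d * B" by (simp add: Re_sum)
    moreover have "(hnorm R (slice (e 0) F))\<^sup>2 \<le> (\<Sum>m<N. (hnorm R (slice (e m) F))\<^sup>2)"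
      using e(2) by (intro member_le_sum) auto
    ultimately have 2: "(hnorm R (slice (e 0) F))\<^sup>2 \<le> Re (tform F F) + d * B" by simp
    have e0: "e 0 = ?e0" using e(3) by simp
    have "slice (e 0) F = hscale R (of_real (1 / c)) (slice eta F)"
    proof -
      have co: "(\<lambda>x. coeff xi (e 0) x * F j x) = (\<lambda>x. of_real (1 / c) * (coeff xi eta x * F j x))" for j
      proof
        fix x
        interpret rx: semi_ip "H (r x)" by (rule semi_fibre) simp
        show "coeff xi (e 0) x * F j x = of_real (1 / c) * (coeff xi eta x * F j x)"
          unfolding e0 by (simp add: coefficient_def rx.ip_scale_right L_closed bsec_closed xi eta)
      qed
      have "slice (e 0) F = hsum R (\<lambda>j. hscale R (of_real (1 / c)) (rho (\<lambda>x. coeff xi eta x * F j x) (h j))) n"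
        unfolding slice_def co using xi eta F hC by (intro R.hsum_cong rho_cmult coeff_Cc) auto
      also have "\<dots> = hscale R (of_real (1 / c)) (slice eta F)"
        unfolding slice_def using xi eta F hC by (intro R.hsum_scale[symmetric] rho_closed coeff_Cc) auto
      finally show ?thesis .
    qed
    then have "hnorm R (slice (e 0) F) = hnorm R (slice eta F) / c"
      using R.norm_scale[OF slice_closed[OF eta F], of "of_real (1 / c)"] c(1) by (simp add: norm_divide)
    then have "(hnorm R (slice eta F))\<^sup>2 / c\<^sup>2 \<le> Re (tform F F) + d * B" using 2 by (simp add: power_divide)
    then show ?thesis using c(1) by (simp add: divide_le_eq mult.commute)
  qed
  show ?thesis
  proof (rule field_le_epsilon)
    fix t :: real assume t: "t > 0"
    define d where "d = t / (c\<^sup>2 * (\<bar>B\<bar> + 1))"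
    have d: "d > 0" using t c by (simp add: d_def)
    have "c\<^sup>2 * (d * B) \<le> c\<^sup>2 * (d * (\<bar>B\<bar> + 1))" using d by (intro mult_left_mono) auto
    also have "\<dots> = d * (c\<^sup>2 * (\<bar>B\<bar> + 1))" by (simp add: mult_ac)
    also have "\<dots> = t"
    proof -
      have "c\<^sup>2 * (\<bar>B\<bar> + 1) > 0" using c(1) by (intro mult_pos_pos) auto
      then show ?thesis using c(1) by (simp add: d_def)
    qed
    finally show "(hnorm R (slice eta F))\<^sup>2 \<le> c\<^sup>2 * Re (tform F F) + t"
      using main[OF d] by (simp add: distrib_left)
  qed
qed

text \<open>The families have components for all natural numbers, although \<open>tform\<close> sees
  only those below n. The others are invisible to the seminorm and disappear in the
  completion.\<close>

definition TV :: "(nat \<Rightarrow> 'g \<Rightarrow> complex) hilb" where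
  "TV = \<lparr>hcarrier = {F. \<forall>i. F i \<in> Cc}, hzero = (\<lambda>i x. 0), hadd = (\<lambda>F F' i x. F i x + F' i x),
     hscale = (\<lambda>a F i x. a * F i x), hip = tform\<rparr>"

lemma TV_simps [simp]:
  "hcarrier TV = {F. \<forall>i. F i \<in> Cc}" "hzero TV = (\<lambda>i x. 0)" "hadd TV F F' = (\<lambda>i x. F i x + F' i x)"
  "hscale TV a F = (\<lambda>i x. a * F i x)" "hip TV = tform"
  by (simp_all add: TV_def)

lemma tform_Cc: "F i \<in> Cc \<Longrightarrow> F' j \<in> Cc \<Longrightarrow> (kern F F' i j) \<in> Cc"
  by (intro coeff_Cc xi conv_Cc star_Cc)

text \<open>Positivity is the substantial axiom: by \<open>slice_bound\<close> with eta = xi, a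
  positive multiple of Re (tform F F) dominates a square.\<close>

lemma TV_semi: "semi_ip TV"
proof
  show "complex_vector_space TV"
    unfolding complex_vector_space_def by (simp add: Cc_zero Cc_add Cc_cmult algebra_simps)
next
  fix F F' F'' assume "F \<in> hcarrier TV" "F' \<in> hcarrier TV" "F'' \<in> hcarrier TV"
  then have F: "F i \<in> Cc" "F' i \<in> Cc" "F'' i \<in> Cc" for i by simp_all
  have "T (h i) (h j) (\<lambda>x. coeff xi xi x * conv (star (F i)) (\<lambda>x. F' j x + F'' j x) x)
     = T (h i) (h j) (kern F F' i j) + T (h i) (h j) (kern F F'' i j)"
    if "i < n" "j < n" for i j
    using T_add[OF hC[OF that(1)] hC[OF that(2)] tform_Cc[of F i F' j] tform_Cc[of F i F'' j]] F
    by (simp add: conv_add_right distrib_left)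
  then show "hip TV F (hadd TV F' F'') = hip TV F F' + hip TV F F''"
    by (simp add: tform_def sum.distrib)
next
  fix a F F' assume "F \<in> hcarrier TV" "F' \<in> hcarrier TV"
  then have F: "F i \<in> Cc" "F' i \<in> Cc" for i by simp_all
  have "T (h i) (h j) (\<lambda>x. coeff xi xi x * conv (star (F i)) (\<lambda>x. a * F' j x) x)
     = a * T (h i) (h j) (kern F F' i j)"
    if "i < n" "j < n" for i j
    using T_cmult[OF hC[OF that(1)] hC[OF that(2)] tform_Cc[of F i F' j], of a] F
    by (simp add: conv_cmult_right mult.left_commute)
  then show "hip TV F (hscale TV a F') = a * hip TV F F'"
    by (simp add: tform_def sum_distrib_left)
next
  fix F F' assume "F \<in> hcarrier TV" "F' \<in> hcarrier TV"
  then have F: "F i \<in> Cc" "F' i \<in> Cc" for i by simp_all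
  have "T (h i) (h j) (kern F' F i j)
     = cnj (T (h j) (h i) (kern F F' j i))"
    if "i < n" "j < n" for i j
  proof -
    have st: "star (kern F F' j i) = (kern F' F i j)"
    proof
      fix x
      have "star (conv (star (F j)) (F' i)) x = conv (star (F' i)) (F j) x" using F by (simp add: star_conv)
      then show "star (kern F F' j i) x = coeff xi xi x * conv (star (F' i)) (F j) x"
        using coeff_hermitian[OF xi, of x] by (simp add: involution_def)
    qed
    show ?thesis using T_star[OF tform_Cc[of F j F' i] hC[OF that(1)] hC[OF that(2)]] F by (simp add: st)
  qed
  then have "tform F' F = (\<Sum>i<n. \<Sum>j<n. cnj (T (h j) (h i) (kern F F' j i)))"
    by (simp add: tform_def)
  also have "\<dots> = (\<Sum>j<n. \<Sum>i<n. cnj (T (h j) (h i) (kern F F' j i)))" by (rule sum.swap)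
  finally show "hip TV F' F = cnj (hip TV F F')" by (simp add: tform_def)
next
  fix F assume "F \<in> hcarrier TV"
  then have F: "F i \<in> Cc" for i by simp
  \<comment> \<open>The summand 1 keeps \<open>c\<close> positive when xi is 0.\<close>
  define c where "c = section_norm U H xi + 1"
  have c: "c > 0" using section_norm_nonneg[OF xi] by (simp add: c_def)
  have "(hnorm R (slice xi F))\<^sup>2 \<le> c\<^sup>2 * Re (tform F F)"
    using section_norm_ge[OF xi] F by (intro slice_bound[OF xi c]) (fastforce simp: c_def)+
  then have "0 \<le> c\<^sup>2 * Re (tform F F)" using zero_le_power2 order_trans by blast
  then show "0 \<le> Re (hip TV F F)" using c by (simp add: zero_le_mult_iff)
qed

sublocale V: semi_ip TV by (rule TV_semi)

text \<open>Crude bounds, with a constant that depends on xi and h. The first carries separability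
  of \<open>Cc\<close> over to the seminorm; the second supplies the growth condition for the
  iteration in \<open>act_norm\<close>.\<close>

lemma TV_bound:
  "\<exists>B\<ge>0. (\<forall>F. (\<forall>i. F i \<in> Cc) \<longrightarrow> hnorm TV F \<le> B * (\<Sum>i<n. Inorm (F i))) \<and>
    (\<forall>F g. (\<forall>i. F i \<in> Cc) \<longrightarrow> g \<in> Cc \<longrightarrow>
      cmod (tform F (\<lambda>i. conv g (F i))) \<le> B\<^sup>2 * Inorm g * (\<Sum>i<n. Inorm (F i))\<^sup>2)"
proof -
  define M where "M = section_norm U H xi"
  have M: "M \<ge> 0" unfolding M_def by (rule section_norm_nonneg[OF xi])
  define N where "N = (\<Sum>i<n. hnorm R (h i))"
  have nh: "hnorm R (h i) \<le> N" if "i < n" for i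
    unfolding N_def using that hC by (intro member_le_sum) auto
  have N: "N \<ge> 0" unfolding N_def using hC by (intro sum_nonneg) auto
  \<comment> \<open>Both bounds at once: F' = F with a = 1, and F' the convolutions of F by g with a
    = Inorm g.\<close>
  have gen: "cmod (tform F F') \<le> (M * N)\<^sup>2 * a * (\<Sum>i<n. Inorm (F i))\<^sup>2"
    if F: "\<And>i. F i \<in> Cc" and F': "\<And>i. F' i \<in> Cc" and a: "a \<ge> 0" "\<And>i. Inorm (F' i) \<le> a * Inorm (F i)" for F F' a
  proof -
    have "cmod (T (h i) (h j) (kern F F' i j)) \<le> (M * N)\<^sup>2 * a * (Inorm (F i) * Inorm (F j))"
      if ij: "i < n" "j < n" for i j
    proof -
      have "Inorm (kern F F' i j) \<le> (M * M) * Inorm (conv (star (F i)) (F' j))"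
        unfolding M_def using F F' by (intro Inorm_mult_le coeff_cont coeff_bound xi conv_Cc star_Cc)
      also have "Inorm (conv (star (F i)) (F' j)) \<le> Inorm (F i) * (a * Inorm (F j))"
        using Inorm_conv_le[OF star_Cc[OF F] F', of i j] Inorm_star[OF F, of i]
          mult_left_mono[OF a(2)[of j] Inorm_nonneg[OF F, of i]] by simp
      finally have 1: "Inorm (kern F F' i j) \<le> (M * M) * (Inorm (F i) * (a * Inorm (F j)))"
        using M by (simp add: mult_left_mono)
      have "cmod (T (h i) (h j) (kern F F' i j))
         \<le> hnorm R (h i) * Inorm (kern F F' i j) * hnorm R (h j)"
        using F F' by (intro T_bound hC ij tform_Cc)
      also have "\<dots> \<le> N * ((M * M) * (Inorm (F i) * (a * Inorm (F j)))) * N"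
      proof (intro mult_mono nh ij 1 hC mult_nonneg_nonneg R.norm_nonneg N Inorm_nonneg F M a(1))
        show "(kern F F' i j) \<in> Cc" using F F' by (intro tform_Cc)
      qed
      also have "\<dots> = (M * N)\<^sup>2 * a * (Inorm (F i) * Inorm (F j))" by (simp add: power2_eq_square mult_ac)
      finally show ?thesis .
    qed
    then have "cmod (tform F F') \<le> (\<Sum>i<n. \<Sum>j<n. (M * N)\<^sup>2 * a * (Inorm (F i) * Inorm (F j)))"
      unfolding tform_def by (intro order_trans[OF norm_sum] sum_mono order_trans[OF norm_sum]) auto
    also have "\<dots> = (M * N)\<^sup>2 * a * (\<Sum>i<n. Inorm (F i))\<^sup>2"
      unfolding power2_eq_square[of "\<Sum>i<n. Inorm (F i)"] sum_product by (simp only: sum_distrib_left)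
    finally show ?thesis .
  qed
  show ?thesis
  proof (intro exI[of _ "M * N"] conjI allI impI)
    show "0 \<le> M * N" using M N by simp
    fix F :: "nat \<Rightarrow> 'g \<Rightarrow> complex" assume "\<forall>i. F i \<in> Cc"
    then have F: "\<And>i. F i \<in> Cc" by blast
    have "(hnorm TV F)\<^sup>2 \<le> (M * N * (\<Sum>i<n. Inorm (F i)))\<^sup>2"
      using gen[of F F 1] F V.norm_sq[of F] complex_Re_le_cmod[of "tform F F"] by (simp add: power_mult_distrib)
    moreover have "0 \<le> M * N * (\<Sum>i<n. Inorm (F i))" using M N F by (intro mult_nonneg_nonneg sum_nonneg Inorm_nonneg) auto
    ultimately show "hnorm TV F \<le> M * N * (\<Sum>i<n. Inorm (F i))" by (rule power2_le_imp_le)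
  next
    fix F :: "nat \<Rightarrow> 'g \<Rightarrow> complex" and g :: "'g \<Rightarrow> complex" assume "\<forall>i. F i \<in> Cc"
    then have F: "\<And>i. F i \<in> Cc" by blast
    assume g: "g \<in> Cc"
    show "cmod (tform F (\<lambda>i. conv g (F i))) \<le> (M * N)\<^sup>2 * Inorm g * (\<Sum>i<n. Inorm (F i))\<^sup>2"
      using F g by (intro gen Inorm_conv_le Inorm_nonneg conv_Cc)
  qed
qed

section \<open>The action of \<open>Cc\<close> by convolution and its bound by the I-norm\<close>

definition act :: "('g \<Rightarrow> complex) \<Rightarrow> (nat \<Rightarrow> 'g \<Rightarrow> complex) \<Rightarrow> (nat \<Rightarrow> 'g \<Rightarrow> complex)" where
  "act g F = (\<lambda>i. conv g (F i))"

lemma act_closed: "g \<in> Cc \<Longrightarrow> F \<in> hcarrier TV \<Longrightarrow> act g F \<in> hcarrier TV"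
  by (simp add: act_def)

lemma act_linear: "g \<in> Cc \<Longrightarrow> hlinear TV TV (act g)"
  unfolding hlinear_def by (auto simp: act_def conv_add_right conv_cmult_right)

lemma act_conv: "f \<in> Cc \<Longrightarrow> g \<in> Cc \<Longrightarrow> F \<in> hcarrier TV \<Longrightarrow> act (conv f g) F = act f (act g F)"
  by (simp add: act_def conv_assoc)

text \<open>The two kernels coincide: the adjoint of \<open>conv (star g) (F i)\<close> is
  \<open>conv (star (F i)) g\<close>, and convolution is associative.\<close>

lemma act_adjoint: "g \<in> Cc \<Longrightarrow> F \<in> hcarrier TV \<Longrightarrow> F' \<in> hcarrier TV \<Longrightarrow> tform (act (star g) F) F' = tform F (act g F')"
  unfolding tform_def act_def by (intro sum.cong refl) (simp add: star_conv conv_assoc)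

text \<open>Iterating \<open>\<parallel>a F\<parallel>\<^sup>2 \<le> \<parallel>F\<parallel> \<parallel>a\<^sup>2 F\<parallel>\<close> for \<open>a = g* g\<close>, as in the proof that positive functionals on
  a Banach *-algebra are bounded.\<close>

lemma act_norm:
  assumes g: "g \<in> Cc" and F: "F \<in> hcarrier TV"
  shows "hnorm TV (act g F) \<le> Inorm g * hnorm TV F"
proof -
  have FC: "\<And>i. F i \<in> Cc" using F by simp
  obtain B where B: "\<forall>F g. (\<forall>i. F i \<in> Cc) \<longrightarrow> g \<in> Cc \<longrightarrow>
      cmod (tform F (\<lambda>i. conv g (F i))) \<le> B\<^sup>2 * Inorm g * (\<Sum>i<n. Inorm (F i))\<^sup>2"
    using TV_bound by blast
  \<comment> \<open>\<open>D\<close> depends on the vector \<open>F\<close> but not on the function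
    g, so it stays fixed during the iteration.\<close>
  define D where "D = B\<^sup>2 * (\<Sum>i<n. Inorm (F i))\<^sup>2"
  have D: "cmod (tform F (act g F)) \<le> D * Inorm g" if "g \<in> Cc" for g
    using B FC that by (simp add: act_def D_def mult_ac)
  have D0: "D \<ge> 0" by (simp add: D_def)
  define a where "a = conv (star g) g"
  have a: "a \<in> Cc" "star a = a" using g by (simp_all add: a_def star_conv)
  \<comment> \<open>Convolution powers of \<open>a\<close> with exponents 2^k, all
    self-adjoint.\<close>
  define b where "b = rec_nat a (\<lambda>_ f. conv f f)"
  have b0: "b 0 = a" and bS: "\<And>k. b (Suc k) = conv (b k) (b k)" by (simp_all add: b_def)
  have b: "b k \<in> Cc \<and> star (b k) = b k \<and> Inorm (b k) \<le> (Inorm a) ^ (2 ^ k)" for k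
  proof (induction k)
    case 0
    then show ?case using a by (simp add: b0)
  next
    case (Suc k)
    have "Inorm (b (Suc k)) \<le> Inorm (b k) * Inorm (b k)" unfolding bS using Suc by (intro Inorm_conv_le) auto
    also have "\<dots> \<le> (Inorm a) ^ (2 ^ k) * (Inorm a) ^ (2 ^ k)"
      using Suc Inorm_nonneg a by (intro mult_mono) auto
    also have "\<dots> = (Inorm a) ^ (2 ^ Suc k)" by (simp add: power_add[symmetric] mult_2)
    finally show ?case using Suc by (simp add: bS star_conv)
  qed
  define m where "m = (\<lambda>k. hnorm TV (act (b k) F))"
  have m0: "0 \<le> m k" for k unfolding m_def using b F by (intro V.norm_nonneg act_closed) auto
  have sq: "(m k)\<^sup>2 = Re (tform F (act (b (Suc k)) F))" for k
  proof -
    have bk: "b k \<in> Cc" "star (b k) = b k" using b by auto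
    have "(m k)\<^sup>2 = Re (tform (act (b k) F) (act (b k) F))"
      unfolding m_def using bk F by (subst V.norm_sq[OF act_closed]) simp_all
    also have "tform (act (b k) F) (act (b k) F) = tform F (act (b k) (act (b k) F))"
      using act_adjoint[of "b k" F "act (b k) F"] bk F act_closed by simp
    also have "act (b k) (act (b k) F) = act (b (Suc k)) F" using bk F by (simp add: bS act_conv)
    finally show ?thesis .
  qed
  have step: "(m k)\<^sup>2 \<le> hnorm TV F * m (Suc k)" for k
  proof -
    have "Re (tform F (act (b (Suc k)) F)) \<le> cmod (hip TV F (act (b (Suc k)) F))" by (simp add: complex_Re_le_cmod)
    also have "\<dots> \<le> hnorm TV F * m (Suc k)" unfolding m_def using b F by (intro V.cauchy_schwarz act_closed) auto
    finally show ?thesis by (simp add: sq)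
  qed
  have up: "m k \<le> sqrt D * (Inorm a) ^ (2 ^ k)" for k
  proof -
    have "(m k)\<^sup>2 \<le> D * Inorm (b (Suc k))"
      using D[of "b (Suc k)"] b[of "Suc k"] complex_Re_le_cmod[of "tform F (act (b (Suc k)) F)"] by (simp add: sq)
    also have "\<dots> \<le> D * (Inorm a) ^ (2 ^ Suc k)" using b[of "Suc k"] D0 by (intro mult_left_mono) auto
    also have "\<dots> = (sqrt D * (Inorm a) ^ (2 ^ k))\<^sup>2"
      using D0 by (simp add: power_mult_distrib power_mult[symmetric] mult.commute)
    finally show ?thesis
      by (rule power2_le_imp_le) (intro mult_nonneg_nonneg zero_le_power Inorm_nonneg a(1) real_sqrt_ge_zero D0)
  qed
  have main: "m 0 \<le> Inorm a * hnorm TV F"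
  proof (cases "hnorm TV F = 0")
    case True
    then show ?thesis using step[of 0] by simp
  next
    case False
    then have NF: "hnorm TV F > 0" using V.norm_nonneg[OF F] by linarith
    define t where "t = (\<lambda>k. m k / hnorm TV F)"
    have t0: "0 \<le> t k" for k using m0 NF by (simp add: t_def)
    have tS: "(t k)\<^sup>2 \<le> t (Suc k)" for k
    proof -
      have "(t k)\<^sup>2 = (m k)\<^sup>2 / (hnorm TV F * hnorm TV F)" by (simp add: t_def power_divide power2_eq_square)
      also have "\<dots> \<le> (hnorm TV F * m (Suc k)) / (hnorm TV F * hnorm TV F)"
        using step NF by (intro divide_right_mono) simp_all
      also have "\<dots> = t (Suc k)" using NF by (simp add: t_def)
      finally show ?thesis .
    qed
    have tk: "t 0 ^ (2 ^ k) \<le> t k" for k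
    proof (induction k)
      case (Suc k)
      have "t 0 ^ (2 ^ Suc k) = (t 0 ^ (2 ^ k))\<^sup>2" by (simp add: power_mult[symmetric] mult.commute)
      also have "\<dots> \<le> (t k)\<^sup>2" using Suc t0 by (intro power_mono) auto
      also have "\<dots> \<le> t (Suc k)" by (rule tS)
      finally show ?case .
    qed simp
    \<comment> \<open>The power of \<open>t 0\<close> is at most \<open>t k\<close> by repeated
      squaring, and \<open>t k\<close> is at most a constant times the power of Inorm a by
      \<open>up\<close>.\<close>
    have "t 0 \<le> Inorm a"
    proof (rule le_if_two_powers_le)
      show "t 0 ^ 2 ^ k \<le> (sqrt D / hnorm TV F) * Inorm a ^ 2 ^ k" for k
      proof -
        have "t k \<le> (sqrt D * (Inorm a) ^ (2 ^ k)) / hnorm TV F"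
          unfolding t_def using up[of k] NF by (intro divide_right_mono) auto
        then show ?thesis using tk[of k] by simp
      qed
    qed (use t0 Inorm_nonneg[OF a(1)] in auto)
    then show ?thesis using NF by (simp add: t_def divide_le_eq)
  qed
  have "(hnorm TV (act g F))\<^sup>2 = Re (tform (act g F) (act g F))"
    using V.norm_sq[OF act_closed[OF g F]] by simp
  also have "tform (act g F) (act g F) = tform F (act a F)"
    using act_adjoint[of "star g" F "act g F"] act_closed[OF g F] g F by (simp add: a_def act_conv)
  also have "Re (tform F (act a F)) \<le> cmod (hip TV F (act a F))" by (simp add: complex_Re_le_cmod)
  also have "\<dots> \<le> hnorm TV F * m 0"
    unfolding m_def b0 using a F by (intro V.cauchy_schwarz act_closed) auto
  also have "\<dots> \<le> hnorm TV F * (Inorm a * hnorm TV F)" using main V.norm_nonneg[OF F] by (rule mult_left_mono)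
  also have "\<dots> \<le> hnorm TV F * ((Inorm g * Inorm g) * hnorm TV F)"
    using Inorm_conv_le[OF star_Cc[OF g] g] Inorm_star[OF g] V.norm_nonneg[OF F]
    by (intro mult_left_mono mult_right_mono) (simp_all add: a_def)
  also have "\<dots> = (Inorm g * hnorm TV F)\<^sup>2" by (simp add: power2_eq_square mult_ac)
  finally show ?thesis
    by (rule power2_le_imp_le) (intro mult_nonneg_nonneg Inorm_nonneg g V.norm_nonneg F)
qed

end

text \<open>A quantitative form of the fact that the error of a best approximation is orthogonal to
  the subspace. Minimality up to t is tested on the multiples a = \<tau> cnj <x, y>, and \<tau> = 1
  / \<parallel>y\<parallel>^2 is the best choice.\<close>

lemma (in semi_ip) almost_orthogonal_if_minimal:
  assumes x: "x \<in> C" and y: "y \<in> C" and t: "t \<ge> 0"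
    and min: "\<And>a. (hnorm H x)\<^sup>2 \<le> (hnorm H (hdiff H x (hscale H a y)))\<^sup>2 + t"
  shows "cmod (hip H x y) \<le> sqrt t * hnorm H y"
proof -
  define c where "c = hip H x y"
  have ineq: "2 * \<tau> * (cmod c)\<^sup>2 \<le> t + \<tau>\<^sup>2 * (cmod c)\<^sup>2 * (hnorm H y)\<^sup>2" for \<tau> :: real
  proof -
    let ?a = "of_real \<tau> * cnj c"
    have "(hnorm H (hdiff H x (hscale H ?a y)))\<^sup>2 = (hnorm H x)\<^sup>2 - 2 * Re (?a * c) + (cmod ?a * hnorm H y)\<^sup>2"
      using x y by (simp add: norm_diff_sq norm_scale ip_scale_right c_def)
    also have "?a * c = of_real (\<tau> * (cmod c)\<^sup>2)"
      by (simp add: mult.assoc mult.commute[of "cnj c"] complex_norm_square[symmetric])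
    also have "Re (complex_of_real (\<tau> * (cmod c)\<^sup>2)) = \<tau> * (cmod c)\<^sup>2" by (rule Re_complex_of_real)
    also have "(cmod ?a * hnorm H y)\<^sup>2 = \<tau>\<^sup>2 * (cmod c)\<^sup>2 * (hnorm H y)\<^sup>2"
      by (simp add: norm_mult power_mult_distrib)
    finally show ?thesis using min[of ?a] by simp
  qed
  show ?thesis
  proof (cases "hnorm H y = 0")
    case True
    then show ?thesis using cauchy_schwarz[OF x y] by simp
  next
    case False
    then have ny: "(hnorm H y)\<^sup>2 > 0" by simp
    have "2 * (1 / (hnorm H y)\<^sup>2) * (cmod c)\<^sup>2 \<le> t + (1 / (hnorm H y)\<^sup>2)\<^sup>2 * (cmod c)\<^sup>2 * (hnorm H y)\<^sup>2" by (rule ineq)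
    also have "(1 / (hnorm H y)\<^sup>2)\<^sup>2 * (cmod c)\<^sup>2 * (hnorm H y)\<^sup>2 = (1 / (hnorm H y)\<^sup>2) * (cmod c)\<^sup>2"
      using ny by (simp add: power2_eq_square)
    finally have "(cmod c)\<^sup>2 / (hnorm H y)\<^sup>2 \<le> t" by simp
    then have "(cmod c)\<^sup>2 \<le> t * (hnorm H y)\<^sup>2" using ny by (simp add: divide_le_eq)
    then have "cmod c \<le> sqrt (t * (hnorm H y)\<^sup>2)" by (rule real_le_rsqrt)
    then show ?thesis using y by (simp add: c_def real_sqrt_mult)
  qed
qed

lemma hsum_carrier_update: "hsum (H\<lparr>hcarrier := S\<rparr>) f n = hsum H f n"
  by (induction n) simp_all

section \<open>The essential subspace, its completion and the representation on it\<close>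

context tensor_rep
begin

text \<open>The essential part \<open>Cc \<cdot> TV\<close>. Working with it, instead of with all of \<open>TV\<close>, gives a
  nondegenerate representation without an approximate unit of \<open>Cc\<close>.\<close>

inductive_set Ess :: "(nat \<Rightarrow> 'g \<Rightarrow> complex) set" where
  Ess_zero: "hzero TV \<in> Ess"
| Ess_step: "v \<in> Ess \<Longrightarrow> f \<in> Cc \<Longrightarrow> F \<in> hcarrier TV \<Longrightarrow> hadd TV v (act f F) \<in> Ess"

lemma Ess_TV: "v \<in> Ess \<Longrightarrow> v \<in> hcarrier TV"
  by (induction rule: Ess.induct) (auto simp only: V.zero_closed V.add_closed act_closed)

lemma Ess_act: "f \<in> Cc \<Longrightarrow> F \<in> hcarrier TV \<Longrightarrow> act f F \<in> Ess"
  using Ess_step[OF Ess_zero, of f F] V.zero_add[OF act_closed, of f F] by (simp only:)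

lemma Ess_add: "w \<in> Ess \<Longrightarrow> v \<in> Ess \<Longrightarrow> hadd TV v w \<in> Ess"
proof (induction rule: Ess.induct)
  case Ess_zero
  then show ?case by (simp only: V.add_zero[OF Ess_TV])
next
  case (Ess_step w f F)
  have "hadd TV v (hadd TV w (act f F)) = hadd TV (hadd TV v w) (act f F)"
    using Ess_step Ess_TV act_closed by (intro V.add_assoc[symmetric]) blast+
  then show ?case using Ess_step Ess.Ess_step by (simp only:)
qed

lemma act_scale: "act f (hscale TV a F) = hscale TV a (act f F)"
  by (simp add: act_def conv_cmult_right)

lemma Ess_scale: "v \<in> Ess \<Longrightarrow> hscale TV a v \<in> Ess"
proof (induction rule: Ess.induct)
  case Ess_zero
  then show ?case by (simp only: V.scale_hzero Ess.Ess_zero)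
next
  case (Ess_step v f F)
  have "hscale TV a (hadd TV v (act f F)) = hadd TV (hscale TV a v) (act f (hscale TV a F))"
    unfolding act_scale using Ess_step by (intro V.scale_add_right Ess_TV[of v] act_closed)
  moreover have "hscale TV a F \<in> hcarrier TV" using Ess_step by (intro V.scale_closed)
  then have "hadd TV (hscale TV a v) (act f (hscale TV a F)) \<in> Ess"
    using Ess_step by (intro Ess.Ess_step)
  ultimately show ?case by (simp only:)
qed

text \<open>Near-best approximation \<open>w\<close> of \<open>F\<close> in \<open>Ess\<close>: since \<open>F - w\<close> is almost orthogonal to
  \<open>Ess\<close>, \<open>f (F - w)\<close> is small.\<close>

lemma act_Ess_dense:
  assumes f: "f \<in> Cc" and F: "F \<in> hcarrier TV" and e: "e > 0"
  shows "\<exists>w\<in>Ess. V.dst (act f F) (act f w) < e"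
proof -
  define d where "d = (INF w\<in>Ess. (V.dst F w)\<^sup>2)"
  have bdd: "bdd_below ((\<lambda>w. (V.dst F w)\<^sup>2) ` Ess)" by (intro bdd_belowI[of _ 0]) auto
  have d_le: "d \<le> (V.dst F w)\<^sup>2" if "w \<in> Ess" for w
    unfolding d_def using that bdd by (intro cINF_lower) auto
  define A where "A = Inorm (conv (star f) f)"
  have A: "A \<ge> 0" unfolding A_def using f by (intro Inorm_nonneg conv_Cc star_Cc)
  define M where "M = sqrt (d + 1)"
  have d0: "d \<ge> 0" unfolding d_def using Ess_zero by (intro cINF_greatest) auto
  have M: "M > 0" using d0 by (simp add: M_def)
  define X where "X = (A + 1) * M"
  have X: "X > 0" using A M by (simp add: X_def)
  \<comment> \<open>Chosen so that sqrt t * X is at most e^2 / 2; the minimum with 1 keeps the norm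
    of F - w below \<open>M\<close>.\<close>
  define t where "t = min 1 ((e\<^sup>2 / (2 * X))\<^sup>2)"
  have t: "t > 0" "t \<le> 1" using e X by (simp_all add: t_def)
  have st: "sqrt t \<le> e\<^sup>2 / (2 * X)"
  proof -
    have "sqrt t \<le> sqrt ((e\<^sup>2 / (2 * X))\<^sup>2)" by (intro real_sqrt_le_mono) (simp add: t_def)
    then show ?thesis using X by simp
  qed
  have "\<exists>w\<in>Ess. (V.dst F w)\<^sup>2 < d + t"
    using cINF_less_iff[OF _ bdd, of "d + t"] Ess_zero t by (auto simp: d_def[symmetric])
  then obtain w where w: "w \<in> Ess" "(V.dst F w)\<^sup>2 < d + t" by blast
  have wT: "w \<in> hcarrier TV" using w(1) by (rule Ess_TV)
  define u where "u = hdiff TV F w"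
  have u: "u \<in> hcarrier TV" unfolding u_def using F wT by (intro V.diff_closed)
  have orth: "cmod (hip TV u y) \<le> sqrt t * hnorm TV y" if y: "y \<in> Ess" for y
  proof (rule V.almost_orthogonal_if_minimal[OF u Ess_TV[OF y]])
    fix a
    have yT: "hscale TV a y \<in> hcarrier TV" using y by (intro V.scale_closed Ess_TV)
    have "hdiff TV u (hscale TV a y) = hdiff TV F (hadd TV w (hscale TV a y))"
      using F wT yT unfolding u_def hdiff_def
      by (simp add: V.scale_add_right V.add_assoc del: TV_simps)
    moreover have "hadd TV w (hscale TV a y) \<in> Ess" using w(1) y by (intro Ess_add Ess_scale)
    ultimately show "(hnorm TV u)\<^sup>2 \<le> (V.dst u (hscale TV a y))\<^sup>2 + t"
      using d_le w(2) by (fastforce simp: u_def[symmetric])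
  qed (use t in simp)
  have nu: "hnorm TV u \<le> M"
  proof -
    have "(hnorm TV u)\<^sup>2 \<le> d + 1" using w(2) t by (simp add: u_def)
    then show ?thesis unfolding M_def by (rule real_le_rsqrt)
  qed
  \<comment> \<open>\<open>act (conv (star f) f) u\<close> lies in \<open>Ess\<close> whatever u is,
    so u is almost orthogonal to it, while its inner product with u is the square norm of
    \<open>act f u\<close>.\<close>
  have yE: "act (conv (star f) f) u \<in> Ess" using f u by (intro Ess_act conv_Cc star_Cc)
  have "(hnorm TV (act f u))\<^sup>2 = Re (hip TV u (act (conv (star f) f) u))"
  proof -
    have "hip TV (act f u) (act f u) = hip TV u (act (star f) (act f u))"
      using act_adjoint[of "star f" u "act f u"] f u act_closed[OF f u] by simp
    also have "act (star f) (act f u) = act (conv (star f) f) u"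
      using f u by (intro act_conv[symmetric] star_Cc)
    finally show ?thesis using V.norm_sq[OF act_closed[OF f u]] by simp
  qed
  also have "\<dots> \<le> cmod (hip TV u (act (conv (star f) f) u))" by (rule complex_Re_le_cmod)
  also have "\<dots> \<le> sqrt t * hnorm TV (act (conv (star f) f) u)" by (rule orth[OF yE])
  also have "\<dots> \<le> sqrt t * (A * hnorm TV u)"
    unfolding A_def using f u t by (intro mult_left_mono act_norm conv_Cc star_Cc) auto
  also have "\<dots> \<le> sqrt t * (A * M)" using nu A t by (intro mult_left_mono) auto
  also have "\<dots> \<le> (e\<^sup>2 / (2 * X)) * X"
    using st A M X by (intro mult_mono) (auto simp: X_def distrib_right)
  also have "\<dots> = e\<^sup>2 / 2" using X by simp
  also have "\<dots> < e\<^sup>2" using e by simp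
  finally have "hnorm TV (act f u) < e" using e by (intro power2_less_imp_less[of _ e]) simp_all
  moreover have "act f u = hdiff TV (act f F) (act f w)"
    using act_linear[OF f] F wT unfolding u_def hdiff_def hlinear_def by (simp add: Cc_cmult del: TV_simps)
  ultimately show ?thesis using w(1) by auto
qed

definition EV :: "(nat \<Rightarrow> 'g \<Rightarrow> complex) hilb" where
  "EV = TV\<lparr>hcarrier := Ess\<rparr>"

lemma EV_simps: "hcarrier EV = Ess" "hzero EV = hzero TV" "hadd EV = hadd TV" "hscale EV = hscale TV" "hip EV = hip TV"
  "hnorm EV = hnorm TV" "hdiff EV = hdiff TV" "hsum EV = hsum TV"
  by (auto simp: EV_def hnorm_def[abs_def] hdiff_def[abs_def] hsum_carrier_update[abs_def] simp del: TV_simps intro!: ext)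

lemma EV_semi: "semi_ip EV"
proof
  show "complex_vector_space EV"
    unfolding complex_vector_space_def EV_simps
    using Ess_zero Ess_add Ess_scale Ess_TV
    by (simp add: V.add_assoc V.add_zero V.add_neg V.scale_one V.scale_scale V.scale_add_left V.scale_add_right del: TV_simps)
      (meson V.add_comm)
qed (unfold EV_simps, simp_all add: Ess_TV V.ip_add_right V.ip_scale_right V.ip_sym[symmetric] V.ip_nonneg del: TV_simps)

text \<open>Families built from a countable dense subset of \<open>Cc\<close> approximate all of
  \<open>TV\<close> by \<open>TV_bound\<close>, but need not lie in \<open>Ess\<close>;
  \<open>separable_subset\<close> replaces them by elements that do.\<close>

lemma EV_dense_sequence:
  "\<exists>d. (\<forall>k. d k \<in> Ess) \<and> (\<forall>v\<in>Ess. \<forall>e>0. \<exists>k. V.dst v (d (k::nat)) < e)"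
proof -
  obtain D :: "('g \<Rightarrow> complex) set" where D: "countable D" "D \<subseteq> Cc"
    "\<And>f e. f \<in> Cc \<Longrightarrow> e > 0 \<Longrightarrow> \<exists>g\<in>D. Inorm (\<lambda>x. f x - g x) < e"
    by (rule Cc_separable) blast
  obtain B where B: "B \<ge> 0" "\<forall>F. (\<forall>i. F i \<in> Cc) \<longrightarrow> hnorm TV F \<le> B * (\<Sum>i<n. Inorm (F i))"
    using TV_bound by blast
  \<comment> \<open>A list encodes the components below n. All others are 0, at no cost since the
    norm bound sees only indices below n.\<close>
  define mk where "mk = (\<lambda>l i. if i < n \<and> i < length l then l ! i else (\<lambda>x::'g. 0::complex))"
  define E where "E = mk ` lists D"
  have "mk l i \<in> Cc" if "l \<in> lists D" for l i
  proof (cases "i < n \<and> i < length l")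
    case True
    then have "l ! i \<in> D" using that nth_mem[of i l] by (auto simp: in_lists_conv_set)
    then show ?thesis using True D(2) by (auto simp: mk_def)
  qed (auto simp: mk_def Cc_zero)
  then have E: "countable E" "E \<subseteq> hcarrier TV"
    using D(1) by (auto simp: E_def)
  have dense: "\<exists>y\<in>E. V.dst F y < e" if F: "F \<in> Ess" and e: "e > 0" for F e
  proof -
    have FC: "F i \<in> Cc" for i using Ess_TV[OF F] by simp
    define t where "t = e / ((B + 1) * (real n + 1))"
    have t: "t > 0" using e B by (simp add: t_def)
    have "\<exists>g\<in>D. Inorm (\<lambda>x. F i x - g x) < t" for i using D(3)[OF FC t] .
    then obtain g where g: "\<And>i. g i \<in> D" "\<And>i. Inorm (\<lambda>x. F i x - g i x) < t" by metis
    define y where "y = mk (map g [0..<n])"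
    have yE: "y \<in> E" unfolding E_def y_def using g by (intro imageI) auto
    have yi: "y i = g i" if "i < n" for i using that by (simp add: y_def mk_def)
    have yC: "y i \<in> Cc" for i using yE E by auto
    have dC: "hdiff TV F y i \<in> Cc" for i using Cc_diff[OF FC yC, of i i] by (simp add: hdiff_def)
    have "V.dst F y \<le> B * (\<Sum>i<n. Inorm (hdiff TV F y i))" using B(2) dC by blast
    also have "\<dots> \<le> B * (\<Sum>i<n. t)"
    proof (intro mult_left_mono sum_mono B)
      fix i assume "i \<in> {..<n}"
      then have "hdiff TV F y i = (\<lambda>x. F i x - g i x)" by (simp add: hdiff_def yi)
      then show "Inorm (hdiff TV F y i) \<le> t" using g(2)[of i] by simp
    qed
    also have "\<dots> = B * (real n * t)" by simp
    also have "\<dots> \<le> (B + 1) * (real n * t)" using t by (intro mult_right_mono) auto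
    also have "\<dots> < (B + 1) * ((real n + 1) * t)" using t B by (intro mult_strict_left_mono) (auto simp: distrib_right)
    also have "\<dots> = e" using B by (simp add: t_def add_nonneg_pos less_imp_neq[symmetric])
    finally show ?thesis using yE by blast
  qed
  have S: "Ess \<subseteq> hcarrier TV" "Ess \<noteq> {}" using Ess_TV Ess_zero by blast+
  show ?thesis
  proof (rule separable_subset[OF TV_semi S E dense])
    fix d :: "nat \<Rightarrow> nat \<Rightarrow> 'g \<Rightarrow> complex"
    assume "\<And>k. d k \<in> Ess" "\<And>v e. v \<in> Ess \<Longrightarrow> e > 0 \<Longrightarrow> \<exists>k. V.dst v (d k) < e"
    then show ?thesis by (intro exI[of _ d]) simp
  qed
qed

definition dseq :: "nat \<Rightarrow> nat \<Rightarrow> 'g \<Rightarrow> complex" where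
  "dseq = (SOME d. (\<forall>k. d k \<in> Ess) \<and> (\<forall>v\<in>Ess. \<forall>e>0. \<exists>k. V.dst v (d k) < e))"

lemma dseq: "dseq k \<in> Ess" "v \<in> Ess \<Longrightarrow> e > 0 \<Longrightarrow> \<exists>k. V.dst v (dseq k) < e"
proof -
  note * = someI_ex[OF EV_dense_sequence, folded dseq_def]
  show "dseq k \<in> Ess" by (rule conjunct1[OF *, rule_format])
  show "\<exists>k. V.dst v (dseq k) < e" if "v \<in> Ess" "e > 0"
    by (rule conjunct2[OF *, rule_format, OF that])
qed

sublocale E: dense_semi_ip EV dseq
  unfolding dense_semi_ip_def dense_semi_ip_axioms_def EV_simps using EV_semi dseq by simp

abbreviation KH where "KH \<equiv> E.cpl"

lemma act_EV: "f \<in> Cc \<Longrightarrow> hlinear EV EV (act f)"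
  unfolding hlinear_def EV_simps using act_linear[of f] Ess_TV Ess_act unfolding hlinear_def by blast

lemma act_EV_norm: "f \<in> Cc \<Longrightarrow> v \<in> hcarrier EV \<Longrightarrow> hnorm EV (act f v) \<le> Inorm f * hnorm EV v"
  unfolding EV_simps using act_norm Ess_TV by blast

definition sigma :: "('g \<Rightarrow> complex) \<Rightarrow> hpoint \<Rightarrow> hpoint" where
  "sigma = (\<lambda>f\<in>Cc. E.lift (act f))"

lemma sigma_coords:
  assumes f: "f \<in> Cc" shows "hcauchy EV w \<Longrightarrow> sigma f (E.coords w) = E.coords (\<lambda>k. act f (w k))"
  using f by (simp add: sigma_def E.lift_coords[OF act_EV[OF f] act_EV_norm[OF f]])

lemma sigma_emb:
  assumes f: "f \<in> Cc" shows "v \<in> Ess \<Longrightarrow> sigma f (E.emb v) = E.emb (act f v)"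
  using f E.lift_emb[OF act_EV[OF f] act_EV_norm[OF f], of v] by (simp add: sigma_def EV_simps(1))

lemma hcauchy_act:
  assumes f: "f \<in> Cc" shows "hcauchy EV w \<Longrightarrow> hcauchy EV (\<lambda>k. act f (w k))"
  by (rule E.hcauchy_A[OF act_EV[OF f] act_EV_norm[OF f]])

lemma hcauchy_TV: "hcauchy EV w \<Longrightarrow> w k \<in> hcarrier TV"
  using E.hcauchy_closed[of w k] Ess_TV by (simp only: EV_simps)

text \<open>An element of \<open>Ess\<close> is by definition a sum of terms f F with F anywhere in
  \<open>TV\<close>. Nondegeneracy on the completion asks for F in \<open>Ess\<close>, and
  \<open>act_Ess_dense\<close> allows this replacement at arbitrarily small cost.\<close>

lemma Ess_approx:
  "v \<in> Ess \<Longrightarrow> e > 0 \<Longrightarrow> \<exists>m f k. (\<forall>i<m. f i \<in> Cc \<and> k i \<in> Ess) \<and>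
     V.dst v (hsum TV (\<lambda>i. act (f i) (k i)) m) < e"
proof (induction arbitrary: e rule: Ess.induct)
  case Ess_zero
  \<comment> \<open>The empty sum, for which the families are irrelevant.\<close>
  have "V.dst (hzero TV) (hsum TV (\<lambda>i. act (undefined i) (undefined i)) 0) < e"
    using Ess_zero by (simp only: hsum.simps V.diff_self[OF V.zero_closed] V.norm_zero)
  then show ?case by (intro exI[of _ 0] exI[of _ undefined] conjI) simp_all
next
  case (Ess_step v g F)
  have e2: "e / 2 > 0" using Ess_step.prems by simp
  obtain m f k where m: "\<forall>i<m. f i \<in> Cc \<and> k i \<in> Ess"
    "V.dst v (hsum TV (\<lambda>i. act (f i) (k i)) m) < e / 2" using Ess_step.IH[OF e2] by blast
  obtain w where w: "w \<in> Ess" "V.dst (act g F) (act g w) < e / 2"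
    using act_Ess_dense[OF Ess_step.hyps(2,3) e2] by blast
  define f' k' where "f' = f(m := g)" and "k' = k(m := w)"
  have cong: "hsum TV (\<lambda>i. act (f' i) (k' i)) m = hsum TV (\<lambda>i. act (f i) (k i)) m"
    by (rule V.hsum_cong) (simp add: f'_def k'_def)
  have sc: "hsum TV (\<lambda>i. act (f i) (k i)) m \<in> hcarrier TV"
    using m(1) by (intro V.hsum_closed act_closed Ess_TV) auto
  have c: "v \<in> hcarrier TV" "act g F \<in> hcarrier TV" "act g w \<in> hcarrier TV"
    using Ess_TV[OF Ess_step.hyps(1)] act_closed[OF Ess_step.hyps(2)] Ess_step.hyps(3) Ess_TV[OF w(1)] by blast+
  have "hdiff TV (hadd TV v (act g F)) (hsum TV (\<lambda>i. act (f' i) (k' i)) (Suc m))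
     = hadd TV (hdiff TV v (hsum TV (\<lambda>i. act (f i) (k i)) m)) (hdiff TV (act g F) (act g w))"
    unfolding hsum.simps cong using c sc
    by (subst V.hdiff_add) (simp_all only: f'_def k'_def fun_upd_same)
  then have "V.dst (hadd TV v (act g F)) (hsum TV (\<lambda>i. act (f' i) (k' i)) (Suc m))
     \<le> V.dst v (hsum TV (\<lambda>i. act (f i) (k i)) m) + V.dst (act g F) (act g w)"
    using V.norm_triangle[OF V.diff_closed[OF c(1) sc] V.diff_closed[OF c(2,3)]] by (simp only:)
  then have "V.dst (hadd TV v (act g F)) (hsum TV (\<lambda>i. act (f' i) (k' i)) (Suc m)) < e"
    using m(2) w(2) by linarith
  moreover have "\<forall>i<Suc m. f' i \<in> Cc \<and> k' i \<in> Ess"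
    using m(1) w(1) Ess_step.hyps(2) by (simp add: f'_def k'_def less_Suc_eq)
  ultimately show ?case by blast
qed

lemma act_add_fun: "f \<in> Cc \<Longrightarrow> g \<in> Cc \<Longrightarrow> F \<in> hcarrier TV \<Longrightarrow> act (\<lambda>x. f x + g x) F = hadd TV (act f F) (act g F)"
  by (simp add: act_def conv_add_left)

lemma act_cmult_fun: "act (\<lambda>x. a * f x) F = hscale TV a (act f F)"
  by (simp add: act_def conv_cmult_left)

text \<open>Algebraic identities pass from \<open>act\<close> to limits of Cauchy sequences, and
  nondegeneracy follows from \<open>Ess_approx\<close> and the density of embedded vectors. As a
  member of \<open>bounded_reps\<close>, \<open>sigma\<close> is one of the representations over
  which the matrix norm is a supremum.\<close>

lemma sigma_rep: "(KH, sigma) \<in> bounded_reps G lam"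
  unfolding bounded_reps_def mem_Collect_eq case_prod_conv
proof (intro conjI ballI allI impI)
  show "separable_hilbert_space KH" by (rule E.cpl_hilbert)
  show "sigma \<in> Cc \<rightarrow>\<^sub>E bounded_operators KH"
  proof (rule PiE_I)
    fix f :: "'g \<Rightarrow> complex" assume f: "f \<in> Cc"
    then show "sigma f \<in> bounded_operators KH"
      using E.lift_bounded[OF act_EV[OF f] act_EV_norm[OF f]] by (simp add: sigma_def)
  qed (simp add: sigma_def)
next
  fix f g :: "'g \<Rightarrow> complex" and c assume fg: "f \<in> Cc" "g \<in> Cc" and "c \<in> hcarrier KH"
  then obtain w where w: "hcauchy EV w" and c: "c = E.coords w" by (metis E.cpl_cases)
  have "sigma (\<lambda>x. f x + g x) c = E.coords (\<lambda>k. hadd EV (act f (w k)) (act g (w k)))"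
    unfolding c sigma_coords[OF Cc_add[OF fg] w] using fg hcauchy_TV[OF w] by (simp only: act_add_fun EV_simps)
  also have "\<dots> = hadd KH (sigma f c) (sigma g c)"
    unfolding c using fg w by (simp add: E.coords_add hcauchy_act sigma_coords)
  finally show "sigma (\<lambda>x. f x + g x) c = hadd KH (sigma f c) (sigma g c)" .
next
  fix a and f :: "'g \<Rightarrow> complex" and c assume f: "f \<in> Cc" and "c \<in> hcarrier KH"
  then obtain w where w: "hcauchy EV w" and c: "c = E.coords w" by (metis E.cpl_cases)
  have "sigma (\<lambda>x. a * f x) c = E.coords (\<lambda>k. hscale EV a (act f (w k)))"
    unfolding c sigma_coords[OF Cc_cmult[OF f] w] by (simp only: act_cmult_fun EV_simps)
  also have "\<dots> = hscale KH a (sigma f c)"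
    unfolding c using f w by (simp add: E.coords_scale hcauchy_act sigma_coords)
  finally show "sigma (\<lambda>x. a * f x) c = hscale KH a (sigma f c)" .
next
  fix f g :: "'g \<Rightarrow> complex" and c assume fg: "f \<in> Cc" "g \<in> Cc" and "c \<in> hcarrier KH"
  then obtain w where w: "hcauchy EV w" and c: "c = E.coords w" by (metis E.cpl_cases)
  show "sigma (conv f g) c = sigma f (sigma g c)"
    unfolding c sigma_coords[OF conv_Cc[OF fg] w] sigma_coords[OF fg(2) w] sigma_coords[OF fg(1) hcauchy_act[OF fg(2) w]]
    using fg hcauchy_TV[OF w] by (simp only: act_conv)
next
  fix f :: "'g \<Rightarrow> complex" and c c' assume f: "f \<in> Cc" and "c \<in> hcarrier KH" "c' \<in> hcarrier KH"
  then obtain w w' where w: "hcauchy EV w" "hcauchy EV w'" and c: "c = E.coords w" "c' = E.coords w'" by (metis E.cpl_cases)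
  have "(\<lambda>k. hip EV (act (star f) (w k)) (w' k)) \<longlonglongrightarrow> hip KH (sigma (star f) c) c'"
    unfolding c sigma_coords[OF star_Cc[OF f] w(1)] using f w by (intro E.cpl_ip hcauchy_act star_Cc)
  moreover have "(\<lambda>k. hip EV (w k) (act f (w' k))) \<longlonglongrightarrow> hip KH c (sigma f c')"
    unfolding c sigma_coords[OF f w(2)] using f w by (intro E.cpl_ip hcauchy_act)
  moreover have "hip EV (act (star f) (w k)) (w' k) = hip EV (w k) (act f (w' k))" for k
    using act_adjoint[OF f hcauchy_TV[OF w(1)] hcauchy_TV[OF w(2)]] by (simp add: EV_simps)
  ultimately show "hip KH (sigma (star f) c) c' = hip KH c (sigma f c')"
    by (simp add: LIMSEQ_unique)
next
  fix f :: "'g \<Rightarrow> complex" and c assume f: "f \<in> Cc" and "c \<in> hcarrier KH"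
  then show "hnorm KH (sigma f c) \<le> Inorm f * hnorm KH c"
    by (simp add: sigma_def E.lift_norm[OF act_EV[OF f] act_EV_norm[OF f]])
next
  fix c and e :: real assume c: "c \<in> hcarrier KH" and e: "e > 0"
  interpret K: ip_space KH by (rule E.cpl_ip_space)
  have e2: "e / 2 > 0" using e by simp
  obtain v where v: "v \<in> Ess" "hnorm KH (hdiff KH c (E.emb v)) < e / 2"
    using E.emb_dense[OF c e2] by (auto simp: EV_simps)
  obtain m f k where m: "\<forall>i<m. f i \<in> Cc \<and> k i \<in> Ess"
     "V.dst v (hsum TV (\<lambda>i. act (f i) (k i)) m) < e / 2" using Ess_approx[OF v(1) e2] by blast
  have ac: "act (f i) (k i) \<in> hcarrier EV" if "i < m" for i
    using m(1) that Ess_act Ess_TV by (simp only: EV_simps)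
  have "E.emb (hsum EV (\<lambda>i. act (f i) (k i)) m) = hsum KH (\<lambda>i. E.emb (act (f i) (k i))) m"
    using ac by (rule E.emb_hsum)
  also have "\<dots> = hsum KH (\<lambda>i. sigma (f i) (E.emb (k i))) m"
    using m(1) by (intro K.hsum_cong) (simp add: sigma_emb)
  finally have eq: "E.emb (hsum EV (\<lambda>i. act (f i) (k i)) m) = hsum KH (\<lambda>i. sigma (f i) (E.emb (k i))) m" .
  have sc: "hsum EV (\<lambda>i. act (f i) (k i)) m \<in> hcarrier EV" using ac by (rule E.hsum_closed)
  have vc: "v \<in> hcarrier EV" using v(1) by (simp add: EV_simps)
  have "hnorm KH (hdiff KH (E.emb v) (E.emb (hsum EV (\<lambda>i. act (f i) (k i)) m))) < e / 2"
    unfolding E.emb_diff[OF vc sc, symmetric] E.emb_norm[OF E.diff_closed[OF vc sc]] using m(2) by (simp only: EV_simps)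
  moreover have "hnorm KH (hdiff KH c (E.emb (hsum EV (\<lambda>i. act (f i) (k i)) m)))
     \<le> hnorm KH (hdiff KH c (E.emb v)) + hnorm KH (hdiff KH (E.emb v) (E.emb (hsum EV (\<lambda>i. act (f i) (k i)) m)))"
    using c vc sc by (intro K.norm_diff_triangle E.emb_in)
  ultimately have "hnorm KH (hdiff KH c (hsum KH (\<lambda>i. sigma (f i) (E.emb (k i))) m)) < e"
    using v(2) by (simp add: eq)
  moreover have "\<forall>i<m. f i \<in> Cc \<and> E.emb (k i) \<in> hcarrier KH"
  proof (intro allI impI conjI)
    fix i assume "i < m"
    then have "k i \<in> hcarrier EV" using m(1) by (simp only: EV_simps)
    then show "E.emb (k i) \<in> hcarrier KH" by (rule E.emb_in)
  qed (use m(1) in blast)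
  ultimately show "\<exists>n f k. (\<forall>i<n. f i \<in> Cc \<and> k i \<in> hcarrier KH) \<and>
        hnorm KH (hdiff KH c (hsum KH (\<lambda>i. sigma (f i) (k i)) n)) < e"
    by (intro exI[of _ m] exI[of _ f] exI[of _ "\<lambda>i. E.emb (k i)"] conjI)
qed

end

section \<open>The matrix estimate\<close>

context semi_ip
begin

lemma L2_norm_scale:
  assumes "\<And>i. i < n \<Longrightarrow> h i \<in> C" and "c \<ge> 0"
  shows "L2_set (\<lambda>i. hnorm H (hscale H (of_real c) (h i))) {..<n} = c * L2_set (\<lambda>i. hnorm H (h i)) {..<n}"
proof -
  have "L2_set (\<lambda>i. hnorm H (hscale H (of_real c) (h i))) {..<n} = L2_set (\<lambda>i. c * hnorm H (h i)) {..<n}"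
    using assms by (intro L2_set_cong) (simp_all add: norm_scale)
  then show ?thesis using assms(2) by (simp add: L2_set_right_distrib)
qed

text \<open>\<open>matrix_opnorm\<close> is an extended real supremum over the unit ball;
  homogeneity of the entries yields the inequality between reals that the estimates need.\<close>

lemma matrix_opnorm_leD:
  assumes A: "\<And>i j x. i < n \<Longrightarrow> j < n \<Longrightarrow> x \<in> C \<Longrightarrow> A i j x \<in> C"
    and hom: "\<And>i j a x. i < n \<Longrightarrow> j < n \<Longrightarrow> x \<in> C \<Longrightarrow> A i j (hscale H a x) = hscale H a (A i j x)"
    and le: "matrix_opnorm H n A \<le> ennreal c" and c: "c \<ge> 0" and h: "\<And>j. j < n \<Longrightarrow> h j \<in> C"
  shows "L2_set (\<lambda>i. hnorm H (hsum H (\<lambda>j. A i j (h j)) n)) {..<n} \<le> c * L2_set (\<lambda>j. hnorm H (h j)) {..<n}"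
proof (rule field_le_epsilon)
  let ?N = "L2_set (\<lambda>j. hnorm H (h j)) {..<n}" and ?S = "\<lambda>i. hsum H (\<lambda>j. A i j (h j)) n"
  fix e :: real assume e: "e > 0"
  define d where "d = e / (c + 1)"
  have d: "d > 0" using e c by (simp add: d_def)
  \<comment> \<open>Dividing by the norm plus d, instead of the norm, also covers the zero
    vector.\<close>
  define t where "t = ?N + d"
  have t: "t > 0" using d by (simp add: t_def add_nonneg_pos)
  let ?h = "\<lambda>j. hscale H (of_real (1 / t)) (h j)"
  have "L2_set (\<lambda>j. hnorm H (?h j)) {..<n} = (1 / t) * ?N" using h t by (intro L2_norm_scale) simp_all
  also have "\<dots> \<le> 1" using t d by (simp add: t_def)
  finally have "(\<Sum>j<n. (hnorm H (?h j))\<^sup>2) \<le> 1" by (simp add: L2_set_def)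
  then have mem: "?h \<in> {h. (\<forall>j<n. h j \<in> C) \<and> (\<Sum>j<n. (hnorm H (h j))\<^sup>2) \<le> 1}" using h by simp
  have "ennreal (sqrt (\<Sum>i<n. (hnorm H (hsum H (\<lambda>j. A i j (?h j)) n))\<^sup>2)) \<le> matrix_opnorm H n A"
    unfolding matrix_opnorm_def by (rule SUP_upper2[OF mem]) simp
  also note le
  finally have "L2_set (\<lambda>i. hnorm H (hsum H (\<lambda>j. A i j (?h j)) n)) {..<n} \<le> c"
    using c by (simp add: L2_set_def)
  also have "L2_set (\<lambda>i. hnorm H (hsum H (\<lambda>j. A i j (?h j)) n)) {..<n}
     = L2_set (\<lambda>i. hnorm H (hscale H (of_real (1 / t)) (?S i))) {..<n}"
  proof (intro L2_set_cong refl arg_cong[where f = "hnorm H"])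
    fix i assume "i \<in> {..<n}"
    then have i: "i < n" by simp
    have "hsum H (\<lambda>j. A i j (?h j)) n = hsum H (\<lambda>j. hscale H (of_real (1 / t)) (A i j (h j))) n"
      using hom[OF i] h by (intro hsum_cong) blast
    also have "\<dots> = hscale H (of_real (1 / t)) (?S i)"
      using A[OF i] h by (intro hsum_scale[symmetric]) blast
    finally show "hsum H (\<lambda>j. A i j (?h j)) n = hscale H (of_real (1 / t)) (?S i)" .
  qed
  also have "\<dots> = (1 / t) * L2_set (\<lambda>i. hnorm H (?S i)) {..<n}"
    using A h t by (intro L2_norm_scale hsum_closed) simp_all
  finally have "L2_set (\<lambda>i. hnorm H (?S i)) {..<n} \<le> c * t" using t by (simp add: divide_le_eq)
  also have "\<dots> = c * ?N + c * d" by (simp add: t_def distrib_left)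
  also have "c * d \<le> e"
  proof -
    have "c * d \<le> (c + 1) * d" using d by simp
    then show ?thesis using c by (simp add: d_def)
  qed
  finally show "L2_set (\<lambda>i. hnorm H (?S i)) {..<n} \<le> c * ?N + e" by simp
qed

lemma matrix_opnorm_leI:
  assumes c: "c \<ge> 0"
    and le: "\<And>h. (\<And>j. j < n \<Longrightarrow> h j \<in> C) \<Longrightarrow>
      L2_set (\<lambda>i. hnorm H (hsum H (\<lambda>j. A i j (h j)) n)) {..<n} \<le> c * L2_set (\<lambda>j. hnorm H (h j)) {..<n}"
  shows "matrix_opnorm H n A \<le> ennreal c"
  unfolding matrix_opnorm_def
proof (rule SUP_least)
  fix h assume "h \<in> {h. (\<forall>j<n. h j \<in> C) \<and> (\<Sum>j<n. (hnorm H (h j))\<^sup>2) \<le> 1}"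
  then have h: "\<And>j. j < n \<Longrightarrow> h j \<in> C" "L2_set (\<lambda>j. hnorm H (h j)) {..<n} \<le> 1"
    by (simp_all add: L2_set_def)
  have "L2_set (\<lambda>i. hnorm H (hsum H (\<lambda>j. A i j (h j)) n)) {..<n} \<le> c * 1"
    by (rule order_trans[OF le[of h, OF h(1)] mult_left_mono[OF h(2) c]])
  then show "ennreal (sqrt (\<Sum>i<n. (hnorm H (hsum H (\<lambda>j. A i j (h j)) n))\<^sup>2)) \<le> ennreal c"
    by (intro ennreal_leI) (simp add: L2_set_def)
qed

end

lemma matrix_norm_leD:
  "matrix_norm G lam n a \<le> c \<Longrightarrow> rp \<in> bounded_reps G lam \<Longrightarrow> matrix_opnorm (fst rp) n (\<lambda>i j. a i j rp) \<le> c"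
  unfolding matrix_norm_def by (meson SUP_upper order_trans)

section \<open>The estimate for one representation and one family of vectors\<close>

context tensor_rep
begin

lemma hsum_TV: "hsum TV F m k = (\<lambda>x. \<Sum>i<m. F i k x)"
  by (induction m) simp_all

context
  fixes fm :: "nat \<Rightarrow> nat \<Rightarrow> 'g \<Rightarrow> complex" and \<alpha> :: real
  assumes fm: "\<And>i j. fm i j \<in> Cc" and \<alpha>: "\<alpha> \<ge> 0"
    and bound: "matrix_norm G lam n (\<lambda>i j. cembed G lam (fm i j)) \<le> ennreal \<alpha>"
begin

text \<open>Components stand for the vectors xi \<otimes> h_j, so the i-th row of the matrix is
  itself an element of \<open>TV\<close>: it represents \<Sum> (fm i j) (xi \<otimes> h_j).\<close>

definition row :: "nat \<Rightarrow> nat \<Rightarrow> 'g \<Rightarrow> complex" where "row i = fm i"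

definition col :: "nat \<Rightarrow> nat \<Rightarrow> 'g \<Rightarrow> complex" where
  "col j = hsum TV (\<lambda>i. act (star (fm i j)) (row i)) n"

lemma row_TV: "row i \<in> hcarrier TV"
  using fm by (simp add: row_def)

lemma hsum_Ess: "(\<And>i. i < m \<Longrightarrow> f i \<in> Ess) \<Longrightarrow> hsum TV f m \<in> Ess"
  using E.hsum_closed[of m f] by (simp only: EV_simps)

text \<open>The rows are only known to lie in \<open>TV\<close>. One application of
  \<open>Cc\<close> takes them into the space on which \<open>sigma\<close> acts, which is why the
  matrix bound is used on \<open>col\<close>.\<close>

lemma col_Ess: "col j \<in> Ess"
  unfolding col_def using fm row_TV by (intro hsum_Ess Ess_act star_Cc)

lemma col_TV: "col j \<in> hcarrier TV"
  by (rule Ess_TV[OF col_Ess])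

text \<open>Here the hypothesis on the matrix is used: its norm in the representation
  \<open>sigma\<close>, read on the vectors \<open>col\<close>.\<close>

lemma sigma_matrix_bound:
  "L2_set (\<lambda>i. hnorm TV (hsum TV (\<lambda>j. act (fm i j) (col j)) n)) {..<n} \<le> \<alpha> * L2_set (\<lambda>j. hnorm TV (col j)) {..<n}"
proof -
  interpret K: ip_space KH by (rule E.cpl_ip_space)
  interpret S: crep G lam KH sigma by unfold_locales (rule sigma_rep)
  have ce: "col j \<in> hcarrier EV" for j using col_Ess by (simp only: EV_simps)
  have ac: "act (fm i j) (col j) \<in> hcarrier EV" for i j using Ess_act[OF fm col_TV] by (simp only: EV_simps)
  have le: "matrix_opnorm KH n (\<lambda>i j. sigma (fm i j)) \<le> ennreal \<alpha>"
    using matrix_norm_leD[OF bound sigma_rep] sigma_rep by (simp add: cembed_def)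
  have "L2_set (\<lambda>i. hnorm KH (hsum KH (\<lambda>j. sigma (fm i j) (E.emb (col j))) n)) {..<n}
      \<le> \<alpha> * L2_set (\<lambda>j. hnorm KH (E.emb (col j))) {..<n}"
  proof (rule K.matrix_opnorm_leD[OF _ _ le \<alpha>])
    show "sigma (fm i j) x \<in> hcarrier KH" if "x \<in> hcarrier KH" for i j x
      using S.rho_closed[OF fm that] .
    show "sigma (fm i j) (hscale KH a x) = hscale KH a (sigma (fm i j) x)" if "x \<in> hcarrier KH" for i j a x
      using S.rho_linear[OF fm] that unfolding hlinear_def by blast
    show "E.emb (col j) \<in> hcarrier KH" for j by (rule E.emb_in[OF ce])
  qed
  moreover have "hnorm KH (hsum KH (\<lambda>j. sigma (fm i j) (E.emb (col j))) n) = hnorm TV (hsum TV (\<lambda>j. act (fm i j) (col j)) n)" for i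
  proof -
    have "hsum KH (\<lambda>j. sigma (fm i j) (E.emb (col j))) n = hsum KH (\<lambda>j. E.emb (act (fm i j) (col j))) n"
      by (intro K.hsum_cong sigma_emb fm col_Ess)
    also have "\<dots> = E.emb (hsum EV (\<lambda>j. act (fm i j) (col j)) n)" using ac by (intro E.emb_hsum[symmetric])
    finally show ?thesis using E.emb_norm[OF E.hsum_closed[of n "\<lambda>j. act (fm i j) (col j)"]] ac by (simp only: EV_simps)
  qed
  moreover have "hnorm KH (E.emb (col j)) = hnorm TV (col j)" for j
    using E.emb_norm[OF ce] by (simp only: EV_simps)
  ultimately show ?thesis by (simp only:)
qed

text \<open>The first Cauchy-Schwarz step, by the usual argument that a matrix and its adjoint have
  the same norm. The sum of the square norms of \<open>col\<close> is the pairing of the image of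
  \<open>col\<close> under the matrix with \<open>row\<close>; a factor \<parallel>col\<parallel>
  then cancels.\<close>

lemma col_row_bound:
  "L2_set (\<lambda>j. hnorm TV (col j)) {..<n} \<le> \<alpha> * L2_set (\<lambda>i. hnorm TV (row i)) {..<n}"
proof -
  let ?Y = "L2_set (\<lambda>j. hnorm TV (col j)) {..<n}" and ?P = "L2_set (\<lambda>i. hnorm TV (row i)) {..<n}"
  let ?z = "\<lambda>i. hsum TV (\<lambda>j. act (fm i j) (col j)) n"
  have z: "?z i \<in> hcarrier TV" for i using fm col_TV by (intro V.hsum_closed act_closed)
  have aT: "act (star (fm i j)) (row i) \<in> hcarrier TV" "act (fm i j) (col j) \<in> hcarrier TV" for i j
    by (rule act_closed[OF star_Cc[OF fm] row_TV], rule act_closed[OF fm col_TV])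
  have "(\<Sum>j<n. hip TV (col j) (col j)) = (\<Sum>j<n. \<Sum>i<n. hip TV (col j) (act (star (fm i j)) (row i)))"
    using aT col_TV by (intro sum.cong refl, subst (2) col_def, subst V.ip_hsum_right) auto
  also have "\<dots> = (\<Sum>j<n. \<Sum>i<n. hip TV (act (fm i j) (col j)) (row i))"
    using act_adjoint[OF star_Cc[OF fm] col_TV row_TV] by simp
  also have "\<dots> = (\<Sum>i<n. \<Sum>j<n. hip TV (act (fm i j) (col j)) (row i))" by (rule sum.swap)
  also have "\<dots> = (\<Sum>i<n. hip TV (?z i) (row i))"
    using aT row_TV by (intro sum.cong refl V.ip_hsum_left[symmetric]) auto
  finally have eq: "(\<Sum>j<n. hip TV (col j) (col j)) = (\<Sum>i<n. hip TV (?z i) (row i))" .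
  have "?Y\<^sup>2 = (\<Sum>j<n. (hnorm TV (col j))\<^sup>2)" by (simp add: L2_set_def sum_nonneg)
  also have "\<dots> = Re (\<Sum>j<n. hip TV (col j) (col j))" by (simp only: Re_sum V.norm_sq[OF col_TV])
  also have "\<dots> = Re (\<Sum>i<n. hip TV (?z i) (row i))" by (simp only: eq)
  also have "\<dots> \<le> (\<Sum>i<n. hnorm TV (?z i) * hnorm TV (row i))"
    unfolding Re_sum using z row_TV
    by (intro sum_mono order_trans[OF complex_Re_le_cmod V.cauchy_schwarz])
  also have "\<dots> = (\<Sum>i<n. \<bar>hnorm TV (?z i)\<bar> * \<bar>hnorm TV (row i)\<bar>)"
    using V.norm_nonneg[OF z] V.norm_nonneg[OF row_TV] by (simp del: TV_simps)
  also have "\<dots> \<le> L2_set (\<lambda>i. hnorm TV (?z i)) {..<n} * ?P" by (rule L2_set_mult_ineq)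
  also have "\<dots> \<le> (\<alpha> * ?Y) * ?P" by (intro mult_right_mono sigma_matrix_bound L2_set_nonneg)
  finally have "?Y * ?Y \<le> ?Y * (\<alpha> * ?P)" by (simp add: power2_eq_square mult_ac)
  then show ?thesis
    using \<alpha> L2_set_nonneg[of "\<lambda>j. hnorm TV (col j)" "{..<n}"] L2_set_nonneg[of "\<lambda>i. hnorm TV (row i)" "{..<n}"]
    by (cases "?Y = 0") (auto simp: mult_le_cancel_left)
qed

text \<open>With \<open>w i = \<Sum> fm i j (xi \<otimes> h j)\<close> and \<open>y j = \<Sum> (fm i j)* w i\<close>, one has
  \<open>\<Sum> \<parallel>w i\<parallel>\<^sup>2 = \<Sum> \<langle>xi \<otimes> h j, y j\<rangle>\<close>. The vectors \<open>xi \<otimes> h j\<close> themselves need not exist: the pairing with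
  them is \<open>slice xi\<close>.\<close>

lemma row_bound:
  assumes M: "M > 0" "\<And>u. u \<in> U \<Longrightarrow> hnorm (H u) (xi u) \<le> M"
  shows "L2_set (\<lambda>i. hnorm TV (row i)) {..<n} \<le> \<alpha> * M * L2_set (\<lambda>j. hnorm R (h j)) {..<n}"
proof -
  let ?P = "L2_set (\<lambda>i. hnorm TV (row i)) {..<n}" and ?h = "L2_set (\<lambda>j. hnorm R (h j)) {..<n}"
  let ?Y = "L2_set (\<lambda>j. hnorm TV (col j)) {..<n}"
  have colC: "col j k \<in> Cc" for j k using col_TV by simp
  have rowC: "row i k \<in> Cc" for i k using fm by (simp add: row_def)
  \<comment> \<open>Component k of \<open>col j\<close> is the sum over i of the convolutions that
    occur in \<open>tform (row i) (row i)\<close>. This identifies the two sides after the sums are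
    interchanged.\<close>
  have col_eq: "col j k = (\<lambda>x. \<Sum>i<n. conv (star (row i j)) (row i k) x)" for j k
    by (simp add: col_def hsum_TV act_def row_def)
  have ip: "hip R (h j) (slice xi (col j)) = (\<Sum>i<n. \<Sum>k<n. T (h j) (h k) (\<lambda>x. coeff xi xi x * conv (star (row i j)) (row i k) x))"
    if j: "j < n" for j
  proof -
    have "hip R (h j) (slice xi (col j)) = (\<Sum>k<n. T (h j) (h k) (\<lambda>x. coeff xi xi x * col j k x))"
      unfolding slice_def T_def using xi colC hC j by (intro R.ip_hsum_right rho_closed coeff_Cc) auto
    also have "\<dots> = (\<Sum>k<n. \<Sum>i<n. T (h j) (h k) (\<lambda>x. coeff xi xi x * conv (star (row i j)) (row i k) x))"
    proof (intro sum.cong refl)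
      fix k assume "k \<in> {..<n}"
      then have k: "k < n" by simp
      have "(\<lambda>x. coeff xi xi x * col j k x) = (\<lambda>x. \<Sum>i<n. coeff xi xi x * conv (star (row i j)) (row i k) x)"
        by (simp add: col_eq sum_distrib_left)
      then show "T (h j) (h k) (\<lambda>x. coeff xi xi x * col j k x) = (\<Sum>i<n. T (h j) (h k) (\<lambda>x. coeff xi xi x * conv (star (row i j)) (row i k) x))"
        using rowC by (simp only:) (intro T_sum hC j k coeff_Cc xi conv_Cc star_Cc)
    qed
    also have "\<dots> = (\<Sum>i<n. \<Sum>k<n. T (h j) (h k) (\<lambda>x. coeff xi xi x * conv (star (row i j)) (row i k) x))" by (rule sum.swap)
    finally show ?thesis .
  qed
  have "?P\<^sup>2 = (\<Sum>i<n. (hnorm TV (row i))\<^sup>2)" by (simp add: L2_set_def sum_nonneg)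
  also have "\<dots> = Re (\<Sum>i<n. tform (row i) (row i))" by (simp only: Re_sum V.norm_sq[OF row_TV] TV_simps)
  also have "(\<Sum>i<n. tform (row i) (row i)) = (\<Sum>j<n. hip R (h j) (slice xi (col j)))"
    unfolding tform_def by (subst sum.swap) (simp add: ip)
  also have "Re \<dots> \<le> (\<Sum>j<n. hnorm R (h j) * hnorm R (slice xi (col j)))"
    unfolding Re_sum using hC slice_closed[OF xi colC]
    by (intro sum_mono order_trans[OF complex_Re_le_cmod R.cauchy_schwarz]) auto
  also have "\<dots> \<le> (\<Sum>j<n. hnorm R (h j) * (M * hnorm TV (col j)))"
  proof (intro sum_mono mult_left_mono)
    fix j assume "j \<in> {..<n}"
    then show "0 \<le> hnorm R (h j)" using hC by simp
    have "(hnorm R (slice xi (col j)))\<^sup>2 \<le> M\<^sup>2 * Re (tform (col j) (col j))"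
      by (rule slice_bound[OF xi M colC])
    also have "\<dots> = (M * hnorm TV (col j))\<^sup>2" using V.norm_sq[OF col_TV, of j] by (simp add: power_mult_distrib)
    finally show "hnorm R (slice xi (col j)) \<le> M * hnorm TV (col j)"
      using M V.norm_nonneg[OF col_TV, of j] by (intro power2_le_imp_le[of "hnorm R (slice xi (col j))"]) (simp_all del: TV_simps)
  qed
  also have "\<dots> = M * (\<Sum>j<n. hnorm R (h j) * hnorm TV (col j))" by (simp add: sum_distrib_left mult_ac)
  also have "(\<Sum>j<n. hnorm R (h j) * hnorm TV (col j)) = (\<Sum>j<n. \<bar>hnorm R (h j)\<bar> * \<bar>hnorm TV (col j)\<bar>)"
    using hC V.norm_nonneg[OF col_TV] by (intro sum.cong) (auto simp del: TV_simps)
  also have "M * \<dots> \<le> M * (?h * ?Y)" using M by (intro mult_left_mono L2_set_mult_ineq) simp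
  also have "\<dots> \<le> M * (?h * (\<alpha> * ?P))" using M by (intro mult_left_mono col_row_bound L2_set_nonneg) simp
  finally have "?P * ?P \<le> ?P * (\<alpha> * M * ?h)" by (simp add: power2_eq_square mult_ac)
  then show ?thesis
    using \<alpha> M L2_set_nonneg[of "\<lambda>j. hnorm R (h j)" "{..<n}"] L2_set_nonneg[of "\<lambda>i. hnorm TV (row i)" "{..<n}"]
    by (cases "?P = 0") (auto simp: mult_le_cancel_left)
qed

text \<open>\<open>slice eta (row i)\<close> is the i-th entry of the multiplied matrix applied to
  h. So \<open>slice_bound\<close> for eta contributes the factor c, and \<open>row_bound\<close>
  the factor \<alpha> M.\<close>

lemma matrix_estimate:
  assumes M: "M > 0" "\<And>u. u \<in> U \<Longrightarrow> hnorm (H u) (xi u) \<le> M"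
    and eta: "eta \<in> bsec" and c: "c > 0" "\<And>u. u \<in> U \<Longrightarrow> hnorm (H u) (eta u) \<le> c"
  shows "L2_set (\<lambda>i. hnorm R (hsum R (\<lambda>j. rho (\<lambda>x. coeff xi eta x * fm i j x) (h j)) n)) {..<n}
     \<le> M * c * \<alpha> * L2_set (\<lambda>j. hnorm R (h j)) {..<n}"
proof -
  have rowC: "row i k \<in> Cc" for i k using fm by (simp add: row_def)
  have "hnorm R (slice eta (row i)) \<le> c * hnorm TV (row i)" for i
  proof -
    have "(hnorm R (slice eta (row i)))\<^sup>2 \<le> c\<^sup>2 * Re (tform (row i) (row i))"
      by (rule slice_bound[OF eta c rowC])
    also have "\<dots> = (c * hnorm TV (row i))\<^sup>2" using V.norm_sq[OF row_TV, of i] by (simp add: power_mult_distrib)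
    finally show ?thesis
      using c V.norm_nonneg[OF row_TV, of i] by (intro power2_le_imp_le[of "hnorm R (slice eta (row i))"]) (simp_all del: TV_simps)
  qed
  then have "L2_set (\<lambda>i. hnorm R (slice eta (row i))) {..<n} \<le> L2_set (\<lambda>i. c * hnorm TV (row i)) {..<n}"
    using slice_closed[OF eta rowC] by (intro L2_set_mono) auto
  also have "\<dots> = c * L2_set (\<lambda>i. hnorm TV (row i)) {..<n}" using c by (simp add: L2_set_right_distrib)
  also have "\<dots> \<le> c * (\<alpha> * M * L2_set (\<lambda>j. hnorm R (h j)) {..<n})"
    using c by (intro mult_left_mono row_bound M) simp_all
  finally show ?thesis by (simp add: slice_def row_def mult_ac)
qed

end

end

section \<open>Matrix norms under multiplication by a coefficient\<close>

context G_bundle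
begin

text \<open>The estimate asks for strictly positive bounds on the two sections. Hence their norms
  are enlarged by 1 / (k + 1), and k tends to infinity.\<close>

lemma coefficient_matrix_norm:
  assumes xi: "xi \<in> bsec" and eta: "eta \<in> bsec" and fm: "\<And>i j. fm i j \<in> Cc" and \<alpha>: "\<alpha> \<ge> 0"
    and le: "matrix_norm G lam n (\<lambda>i j. cembed G lam (fm i j)) \<le> ennreal \<alpha>"
  shows "matrix_norm G lam n (\<lambda>i j. cembed G lam (\<lambda>x. coeff xi eta x * fm i j x))
     \<le> ennreal (section_norm U H xi * section_norm U H eta * \<alpha>)"
proof (rule tendsto_lowerbound)
  let ?d = "\<lambda>k. inverse (real (Suc k))"
  let ?X = "\<lambda>k. (section_norm U H xi + ?d k) * (section_norm U H eta + ?d k) * \<alpha>"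
  show "(\<lambda>k. ennreal (?X k)) \<longlonglongrightarrow> ennreal (section_norm U H xi * section_norm U H eta * \<alpha>)"
  proof (rule tendsto_ennrealI)
    have "?X \<longlonglongrightarrow> (section_norm U H xi + 0) * (section_norm U H eta + 0) * \<alpha>"
      by (intro tendsto_intros LIMSEQ_inverse_real_of_nat)
    then show "?X \<longlonglongrightarrow> section_norm U H xi * section_norm U H eta * \<alpha>" by simp
  qed
  show "\<forall>\<^sub>F k in sequentially. matrix_norm G lam n (\<lambda>i j. cembed G lam (\<lambda>x. coeff xi eta x * fm i j x)) \<le> ennreal (?X k)"
  proof (rule always_eventually, rule allI)
    fix k
    define M c where "M = section_norm U H xi + ?d k" and "c = section_norm U H eta + ?d k"
    have dk: "?d k > 0" by simp
    have M: "M > 0" "\<And>u. u \<in> U \<Longrightarrow> hnorm (H u) (xi u) \<le> M"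
    proof -
      show "M > 0" unfolding M_def by (rule add_nonneg_pos[OF section_norm_nonneg[OF xi] dk])
      show "hnorm (H u) (xi u) \<le> M" if "u \<in> U" for u
        using section_norm_ge[OF xi that] dk unfolding M_def by linarith
    qed
    have c: "c > 0" "\<And>u. u \<in> U \<Longrightarrow> hnorm (H u) (eta u) \<le> c"
    proof -
      show "c > 0" unfolding c_def by (rule add_nonneg_pos[OF section_norm_nonneg[OF eta] dk])
      show "hnorm (H u) (eta u) \<le> c" if "u \<in> U" for u
        using section_norm_ge[OF eta that] dk unfolding c_def by linarith
    qed
    show "matrix_norm G lam n (\<lambda>i j. cembed G lam (\<lambda>x. coeff xi eta x * fm i j x)) \<le> ennreal (?X k)"
      unfolding matrix_norm_def
    proof (rule SUP_least)
      fix rp assume rp: "rp \<in> bounded_reps G lam"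
      obtain R rho where rp_eq: "rp = (R, rho)" by (cases rp)
      interpret bundle_rep G lam H Gam L R rho
        by unfold_locales (use rp rp_eq in simp)
      have "matrix_opnorm R n (\<lambda>i j. rho (\<lambda>x. coeff xi eta x * fm i j x)) \<le> ennreal (M * c * \<alpha>)"
      proof (rule R.matrix_opnorm_leI)
        show "0 \<le> M * c * \<alpha>" using M c \<alpha> by simp
        fix h assume h: "\<And>j. j < n \<Longrightarrow> h j \<in> hcarrier R"
        interpret tensor_rep G lam H Gam L R rho xi n h by unfold_locales (use xi h in auto)
        show "L2_set (\<lambda>i. hnorm R (hsum R (\<lambda>j. rho (\<lambda>x. coeff xi eta x * fm i j x) (h j)) n)) {..<n}
          \<le> M * c * \<alpha> * L2_set (\<lambda>j. hnorm R (h j)) {..<n}"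
          by (rule matrix_estimate[OF fm \<alpha> le M eta c])
      qed
      then show "matrix_opnorm (fst rp) n (\<lambda>i j. cembed G lam (\<lambda>x. coeff xi eta x * fm i j x) rp) \<le> ennreal (?X k)"
        using rp by (simp add: cembed_def rp_eq M_def c_def)
    qed
  qed
qed simp

end

section \<open>Extension to the C*-algebra\<close>

text \<open>From here on the bundle is present only through the continuity of \<open>phi\<close> and
  one matrix inequality for embedded functions.\<close>

locale bounded_multiplier = haar_groupoid G lam
  for G :: "'g::{second_countable_topology, t2_space} gpd" and lam +
  fixes phi :: "'g \<Rightarrow> complex" and \<kappa> :: real
  assumes phi_cont: "continuous_on UNIV phi" and \<kappa>: "\<kappa> \<ge> 0"
    and multiplier_bound: "\<And>fm n \<alpha>. (\<And>i j. fm i j \<in> Cc) \<Longrightarrow> \<alpha> \<ge> 0 \<Longrightarrow>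
      matrix_norm G lam n (\<lambda>i j. cembed G lam (fm i j)) \<le> ennreal \<alpha> \<Longrightarrow>
      matrix_norm G lam n (\<lambda>i j. cembed G lam (\<lambda>x. phi x * fm i j x)) \<le> ennreal (\<kappa> * \<alpha>)"
begin

abbreviation reps where "reps \<equiv> bounded_reps G lam"
abbreviation CS where "CS \<equiv> Cstar G lam"
abbreviation "crr rp \<equiv> hcarrier (fst rp)"

abbreviation rnorm where "rnorm rp \<equiv> hnorm (fst rp)"
abbreviation rdst where "rdst rp x y \<equiv> hnorm (fst rp) (hdiff (fst rp) x y)"
abbreviation ce where "ce \<equiv> cembed G lam"
abbreviation cplus where "cplus \<equiv> cadd G lam"
abbreviation cscl where "cscl \<equiv> cscale G lam"
abbreviation mnorm where "mnorm \<equiv> matrix_norm G lam"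
abbreviation pm where "pm f \<equiv> (\<lambda>x. phi x * f x)"

lemma rep_hilbert: "rp \<in> reps \<Longrightarrow> hilbert_space (fst rp)"
  by (auto simp: bounded_reps_def hilbert_space_iff)

lemma rep_crep: "rp \<in> reps \<Longrightarrow> crep G lam (fst rp) (snd rp)"
  by unfold_locales simp

lemma phi_Cc [simp]: "f \<in> Cc \<Longrightarrow> (pm f) \<in> Cc"
  by (rule Cc_mult[OF phi_cont])

definition ops :: "'g celem set" where
  "ops = (\<Pi>\<^sub>E rp\<in>reps. bounded_operators (fst rp))"

lemma ops_linear: "a \<in> ops \<Longrightarrow> rp \<in> reps \<Longrightarrow> hlinear (fst rp) (fst rp) (a rp)"
  unfolding ops_def bounded_operators_def by blast

lemma ops_closed: "a \<in> ops \<Longrightarrow> rp \<in> reps \<Longrightarrow> x \<in> crr rp \<Longrightarrow> a rp x \<in> crr rp"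
  using ops_linear unfolding hlinear_def by blast

lemma ops_scale: "a \<in> ops \<Longrightarrow> rp \<in> reps \<Longrightarrow> x \<in> crr rp \<Longrightarrow> a rp (hscale (fst rp) z x) = hscale (fst rp) z (a rp x)"
  using ops_linear unfolding hlinear_def by blast

lemma ops_eqI:
  assumes "a \<in> ops" "b \<in> ops" "\<And>rp x. rp \<in> reps \<Longrightarrow> x \<in> crr rp \<Longrightarrow> a rp x = b rp x"
  shows "a = b"
proof (rule PiE_ext)
  show "a \<in> (\<Pi>\<^sub>E rp\<in>reps. bounded_operators (fst rp))" "b \<in> (\<Pi>\<^sub>E rp\<in>reps. bounded_operators (fst rp))"
    using assms by (simp_all add: ops_def)
  fix rp assume rp: "rp \<in> reps"
  have "a rp \<in> extensional (crr rp)" "b rp \<in> extensional (crr rp)"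
    using assms rp by (auto simp: ops_def bounded_operators_def)
  then show "a rp = b rp" using assms(3)[OF rp] by (rule extensionalityI)
qed

lemma cembed_apply: "rp \<in> reps \<Longrightarrow> ce f rp = snd rp f"
  by (simp add: cembed_def)

lemma cembed_ops: "f \<in> Cc \<Longrightarrow> ce f \<in> ops"
  using crep.rho_op[OF rep_crep] by (auto simp: ops_def cembed_def)

text \<open>The bound c on the matrix norm, freed from suprema and extended reals: a homogeneous
  inequality for each representation.\<close>

definition mbound :: "nat \<Rightarrow> (nat \<Rightarrow> nat \<Rightarrow> 'g celem) \<Rightarrow> real \<Rightarrow> bool" where
  "mbound n a c \<longleftrightarrow> (\<forall>rp\<in>reps. \<forall>h. (\<forall>j<n. h j \<in> crr rp) \<longrightarrow>
     L2_set (\<lambda>i. rnorm rp (hsum (fst rp) (\<lambda>j. a i j rp (h j)) n)) {..<n} \<le> c * L2_set (\<lambda>j. rnorm rp (h j)) {..<n})"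

lemma matrix_norm_iff:
  assumes a: "\<And>i j. i < n \<Longrightarrow> j < n \<Longrightarrow> a i j \<in> ops" and c: "c \<ge> 0"
  shows "mnorm n a \<le> ennreal c \<longleftrightarrow> mbound n a c"
proof
  assume le: "mnorm n a \<le> ennreal c"
  show "mbound n a c"
    unfolding mbound_def
  proof (intro ballI allI impI)
    fix rp h assume rp: "rp \<in> reps" and h: "\<forall>j<n. h j \<in> crr rp"
    interpret hilbert_space "fst rp" by (rule rep_hilbert[OF rp])
    show "L2_set (\<lambda>i. rnorm rp (hsum (fst rp) (\<lambda>j. a i j rp (h j)) n)) {..<n} \<le> c * L2_set (\<lambda>j. rnorm rp (h j)) {..<n}"
      using h by (intro matrix_opnorm_leD[OF _ _ matrix_norm_leD[OF le rp] c] ops_closed[OF a rp] ops_scale[OF a rp]) auto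
  qed
next
  assume b: "mbound n a c"
  show "mnorm n a \<le> ennreal c"
    unfolding matrix_norm_def
  proof (rule SUP_least)
    fix rp assume rp: "rp \<in> reps"
    interpret hilbert_space "fst rp" by (rule rep_hilbert[OF rp])
    show "matrix_opnorm (fst rp) n (\<lambda>i j. a i j rp) \<le> ennreal c"
      using b rp unfolding mbound_def by (intro matrix_opnorm_leI c) blast
  qed
qed

lemma mbound_multiplier:
  assumes "\<And>i j. fm i j \<in> Cc" "c \<ge> 0" "mbound n (\<lambda>i j. ce (fm i j)) c"
  shows "mbound n (\<lambda>i j. ce (pm (fm i j))) (\<kappa> * c)"
proof (rule iffD1[OF matrix_norm_iff])
  have "mnorm n (\<lambda>i j. ce (fm i j)) \<le> ennreal c"
    using assms by (subst matrix_norm_iff) (auto intro: cembed_ops)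
  then show "mnorm n (\<lambda>i j. ce (pm (fm i j))) \<le> ennreal (\<kappa> * c)"
    by (rule multiplier_bound[OF assms(1,2)])
  show "ce (pm (fm i j)) \<in> ops" for i j using assms(1) by (intro cembed_ops phi_Cc)
  show "0 \<le> \<kappa> * c" using assms(2) \<kappa> by simp
qed

text \<open>For a and b in \<open>ops\<close> and c \<ge> 0 this is \<parallel>a - b\<parallel>
  \<le> c in the C*-norm, as \<open>near_iff_mbound\<close> makes precise. Written out it needs
  neither extended reals nor the difference as an element.\<close>

definition near :: "'g celem \<Rightarrow> 'g celem \<Rightarrow> real \<Rightarrow> bool" where
  "near a b c \<longleftrightarrow> (\<forall>rp\<in>reps. \<forall>h\<in>crr rp. rdst rp (a rp h) (b rp h) \<le> c * rnorm rp h)"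

lemma near_triangle:
  assumes "a \<in> ops" "b \<in> ops" "d \<in> ops" "near a b x" "near b d y"
  shows "near a d (x + y)"
  unfolding near_def
proof (intro ballI)
  fix rp h assume rp: "rp \<in> reps" and h: "h \<in> crr rp"
  interpret hilbert_space "fst rp" by (rule rep_hilbert[OF rp])
  have "rdst rp (a rp h) (d rp h)
     \<le> rdst rp (a rp h) (b rp h) + rdst rp (b rp h) (d rp h)"
    by (intro norm_diff_triangle ops_closed[OF _ rp h] assms(1-3))
  also have "\<dots> \<le> x * rnorm rp h + y * rnorm rp h"
    using assms rp h unfolding near_def by (intro add_mono) blast+
  finally show "rdst rp (a rp h) (d rp h) \<le> (x + y) * rnorm rp h"
    by (simp add: distrib_right)
qed

lemma near_sym: "a \<in> ops \<Longrightarrow> b \<in> ops \<Longrightarrow> near a b x \<Longrightarrow> near b a x"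
  unfolding near_def
proof (intro ballI)
  fix rp h assume *: "a \<in> ops" "b \<in> ops" "\<forall>rp\<in>reps. \<forall>h\<in>crr rp. rdst rp (a rp h) (b rp h) \<le> x * rnorm rp h"
    and rp: "rp \<in> reps" and h: "h \<in> crr rp"
  interpret hilbert_space "fst rp" by (rule rep_hilbert[OF rp])
  show "rdst rp (b rp h) (a rp h) \<le> x * rnorm rp h"
    unfolding norm_diff_swap[OF ops_closed[OF *(2) rp h] ops_closed[OF *(1) rp h]] using *(3) rp h by blast
qed

lemma near_mono: "near a b x \<Longrightarrow> x \<le> y \<Longrightarrow> near a b y"
  unfolding near_def
proof (intro ballI)
  fix rp h assume *: "\<forall>rp\<in>reps. \<forall>h\<in>crr rp. rdst rp (a rp h) (b rp h) \<le> x * rnorm rp h"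
    and xy: "x \<le> y" and rp: "rp \<in> reps" and h: "h \<in> crr rp"
  interpret hilbert_space "fst rp" by (rule rep_hilbert[OF rp])
  have "x * rnorm rp h \<le> y * rnorm rp h" using xy h by (intro mult_right_mono) simp_all
  then show "rdst rp (a rp h) (b rp h) \<le> y * rnorm rp h" using * rp h by fastforce
qed

lemma near_eq:
  assumes a: "a \<in> ops" and b: "b \<in> ops" and near: "\<And>e. e > 0 \<Longrightarrow> near a b e"
  shows "a = b"
proof (rule ops_eqI[OF a b])
  fix rp h assume rp: "rp \<in> reps" and h: "h \<in> crr rp"
  interpret hilbert_space "fst rp" by (rule rep_hilbert[OF rp])
  have c: "a rp h \<in> crr rp" "b rp h \<in> crr rp" by (rule ops_closed[OF a rp h], rule ops_closed[OF b rp h])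
  have "rdst rp (a rp h) (b rp h) \<le> 0"
  proof (rule field_le_epsilon)
    fix e :: real assume e: "e > 0"
    have nn: "0 \<le> rnorm rp h" using h by simp
    have "rdst rp (a rp h) (b rp h) \<le> e / (rnorm rp h + 1) * rnorm rp h"
      using near[of "e / (rnorm rp h + 1)"] e nn rp h unfolding near_def by (simp add: add_nonneg_pos)
    also have "\<dots> \<le> e / (rnorm rp h + 1) * (rnorm rp h + 1)"
      using e nn by (intro mult_left_mono) auto
    also have "\<dots> = e" using nn by simp
    finally show "rdst rp (a rp h) (b rp h) \<le> 0 + e" by simp
  qed
  then have "rdst rp (a rp h) (b rp h) = 0"
    using c by (intro order_antisym norm_nonneg diff_closed)
  then have "hdiff (fst rp) (a rp h) (b rp h) = hzero (fst rp)"
    using c by (intro norm_eq_zero diff_closed)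
  then show "a rp h = b rp h" by (rule eq_iff_norm_diff[OF c])
qed

lemma mbound_one_iff:
  assumes a: "a \<in> ops" and c: "c \<ge> 0"
  shows "mbound 1 (\<lambda>i j. a) c \<longleftrightarrow> (\<forall>rp\<in>reps. \<forall>h\<in>crr rp. rnorm rp (a rp h) \<le> c * rnorm rp h)"
proof -
  have *: "L2_set (\<lambda>i::nat. rnorm rp (hsum (fst rp) (\<lambda>j. a rp (h j)) 1)) {..<1} = rnorm rp (a rp (h 0))
      \<and> L2_set (\<lambda>j. rnorm rp (h j)) {..<1} = rnorm rp (h 0)"
    if rp: "rp \<in> reps" and h: "h 0 \<in> crr rp" for rp and h :: "nat \<Rightarrow> hpoint"
  proof -
    interpret hilbert_space "fst rp" by (rule rep_hilbert[OF rp])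
    have "a rp (h 0) \<in> crr rp" by (rule ops_closed[OF a rp h])
    then show ?thesis using h by (simp add: L2_set_def zero_add)
  qed
  show ?thesis
  proof
    assume m: "mbound 1 (\<lambda>i j. a) c"
    show "\<forall>rp\<in>reps. \<forall>h\<in>crr rp. rnorm rp (a rp h) \<le> c * rnorm rp h"
    proof (intro ballI)
      fix rp h assume rp: "rp \<in> reps" and h: "h \<in> crr rp"
      show "rnorm rp (a rp h) \<le> c * rnorm rp h"
        using m[unfolded mbound_def, rule_format, OF rp, of "\<lambda>_. h"] *[OF rp, of "\<lambda>_. h"] h by (simp only: simp_thms)
    qed
  next
    assume b: "\<forall>rp\<in>reps. \<forall>h\<in>crr rp. rnorm rp (a rp h) \<le> c * rnorm rp h"
    show "mbound 1 (\<lambda>i j. a) c"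
      unfolding mbound_def
    proof (intro ballI allI impI)
      fix rp and h :: "nat \<Rightarrow> hpoint" assume rp: "rp \<in> reps" and h: "\<forall>j<1. h j \<in> crr rp"
      then have h0: "h 0 \<in> crr rp" by simp
      show "L2_set (\<lambda>i::nat. rnorm rp (hsum (fst rp) (\<lambda>j. a rp (h j)) 1)) {..<1} \<le> c * L2_set (\<lambda>j. rnorm rp (h j)) {..<1}"
        using *[of rp h, OF rp h0] b rp h0 by (simp del: One_nat_def)
    qed
  qed
qed

lemma cadd_apply: "rp \<in> reps \<Longrightarrow> h \<in> crr rp \<Longrightarrow> cplus a b rp h = hadd (fst rp) (a rp h) (b rp h)"
  and cscale_apply: "rp \<in> reps \<Longrightarrow> h \<in> crr rp \<Longrightarrow> cscl z a rp h = hscale (fst rp) z (a rp h)"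
  by (simp_all add: cadd_def cscale_def)

lemma bounded_operatorsI:
  assumes "A \<in> extensional (hcarrier H)" "hlinear H H A" "\<And>x. x \<in> hcarrier H \<Longrightarrow> hnorm H (A x) \<le> c * hnorm H x"
  shows "A \<in> bounded_operators H"
  using assms unfolding bounded_operators_def by blast

lemma opsE:
  assumes "a \<in> ops" "rp \<in> reps"
  obtains c where "c \<ge> 0" "\<And>x. x \<in> crr rp \<Longrightarrow> rnorm rp (a rp x) \<le> c * rnorm rp x"
proof -
  interpret hilbert_space "fst rp" by (rule rep_hilbert[OF assms(2)])
  obtain c where c: "\<forall>x\<in>crr rp. rnorm rp (a rp x) \<le> c * rnorm rp x"
    using assms unfolding ops_def bounded_operators_def by blast
  show ?thesis
  proof (rule that[of "\<bar>c\<bar>"])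
    fix x assume x: "x \<in> crr rp"
    have "c * rnorm rp x \<le> \<bar>c\<bar> * rnorm rp x" using x by (intro mult_right_mono) simp_all
    then show "rnorm rp (a rp x) \<le> \<bar>c\<bar> * rnorm rp x" using c x by fastforce
  qed simp
qed

lemma cadd_ops: assumes a: "a \<in> ops" and b: "b \<in> ops" shows "cplus a b \<in> ops"
  unfolding ops_def
proof (rule PiE_I)
  fix rp assume rp: "rp \<in> reps"
  interpret hilbert_space "fst rp" by (rule rep_hilbert[OF rp])
  obtain x where x: "\<And>h. h \<in> crr rp \<Longrightarrow> rnorm rp (a rp h) \<le> x * rnorm rp h" using opsE[OF a rp] by metis
  obtain y where y: "\<And>h. h \<in> crr rp \<Longrightarrow> rnorm rp (b rp h) \<le> y * rnorm rp h" using opsE[OF b rp] by metis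
  note la = ops_linear[OF a rp, unfolded hlinear_def] and lb = ops_linear[OF b rp, unfolded hlinear_def]
  note cl = ops_closed[OF a rp] ops_closed[OF b rp]
  show "cplus a b rp \<in> bounded_operators (fst rp)"
  proof (rule bounded_operatorsI[where c = "x + y"])
    show "cplus a b rp \<in> extensional (crr rp)" using rp by (simp add: cadd_def)
    show "hlinear (fst rp) (fst rp) (cplus a b rp)"
      unfolding hlinear_def
    proof (intro conjI ballI allI funcsetI)
      fix h k assume h: "h \<in> crr rp" and k: "k \<in> crr rp"
      have "hadd (fst rp) (hadd (fst rp) (a rp h) (a rp k)) (hadd (fst rp) (b rp h) (b rp k))
         = hadd (fst rp) (hadd (fst rp) (a rp h) (b rp h)) (hadd (fst rp) (a rp k) (b rp k))"
        using h k cl by (intro add_add)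
      then show "cplus a b rp (hadd (fst rp) h k) = hadd (fst rp) (cplus a b rp h) (cplus a b rp k)"
        using la lb rp h k by (simp add: cadd_apply)
    qed (use la lb rp cl in \<open>simp_all add: cadd_apply scale_add_right\<close>)
    fix h assume h: "h \<in> crr rp"
    have "rnorm rp (hadd (fst rp) (a rp h) (b rp h)) \<le> rnorm rp (a rp h) + rnorm rp (b rp h)"
      using h cl by (intro norm_triangle)
    then show "rnorm rp (cplus a b rp h) \<le> (x + y) * rnorm rp h"
      using x[OF h] y[OF h] rp h by (simp add: cadd_apply distrib_right)
  qed
qed (simp add: cadd_def)

lemma cscale_ops: assumes a: "a \<in> ops" shows "cscl z a \<in> ops"
  unfolding ops_def
proof (rule PiE_I)
  fix rp assume rp: "rp \<in> reps"
  interpret hilbert_space "fst rp" by (rule rep_hilbert[OF rp])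
  obtain x where x: "\<And>h. h \<in> crr rp \<Longrightarrow> rnorm rp (a rp h) \<le> x * rnorm rp h" using opsE[OF a rp] by metis
  note la = ops_linear[OF a rp, unfolded hlinear_def]
  note cl = ops_closed[OF a rp]
  show "cscl z a rp \<in> bounded_operators (fst rp)"
  proof (rule bounded_operatorsI[where c = "cmod z * x"])
    show "cscl z a rp \<in> extensional (crr rp)" using rp by (simp add: cscale_def)
    show "hlinear (fst rp) (fst rp) (cscl z a rp)"
      unfolding hlinear_def
      using la rp cl by (auto simp: cscale_apply scale_add_right scale_scale mult.commute)
    fix h assume h: "h \<in> crr rp"
    show "rnorm rp (cscl z a rp h) \<le> cmod z * x * rnorm rp h"
      using mult_left_mono[OF x[OF h], of "cmod z"] rp h cl by (simp add: cscale_apply norm_scale mult.assoc)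
  qed
qed (simp add: cscale_def)

lemma near_cadd:
  assumes "a \<in> ops" "a' \<in> ops" "b \<in> ops" "b' \<in> ops" "near a b x" "near a' b' y"
  shows "near (cplus a a') (cplus b b') (x + y)"
  unfolding near_def
proof (intro ballI)
  fix rp h assume rp: "rp \<in> reps" and h: "h \<in> crr rp"
  interpret hilbert_space "fst rp" by (rule rep_hilbert[OF rp])
  have c: "a rp h \<in> crr rp" "a' rp h \<in> crr rp" "b rp h \<in> crr rp" "b' rp h \<in> crr rp"
    using assms by (auto intro: ops_closed[OF _ rp h])
  have "rdst rp (cplus a a' rp h) (cplus b b' rp h)
     \<le> rdst rp (a rp h) (b rp h) + rdst rp (a' rp h) (b' rp h)"
    using rp h c by (simp add: cadd_apply hdiff_add norm_triangle)
  also have "\<dots> \<le> x * rnorm rp h + y * rnorm rp h"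
    using assms(5,6) rp h unfolding near_def by (intro add_mono) blast+
  finally show "rdst rp (cplus a a' rp h) (cplus b b' rp h) \<le> (x + y) * rnorm rp h"
    by (simp add: distrib_right)
qed

lemma near_cscale:
  assumes "a \<in> ops" "b \<in> ops" "near a b x"
  shows "near (cscl z a) (cscl z b) (cmod z * x)"
  unfolding near_def
proof (intro ballI)
  fix rp h assume rp: "rp \<in> reps" and h: "h \<in> crr rp"
  interpret hilbert_space "fst rp" by (rule rep_hilbert[OF rp])
  have c: "a rp h \<in> crr rp" "b rp h \<in> crr rp"
    using assms by (auto intro: ops_closed[OF _ rp h])
  have "rdst rp (a rp h) (b rp h) \<le> x * rnorm rp h"
    using assms(3) rp h unfolding near_def by blast
  then show "rdst rp (cscl z a rp h) (cscl z b rp h) \<le> cmod z * x * rnorm rp h"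
    using rp h c by (simp add: cscale_apply hdiff_scale norm_scale mult.assoc mult_left_mono)
qed

lemma cembed_add: "f \<in> Cc \<Longrightarrow> g \<in> Cc \<Longrightarrow> ce (\<lambda>x. f x + g x) = cplus (ce f) (ce g)"
  by (rule ops_eqI) (auto simp: cembed_ops Cc_add cadd_ops cadd_apply cembed_apply crep.rho_add[OF rep_crep])

lemma cembed_scale: "f \<in> Cc \<Longrightarrow> ce (\<lambda>x. z * f x) = cscl z (ce f)"
  by (rule ops_eqI) (auto simp: cembed_ops Cc_cmult cscale_ops cscale_apply cembed_apply crep.rho_cmult[OF rep_crep])

lemma near_iff_mbound:
  assumes a: "a \<in> ops" and b: "b \<in> ops" and c: "c \<ge> 0"
  shows "near a b c \<longleftrightarrow> mbound 1 (\<lambda>i j. cplus a (cscl (- 1) b)) c"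
  unfolding mbound_one_iff[OF cadd_ops[OF a cscale_ops[OF b]] c] near_def
  by (intro ball_cong refl) (simp add: cadd_apply cscale_apply hdiff_def)

lemma Cstar_iff: "a \<in> CS \<longleftrightarrow> a \<in> ops \<and> (\<forall>e>0. \<exists>f\<in>Cc. near a (ce f) e)"
proof -
  have "(\<forall>e>0. \<exists>f\<in>Cc. cnorm G lam (cplus a (cscl (- 1) (ce f))) \<le> ennreal e)
     \<longleftrightarrow> (\<forall>e>0. \<exists>f\<in>Cc. near a (ce f) e)" if a: "a \<in> ops"
    unfolding cnorm_def
    using a by (intro all_cong bex_cong refl) (simp add: matrix_norm_iff near_iff_mbound cadd_ops cscale_ops cembed_ops)
  then show ?thesis unfolding Cstar_def ops_def[symmetric] by blast
qed

lemma CS_ops: "a \<in> CS \<Longrightarrow> a \<in> ops"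
  by (simp add: Cstar_iff)

lemma cembed_CS: "f \<in> Cc \<Longrightarrow> ce f \<in> CS"
proof -
  assume f: "f \<in> Cc"
  have "near (ce f) (ce f) e" if "e > 0" for e
    unfolding near_def
  proof (intro ballI)
    fix rp h assume rp: "rp \<in> reps" and h: "h \<in> crr rp"
    interpret hilbert_space "fst rp" by (rule rep_hilbert[OF rp])
    show "rdst rp (ce f rp h) (ce f rp h) \<le> e * rnorm rp h"
      using that h ops_closed[OF cembed_ops[OF f] rp h] by (simp add: diff_self norm_zero)
  qed
  then show ?thesis using f by (auto simp: Cstar_iff cembed_ops)
qed

lemma CS_approx: "a \<in> CS \<Longrightarrow> e > 0 \<Longrightarrow> \<exists>f\<in>Cc. near a (ce f) e"
  by (simp add: Cstar_iff)

lemma cadd_CS: assumes a: "a \<in> CS" and b: "b \<in> CS" shows "cplus a b \<in> CS"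
  unfolding Cstar_iff
proof (intro conjI allI impI)
  show "cplus a b \<in> ops" using a b by (intro cadd_ops CS_ops)
  fix e :: real assume "e > 0"
  then have e2: "e / 2 > 0" by simp
  obtain f where f: "f \<in> Cc" "near a (ce f) (e / 2)" using CS_approx[OF a e2] by blast
  obtain g where g: "g \<in> Cc" "near b (ce g) (e / 2)" using CS_approx[OF b e2] by blast
  have "near (cplus a b) (cplus (ce f) (ce g)) (e / 2 + e / 2)"
    using a b f g by (intro near_cadd CS_ops cembed_CS)
  then show "\<exists>f\<in>Cc. near (cplus a b) (ce f) e"
    using f g cembed_add[OF f(1) g(1)] Cc_add[OF f(1) g(1)] by (intro bexI[of _ "\<lambda>x. f x + g x"]) simp_all
qed

lemma cscale_CS: assumes a: "a \<in> CS" shows "cscl z a \<in> CS"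
  unfolding Cstar_iff
proof (intro conjI allI impI)
  show "cscl z a \<in> ops" using a by (intro cscale_ops CS_ops)
  fix e :: real assume e: "e > 0"
  define d where "d = e / (cmod z + 1)"
  have z1: "cmod z + 1 > 0" by (simp add: add_nonneg_pos)
  have d: "d > 0" using e z1 by (simp add: d_def)
  obtain f where f: "f \<in> Cc" "near a (ce f) d" using CS_approx[OF a d] by blast
  have "near (cscl z a) (cscl z (ce f)) (cmod z * d)"
    using a f by (intro near_cscale CS_ops cembed_CS)
  moreover have "cmod z * d \<le> e"
  proof -
    have "cmod z * d \<le> (cmod z + 1) * d" using d by (simp add: distrib_right)
    then show ?thesis using z1 by (simp add: d_def)
  qed
  ultimately have "near (cscl z a) (ce (\<lambda>x. z * f x)) e"
    unfolding cembed_scale[OF f(1)] by (rule near_mono)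
  then show "\<exists>f\<in>Cc. near (cscl z a) (ce f) e" using Cc_cmult[OF f(1)] by blast
qed

lemma near_multiplier:
  assumes f: "f \<in> Cc" and g: "g \<in> Cc" and c: "c \<ge> 0" and near: "near (ce f) (ce g) c"
  shows "near (ce (pm f)) (ce (pm g)) (\<kappa> * c)"
proof -
  have diff: "cplus (ce f) (cscl (- 1) (ce g)) = ce (\<lambda>x. f x + (- 1) * g x)"
    if "f \<in> Cc" "g \<in> Cc" for f g
    using cembed_add[OF that(1) Cc_cmult[OF that(2), of "-1"]] cembed_scale[OF that(2), of "-1"] by simp
  have "mbound 1 (\<lambda>i j. ce (\<lambda>x. f x + (- 1) * g x)) c"
    using near unfolding near_iff_mbound[OF cembed_ops[OF f] cembed_ops[OF g] c] diff[OF f g] .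
  then have "mbound 1 (\<lambda>i j. ce (\<lambda>x. phi x * (f x + (- 1) * g x))) (\<kappa> * c)"
    using f g c by (intro mbound_multiplier Cc_add Cc_cmult)
  also have "(\<lambda>x. phi x * (f x + (- 1) * g x)) = (\<lambda>x. phi x * f x + (- 1) * (phi x * g x))"
    by (simp add: algebra_simps)
  finally have "mbound 1 (\<lambda>i j. ce (\<lambda>x. phi x * f x + (- 1) * (phi x * g x))) (\<kappa> * c)" .
  then show ?thesis
    using c \<kappa> f g by (subst near_iff_mbound) (simp_all add: cembed_ops diff)
qed

definition extends_at :: "'g celem \<Rightarrow> 'g celem \<Rightarrow> bool" where
  "extends_at a b \<longleftrightarrow> b \<in> CS \<and> (\<forall>f\<in>Cc. \<forall>c\<ge>0. near a (ce f) c \<longrightarrow> near b (ce (pm f)) (\<kappa> * c))"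

text \<open>Completeness of \<open>ops\<close> for uniform convergence, with the limit taken vector
  by vector in each representation. The prescribed rate is the one that arises in
  \<open>extension_exists\<close>.\<close>

lemma limit_near:
  assumes F: "\<And>k. F k \<in> ops" and cauchy: "\<And>k l. near (F k) (F l) (\<kappa> * (inverse (real (Suc k)) + inverse (real (Suc l))))"
  shows "\<exists>b\<in>ops. \<forall>g\<in>ops. \<forall>c. (\<forall>k. near g (F k) (c + \<kappa> * inverse (real (Suc k)))) \<longrightarrow> near g b c"
proof -
  let ?d = "\<lambda>k. inverse (real (Suc k))"
  have d0: "?d \<longlonglongrightarrow> 0" by (rule LIMSEQ_inverse_real_of_nat)
  have lim: "\<exists>x\<in>crr rp. (\<lambda>k. rdst rp (F k rp h) x) \<longlonglongrightarrow> 0" if rp: "rp \<in> reps" and h: "h \<in> crr rp" for rp h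
  proof -
    interpret hilbert_space "fst rp" by (rule rep_hilbert[OF rp])
    show ?thesis
    proof (rule Cauchy_convergent)
      show "F k rp h \<in> crr rp" for k by (rule ops_closed[OF F rp h])
      fix e :: real assume e: "e > 0"
      \<comment> \<open>The summands 1 keep \<open>D\<close> positive when \<kappa> or the norm of h
        is 0.\<close>
      define D where "D = (\<kappa> + 1) * (rnorm rp h + 1)"
      have D: "D > 0" unfolding D_def using \<kappa> h by (intro mult_pos_pos add_nonneg_pos) simp_all
      have "e / (2 * D) > 0" using e D by simp
      then obtain N where N: "?d N < e / (2 * D)" using reals_Archimedean by blast
      have "rdst rp (F m rp h) (F k rp h) < e" if "m \<ge> N" "k \<ge> N" for m k
      proof -
        have dd: "?d m \<le> ?d N" "?d k \<le> ?d N" using that by (simp_all add: field_simps)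
        have "rdst rp (F m rp h) (F k rp h) \<le> \<kappa> * (?d m + ?d k) * rnorm rp h"
          using cauchy[of m k] rp h unfolding near_def by blast
        also have "\<dots> \<le> (\<kappa> + 1) * (2 * ?d N) * (rnorm rp h + 1)"
        proof (intro mult_right_mono mult_mono)
          show "?d m + ?d k \<le> 2 * ?d N" using dd by linarith
        qed (use \<kappa> h in \<open>simp_all del: of_nat_Suc\<close>)
        also have "\<dots> = 2 * D * ?d N" by (simp add: D_def)
        also have "\<dots> < 2 * D * (e / (2 * D))" using N D by (intro mult_strict_left_mono) simp_all
        also have "\<dots> = e" using D by simp
        finally show ?thesis .
      qed
      then show "\<exists>N. \<forall>m\<ge>N. \<forall>k\<ge>N. rdst rp (F m rp h) (F k rp h) < e" by blast
    qed
  qed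
  define b where "b = (\<lambda>rp\<in>reps. \<lambda>h\<in>crr rp. SOME x. x \<in> crr rp \<and> (\<lambda>k. rdst rp (F k rp h) x) \<longlonglongrightarrow> 0)"
  have b: "b rp h \<in> crr rp" "(\<lambda>k. rdst rp (F k rp h) (b rp h)) \<longlonglongrightarrow> 0"
    if rp: "rp \<in> reps" and h: "h \<in> crr rp" for rp h
    using someI_ex[of "\<lambda>x. x \<in> crr rp \<and> (\<lambda>k. rdst rp (F k rp h) x) \<longlonglongrightarrow> 0"] lim[OF rp h] rp h
    by (auto simp: b_def)
  have limit: "rdst rp x (b rp h) \<le> c * rnorm rp h"
    if rp: "rp \<in> reps" and h: "h \<in> crr rp" and x: "x \<in> crr rp"
      and le: "\<And>k. rdst rp x (F k rp h) \<le> (c + \<kappa> * ?d k) * rnorm rp h" for rp h x c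
  proof -
    interpret hilbert_space "fst rp" by (rule rep_hilbert[OF rp])
    have Fc: "F k rp h \<in> crr rp" for k by (rule ops_closed[OF F rp h])
    have "(\<lambda>k. (c + \<kappa> * ?d k) * rnorm rp h + rdst rp (F k rp h) (b rp h))
       \<longlonglongrightarrow> (c + \<kappa> * 0) * rnorm rp h + 0"
      by (intro tendsto_intros d0 b rp h)
    moreover have "rdst rp x (b rp h)
       \<le> (c + \<kappa> * ?d k) * rnorm rp h + rdst rp (F k rp h) (b rp h)" for k
      using norm_diff_triangle[OF x Fc b(1)[OF rp h], of k] le[of k] by linarith
    ultimately have "rdst rp x (b rp h) \<le> (c + \<kappa> * 0) * rnorm rp h + 0"
      by (intro LIMSEQ_le_const) auto
    then show ?thesis by simp
  qed
  have bops: "b \<in> ops"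
    unfolding ops_def
  proof (rule PiE_I)
    fix rp assume rp: "rp \<in> reps"
    interpret hilbert_space "fst rp" by (rule rep_hilbert[OF rp])
    note cl = ops_closed[OF F rp]
    obtain x where x: "\<And>h. h \<in> crr rp \<Longrightarrow> rnorm rp (F 0 rp h) \<le> x * rnorm rp h" using opsE[OF F rp] by metis
    show "b rp \<in> bounded_operators (fst rp)"
    \<comment> \<open>\<open>F 0\<close> is within \<kappa> (1 + 1 / (k + 1)) \<le> 2 \<kappa> of
      every \<open>F k\<close>.\<close>
    proof (rule bounded_operatorsI[where c = "x + 2 * \<kappa>"])
      show "b rp \<in> extensional (crr rp)" using rp by (simp add: b_def)
      show "hlinear (fst rp) (fst rp) (b rp)"
        unfolding hlinear_def
      proof (intro conjI ballI allI funcsetI)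
        show "b rp h \<in> crr rp" if "h \<in> crr rp" for h by (rule b(1)[OF rp that])
        fix h k assume h: "h \<in> crr rp" and k: "k \<in> crr rp"
        have "(\<lambda>j. rdst rp (F j rp h) (b rp h) + rdst rp (F j rp k) (b rp k)) \<longlonglongrightarrow> 0 + 0"
          by (intro tendsto_add b rp h k)
        then have null: "(\<lambda>j. rdst rp (F j rp h) (b rp h) + rdst rp (F j rp k) (b rp k)) \<longlonglongrightarrow> 0"
          by simp
        have "(\<lambda>j. rdst rp (F j rp (hadd (fst rp) h k)) (hadd (fst rp) (b rp h) (b rp k))) \<longlonglongrightarrow> 0"
        proof (rule LIMSEQ_null_comparison[OF null])
          fix j
          have "F j rp (hadd (fst rp) h k) = hadd (fst rp) (F j rp h) (F j rp k)"
            using ops_linear[OF F rp] h k unfolding hlinear_def by blast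
          then show "norm (rdst rp (F j rp (hadd (fst rp) h k)) (hadd (fst rp) (b rp h) (b rp k)))
             \<le> rdst rp (F j rp h) (b rp h) + rdst rp (F j rp k) (b rp k)"
            using cl h k b(1)[OF rp] by (simp add: hdiff_add norm_triangle)
        qed
        then show "b rp (hadd (fst rp) h k) = hadd (fst rp) (b rp h) (b rp k)"
          using h k cl b[OF rp] by (intro diff_limit_unique[of "b rp (hadd (fst rp) h k)" _ "\<lambda>j. F j rp (hadd (fst rp) h k)"]) simp_all
      next
        fix a h assume h: "h \<in> crr rp"
        have "(\<lambda>j. cmod a * rdst rp (F j rp h) (b rp h)) \<longlonglongrightarrow> cmod a * 0"
          by (intro tendsto_mult tendsto_const b rp h)
        moreover have "rdst rp (F j rp (hscale (fst rp) a h)) (hscale (fst rp) a (b rp h))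
           = cmod a * rdst rp (F j rp h) (b rp h)" for j
          using ops_scale[OF F rp h] cl h b(1)[OF rp h] by (simp add: hdiff_scale norm_scale)
        ultimately have "(\<lambda>j. rdst rp (F j rp (hscale (fst rp) a h)) (hscale (fst rp) a (b rp h))) \<longlonglongrightarrow> 0"
          by simp
        then show "b rp (hscale (fst rp) a h) = hscale (fst rp) a (b rp h)"
          using h cl b[OF rp] by (intro diff_limit_unique[of "b rp (hscale (fst rp) a h)" _ "\<lambda>j. F j rp (hscale (fst rp) a h)"]) simp_all
      qed
      fix h assume h: "h \<in> crr rp"
      have "rdst rp (F 0 rp h) (b rp h) \<le> \<kappa> * rnorm rp h"
      proof (rule limit[OF rp h cl[OF h]])
        fix k
        show "rdst rp (F 0 rp h) (F k rp h) \<le> (\<kappa> + \<kappa> * ?d k) * rnorm rp h"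
          using cauchy[of 0 k] rp h unfolding near_def by (simp add: distrib_left)
      qed
      moreover have "rnorm rp (b rp h) \<le> rdst rp (b rp h) (F 0 rp h) + rnorm rp (F 0 rp h)"
        using b(1)[OF rp h] cl[OF h] by (intro norm_le_diff)
      moreover have "rdst rp (b rp h) (F 0 rp h) = rdst rp (F 0 rp h) (b rp h)"
        using b(1)[OF rp h] cl[OF h] by (intro norm_diff_swap)
      moreover have "0 \<le> \<kappa> * rnorm rp h" using \<kappa> h by simp
      ultimately show "rnorm rp (b rp h) \<le> (x + 2 * \<kappa>) * rnorm rp h"
        using x[OF h] by (simp add: distrib_right)
    qed
  qed (simp add: b_def)
  show ?thesis
  proof (intro bexI[OF _ bops] ballI allI impI)
    fix g c assume g: "g \<in> ops" and c: "\<forall>k. near g (F k) (c + \<kappa> * ?d k)"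
    show "near g b c"
      unfolding near_def
    proof (intro ballI)
      fix rp h assume rp: "rp \<in> reps" and h: "h \<in> crr rp"
      show "rdst rp (g rp h) (b rp h) \<le> c * rnorm rp h"
        using c rp h unfolding near_def by (intro limit ops_closed[OF g]) blast+
    qed
  qed
qed

text \<open>The multiplier bound applies to differences of functions, so multiplied approximations
  of \<open>a\<close> form a Cauchy sequence. Its limit stays within \<kappa> c of the product with
  any function that is within c of \<open>a\<close>.\<close>

lemma extension_exists:
  assumes a: "a \<in> CS"
  shows "\<exists>b. extends_at a b"
proof -
  let ?d = "\<lambda>k. inverse (real (Suc k))"
  have dpos: "?d k > 0" for k by simp
  have "\<exists>f\<in>Cc. near a (ce f) (?d k)" for k by (rule CS_approx[OF a dpos])
  then obtain f where f: "\<And>k. f k \<in> Cc" "\<And>k. near a (ce (f k)) (?d k)" by metis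
  define F where "F = (\<lambda>k. ce (pm (f k)))"
  have F: "F k \<in> ops" for k unfolding F_def using f by (intro cembed_ops phi_Cc)
  have aops: "a \<in> ops" by (rule CS_ops[OF a])
  have key: "near (ce (pm g)) (F k) (\<kappa> * (c + ?d k))"
    if g: "g \<in> Cc" and c: "c \<ge> 0" and near: "near a (ce g) c" for g c k
  proof -
    have "near (ce g) (ce (f k)) (c + ?d k)"
      using near_sym[OF aops cembed_ops[OF g] near] f aops g by (intro near_triangle[of _ a]) (simp_all add: cembed_ops del: of_nat_Suc)
    then show ?thesis unfolding F_def using g f c dpos[of k] by (intro near_multiplier) (simp_all del: of_nat_Suc)
  qed
  have cauchy: "near (F k) (F l) (\<kappa> * (?d k + ?d l))" for k l
    using key[OF f(1) _ f(2), of k l] dpos[of k] unfolding F_def by (simp del: of_nat_Suc)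
  obtain b where b: "b \<in> ops" "\<forall>g\<in>ops. \<forall>c. (\<forall>k. near g (F k) (c + \<kappa> * ?d k)) \<longrightarrow> near g b c"
    using limit_near[OF F cauchy] by blast
  have ext: "near b (ce (pm g)) (\<kappa> * c)"
    if g: "g \<in> Cc" and c: "c \<ge> 0" and near: "near a (ce g) c" for g c
  proof (rule near_sym[OF _ b(1)])
    show gops: "ce (pm g) \<in> ops" using g by (intro cembed_ops phi_Cc)
    show "near (ce (pm g)) b (\<kappa> * c)"
      using key[OF g c near] by (intro b(2)[rule_format, OF gops]) (simp add: distrib_left)
  qed
  have "b \<in> CS"
    unfolding Cstar_iff
  proof (intro conjI b allI impI)
    fix e :: real assume e: "e > 0"
    define c where "c = e / (\<kappa> + 1)"
    have c: "c > 0" using e \<kappa> by (simp add: c_def)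
    obtain g where g: "g \<in> Cc" "near a (ce g) c" using CS_approx[OF a c] by blast
    have "\<kappa> * c \<le> (\<kappa> + 1) * c" using c by simp
    also have "\<dots> = e" using \<kappa> by (simp add: c_def)
    finally have "near b (ce (pm g)) e"
      using ext[OF g(1) _ g(2)] c near_mono by simp
    then show "\<exists>f\<in>Cc. near b (ce f) e" using phi_Cc[OF g(1)] by blast
  qed
  then show ?thesis using ext unfolding extends_at_def by blast
qed

section \<open>The extended multiplier, its matrix bounds and its uniqueness\<close>

definition Tm :: "'g celem \<Rightarrow> 'g celem" where
  "Tm = (\<lambda>a\<in>CS. SOME b. extends_at a b)"

lemma Tm: "a \<in> CS \<Longrightarrow> extends_at a (Tm a)"
  using someI_ex[OF extension_exists] by (simp add: Tm_def)

lemma Tm_CS: "a \<in> CS \<Longrightarrow> Tm a \<in> CS"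
  using Tm by (simp add: extends_at_def)

lemma Tm_near: "a \<in> CS \<Longrightarrow> f \<in> Cc \<Longrightarrow> c \<ge> 0 \<Longrightarrow> near a (ce f) c \<Longrightarrow>
    near (Tm a) (ce (pm f)) (\<kappa> * c)"
  using Tm unfolding extends_at_def by blast

text \<open>One criterion for all identities: an element that follows approximations of
  \<open>a\<close> with some Lipschitz constant \<open>K\<close> is the value of the extension.
  \<open>K\<close> is 0 for embedded functions, \<kappa> for linearity, and the cb norm of a
  competing extension in \<open>cb_extension_unique\<close>.\<close>

lemma Tm_unique:
  assumes a: "a \<in> CS" and b: "b \<in> ops" and K: "K \<ge> 0"
    and near: "\<And>e. e > 0 \<Longrightarrow> \<exists>f\<in>Cc. near a (ce f) e \<and> near b (ce (pm f)) (K * e)"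
  shows "Tm a = b"
proof (rule near_eq[OF CS_ops[OF Tm_CS[OF a]] b])
  fix e :: real assume e: "e > 0"
  define d where "d = e / (\<kappa> + K + 1)"
  have d: "d > 0" using e \<kappa> K by (simp add: d_def)
  obtain f where f: "f \<in> Cc" "near a (ce f) d" "near b (ce (pm f)) (K * d)"
    using near[OF d] by blast
  have fo: "ce (pm f) \<in> ops" using f by (intro cembed_ops phi_Cc)
  have "near (Tm a) b (\<kappa> * d + K * d)"
    using Tm_near[OF a f(1) _ f(2)] near_sym[OF b fo f(3)] d CS_ops[OF Tm_CS[OF a]] b fo
    by (intro near_triangle[of _ "ce (pm f)"]) simp_all
  moreover have "\<kappa> * d + K * d \<le> e"
  proof -
    have "\<kappa> * d + K * d \<le> (\<kappa> + K + 1) * d" using d by (simp add: distrib_right)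
    also have "\<dots> = e" using \<kappa> K by (simp add: d_def)
    finally show ?thesis .
  qed
  ultimately show "near (Tm a) b e" by (rule near_mono)
qed

lemma near_self: "a \<in> ops \<Longrightarrow> near a a 0"
  unfolding near_def
proof (intro ballI)
  fix rp h assume a: "a \<in> ops" and rp: "rp \<in> reps" and h: "h \<in> crr rp"
  interpret hilbert_space "fst rp" by (rule rep_hilbert[OF rp])
  show "rdst rp (a rp h) (a rp h) \<le> 0 * rnorm rp h"
    using ops_closed[OF a rp h] by (simp add: diff_self norm_zero)
qed

lemma Tm_cembed: "f \<in> Cc \<Longrightarrow> Tm (ce f) = ce (pm f)"
  by (rule Tm_unique[where K = 0])
     (auto intro!: cembed_CS cembed_ops bexI[of _ f] near_mono[OF near_self] near_self)

lemma Tm_add: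
  assumes a: "a \<in> CS" and b: "b \<in> CS"
  shows "Tm (cplus a b) = cplus (Tm a) (Tm b)"
proof (rule Tm_unique[OF cadd_CS[OF a b] _ \<kappa>])
  show "cplus (Tm a) (Tm b) \<in> ops" using a b by (intro cadd_ops CS_ops Tm_CS)
  fix e :: real assume "e > 0"
  then have e2: "e / 2 > 0" by simp
  obtain f where f: "f \<in> Cc" "near a (ce f) (e / 2)" using CS_approx[OF a e2] by blast
  obtain g where g: "g \<in> Cc" "near b (ce g) (e / 2)" using CS_approx[OF b e2] by blast
  have 1: "near (cplus a b) (ce (\<lambda>x. f x + g x)) (e / 2 + e / 2)"
    unfolding cembed_add[OF f(1) g(1)] using a b f g by (intro near_cadd CS_ops cembed_CS)
  have "near (cplus (Tm a) (Tm b)) (ce (\<lambda>x. phi x * f x + phi x * g x)) (\<kappa> * (e / 2) + \<kappa> * (e / 2))"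
    unfolding cembed_add[OF phi_Cc[OF f(1)] phi_Cc[OF g(1)]]
    using a b f g e2 by (intro near_cadd CS_ops cembed_CS Tm_CS Tm_near phi_Cc) simp_all
  then have 2: "near (cplus (Tm a) (Tm b)) (ce (\<lambda>x. phi x * (f x + g x))) (\<kappa> * e)"
    by (simp add: distrib_left)
  show "\<exists>f\<in>Cc. near (cplus a b) (ce f) e \<and> near (cplus (Tm a) (Tm b)) (ce (pm f)) (\<kappa> * e)"
    using 1 2 Cc_add[OF f(1) g(1)] by (intro bexI[of _ "\<lambda>x. f x + g x"]) simp_all
qed

lemma Tm_scale:
  assumes a: "a \<in> CS"
  shows "Tm (cscl z a) = cscl z (Tm a)"
proof (rule Tm_unique[OF cscale_CS[OF a] _ \<kappa>])
  show "cscl z (Tm a) \<in> ops" using a by (intro cscale_ops CS_ops Tm_CS)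
  fix e :: real assume e: "e > 0"
  define d where "d = e / (cmod z + 1)"
  have z1: "cmod z + 1 > 0" by (simp add: add_nonneg_pos)
  have d: "d > 0" using e z1 by (simp add: d_def)
  have de: "cmod z * d \<le> e"
  proof -
    have "cmod z * d \<le> (cmod z + 1) * d" using d by (simp add: distrib_right)
    then show ?thesis using z1 by (simp add: d_def)
  qed
  obtain f where f: "f \<in> Cc" "near a (ce f) d" using CS_approx[OF a d] by blast
  have 1: "near (cscl z a) (ce (\<lambda>x. z * f x)) e"
    unfolding cembed_scale[OF f(1)]
    by (rule near_mono[OF near_cscale[OF CS_ops[OF a] cembed_ops[OF f(1)] f(2)] de])
  have "near (cscl z (Tm a)) (ce (\<lambda>x. z * (phi x * f x))) (cmod z * (\<kappa> * d))"
    unfolding cembed_scale[OF phi_Cc[OF f(1)]]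
    using a f d by (intro near_cscale CS_ops Tm_CS cembed_CS phi_Cc Tm_near) simp_all
  moreover have "cmod z * (\<kappa> * d) \<le> \<kappa> * e" using mult_left_mono[OF de \<kappa>] by (simp add: mult_ac)
  ultimately have "near (cscl z (Tm a)) (ce (\<lambda>x. z * (phi x * f x))) (\<kappa> * e)"
    by (rule near_mono)
  then have 2: "near (cscl z (Tm a)) (ce (\<lambda>x. phi x * (z * f x))) (\<kappa> * e)"
    by (simp add: mult.left_commute)
  show "\<exists>f\<in>Cc. near (cscl z a) (ce f) e \<and> near (cscl z (Tm a)) (ce (pm f)) (\<kappa> * e)"
    using 1 2 Cc_cmult[OF f(1)] by (intro bexI[of _ "\<lambda>x. z * f x"]) simp_all
qed

text \<open>Entrywise estimates lose a factor n^2, which is harmless because n stays fixed while the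
  error tends to 0.\<close>

lemma mbound_perturb:
  assumes a: "\<And>i j. i < n \<Longrightarrow> j < n \<Longrightarrow> a i j \<in> ops" and b: "\<And>i j. i < n \<Longrightarrow> j < n \<Longrightarrow> b i j \<in> ops"
    and near: "\<And>i j. i < n \<Longrightarrow> j < n \<Longrightarrow> near (b i j) (a i j) e" and e: "e \<ge> 0" and m: "mbound n a c"
  shows "mbound n b (c + real n * (real n * e))"
  unfolding mbound_def
proof (intro ballI allI impI)
  fix rp h assume rp: "rp \<in> reps" and h: "\<forall>j<n. h j \<in> crr rp"
  interpret hilbert_space "fst rp" by (rule rep_hilbert[OF rp])
  let ?N = "L2_set (\<lambda>j. rnorm rp (h j)) {..<n}"
  let ?A = "\<lambda>i. hsum (fst rp) (\<lambda>j. a i j rp (h j)) n" and ?B = "\<lambda>i. hsum (fst rp) (\<lambda>j. b i j rp (h j)) n"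
  have ac: "a i j rp (h j) \<in> crr rp" and bc: "b i j rp (h j) \<in> crr rp" if "i < n" "j < n" for i j
    using ops_closed[OF a[OF that] rp, of "h j"] ops_closed[OF b[OF that] rp, of "h j"] h that by simp_all
  have hn: "rnorm rp (h j) \<le> ?N" if "j < n" for j
    using that by (intro member_le_L2_set) auto
  have diff: "rnorm rp (?B i) \<le> rnorm rp (?A i) + real n * (e * ?N)" if i: "i < n" for i
  proof -
    have eq: "hdiff (fst rp) (hsum (fst rp) (\<lambda>j. b i j rp (h j)) k) (hsum (fst rp) (\<lambda>j. a i j rp (h j)) k)
      = hsum (fst rp) (\<lambda>j. hdiff (fst rp) (b i j rp (h j)) (a i j rp (h j))) k" if "k \<le> n" for k
      using that
    proof (induction k)
      case (Suc k)
      then show ?case using ac[OF i] bc[OF i] by (simp add: hdiff_add hsum_closed)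
    qed (simp add: diff_self)
    have "rdst rp (?B i) (?A i) \<le> (\<Sum>j<n. rdst rp (b i j rp (h j)) (a i j rp (h j)))"
      unfolding eq[OF order_refl] using ac[OF i] bc[OF i] by (intro norm_hsum_le) simp
    also have "\<dots> \<le> (\<Sum>j<n. e * ?N)"
    proof (intro sum_mono)
      fix j assume "j \<in> {..<n}"
      then have j: "j < n" by simp
      have "rdst rp (b i j rp (h j)) (a i j rp (h j)) \<le> e * rnorm rp (h j)"
        using near[OF i j] rp h j unfolding near_def by blast
      also have "\<dots> \<le> e * ?N" using hn[OF j] e by (rule mult_left_mono)
      finally show "rdst rp (b i j rp (h j)) (a i j rp (h j)) \<le> e * ?N" .
    qed
    also have "\<dots> = real n * (e * ?N)" by simp
    finally show ?thesis
      using norm_le_diff[of "?B i" "?A i"] ac[OF i] bc[OF i] by (simp add: hsum_closed)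
  qed
  have "L2_set (\<lambda>i. rnorm rp (?B i)) {..<n} \<le> L2_set (\<lambda>i. rnorm rp (?A i) + real n * (e * ?N)) {..<n}"
    using diff bc by (intro L2_set_mono) (auto intro!: norm_nonneg hsum_closed)
  also have "\<dots> \<le> L2_set (\<lambda>i. rnorm rp (?A i)) {..<n} + L2_set (\<lambda>i. real n * (e * ?N)) {..<n}"
    by (rule L2_set_triangle_ineq)
  also have "L2_set (\<lambda>i. real n * (e * ?N)) {..<n} \<le> (\<Sum>i<n. real n * (e * ?N))"
    using e by (intro L2_set_le_sum) simp
  also have "\<dots> = real n * (real n * e) * ?N" by simp
  also have "L2_set (\<lambda>i. rnorm rp (?A i)) {..<n} \<le> c * ?N"
    using m rp h unfolding mbound_def by blast
  finally show "L2_set (\<lambda>i. rnorm rp (?B i)) {..<n} \<le> (c + real n * (real n * e)) * ?N"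
    by (simp add: distrib_right)
qed

lemma mbound_limit:
  assumes "\<And>e. e > 0 \<Longrightarrow> mbound n a (c + K * e)" and K: "K \<ge> 0"
  shows "mbound n a c"
  unfolding mbound_def
proof (intro ballI allI impI)
  fix rp h assume rp: "rp \<in> reps" and h: "\<forall>j<n. h j \<in> crr rp"
  let ?N = "L2_set (\<lambda>j. rnorm rp (h j)) {..<n}"
  show "L2_set (\<lambda>i. rnorm rp (hsum (fst rp) (\<lambda>j. a i j rp (h j)) n)) {..<n} \<le> c * ?N"
  proof (rule field_le_epsilon)
    fix t :: real assume t: "t > 0"
    define X where "X = K * ?N + 1"
    have X: "X > 0" unfolding X_def using K by (intro add_nonneg_pos) simp_all
    have "t / X > 0" using t X by simp
    then have "L2_set (\<lambda>i. rnorm rp (hsum (fst rp) (\<lambda>j. a i j rp (h j)) n)) {..<n} \<le> (c + K * (t / X)) * ?N"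
      using assms(1)[of "t / X"] rp h unfolding mbound_def by blast
    also have "\<dots> = c * ?N + (t / X) * (K * ?N)" by (simp add: distrib_right)
    also have "(t / X) * (K * ?N) \<le> (t / X) * X" using t X by (intro mult_left_mono) (simp_all add: X_def)
    also have "\<dots> = t" using X by simp
    finally show "L2_set (\<lambda>i. rnorm rp (hsum (fst rp) (\<lambda>j. a i j rp (h j)) n)) {..<n} \<le> c * ?N + t" by simp
  qed
qed

lemma Tm_mbound:
  assumes a: "\<And>i j. i < n \<Longrightarrow> j < n \<Longrightarrow> a i j \<in> CS" and c: "c \<ge> 0" and m: "mbound n a c"
  shows "mbound n (\<lambda>i j. Tm (a i j)) (\<kappa> * c)"
\<comment> \<open>One term \<kappa> n^2 e comes from replacing the entries by functions, the other
  from returning from the multiplied functions to the images of the entries.\<close>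
proof (rule mbound_limit[where K = "2 * \<kappa> * (real n * real n)"])
  show "0 \<le> 2 * \<kappa> * (real n * real n)" using \<kappa> by simp
  fix e :: real assume e: "e > 0"
  \<comment> \<open>Outside the n by n block any member of \<open>Cc\<close> will do; one is chosen
    there because the multiplier bound asks for it at all indices.\<close>
  have "\<exists>f\<in>Cc. i < n \<longrightarrow> j < n \<longrightarrow> near (a i j) (ce f) e" for i j
    using CS_approx[OF a e] Cc_zero by (cases "i < n \<and> j < n") auto
  then obtain f where f: "\<And>i j. f i j \<in> Cc" "\<And>i j. i < n \<Longrightarrow> j < n \<Longrightarrow> near (a i j) (ce (f i j)) e"
    by metis
  have "mbound n (\<lambda>i j. ce (f i j)) (c + real n * (real n * e))"
    using e m by (intro mbound_perturb[of n a] CS_ops[OF a] cembed_ops f(1)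
        near_sym[OF CS_ops[OF a] cembed_ops[OF f(1)] f(2)]) simp_all
  then have "mbound n (\<lambda>i j. ce (pm (f i j))) (\<kappa> * (c + real n * (real n * e)))"
    using f c e by (intro mbound_multiplier) simp_all
  then have "mbound n (\<lambda>i j. Tm (a i j)) (\<kappa> * (c + real n * (real n * e)) + real n * (real n * (\<kappa> * e)))"
    using a f e \<kappa> by (intro mbound_perturb[of n "\<lambda>i j. ce (pm (f i j))"])
      (auto intro!: CS_ops[OF Tm_CS] CS_ops[OF cembed_CS] Tm_near)
  then show "mbound n (\<lambda>i j. Tm (a i j)) (\<kappa> * c + 2 * \<kappa> * (real n * real n) * e)"
    by (simp add: algebra_simps)
qed

lemma cb_norm_Tm: "cb_norm G lam Tm \<le> ennreal \<kappa>"
  unfolding cb_norm_def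
proof (intro SUP_least)
  fix n a assume "a \<in> {a. (\<forall>i<n. \<forall>j<n. a i j \<in> CS) \<and> mnorm n a \<le> 1}"
  then have a: "\<And>i j. i < n \<Longrightarrow> j < n \<Longrightarrow> a i j \<in> CS" and le: "mnorm n a \<le> ennreal 1" by simp_all
  have "mbound n a 1" using le by (subst (asm) matrix_norm_iff) (auto intro: CS_ops a)
  then have "mbound n (\<lambda>i j. Tm (a i j)) (\<kappa> * 1)" by (intro Tm_mbound a) simp_all
  then show "mnorm n (\<lambda>i j. Tm (a i j)) \<le> ennreal \<kappa>"
    using \<kappa> by (subst matrix_norm_iff) (auto intro: CS_ops[OF Tm_CS] a)
qed

lemma completely_bounded_Tm: "completely_bounded G lam Tm"
  unfolding completely_bounded_def
  using cb_norm_Tm by (auto simp: Tm_CS Tm_add Tm_scale intro: order_le_less_trans)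

text \<open>The bound on 1 by 1 matrices makes \<open>T\<close> Lipschitz for the C*-norm, so that
  it is determined by its values on the dense image of \<open>Cc\<close>; \<open>Tm_unique\<close>
  expresses this.\<close>

lemma cb_extension_unique:
  assumes ext: "T \<in> extensional CS" and cb: "completely_bounded G lam T"
    and T: "\<forall>f\<in>Cc. T (ce f) = ce (pm f)"
  shows "T = Tm"
proof (rule extensionalityI[OF ext])
  show "Tm \<in> extensional CS" by (simp add: Tm_def)
  fix a assume a: "a \<in> CS"
  have TC: "T x \<in> CS" if "x \<in> CS" for x using cb that by (auto simp: completely_bounded_def)
  have Tadd: "T (cplus x y) = cplus (T x) (T y)" if "x \<in> CS" "y \<in> CS" for x y
    using cb that by (simp add: completely_bounded_def)
  have Tscale: "T (cscl z x) = cscl z (T x)" if "x \<in> CS" for x z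
    using cb that by (simp add: completely_bounded_def)
  obtain K where K: "K \<ge> 0" "cb_norm G lam T = ennreal K"
    using cb by (cases "cb_norm G lam T") (auto simp: completely_bounded_def)
  have Tbound: "mbound 1 (\<lambda>i j. T x) (K * e)" if x: "x \<in> CS" and e: "e > 0" and m: "mbound 1 (\<lambda>i j. x) e" for x e
  proof -
    \<comment> \<open>Scaled into the unit ball, over which the cb norm is a supremum.\<close>
    let ?y = "cscl (of_real (1 / e)) x"
    have yC: "?y \<in> CS" by (rule cscale_CS[OF x])
    have scale: "rnorm rp (cscl (of_real (1 / e)) y rp h) = (1 / e) * rnorm rp (y rp h)"
      if "y \<in> ops" "rp \<in> reps" "h \<in> crr rp" for y rp h
    proof -
      interpret hilbert_space "fst rp" by (rule rep_hilbert[OF that(2)])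
      show ?thesis using that e ops_closed[OF that] by (simp add: cscale_apply norm_scale norm_divide)
    qed
    have "mbound 1 (\<lambda>i j. ?y) 1"
    proof -
      have "rnorm rp (?y rp h) \<le> 1 * rnorm rp h" if "rp \<in> reps" "h \<in> crr rp" for rp h
      proof -
        have "rnorm rp (x rp h) \<le> e * rnorm rp h"
          using iffD1[OF mbound_one_iff[OF CS_ops[OF x] less_imp_le[OF e]] m] that by blast
        then show ?thesis unfolding scale[OF CS_ops[OF x] that] using e by (simp add: field_simps)
      qed
      then show ?thesis using mbound_one_iff[OF CS_ops[OF yC] zero_le_one] by blast
    qed
    then have "mnorm 1 (\<lambda>i j. ?y) \<le> 1"
      using matrix_norm_iff[of 1 "\<lambda>i j. ?y" 1] CS_ops[OF yC] by (simp del: One_nat_def)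
    then have mem: "(\<lambda>i j. ?y) \<in> {a. (\<forall>i<1. \<forall>j<1. a i j \<in> CS) \<and> mnorm 1 a \<le> 1}"
      using yC by simp
    have "mnorm 1 (\<lambda>i j. T ?y) \<le> cb_norm G lam T"
      unfolding cb_norm_def by (rule SUP_upper2[OF UNIV_I], rule SUP_upper2[OF mem]) simp
    then have "mbound 1 (\<lambda>i j. T ?y) K"
      unfolding K(2) using matrix_norm_iff[of 1 "\<lambda>i j. T ?y" K] CS_ops[OF TC[OF yC]] K(1) by (simp del: One_nat_def)
    then have b: "\<forall>rp\<in>reps. \<forall>h\<in>crr rp. rnorm rp (T ?y rp h) \<le> K * rnorm rp h"
      using mbound_one_iff[OF CS_ops[OF TC[OF yC]] K(1)] by blast
    have "rnorm rp (T x rp h) \<le> K * e * rnorm rp h" if "rp \<in> reps" "h \<in> crr rp" for rp h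
    proof -
      have "rnorm rp (T ?y rp h) \<le> K * rnorm rp h" using b that by blast
      then have "(1 / e) * rnorm rp (T x rp h) \<le> K * rnorm rp h"
        unfolding Tscale[OF x] scale[OF CS_ops[OF TC[OF x]] that] .
      then show ?thesis using e by (simp add: field_simps)
    qed
    moreover have "0 \<le> K * e" using K(1) e by simp
    ultimately show ?thesis using mbound_one_iff[OF CS_ops[OF TC[OF x]]] by blast
  qed
  show "T a = Tm a"
  proof (rule Tm_unique[OF a CS_ops[OF TC[OF a]] K(1), symmetric])
    fix e :: real assume e: "e > 0"
    obtain f where f: "f \<in> Cc" "near a (ce f) e" using CS_approx[OF a e] by blast
    let ?x = "cplus a (cscl (- 1) (ce f))"
    have fC: "ce f \<in> CS" by (rule cembed_CS[OF f(1)])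
    have xC: "?x \<in> CS" using a fC by (intro cadd_CS cscale_CS)
    have "mbound 1 (\<lambda>i j. ?x) e"
      using f(2) near_iff_mbound[OF CS_ops[OF a] CS_ops[OF fC]] e by (simp del: One_nat_def)
    then have "mbound 1 (\<lambda>i j. T ?x) (K * e)" by (rule Tbound[OF xC e])
    moreover have "T ?x = cplus (T a) (cscl (- 1) (ce (pm f)))"
      using T f(1) by (simp add: Tadd[OF a cscale_CS[OF fC]] Tscale[OF fC])
    ultimately have "near (T a) (ce (pm f)) (K * e)"
      using near_iff_mbound[OF CS_ops[OF TC[OF a]] cembed_ops[OF phi_Cc[OF f(1)]], of "K * e"] K(1) e by (simp del: One_nat_def)
    then show "\<exists>f\<in>Cc. near a (ce f) e \<and> near (T a) (ce (pm f)) (K * e)"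
      using f by blast
  qed
qed

lemma multiplier_eq: "multiplier G lam phi = Tm"
  unfolding multiplier_def
proof (rule the_equality)
  show "Tm \<in> extensional CS \<and> completely_bounded G lam Tm \<and> (\<forall>f\<in>Cc. Tm (ce f) = ce (pm f))"
    using completely_bounded_Tm Tm_cembed by (simp add: Tm_def)
qed (use cb_extension_unique in blast)

lemma cb_multiplier_norm_le: "cb_multiplier_norm G lam phi \<le> ennreal \<kappa>"
  unfolding cb_multiplier_norm_def multiplier_eq by (rule cb_norm_Tm)

end

section \<open>The infimum over all representations of a coefficient\<close>

theorem corollary1:
  fixes G :: "'g::{second_countable_topology, t2_space} gpd"
    and lam :: "'g \<Rightarrow> 'g measure"
  assumes "locally_compact_groupoid G"
    and "left_haar_system G lam"
  shows "\<forall>phi\<in>BG G. cb_multiplier_norm G lam phi \<le> ennreal (BG_norm G phi)"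
proof
  fix phi assume phi: "phi \<in> BG G"
  interpret haar_groupoid G lam by unfold_locales (fact assms)+
  let ?S = "{section_norm (unit_space G) H xi * section_norm (unit_space G) H eta
          | (H :: 'g \<Rightarrow> hpoint hilb) Gam L xi eta. represents G phi H Gam L xi eta}"
  have ne: "?S \<noteq> {}" using phi unfolding BG_def by blast
  have bound: "0 \<le> c \<and> cb_multiplier_norm G lam phi \<le> ennreal c" if cS: "c \<in> ?S" for c
  proof -
    obtain H :: "'g \<Rightarrow> hpoint hilb" and Gam L xi eta where c: "c = section_norm (unit_space G) H xi * section_norm (unit_space G) H eta"
      and rep: "represents G phi H Gam L xi eta" using cS by blast
    interpret G_bundle G lam H Gam L by unfold_locales (use rep in \<open>simp add: represents_def\<close>)
    have xi: "xi \<in> bsec" and eta: "eta \<in> bsec" and phi_eq: "phi = coeff xi eta"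
      using rep by (simp_all add: represents_def)
    have c0: "0 \<le> c" unfolding c by (intro mult_nonneg_nonneg section_norm_nonneg xi eta)
    \<comment> \<open>Every representation of \<open>phi\<close> as a coefficient makes
      \<open>phi\<close> a bounded multiplier, with the product of the section norms as
      constant.\<close>
    interpret bounded_multiplier G lam phi c
    proof
      show "continuous_on UNIV phi" unfolding phi_eq by (rule coeff_cont[OF xi eta])
    qed (use c0 coefficient_matrix_norm[OF xi eta] in \<open>simp_all add: phi_eq c\<close>)
    show ?thesis using c0 cb_multiplier_norm_le by blast
  qed
  \<comment> \<open>\<open>BG_norm\<close> is an infimum of reals, so the cb norm must be known to
    be finite before it can serve as a lower bound.\<close>
  obtain c where "c \<in> ?S" using ne by blast
  then have "cb_multiplier_norm G lam phi < \<infinity>" using bound[of c] by (auto intro: order_le_less_trans)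
  then obtain b where b: "b \<ge> 0" "cb_multiplier_norm G lam phi = ennreal b"
    by (cases "cb_multiplier_norm G lam phi") auto
  have "b \<le> BG_norm G phi"
    unfolding BG_norm_def
  proof (rule cInf_greatest[OF ne])
    fix c assume "c \<in> ?S"
    then show "b \<le> c" using bound[of c] b(2) ennreal_le_iff[of c b] by simp
  qed
  then show "cb_multiplier_norm G lam phi \<le> ennreal (BG_norm G phi)"
    unfolding b(2) by (rule ennreal_leI)
qed

end
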